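(* Assume that the (unbiased) fibration weak factorization system $(\mathsf{TCof},\mathcal{F})$ on $\mathsf{cSet}$ satisfies the fibration extension property: for every fibration $f:Y\to X$ and every trivial cofibration $\eta:X\to X'$ there is a fibration $f':Y'\to X'$ whose pullback along $\eta$ is $f$. Then the class $\mathcal{W}$ of weak equivalences has the 3-for-2 property, and hence the classes $(\mathcal{C},\mathcal{W},\mathcal{F})$ form a Quillen model structure on $\mathsf{cSet}$. Moreover, the weak equivalences $\mathcal{W}$ are exactly the weak homotopy equivalences: those maps $f:X\to Y$ such that $K^f:K^Y\to K^X$ is bijective on connected components whenever $K$ is fibrant.
   Context: Cubical sets. The Cartesian cube category $\Box$ has as objects the finite strictly bipointed sets $[n]=\{0,x_1,\dots,x_n,1\}$ ($n\ge 0$, all listed elements distinct); an arrow $[m]\to[n]$ in $\Box$ is a function $[n]\to[m]$ preserving $0$ and $1$. $\mathsf{cSet}=\mathsf{Set}^{\Box^{\mathrm{op}}}$. $\mathrm{I}^n$ denotes the presheaf represented by $[n]$, $\mathrm{I}=\mathrm{I}^1$, $1=\mathrm{I}^0$, and $\delta_0,\delta_1:1\rightrightarrows\mathrm{I}$ are the two endpoints. For a cubical set $X$, $\pi_0X$ is the coequalizer of the two maps $X_1\rightrightarrows X_0$ induced by $\delta_0,\delta_1$, where $X_n=X([n])$; "bijective on connected components" means inducing a bijection under $\pi_0$. Cofibrations. $\mathcal{C}$ is a fixed class of monomorphisms of $\mathsf{cSet}$, called cofibrations, such that: (C0) $0\to C$ is a cofibration for every $C$; (C1) isomorphisms are cofibrations;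 (C2) cofibrations are closed under composition; (C3) cofibrations are stable under pullback; (C4) the category of cofibrations and cartesian squares has a terminal object $t:1\to\Phi$; (C5) $\delta_0,\delta_1:1\to\mathrm{I}$ are cofibrations; (C6) the join of two subobjects of an object whose inclusions are cofibrations is again included by a cofibration; (C7) the diagonal $\delta:\mathrm{I}\to\mathrm{I}\times\mathrm{I}$ is a cofibration. $\mathsf{TFib}$ (trivial fibrations) is the class of maps with the right lifting property against all cofibrations. Fibrations. $\mathcal{F}$ is the class of (unbiased) fibrations: maps $f:Y\to X$ such that the canonical map $\langle f^{\mathrm{I}}\times\mathrm{I},\langle\mathsf{eval},p_2\rangle\rangle : Y^{\mathrm{I}}\times\mathrm{I}\to(X^{\mathrm{I}}\times\mathrm{I})\times_{(X\times\mathrm{I})}(Y\times\mathrm{I})$ is a trivial fibration, where $X^{\mathrm{I}}\times\mathrm{I}\to X\times\mathrm{I}$ is $\langle\mathsf{eval},p_2\rangle$. An object $K$ is fibrant if $K\to1$ is a fibration. $\mathsf{TCof}$ (trivial cofibrations) is the class of maps with the left lifting property against all fibrations. Weak equivalences. $\mathcal{W}$ is the class of maps of the form $g\circ h$ with $h\in\mathsf{TCof}$ and $g\in\mathsf{TFib}$. A Quillen model structure on a bicomplete category consists of classes $\mathcal{C},\mathcal{W},\mathcal{F}$ such that $(\mathcal{C},\mathcal{W}\cap\mathcal{F})$ and $(\mathcal{C}\cap\mathcal{W},\mathcal{F})$ are weak factorization systems and $\mathcal{W}$ has the 3-for-2 property. *)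

theory Defs
  imports Main "HOL-Library.FuncSet"
begin

unbundle cardinal_syntax

section \<open>Categories\<close>

record ('o, 'a) cat =
  Obj :: "'o set"
  Arr :: "'a set"
  Dom :: "'a \<Rightarrow> 'o"
  Cod :: "'a \<Rightarrow> 'o"
  Idn :: "'o \<Rightarrow> 'a"
  Cmp :: "'a \<Rightarrow> 'a \<Rightarrow> 'a"  (infixl "\<cdot>\<index>" 70)

definition hom :: "('o, 'a) cat \<Rightarrow> 'o \<Rightarrow> 'o \<Rightarrow> 'a set" where
  "hom C A B = {f \<in> Arr C. Dom C f = A \<and> Cod C f = B}"

text \<open>Composition is written in the usual order and is only meaningful on composable pairs.\<close>

locale category =
  fixes C :: "('o, 'a) cat" (structure)
  assumes dom_obj: "f \<in> Arr C \<Longrightarrow> Dom C f \<in> Obj C"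
    and cod_obj: "f \<in> Arr C \<Longrightarrow> Cod C f \<in> Obj C"
    and id_hom: "A \<in> Obj C \<Longrightarrow> Idn C A \<in> hom C A A"
    and cmp_hom: "f \<in> hom C A B \<Longrightarrow> g \<in> hom C B D \<Longrightarrow> g \<cdot> f \<in> hom C A D"
    and id_left: "f \<in> hom C A B \<Longrightarrow> Idn C B \<cdot> f = f"
    and id_right: "f \<in> hom C A B \<Longrightarrow> f \<cdot> Idn C A = f"
    and assoc: "f \<in> hom C A B \<Longrightarrow> g \<in> hom C B D \<Longrightarrow> h \<in> hom C D E \<Longrightarrow>
      (h \<cdot> g) \<cdot> f = h \<cdot> (g \<cdot> f)"

definition op_cat :: "('o, 'a) cat \<Rightarrow> ('o, 'a) cat" where
  "op_cat C = \<lparr>Obj = Obj C, Arr = Arr C, Dom = Cod C, Cod = Dom C, Idn = Idn C,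
    Cmp = (\<lambda>g f. f \<cdot>\<^bsub>C\<^esub> g)\<rparr>"

definition monic :: "('o, 'a) cat \<Rightarrow> 'a \<Rightarrow> bool" where
  "monic C m \<longleftrightarrow> m \<in> Arr C \<and>
    (\<forall>A. \<forall>f \<in> hom C A (Dom C m). \<forall>g \<in> hom C A (Dom C m). m \<cdot>\<^bsub>C\<^esub> f = m \<cdot>\<^bsub>C\<^esub> g \<longrightarrow> f = g)"

definition isomorphism :: "('o, 'a) cat \<Rightarrow> 'a \<Rightarrow> bool" where
  "isomorphism C f \<longleftrightarrow> f \<in> Arr C \<and>
    (\<exists>g \<in> hom C (Cod C f) (Dom C f). g \<cdot>\<^bsub>C\<^esub> f = Idn C (Dom C f) \<and> f \<cdot>\<^bsub>C\<^esub> g = Idn C (Cod C f))"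

definition initial :: "('o, 'a) cat \<Rightarrow> 'o \<Rightarrow> bool" where
  "initial C Z \<longleftrightarrow> Z \<in> Obj C \<and> (\<forall>A \<in> Obj C. \<exists>!f. f \<in> hom C Z A)"

definition factors_through :: "('o, 'a) cat \<Rightarrow> 'a \<Rightarrow> 'a \<Rightarrow> bool" where
  "factors_through C a j \<longleftrightarrow> (\<exists>h \<in> hom C (Dom C a) (Dom C j). j \<cdot>\<^bsub>C\<^esub> h = a)"

text \<open>\<open>j\<close> represents the join of the subobjects \<open>a\<close> and \<open>b\<close> of \<open>Z\<close>.\<close>

definition is_join :: "('o, 'a) cat \<Rightarrow> 'o \<Rightarrow> 'a \<Rightarrow> 'a \<Rightarrow> 'a \<Rightarrow> bool" where
  "is_join C Z a b j \<longleftrightarrow>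
    monic C a \<and> monic C b \<and> monic C j \<and> Cod C a = Z \<and> Cod C b = Z \<and> Cod C j = Z \<and>
    factors_through C a j \<and> factors_through C b j \<and>
    (\<forall>k. monic C k \<and> Cod C k = Z \<and> factors_through C a k \<and> factors_through C b k \<longrightarrow>
      factors_through C j k)"


section \<open>Limits, colimits and exponentials\<close>

datatype ('o, 'a, 'p, 'b) fctr = Fctr (fobj: "'o \<Rightarrow> 'p") (farr: "'a \<Rightarrow> 'b")

definition is_functor :: "('o, 'a) cat \<Rightarrow> ('p, 'b) cat \<Rightarrow> ('o, 'a, 'p, 'b) fctr \<Rightarrow> bool" where
  "is_functor C D F \<longleftrightarrow>
    (\<forall>A \<in> Obj C. fobj F A \<in> Obj D) \<and>
    (\<forall>f \<in> Arr C. farr F f \<in> hom D (fobj F (Dom C f)) (fobj F (Cod C f))) \<and>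
    (\<forall>A \<in> Obj C. farr F (Idn C A) = Idn D (fobj F A)) \<and>
    (\<forall>f \<in> Arr C. \<forall>g \<in> Arr C. Cod C f = Dom C g \<longrightarrow>
      farr F (g \<cdot>\<^bsub>C\<^esub> f) = farr F g \<cdot>\<^bsub>D\<^esub> farr F f)"

definition is_cone ::
  "('i, 'j) cat \<Rightarrow> ('o, 'a) cat \<Rightarrow> ('i, 'j, 'o, 'a) fctr \<Rightarrow> 'o \<Rightarrow> ('i \<Rightarrow> 'a) \<Rightarrow> bool" where
  "is_cone J C D L p \<longleftrightarrow> L \<in> Obj C \<and>
    (\<forall>i \<in> Obj J. p i \<in> hom C L (fobj D i)) \<and>
    (\<forall>u \<in> Arr J. farr D u \<cdot>\<^bsub>C\<^esub> p (Dom J u) = p (Cod J u))"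

definition is_limit ::
  "('i, 'j) cat \<Rightarrow> ('o, 'a) cat \<Rightarrow> ('i, 'j, 'o, 'a) fctr \<Rightarrow> 'o \<Rightarrow> ('i \<Rightarrow> 'a) \<Rightarrow> bool" where
  "is_limit J C D L p \<longleftrightarrow> is_cone J C D L p \<and>
    (\<forall>M q. is_cone J C D M q \<longrightarrow>
      (\<exists>!h. h \<in> hom C M L \<and> (\<forall>i \<in> Obj J. p i \<cdot>\<^bsub>C\<^esub> h = q i)))"

definition has_limits :: "('i, 'j) cat \<Rightarrow> ('o, 'a) cat \<Rightarrow> bool" where
  "has_limits J C \<longleftrightarrow> (\<forall>D. is_functor J C D \<longrightarrow> (\<exists>L p. is_limit J C D L p))"

definition is_coequalizer :: "('o, 'a) cat \<Rightarrow> 'a \<Rightarrow> 'a \<Rightarrow> 'a \<Rightarrow> bool" where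
  "is_coequalizer C u v q \<longleftrightarrow> q \<in> Arr C \<and> Dom C q = Cod C u \<and> q \<cdot>\<^bsub>C\<^esub> u = q \<cdot>\<^bsub>C\<^esub> v \<and>
    (\<forall>B. \<forall>r \<in> hom C (Cod C u) B. r \<cdot>\<^bsub>C\<^esub> u = r \<cdot>\<^bsub>C\<^esub> v \<longrightarrow>
      (\<exists>!h. h \<in> hom C (Cod C q) B \<and> h \<cdot>\<^bsub>C\<^esub> q = r))"

definition coeq :: "('o, 'a) cat \<Rightarrow> 'a \<Rightarrow> 'a \<Rightarrow> 'a" where
  "coeq C u v = (SOME q. is_coequalizer C u v q)"

text \<open>\<open>is_pullback C f g p q\<close>: the square \<open>f \<cdot> p = g \<cdot> q\<close> is a pullback of the cospan \<open>f\<close>, \<open>g\<close>.\<close>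

definition is_pullback :: "('o, 'a) cat \<Rightarrow> 'a \<Rightarrow> 'a \<Rightarrow> 'a \<Rightarrow> 'a \<Rightarrow> bool" where
  "is_pullback C f g p q \<longleftrightarrow>
    f \<in> Arr C \<and> g \<in> Arr C \<and> Cod C f = Cod C g \<and>
    p \<in> hom C (Dom C p) (Dom C f) \<and> q \<in> hom C (Dom C p) (Dom C g) \<and>
    f \<cdot>\<^bsub>C\<^esub> p = g \<cdot>\<^bsub>C\<^esub> q \<and>
    (\<forall>A. \<forall>a \<in> hom C A (Dom C f). \<forall>b \<in> hom C A (Dom C g). f \<cdot>\<^bsub>C\<^esub> a = g \<cdot>\<^bsub>C\<^esub> b \<longrightarrow>
      (\<exists>!h. h \<in> hom C A (Dom C p) \<and> p \<cdot>\<^bsub>C\<^esub> h = a \<and> q \<cdot>\<^bsub>C\<^esub> h = b))"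

text \<open>Pullbacks, binary products and exponentials are fixed by choice; the choice is
  immaterial up to canonical isomorphism.\<close>

definition pb :: "('o, 'a) cat \<Rightarrow> 'a \<Rightarrow> 'a \<Rightarrow> 'a \<times> 'a" where
  "pb C f g = (SOME (p, q). is_pullback C f g p q)"

definition pb_obj :: "('o, 'a) cat \<Rightarrow> 'a \<Rightarrow> 'a \<Rightarrow> 'o" where
  "pb_obj C f g = Dom C (fst (pb C f g))"

definition pb_pair :: "('o, 'a) cat \<Rightarrow> 'a \<Rightarrow> 'a \<Rightarrow> 'a \<Rightarrow> 'a \<Rightarrow> 'a" where
  "pb_pair C f g a b = (THE h. h \<in> hom C (Dom C a) (pb_obj C f g) \<and>
    fst (pb C f g) \<cdot>\<^bsub>C\<^esub> h = a \<and> snd (pb C f g) \<cdot>\<^bsub>C\<^esub> h = b)"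

definition is_product :: "('o, 'a) cat \<Rightarrow> 'o \<Rightarrow> 'o \<Rightarrow> 'a \<Rightarrow> 'a \<Rightarrow> bool" where
  "is_product C A B p q \<longleftrightarrow> p \<in> hom C (Dom C p) A \<and> q \<in> hom C (Dom C p) B \<and>
    (\<forall>Z. \<forall>a \<in> hom C Z A. \<forall>b \<in> hom C Z B.
      \<exists>!h. h \<in> hom C Z (Dom C p) \<and> p \<cdot>\<^bsub>C\<^esub> h = a \<and> q \<cdot>\<^bsub>C\<^esub> h = b)"

definition prodc :: "('o, 'a) cat \<Rightarrow> 'o \<Rightarrow> 'o \<Rightarrow> 'a \<times> 'a" where
  "prodc C A B = (SOME (p, q). is_product C A B p q)"

definition pr1 :: "('o, 'a) cat \<Rightarrow> 'o \<Rightarrow> 'o \<Rightarrow> 'a" where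
  "pr1 C A B = fst (prodc C A B)"

definition pr2 :: "('o, 'a) cat \<Rightarrow> 'o \<Rightarrow> 'o \<Rightarrow> 'a" where
  "pr2 C A B = snd (prodc C A B)"

definition prod_obj :: "('o, 'a) cat \<Rightarrow> 'o \<Rightarrow> 'o \<Rightarrow> 'o" where
  "prod_obj C A B = Dom C (pr1 C A B)"

definition pairing :: "('o, 'a) cat \<Rightarrow> 'a \<Rightarrow> 'a \<Rightarrow> 'a" where
  "pairing C a b = (THE h. h \<in> hom C (Dom C a) (prod_obj C (Cod C a) (Cod C b)) \<and>
    pr1 C (Cod C a) (Cod C b) \<cdot>\<^bsub>C\<^esub> h = a \<and> pr2 C (Cod C a) (Cod C b) \<cdot>\<^bsub>C\<^esub> h = b)"

definition prod_map :: "('o, 'a) cat \<Rightarrow> 'a \<Rightarrow> 'a \<Rightarrow> 'a" where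
  "prod_map C f g = pairing C (f \<cdot>\<^bsub>C\<^esub> pr1 C (Dom C f) (Dom C g)) (g \<cdot>\<^bsub>C\<^esub> pr2 C (Dom C f) (Dom C g))"

text \<open>\<open>is_exponential C A B E e\<close>: the object \<open>E\<close> with evaluation \<open>e : E \<times> A \<rightarrow> B\<close> is the
  exponential \<open>B\<^sup>A\<close>.\<close>

definition is_exponential :: "('o, 'a) cat \<Rightarrow> 'o \<Rightarrow> 'o \<Rightarrow> 'o \<Rightarrow> 'a \<Rightarrow> bool" where
  "is_exponential C A B E e \<longleftrightarrow> E \<in> Obj C \<and> e \<in> hom C (prod_obj C E A) B \<and>
    (\<forall>Z \<in> Obj C. \<forall>g \<in> hom C (prod_obj C Z A) B.
      \<exists>!h. h \<in> hom C Z E \<and> e \<cdot>\<^bsub>C\<^esub> prod_map C h (Idn C A) = g)"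

definition expc :: "('o, 'a) cat \<Rightarrow> 'o \<Rightarrow> 'o \<Rightarrow> 'o \<times> 'a" where
  "expc C A B = (SOME (E, e). is_exponential C A B E e)"

definition exp_obj :: "('o, 'a) cat \<Rightarrow> 'o \<Rightarrow> 'o \<Rightarrow> 'o" where
  "exp_obj C A B = fst (expc C A B)"

definition evalc :: "('o, 'a) cat \<Rightarrow> 'o \<Rightarrow> 'o \<Rightarrow> 'a" where
  "evalc C A B = snd (expc C A B)"

definition curryc :: "('o, 'a) cat \<Rightarrow> 'o \<Rightarrow> 'o \<Rightarrow> 'a \<Rightarrow> 'a" where
  "curryc C Z A g = (THE h. h \<in> hom C Z (exp_obj C A (Cod C g)) \<and>
    evalc C A (Cod C g) \<cdot>\<^bsub>C\<^esub> prod_map C h (Idn C A) = g)"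

text \<open>\<open>exp_post C A f\<close> is \<open>f\<^sup>A : Y\<^sup>A \<rightarrow> X\<^sup>A\<close> for \<open>f : Y \<rightarrow> X\<close>, and
  \<open>exp_pre C K f\<close> is \<open>K\<^sup>f : K\<^sup>Y \<rightarrow> K\<^sup>X\<close> for \<open>f : X \<rightarrow> Y\<close>.\<close>

definition exp_post :: "('o, 'a) cat \<Rightarrow> 'o \<Rightarrow> 'a \<Rightarrow> 'a" where
  "exp_post C A f = curryc C (exp_obj C A (Dom C f)) A (f \<cdot>\<^bsub>C\<^esub> evalc C A (Dom C f))"

definition exp_pre :: "('o, 'a) cat \<Rightarrow> 'o \<Rightarrow> 'a \<Rightarrow> 'a" where
  "exp_pre C K f = curryc C (exp_obj C (Cod C f) K) (Dom C f)
    (evalc C (Cod C f) K \<cdot>\<^bsub>C\<^esub> prod_map C (Idn C (exp_obj C (Cod C f) K)) f)"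


section \<open>The category of sets\<close>

text \<open>The category of all sets is rendered relative to a universe: a type \<open>'u\<close> whose cardinality
  is inaccessible.  A set is small if it has fewer elements than the universe.\<close>

definition inaccessible :: "'u set \<Rightarrow> bool" where
  "inaccessible U \<longleftrightarrow> natLeq <o |U| \<and> regularCard |U| \<and> (\<forall>A \<subseteq> U. |A| <o |U| \<longrightarrow> |Pow A| <o |U| )"

definition small :: "'u set \<Rightarrow> bool" where
  "small A \<longleftrightarrow> |A| <o |UNIV :: 'u set|"

datatype ('o, 'f) arrow = Arrow (src: 'o) (tgt: 'o) (fn: 'f)

type_synonym 'u sarrow = "('u set, 'u \<Rightarrow> 'u) arrow"

definition SET :: "('u set, 'u sarrow) cat" where
  "SET = \<lparr>Obj = {A. small A},
    Arr = {Arrow A B f | A B f. small A \<and> small B \<and> f \<in> A \<rightarrow>\<^sub>E B},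
    Dom = src, Cod = tgt,
    Idn = (\<lambda>A. Arrow A A (\<lambda>x\<in>A. x)),
    Cmp = (\<lambda>g f. Arrow (src f) (tgt g) (compose (src f) (fn g) (fn f)))\<rparr>"

definition small_cat :: "('u, 'u) cat \<Rightarrow> bool" where
  "small_cat J \<longleftrightarrow> category J \<and> small (Obj J) \<and> small (Arr J)"

text \<open>Every category whose sets of objects and arrows are small relative to \<open>'u\<close> is isomorphic
  to one with objects and arrows in \<open>'u\<close>.  Colimits are limits in the opposite category.\<close>

definition bicomplete :: "'u itself \<Rightarrow> ('o, 'a) cat \<Rightarrow> bool" where
  "bicomplete U C \<longleftrightarrow>
    (\<forall>J :: ('u, 'u) cat. small_cat J \<longrightarrow> has_limits J C \<and> has_limits (op_cat J) (op_cat C))"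

definition fun_cat :: "('o, 'a) cat \<Rightarrow> ('p, 'b) cat \<Rightarrow>
    (('o, 'a, 'p, 'b) fctr, (('o, 'a, 'p, 'b) fctr, 'o \<Rightarrow> 'b) arrow) cat" where
  "fun_cat C D = \<lparr>
    Obj = {F. is_functor C D F \<and> fobj F \<in> extensional (Obj C) \<and> farr F \<in> extensional (Arr C)},
    Arr = {Arrow F G t | F G t.
      is_functor C D F \<and> fobj F \<in> extensional (Obj C) \<and> farr F \<in> extensional (Arr C) \<and>
      is_functor C D G \<and> fobj G \<in> extensional (Obj C) \<and> farr G \<in> extensional (Arr C) \<and>
      t \<in> (\<Pi>\<^sub>E A \<in> Obj C. hom D (fobj F A) (fobj G A)) \<and>
      (\<forall>f \<in> Arr C. t (Cod C f) \<cdot>\<^bsub>D\<^esub> farr F f = farr G f \<cdot>\<^bsub>D\<^esub> t (Dom C f))},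
    Dom = src, Cod = tgt,
    Idn = (\<lambda>F. Arrow F F (\<lambda>A\<in>Obj C. Idn D (fobj F A))),
    Cmp = (\<lambda>s t. Arrow (src t) (tgt s) (\<lambda>A\<in>Obj C. fn s A \<cdot>\<^bsub>D\<^esub> fn t A))\<rparr>"


section \<open>Cubical sets\<close>

datatype pt = Pt0 | Var nat | Pt1

definition bip :: "nat \<Rightarrow> pt set" where
  "bip n = {Pt0, Pt1} \<union> Var ` {1..n}"

type_synonym cube_arrow = "(nat, pt \<Rightarrow> pt) arrow"

text \<open>An arrow \<open>[m] \<rightarrow> [n]\<close> is a bipointed function in the opposite direction.\<close>

definition Cube :: "(nat, cube_arrow) cat" where
  "Cube = \<lparr>Obj = UNIV,
    Arr = {Arrow m n h | m n h. h \<in> bip n \<rightarrow>\<^sub>E bip m \<and> h Pt0 = Pt0 \<and> h Pt1 = Pt1},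
    Dom = src, Cod = tgt,
    Idn = (\<lambda>n. Arrow n n (\<lambda>x\<in>bip n. x)),
    Cmp = (\<lambda>g f. Arrow (src f) (tgt g) (compose (bip (tgt g)) (fn f) (fn g)))\<rparr>"

type_synonym 'u cset = "(nat, cube_arrow, 'u set, 'u sarrow) fctr"
type_synonym 'u cmap = "('u cset, nat \<Rightarrow> 'u sarrow) arrow"

definition cSet :: "('u cset, 'u cmap) cat" where
  "cSet = fun_cat (op_cat Cube) SET"

text \<open>As \<open>Cube\<close> has countably many arrows, these can be coded by elements of an infinite
  universe; the representables are formed from the coded hom-sets.\<close>

definition enc :: "cube_arrow \<Rightarrow> 'u" where
  "enc = (SOME e. inj_on e (Arr Cube))"

definition dec :: "'u \<Rightarrow> cube_arrow" where
  "dec = inv_into (Arr Cube) enc"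

definition cube :: "nat \<Rightarrow> 'u cset" where
  "cube n = Fctr (\<lambda>k. enc ` hom Cube k n)
    (\<lambda>a \<in> Arr Cube. Arrow (enc ` hom Cube (Cod Cube a) n) (enc ` hom Cube (Dom Cube a) n)
      (\<lambda>x \<in> enc ` hom Cube (Cod Cube a) n. enc (dec x \<cdot>\<^bsub>Cube\<^esub> a)))"

definition cube_map :: "cube_arrow \<Rightarrow> 'u cmap" where
  "cube_map b = Arrow (cube (Dom Cube b)) (cube (Cod Cube b))
    (\<lambda>k. Arrow (enc ` hom Cube k (Dom Cube b)) (enc ` hom Cube k (Cod Cube b))
      (\<lambda>x \<in> enc ` hom Cube k (Dom Cube b). enc (b \<cdot>\<^bsub>Cube\<^esub> dec x)))"

text \<open>The representable \<open>cube 0\<close> is terminal, and \<open>cube 1\<close> is the interval.\<close>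

abbreviation one :: "'u cset" where "one \<equiv> cube 0"

abbreviation II :: "'u cset" where "II \<equiv> cube 1"

definition end0 :: cube_arrow where
  "end0 = Arrow 0 1 (\<lambda>x \<in> bip 1. if x = Pt1 then Pt1 else Pt0)"

definition end1 :: cube_arrow where
  "end1 = Arrow 0 1 (\<lambda>x \<in> bip 1. if x = Pt0 then Pt0 else Pt1)"

definition delta0 :: "'u cmap" where "delta0 = cube_map end0"

definition delta1 :: "'u cmap" where "delta1 = cube_map end1"

definition diag :: "'u cmap" where
  "diag = pairing cSet (Idn cSet II) (Idn cSet II)"

definition comp_proj :: "'u cset \<Rightarrow> 'u sarrow" where
  "comp_proj X = coeq SET (farr X end0) (farr X end1)"

definition pi0 :: "'u cset \<Rightarrow> 'u set" where
  "pi0 X = Cod SET (comp_proj X)"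

definition pi0_map :: "'u cmap \<Rightarrow> 'u sarrow" where
  "pi0_map f = (THE h. h \<in> hom SET (pi0 (Dom cSet f)) (pi0 (Cod cSet f)) \<and>
    h \<cdot>\<^bsub>SET\<^esub> comp_proj (Dom cSet f) = comp_proj (Cod cSet f) \<cdot>\<^bsub>SET\<^esub> fn f 0)"

definition bijective_on_components :: "'u cmap \<Rightarrow> bool" where
  "bijective_on_components f \<longleftrightarrow>
    bij_betw (fn (pi0_map f)) (pi0 (Dom cSet f)) (pi0 (Cod cSet f))"


section \<open>Weak factorization systems and model structures\<close>

definition lifts :: "('o, 'a) cat \<Rightarrow> 'a \<Rightarrow> 'a \<Rightarrow> bool" where
  "lifts C l r \<longleftrightarrow>
    (\<forall>u \<in> hom C (Dom C l) (Dom C r). \<forall>v \<in> hom C (Cod C l) (Cod C r). r \<cdot>\<^bsub>C\<^esub> u = v \<cdot>\<^bsub>C\<^esub> l \<longrightarrow>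
      (\<exists>d \<in> hom C (Cod C l) (Dom C r). d \<cdot>\<^bsub>C\<^esub> l = u \<and> r \<cdot>\<^bsub>C\<^esub> d = v))"

definition rlp :: "('o, 'a) cat \<Rightarrow> 'a set \<Rightarrow> 'a set" where
  "rlp C L = {r \<in> Arr C. \<forall>l \<in> L. lifts C l r}"

definition llp :: "('o, 'a) cat \<Rightarrow> 'a set \<Rightarrow> 'a set" where
  "llp C R = {l \<in> Arr C. \<forall>r \<in> R. lifts C l r}"

definition weak_factorization_system :: "('o, 'a) cat \<Rightarrow> 'a set \<Rightarrow> 'a set \<Rightarrow> bool" where
  "weak_factorization_system C L R \<longleftrightarrow> L = llp C R \<and> R = rlp C L \<and>
    (\<forall>f \<in> Arr C. \<exists>l \<in> L. \<exists>r \<in> R. Cod C l = Dom C r \<and> f = r \<cdot>\<^bsub>C\<^esub> l)"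

definition three_for_two :: "('o, 'a) cat \<Rightarrow> 'a set \<Rightarrow> bool" where
  "three_for_two C W \<longleftrightarrow> (\<forall>f \<in> Arr C. \<forall>g \<in> Arr C. Cod C f = Dom C g \<longrightarrow>
    (f \<in> W \<and> g \<in> W \<longrightarrow> g \<cdot>\<^bsub>C\<^esub> f \<in> W) \<and>
    (f \<in> W \<and> g \<cdot>\<^bsub>C\<^esub> f \<in> W \<longrightarrow> g \<in> W) \<and>
    (g \<in> W \<and> g \<cdot>\<^bsub>C\<^esub> f \<in> W \<longrightarrow> f \<in> W))"

definition quillen_model_structure ::
    "'u itself \<Rightarrow> ('o, 'a) cat \<Rightarrow> 'a set \<Rightarrow> 'a set \<Rightarrow> 'a set \<Rightarrow> bool" where
  "quillen_model_structure U M C W F \<longleftrightarrow> category M \<and> bicomplete U M \<and>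
    C \<subseteq> Arr M \<and> W \<subseteq> Arr M \<and> F \<subseteq> Arr M \<and>
    weak_factorization_system M C (W \<inter> F) \<and> weak_factorization_system M (C \<inter> W) F \<and>
    three_for_two M W"

definition fibration_extension_property :: "('o, 'a) cat \<Rightarrow> 'a set \<Rightarrow> 'a set \<Rightarrow> bool" where
  "fibration_extension_property C L R \<longleftrightarrow>
    (\<forall>f \<in> R. \<forall>e \<in> L. Dom C e = Cod C f \<longrightarrow>
      (\<exists>f' \<in> R. \<exists>q. Cod C f' = Cod C e \<and> is_pullback C e f' f q))"


section \<open>Cofibrations, fibrations and weak equivalences of cubical sets\<close>

locale cofibrations =
  fixes \<C> :: "'u cmap set"
  assumes cof_monic: "c \<in> \<C> \<Longrightarrow> monic cSet c"
    and C0: "initial cSet Z \<Longrightarrow> c \<in> hom cSet Z A \<Longrightarrow> c \<in> \<C>"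
    and C1: "isomorphism cSet c \<Longrightarrow> c \<in> \<C>"
    and C2: "c \<in> \<C> \<Longrightarrow> d \<in> \<C> \<Longrightarrow> Cod cSet c = Dom cSet d \<Longrightarrow> d \<cdot>\<^bsub>cSet\<^esub> c \<in> \<C>"
    and C3: "c \<in> \<C> \<Longrightarrow> is_pullback cSet f c c' q \<Longrightarrow> c' \<in> \<C>"
    and C4: "\<exists>\<Phi>. \<exists>t \<in> hom cSet one \<Phi>. t \<in> \<C> \<and>
      (\<forall>c \<in> \<C>. \<exists>!(x, y). x \<in> hom cSet (Cod cSet c) \<Phi> \<and> y \<in> hom cSet (Dom cSet c) one \<and>
        is_pullback cSet x t c y)"
    and C5: "delta0 \<in> \<C>" "delta1 \<in> \<C>"
    and C6: "a \<in> \<C> \<Longrightarrow> b \<in> \<C> \<Longrightarrow> is_join cSet Z a b j \<Longrightarrow> j \<in> \<C>"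
    and C7: "diag \<in> \<C>"

definition TFib :: "'u cmap set \<Rightarrow> 'u cmap set" where
  "TFib \<C> = rlp cSet \<C>"

text \<open>\<open>eval_pr X\<close> is \<open>\<langle>eval, p\<^sub>2\<rangle> : X\<^sup>I \<times> I \<rightarrow> X \<times> I\<close>.\<close>

definition eval_pr :: "'u cset \<Rightarrow> 'u cmap" where
  "eval_pr X = pairing cSet (evalc cSet II X) (pr2 cSet (exp_obj cSet II X) II)"

text \<open>\<open>gap f\<close> is the canonical map
  \<open>Y\<^sup>I \<times> I \<rightarrow> (X\<^sup>I \<times> I) \<times>\<^bsub>X \<times> I\<^esub> (Y \<times> I)\<close> for \<open>f : Y \<rightarrow> X\<close>.\<close>

definition gap :: "'u cmap \<Rightarrow> 'u cmap" where
  "gap f = pb_pair cSet (eval_pr (Cod cSet f)) (prod_map cSet f (Idn cSet II))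
    (prod_map cSet (exp_post cSet II f) (Idn cSet II)) (eval_pr (Dom cSet f))"

definition Fib :: "'u cmap set \<Rightarrow> 'u cmap set" where
  "Fib \<C> = {f \<in> Arr cSet. gap f \<in> TFib \<C>}"

definition fibrant :: "'u cmap set \<Rightarrow> 'u cset \<Rightarrow> bool" where
  "fibrant \<C> K \<longleftrightarrow> K \<in> Obj cSet \<and> (\<exists>k \<in> hom cSet K one. k \<in> Fib \<C>)"

definition TCof :: "'u cmap set \<Rightarrow> 'u cmap set" where
  "TCof \<C> = llp cSet (Fib \<C>)"

definition WEq :: "'u cmap set \<Rightarrow> 'u cmap set" where
  "WEq \<C> = {g \<cdot>\<^bsub>cSet\<^esub> h | g h. h \<in> TCof \<C> \<and> g \<in> TFib \<C> \<and> Cod cSet h = Dom cSet g}"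

definition weak_homotopy_equivalences :: "'u cmap set \<Rightarrow> 'u cmap set" where
  "weak_homotopy_equivalences \<C> = {f \<in> Arr cSet.
    \<forall>K. fibrant \<C> K \<longrightarrow> bijective_on_components (exp_pre cSet K f)}"

end

theory Submission
  imports Defs "HOL-Library.Countable_Set"
begin

text \<open>
  The theorem rests on a comparison: under the fibration extension property, a map \<open>f : X \<rightarrow> Y\<close> lies in
  \<open>\<W>\<close> iff precomposition with it is bijective on homotopy classes \<open>[Y, K] \<rightarrow> [X, K]\<close> for all fibrant
  \<open>K\<close> (predicate \<open>whe\<close>). Maps of the latter kind clearly have the 3-for-2 property, and since the
  connected components of \<open>K\<^sup>X\<close> are the homotopy classes of maps \<open>X \<rightarrow> K\<close>, they are the weak homotopy
  equivalences (\<open>weak_homotopy_equivalence_iff\<close>).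

  Maps in \<open>\<W>\<close> satisfy \<open>whe\<close> because both of their factors do. A trivial fibration has a homotopy inverse
  section (\<open>TFib_whe\<close>). Along a trivial cofibration, maps into a fibrant \<open>K\<close> extend, and so do homotopies,
  because the endpoint map \<open>K\<^sup>I \<rightarrow> K \<times> K\<close> is a fibration (\<open>ev01_Fib\<close>, \<open>TCof_whe\<close>).

  Conversely, factoring \<open>f\<close> into a trivial cofibration and a fibration, one has to show that a
  fibration \<open>p : Y \<rightarrow> X\<close> with \<open>whe\<close> is a trivial fibration. If \<open>X\<close> is fibrant, then so is \<open>Y\<close>, and \<open>p\<close>
  has a homotopy inverse. Lifting a homotopy along \<open>p\<close> straightens the inverse to a section \<open>s\<close>; the
  homotopy from \<open>s \<cdot> p\<close> to the identity is made fibrewise by box filling; and a fibration that contracts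
  fibrewise onto a section is trivial, by box filling once more (\<open>Fib_whe_TFib\<close>). For arbitrary \<open>X\<close>,
  choose a trivial cofibration \<open>X \<rightarrow> X'\<close> into a fibrant object and extend \<open>p\<close> to a fibration
  \<open>p' : Y' \<rightarrow> X'\<close>. Trivial cofibrations are stable under pullback along fibrations, so \<open>Y \<rightarrow> Y'\<close> is a trivial
  cofibration (\<open>frobenius\<close>); hence \<open>p'\<close> satisfies \<open>whe\<close> over a fibrant base and is trivial, and
  with it its pullback \<open>p\<close> (\<open>whe_Fib_TFib\<close>).

  Lifting problems are treated as extension problems for subpresheaves. Two reformulations make that
  possible. First, being a cofibration is a local property: a monomorphism is a
  cofibration iff its pullbacks to all representables are (\<open>cofibration_local\<close>), a consequence of the
  uniqueness of classifying maps. So cofibrations are described by a class of sieves on cubes. Second,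
  by the exponential adjunction, fibrations are the maps that lift against the box inclusions
  \<open>A \<times> I \<union> graph i \<subseteq> P \<times> I\<close> (\<open>gap_ext\<close>), where \<open>A \<subseteq> P\<close> is cofibrant and \<open>i : P \<rightarrow> I\<close>.

  The two factorizations are given by explicit objects. For a cofibration followed by a trivial
  fibration it is the object of partial elements with cofibrant extent (\<open>factor_C_TFib\<close>). For a trivial
  cofibration followed by a fibration it is an object of well-founded trees, in which a filler of every
  box has been added freely (\<open>factor_TCof_Fib\<close>); such trees are determined by the labels along finite
  paths, so that they form a set of the universe. The retract argument then gives
  \<open>\<C> \<inter> \<W> = TCof\<close> and \<open>\<W> \<inter> \<F> = TFib\<close>. Limits and colimits are computed at each stage separately.

  The constructions produce presheaves whose elements are functions, sieves or trees. They
  are carried out with presheaves over arbitrary element types, of which the small ones are coded as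
  cubical sets (\<open>cset_coding\<close>).
\<close>


section \<open>Smallness relative to the universe\<close>

locale universe =
  fixes U :: "'u itself"
  assumes inaccessible_U: "inaccessible (UNIV :: 'u set)"
begin

text \<open>Smallness for sets over any type, to be applied to sets of functions or of trees before
  their elements are coded in the universe.\<close>

definition tiny :: "'z set => bool" where
  "tiny A \<longleftrightarrow> |A| <o |UNIV :: 'u set|"

lemma small_iff_tiny: "small (A :: 'u set) \<longleftrightarrow> tiny A"
  by (simp add: small_def tiny_def)

lemma infinite_U: "infinite (UNIV :: 'u set)"
  using inaccessible_U unfolding inaccessible_def
  by (meson finite_iff_ordLess_natLeq not_ordLess_ordLeq ordLess_imp_ordLeq)

lemma stable_U: "stable |UNIV :: 'u set|"
  using inaccessible_U infinite_U unfolding inaccessible_def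
  by (intro regularCard_stable[OF card_of_Card_order]) (auto simp: Field_card_of)

lemma tiny_le: "|A| \<le>o |B| ==> tiny B ==> tiny A"
  unfolding tiny_def by (rule ordLeq_ordLess_trans)

lemma tiny_subset: "tiny B ==> A \<subseteq> B ==> tiny A"
  by (meson tiny_le card_of_mono1)

lemma tiny_image: "tiny A ==> tiny (f ` A)"
  by (meson tiny_le card_of_image)

lemma tiny_inj: "inj_on f A ==> f ` A \<subseteq> B ==> tiny B ==> tiny A"
  by (meson tiny_le card_of_ordLeq)

lemma tiny_code: "tiny (A :: 'z set) ==> \<exists>f :: 'z => 'u. inj_on f A"
  unfolding tiny_def using ordLess_imp_ordLeq card_of_ordLeq by (metis)

lemma tiny_countable: "countable A ==> tiny A"
proof -
  assume "countable A"
  then have "|A| \<le>o natLeq"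
    by (metis card_of_nat card_of_ordLeq countable_def ordLeq_ordIso_trans subset_UNIV)
  then show ?thesis
    using inaccessible_U unfolding tiny_def inaccessible_def by (meson ordLeq_ordLess_trans)
qed

text \<open>Regularity of the universe enters here, as stability: the family is coded fibre by fibre in
  \<open>'u\<close>.\<close>

lemma tiny_Sigma: "tiny A ==> (\<And>a. a \<in> A ==> tiny (B a)) ==> tiny (Sigma A B)"
proof -
  assume A: "tiny A" and B: "\<And>a. a \<in> A ==> tiny (B a)"
  obtain f :: "'a => 'u" where f: "inj_on f A" using tiny_code[OF A] by blast
  have "\<forall>a. \<exists>g :: 'b => 'u. a \<in> A \<longrightarrow> inj_on g (B a)"
    using tiny_code[OF B] by blast
  then obtain g :: "'a => 'b => 'u" where g: "\<And>a. a \<in> A ==> inj_on (g a) (B a)"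
    by metis
  let ?S = "Sigma (f ` A) (\<lambda>c. g (inv_into A f c) ` B (inv_into A f c))"
  have "|?S| <o |UNIV :: 'u set|"
  proof (rule stable_elim[OF stable_U])
    show "|f ` A| <o |UNIV :: 'u set|" using tiny_image[OF A] unfolding tiny_def .
    fix c assume "c \<in> f ` A"
    then have "inv_into A f c \<in> A" by (rule inv_into_into)
    then show "|g (inv_into A f c) ` B (inv_into A f c)| <o |UNIV :: 'u set|"
      using tiny_image[OF B] unfolding tiny_def by blast
  qed
  then have t: "tiny ?S" unfolding tiny_def .
  show ?thesis
  proof (rule tiny_inj[OF _ _ t])
    show "inj_on (\<lambda>(a, b). (f a, g a b)) (Sigma A B)"
      using f g by (auto simp: inj_on_def)
    show "(\<lambda>(a, b). (f a, g a b)) ` Sigma A B \<subseteq> ?S"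
      using f by auto
  qed
qed

lemma tiny_Times: "tiny A ==> tiny B ==> tiny (A \<times> B)"
  by (rule tiny_Sigma)

lemma tiny_UN: "tiny A ==> (\<And>a. a \<in> A ==> tiny (B a)) ==> tiny (\<Union>a\<in>A. B a)"
proof -
  assume "tiny A" "\<And>a. a \<in> A ==> tiny (B a)"
  then have "tiny (Sigma A B)" by (rule tiny_Sigma)
  moreover have "(\<Union>a\<in>A. B a) = snd ` Sigma A B" by force
  ultimately show ?thesis using tiny_image by metis
qed

lemma tiny_Un: "tiny A ==> tiny B ==> tiny (A \<union> B)"
  unfolding tiny_def using infinite_U by (rule card_of_Un_ordLess_infinite)

text \<open>As inaccessibility speaks of subsets of \<open>'u\<close>, the set is coded first.\<close>

lemma tiny_Pow: "tiny A ==> tiny (Pow A)"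
proof -
  assume A: "tiny A"
  obtain f :: "'a => 'u" where f: "inj_on f A" using tiny_code[OF A] by blast
  have "tiny (Pow (f ` A))"
    using inaccessible_U tiny_image[OF A, of f] unfolding tiny_def inaccessible_def by auto
  then show ?thesis
    using f by (intro tiny_inj[of "image f" "Pow A" "Pow (f ` A)"])
      (auto simp: inj_on_image_Pow)
qed

text \<open>A set of functions is small as soon as its members are determined by their restriction to a
  small set and take values there in a small set.\<close>

lemma tiny_functions:
  assumes "tiny A" "tiny B"
    and "\<And>f a. f \<in> F ==> a \<in> A ==> f a \<in> B"
    and "\<And>f g. f \<in> F ==> g \<in> F ==> (\<And>a. a \<in> A ==> f a = g a) ==> f = g"
  shows "tiny F"
proof (rule tiny_inj)
  show "tiny (Pow (A \<times> B))" using assms tiny_Times tiny_Pow by blast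
  let ?c = "\<lambda>f. (\<lambda>a. (a, f a)) ` A"
  show "inj_on ?c F"
  proof (rule inj_onI)
    fix f g assume fg: "f \<in> F" "g \<in> F" and e: "?c f = ?c g"
    have "f a = g a" if "a \<in> A" for a
    proof -
      have "(a, f a) \<in> ?c g" using that e by blast
      then show ?thesis by auto
    qed
    then show "f = g" using assms(4) fg by blast
  qed
  show "?c ` F \<subseteq> Pow (A \<times> B)" using assms(3) by auto
qed

end


section \<open>The cube category\<close>

abbreviation cub :: "nat => nat => cube_arrow set" where
  "cub m n \<equiv> hom Cube m n"

abbreviation cube_comp :: "cube_arrow => cube_arrow => cube_arrow"  (infixl "\<odot>" 70) where
  "b \<odot> a \<equiv> Cmp Cube b a"

abbreviation cid :: "nat => cube_arrow" where
  "cid n \<equiv> Idn Cube n"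

lemma cub_iff: "a \<in> cub m n \<longleftrightarrow>
  (\<exists>h. a = Arrow m n h \<and> h \<in> bip n \<rightarrow>\<^sub>E bip m \<and> h Pt0 = Pt0 \<and> h Pt1 = Pt1)"
  by (auto simp: hom_def Cube_def)

lemma bip_ends [simp]: "Pt0 \<in> bip n" "Pt1 \<in> bip n"
  by (auto simp: bip_def)

lemma cub_Arr: "a \<in> cub m n ==> a \<in> Arr Cube"
  and cub_Dom: "a \<in> cub m n ==> Dom Cube a = m"
  by (auto simp: hom_def)

lemma cid_eq: "cid n = Arrow n n (\<lambda>x\<in>bip n. x)"
  by (simp add: Cube_def)

lemma cube_comp_eq: "b \<odot> a = Arrow (src a) (tgt b) (compose (bip (tgt b)) (fn a) (fn b))"
  by (simp add: Cube_def)

lemma cid_cub [simp, intro]: "cid n \<in> cub n n"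
  by (auto simp: cub_iff cid_eq)

lemma comp_cub [intro]: "a \<in> cub l m ==> b \<in> cub m n ==> b \<odot> a \<in> cub l n"
  by (auto simp: cub_iff cube_comp_eq compose_def PiE_iff)

lemma cub_idl: "a \<in> cub m n ==> cid n \<odot> a = a"
  by (auto simp: cub_iff cid_eq cube_comp_eq compose_def fun_eq_iff PiE_iff extensional_def)

lemma cub_idr: "a \<in> cub m n ==> a \<odot> cid m = a"
  by (auto simp: cub_iff cid_eq cube_comp_eq compose_def fun_eq_iff PiE_iff extensional_def) metis

lemma cub_assoc: "a \<in> cub k l ==> b \<in> cub l m ==> c \<in> cub m n ==> (c \<odot> b) \<odot> a = c \<odot> (b \<odot> a)"
  by (auto simp: cub_iff cube_comp_eq compose_def fun_eq_iff PiE_iff extensional_def)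

lemma finite_bip: "finite (bip n)"
  by (auto simp: bip_def)

lemma countable_Cube: "countable (Arr Cube)"
proof -
  have "Arr Cube \<subseteq> (\<Union>m. \<Union>n. Arrow m n ` (bip n \<rightarrow>\<^sub>E bip m))"
    by (auto simp: Cube_def)
  moreover have "countable (\<Union>m. \<Union>n. Arrow m n ` (bip n \<rightarrow>\<^sub>E bip m))"
    by (intro countable_UN[OF countableI_type] countable_image)
      (auto intro!: countable_finite finite_PiE simp: finite_bip)
  ultimately show ?thesis using countable_subset by blast
qed

text \<open>The object \<open>[0]\<close> is terminal, and \<open>bang n\<close> is the arrow \<open>[n] \<rightarrow> [0]\<close>; composing with it turns the
  two endpoints into points \<open>e0 n\<close>, \<open>e1 n\<close> of the interval at every stage.\<close>

definition bang :: "nat => cube_arrow" where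
  "bang n = Arrow n 0 (\<lambda>x\<in>bip 0. x)"

definition e0 :: "nat => cube_arrow" where "e0 n = end0 \<odot> bang n"
definition e1 :: "nat => cube_arrow" where "e1 n = end1 \<odot> bang n"

lemma bip_0: "bip 0 = {Pt0, Pt1}"
  by (auto simp: bip_def)

lemma bang_cub: "bang n \<in> cub n 0"
  by (auto simp: cub_iff bang_def bip_0)

lemma cub_0: "a \<in> cub n 0 ==> a = bang n"
  by (auto simp: cub_iff bang_def bip_0 PiE_iff extensional_def fun_eq_iff)

lemma end0_cub: "end0 \<in> cub 0 1" and end1_cub: "end1 \<in> cub 0 1"
  by (auto simp: cub_iff end0_def end1_def bip_0)

lemma e0_cub [simp, intro]: "e0 n \<in> cub n 1" and e1_cub [simp, intro]: "e1 n \<in> cub n 1"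
  unfolding e0_def e1_def using comp_cub bang_cub end0_cub end1_cub by blast+

lemma e0_comp: "a \<in> cub m n ==> e0 n \<odot> a = e0 m" and e1_comp: "a \<in> cub m n ==> e1 n \<odot> a = e1 m"
  unfolding e0_def e1_def
  using cub_assoc[OF _ bang_cub end0_cub] cub_assoc[OF _ bang_cub end1_cub]
    cub_0[OF comp_cub[OF _ bang_cub]] by metis+

lemma e0_neq_e1: "e0 n \<noteq> e1 n"
proof -
  have "Var 1 \<in> bip 1" by (auto simp: bip_def)
  then have "fn (e0 n) (Var 1) \<noteq> fn (e1 n) (Var 1)"
    by (auto simp: e0_def e1_def cube_comp_eq end0_def end1_def bang_def compose_def)
  then show ?thesis by auto
qed


section \<open>Presheaves on the cube category\<close>

datatype 'z psh = Psh (el: "nat => 'z set") (rs: "cube_arrow => 'z => 'z")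

text \<open>Elements may have any type. Restriction is a plain function, whose values matter only where
  the stages of the arrow and of the element match.\<close>

definition psh :: "'z psh => bool" where
  "psh P \<longleftrightarrow>
    (\<forall>m n. \<forall>a \<in> cub m n. \<forall>z \<in> el P n. rs P a z \<in> el P m) \<and>
    (\<forall>n. \<forall>z \<in> el P n. rs P (cid n) z = z) \<and>
    (\<forall>l m n. \<forall>a \<in> cub l m. \<forall>b \<in> cub m n. \<forall>z \<in> el P n. rs P (b \<odot> a) z = rs P a (rs P b z))"

definition natm :: "'z psh => 'w psh => (nat => 'z => 'w) => bool" where
  "natm P Q f \<longleftrightarrow>
    (\<forall>n. \<forall>z \<in> el P n. f n z \<in> el Q n) \<and>
    (\<forall>m n. \<forall>a \<in> cub m n. \<forall>z \<in> el P n. f m (rs P a z) = rs Q a (f n z))"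

lemma pshI:
  assumes "\<And>m n a z. a \<in> cub m n ==> z \<in> el P n ==> rs P a z \<in> el P m"
    and "\<And>n z. z \<in> el P n ==> rs P (cid n) z = z"
    and "\<And>l m n a b z. a \<in> cub l m ==> b \<in> cub m n ==> z \<in> el P n ==> rs P (b \<odot> a) z = rs P a (rs P b z)"
  shows "psh P"
  using assms unfolding psh_def by blast

lemma rs_el: "psh P ==> a \<in> cub m n ==> z \<in> el P n ==> rs P a z \<in> el P m"
  and rs_id: "psh P ==> z \<in> el P n ==> rs P (cid n) z = z"
  and rs_comp: "psh P ==> a \<in> cub l m ==> b \<in> cub m n ==> z \<in> el P n ==>
    rs P (b \<odot> a) z = rs P a (rs P b z)"
  unfolding psh_def by blast+

lemma natmI:
  assumes "\<And>n z. z \<in> el P n ==> f n z \<in> el Q n"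
    and "\<And>m n a z. a \<in> cub m n ==> z \<in> el P n ==> f m (rs P a z) = rs Q a (f n z)"
  shows "natm P Q f"
  using assms unfolding natm_def by blast

lemma natm_el: "natm P Q f ==> z \<in> el P n ==> f n z \<in> el Q n"
  and natm_rs: "natm P Q f ==> a \<in> cub m n ==> z \<in> el P n ==> f m (rs P a z) = rs Q a (f n z)"
  unfolding natm_def by blast+

lemma natm_id: "natm P P (\<lambda>n z. z)"
  by (simp add: natm_def)

lemma natm_comp: "natm P Q f ==> natm Q R g ==> natm P R (\<lambda>n z. g n (f n z))"
  by (simp add: natm_def)

definition natiso :: "'z psh => 'w psh => (nat => 'z => 'w) => (nat => 'w => 'z) => bool" where
  "natiso P Q e d \<longleftrightarrow> natm P Q e \<and> natm Q P d \<and>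
    (\<forall>n. \<forall>z \<in> el P n. d n (e n z) = z) \<and> (\<forall>n. \<forall>w \<in> el Q n. e n (d n w) = w)"

lemma natm_inverse:
  assumes f: "natm P Q f" and P: "psh P"
    and d: "\<And>n w. w \<in> el Q n ==> d n w \<in> el P n \<and> f n (d n w) = w"
    and inj: "\<And>n z. z \<in> el P n ==> d n (f n z) = z"
  shows "natiso P Q f d"
proof -
  have "natm Q P d"
  proof (rule natmI)
    fix m n a w assume a: "a \<in> cub m n" and w: "w \<in> el Q n"
    show "d m (rs Q a w) = rs P a (d n w)"
      using natm_rs[OF f a] d[OF w] inj rs_el[OF P a] by metis
  qed (use d in blast)
  then show ?thesis using f d inj by (auto simp: natiso_def)
qed

text \<open>Subpresheaves are given by families of subsets.\<close>

definition subf :: "'z psh => (nat => 'z set) => bool" where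
  "subf P A \<longleftrightarrow> (\<forall>n. A n \<subseteq> el P n) \<and> (\<forall>m n. \<forall>a \<in> cub m n. \<forall>z \<in> A n. rs P a z \<in> A m)"

definition restr :: "'z psh => (nat => 'z set) => 'z psh" where
  "restr P A = Psh A (rs P)"

lemma el_restr [simp]: "el (restr P A) = A" and rs_restr [simp]: "rs (restr P A) = rs P"
  by (simp_all add: restr_def)

lemma subf_el: "subf P A ==> z \<in> A n ==> z \<in> el P n"
  and subf_rs: "subf P A ==> a \<in> cub m n ==> z \<in> A n ==> rs P a z \<in> A m"
  unfolding subf_def by blast+

lemma psh_restr: "psh P ==> subf P A ==> psh (restr P A)"
  by (rule pshI) (auto simp: subf_rs rs_id rs_comp dest: subf_el)

definition yo :: "nat => cube_arrow psh" where
  "yo n = Psh (\<lambda>k. cub k n) (\<lambda>a t. t \<odot> a)"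

abbreviation Ip :: "cube_arrow psh" where
  "Ip \<equiv> yo 1"

definition prodp :: "'z psh => 'w psh => ('z \<times> 'w) psh"  (infixr "\<otimes>" 75) where
  "P \<otimes> Q = Psh (\<lambda>n. el P n \<times> el Q n) (\<lambda>a (z, w). (rs P a z, rs Q a w))"

lemma el_yo [simp]: "el (yo n) k = cub k n" and rs_yo [simp]: "rs (yo n) a t = t \<odot> a"
  by (simp_all add: yo_def)

lemma el_prodp [simp]: "el (P \<otimes> Q) n = el P n \<times> el Q n"
  and rs_prodp [simp]: "rs (P \<otimes> Q) a (z, w) = (rs P a z, rs Q a w)"
  by (simp_all add: prodp_def)

lemma psh_yo: "psh (yo n)"
  by (rule pshI) (auto simp: cub_idr cub_assoc)

lemma psh_prodp: "psh P ==> psh Q ==> psh (P \<otimes> Q)"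
  by (rule pshI) (auto simp: rs_el rs_id rs_comp)


section \<open>Cubical sets as presheaves\<close>

text \<open>The functions \<open>cs\<close>, \<open>ap\<close> and \<open>mp\<close> translate between
  cubical sets with their maps and presheaves with natural functions.\<close>

definition cs :: "'u cset => 'u psh" where
  "cs X = Psh (fobj X) (\<lambda>a. fn (farr X a))"

definition ap :: "'u cmap => nat => 'u => 'u" where
  "ap f n x = fn (fn f n) x"

definition mp :: "'u cset => 'u cset => (nat => 'u => 'u) => 'u cmap" where
  "mp X Y f = Arrow X Y (\<lambda>n. Arrow (fobj X n) (fobj Y n) (\<lambda>x\<in>fobj X n. f n x))"

lemma hom_SET_iff: "f \<in> hom SET A B \<longleftrightarrow>
    (\<exists>g. f = Arrow A B g \<and> small A \<and> small B \<and> g \<in> A \<rightarrow>\<^sub>E B)"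
  by (auto simp: hom_def SET_def)

lemma SET_comp: "g \<cdot>\<^bsub>SET\<^esub> f = Arrow (src f) (tgt g) (compose (src f) (fn g) (fn f))"
  by (simp add: SET_def)

lemma SET_id: "Idn SET A = Arrow A A (\<lambda>x\<in>A. x)"
  by (simp add: SET_def)

lemma SET_simps [simp]: "Dom SET f = src f" "Cod SET f = tgt f" "A \<in> Obj SET \<longleftrightarrow> small A"
  by (simp_all add: SET_def)

lemma op_simps [simp]: "Obj (op_cat C) = Obj C" "Arr (op_cat C) = Arr C" "Dom (op_cat C) = Cod C"
  "Cod (op_cat C) = Dom C" "Idn (op_cat C) = Idn C" "g \<cdot>\<^bsub>op_cat C\<^esub> f = f \<cdot>\<^bsub>C\<^esub> g"
  by (simp_all add: op_cat_def)

lemma Obj_Cube [simp]: "Obj Cube = UNIV"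
  by (simp add: Cube_def)

lemma cSet_Obj_iff: "X \<in> Obj cSet \<longleftrightarrow> is_functor (op_cat Cube) SET X \<and> farr X \<in> extensional (Arr Cube)"
  by (simp add: cSet_def fun_cat_def extensional_def)

lemma cSet_simps [simp]: "Dom cSet f = src f" "Cod cSet f = tgt f"
  by (simp_all add: cSet_def fun_cat_def)

lemma functor_iff: "is_functor (op_cat Cube) SET X \<longleftrightarrow>
    (\<forall>n. small (fobj X n)) \<and> (\<forall>m n. \<forall>a \<in> cub m n. farr X a \<in> hom SET (fobj X n) (fobj X m)) \<and>
    (\<forall>n. farr X (cid n) = Idn SET (fobj X n)) \<and>
    (\<forall>l m n. \<forall>a \<in> cub l m. \<forall>b \<in> cub m n. farr X (b \<odot> a) = farr X a \<cdot>\<^bsub>SET\<^esub> farr X b)"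
  unfolding is_functor_def by (auto simp: hom_def)

lemma el_cs [simp]: "el (cs X) = fobj X" and rs_cs: "rs (cs X) a = fn (farr X a)"
  by (simp_all add: cs_def)

lemma farr_hom: "X \<in> Obj cSet ==> a \<in> cub m n ==> farr X a \<in> hom SET (fobj X n) (fobj X m)"
  by (auto simp: cSet_Obj_iff functor_iff)

lemma farr_eq: "X \<in> Obj cSet ==> a \<in> cub m n ==>
    farr X a = Arrow (fobj X n) (fobj X m) (\<lambda>x\<in>fobj X n. rs (cs X) a x)"
  using farr_hom[of X a m n] by (auto simp: hom_SET_iff rs_cs PiE_iff extensional_restrict)

lemma psh_cs: "X \<in> Obj cSet ==> psh (cs X)"
proof (rule pshI)
  assume X: "X \<in> Obj cSet"
  show "rs (cs X) a z \<in> el (cs X) m" if "a \<in> cub m n" "z \<in> el (cs X) n" for m n a z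
    using farr_hom[OF X that(1)] that(2) by (auto simp: hom_SET_iff rs_cs)
  show "rs (cs X) (cid n) z = z" if "z \<in> el (cs X) n" for n z
    using X that by (auto simp: cSet_Obj_iff functor_iff SET_id rs_cs)
  show "rs (cs X) (b \<odot> a) z = rs (cs X) a (rs (cs X) b z)"
    if "a \<in> cub l m" "b \<in> cub m n" "z \<in> el (cs X) n" for l m n a b z
  proof -
    have "farr X (b \<odot> a) = farr X a \<cdot>\<^bsub>SET\<^esub> farr X b"
      using X that by (auto simp: cSet_Obj_iff functor_iff)
    moreover have "src (farr X b) = fobj X n"
      using farr_hom[OF X that(2)] by (auto simp: hom_SET_iff)
    ultimately show ?thesis using that(3) by (simp add: rs_cs SET_comp compose_def)
  qed
qed

lemma hom_cSet_iff: "f \<in> hom cSet X Y \<longleftrightarrow> X \<in> Obj cSet \<and> Y \<in> Obj cSet \<and>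
    (\<exists>t. f = Arrow X Y t \<and> (\<forall>n. t n \<in> hom SET (fobj X n) (fobj Y n)) \<and>
      (\<forall>m n. \<forall>a \<in> cub m n. t m \<cdot>\<^bsub>SET\<^esub> farr X a = farr Y a \<cdot>\<^bsub>SET\<^esub> t n))"
proof -
  have "f \<in> hom cSet X Y \<longleftrightarrow> X \<in> Obj cSet \<and> Y \<in> Obj cSet \<and>
    (\<exists>t. f = Arrow X Y t \<and> (\<forall>n. t n \<in> hom SET (fobj X n) (fobj Y n)) \<and>
      (\<forall>a \<in> Arr Cube. t (Dom Cube a) \<cdot>\<^bsub>SET\<^esub> farr X a = farr Y a \<cdot>\<^bsub>SET\<^esub> t (Cod Cube a)))"
    by (auto simp: hom_def cSet_def fun_cat_def PiE_iff)
  then show ?thesis by (auto simp: hom_def)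
qed

lemma hom_Obj: "f \<in> hom cSet X Y ==> X \<in> Obj cSet" "f \<in> hom cSet X Y ==> Y \<in> Obj cSet"
  by (auto simp: hom_cSet_iff)

lemma hom_src: "f \<in> hom cSet X Y ==> src f = X" and hom_tgt: "f \<in> hom cSet X Y ==> tgt f = Y"
  by (auto simp: hom_cSet_iff)

lemma hom_Arr: "f \<in> hom cSet X Y ==> f \<in> Arr cSet"
  and Arr_hom: "f \<in> Arr cSet ==> f \<in> hom cSet (src f) (tgt f)"
  by (auto simp: hom_def)

lemma hom_fn:
  assumes "f \<in> hom cSet X Y"
  shows "fn f n = Arrow (fobj X n) (fobj Y n) (\<lambda>x\<in>fobj X n. ap f n x)"
    and "x \<in> fobj X n ==> ap f n x \<in> fobj Y n"
proof -
  have "fn f n \<in> hom SET (fobj X n) (fobj Y n)"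
    using assms by (auto simp: hom_cSet_iff)
  then obtain g where g: "fn f n = Arrow (fobj X n) (fobj Y n) g" "g \<in> fobj X n \<rightarrow>\<^sub>E fobj Y n"
    by (auto simp: hom_SET_iff)
  show "fn f n = Arrow (fobj X n) (fobj Y n) (\<lambda>x\<in>fobj X n. ap f n x)"
    using g by (simp add: ap_def PiE_restrict)
  show "ap f n x \<in> fobj Y n" if "x \<in> fobj X n" using g that by (auto simp: ap_def)
qed

lemma ap_natm: "f \<in> hom cSet X Y ==> natm (cs X) (cs Y) (ap f)"
proof (rule natmI)
  assume f: "f \<in> hom cSet X Y"
  note X = hom_Obj(1)[OF f] and Y = hom_Obj(2)[OF f]
  show "ap f n z \<in> el (cs Y) n" if "z \<in> el (cs X) n" for n z
    using hom_fn(2)[OF f] that by simp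
  show "ap f m (rs (cs X) a z) = rs (cs Y) a (ap f n z)"
    if a: "a \<in> cub m n" and z: "z \<in> el (cs X) n" for m n a z
  proof -
    have "fn f m \<cdot>\<^bsub>SET\<^esub> farr X a = farr Y a \<cdot>\<^bsub>SET\<^esub> fn f n"
      using f a by (auto simp: hom_cSet_iff)
    then have "fn (fn f m \<cdot>\<^bsub>SET\<^esub> farr X a) z = fn (farr Y a \<cdot>\<^bsub>SET\<^esub> fn f n) z" by simp
    then show ?thesis
      using z hom_fn(2)[OF f] rs_el[OF psh_cs[OF X] a]
      by (simp add: SET_comp compose_def farr_eq[OF X a] farr_eq[OF Y a] hom_fn(1)[OF f])
  qed
qed

lemma hom_ext:
  assumes f: "f \<in> hom cSet X Y" and g: "g \<in> hom cSet X Y"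
    and eq: "\<And>n x. x \<in> fobj X n ==> ap f n x = ap g n x"
  shows "f = g"
proof -
  have "fn f n = fn g n" for n
    unfolding hom_fn(1)[OF f] hom_fn(1)[OF g] using eq by (simp cong: restrict_cong)
  then have "fn f = fn g" by (rule ext)
  then show ?thesis
    by (intro arrow.expand) (simp add: hom_src[OF f] hom_src[OF g] hom_tgt[OF f] hom_tgt[OF g])
qed

lemma ap_mp [simp]: "x \<in> fobj X n ==> ap (mp X Y f) n x = f n x"
  by (simp add: ap_def mp_def)

lemma src_mp [simp]: "src (mp X Y f) = X" and tgt_mp [simp]: "tgt (mp X Y f) = Y"
  by (simp_all add: mp_def)

lemma mp_hom:
  assumes X: "X \<in> Obj cSet" and Y: "Y \<in> Obj cSet" and f: "natm (cs X) (cs Y) f"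
  shows "mp X Y f \<in> hom cSet X Y"
  unfolding hom_cSet_iff mp_def
proof (intro conjI exI[of _ "\<lambda>n. Arrow (fobj X n) (fobj Y n) (\<lambda>x\<in>fobj X n. f n x)"] allI ballI X Y refl)
  fix n
  show "Arrow (fobj X n) (fobj Y n) (\<lambda>x\<in>fobj X n. f n x) \<in> hom SET (fobj X n) (fobj Y n)"
    using X Y natm_el[OF f] by (auto simp: hom_SET_iff cSet_Obj_iff functor_iff)
next
  fix m n a assume a: "a \<in> cub m n"
  show "Arrow (fobj X m) (fobj Y m) (\<lambda>x\<in>fobj X m. f m x) \<cdot>\<^bsub>SET\<^esub> farr X a =
    farr Y a \<cdot>\<^bsub>SET\<^esub> Arrow (fobj X n) (fobj Y n) (\<lambda>x\<in>fobj X n. f n x)"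
  proof -
    have "f m (rs (cs X) a x) = rs (cs Y) a (f n x)" "rs (cs X) a x \<in> fobj X m" "f n x \<in> fobj Y n"
      if "x \<in> fobj X n" for x
      using natm_el[OF f, of x n] natm_rs[OF f a, of x] rs_el[OF psh_cs[OF X] a, of x] that by simp_all
    then show ?thesis
      by (simp add: SET_comp farr_eq[OF X a] farr_eq[OF Y a] compose_def cong: restrict_cong)
  qed
qed

lemma cSet_comp: "g \<cdot>\<^bsub>cSet\<^esub> f = Arrow (src f) (tgt g) (\<lambda>n. fn g n \<cdot>\<^bsub>SET\<^esub> fn f n)"
  by (simp add: cSet_def fun_cat_def fun_eq_iff)

lemma ap_comp:
  assumes "f \<in> hom cSet X Y" "x \<in> fobj X n"
  shows "ap (g \<cdot>\<^bsub>cSet\<^esub> f) n x = ap g n (ap f n x)"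
  using assms(2) by (simp add: cSet_comp ap_def[of "Arrow _ _ _"] SET_comp hom_fn(1)[OF assms(1)] compose_def)
    (simp add: ap_def)

lemma id_eq_mp: "X \<in> Obj cSet ==> Idn cSet X = mp X X (\<lambda>n x. x)"
  by (simp add: cSet_def fun_cat_def mp_def SET_id fun_eq_iff)

lemma comp_hom:
  assumes f: "f \<in> hom cSet X Y" and g: "g \<in> hom cSet Y Z"
  shows "g \<cdot>\<^bsub>cSet\<^esub> f \<in> hom cSet X Z"
proof -
  have "g \<cdot>\<^bsub>cSet\<^esub> f = mp X Z (\<lambda>n x. ap g n (ap f n x))"
  proof -
    have "fn g n \<cdot>\<^bsub>SET\<^esub> fn f n = Arrow (fobj X n) (fobj Z n) (\<lambda>x\<in>fobj X n. ap g n (ap f n x))" for n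
      using hom_fn(2)[OF f]
      by (simp add: SET_comp hom_fn(1)[OF f] hom_fn(1)[OF g] compose_def cong: restrict_cong)
    then show ?thesis
      using f g by (simp add: cSet_comp mp_def fun_eq_iff hom_src hom_tgt)
  qed
  then show ?thesis
    using mp_hom[OF hom_Obj(1)[OF f] hom_Obj(2)[OF g] natm_comp[OF ap_natm[OF f] ap_natm[OF g]]]
    by simp
qed

lemma id_hom': "X \<in> Obj cSet ==> Idn cSet X \<in> hom cSet X X"
  by (simp add: id_eq_mp mp_hom natm_id)

lemma ap_id [simp]: "X \<in> Obj cSet ==> x \<in> fobj X n ==> ap (Idn cSet X) n x = x"
  by (simp add: id_eq_mp)

lemma ap_el: "f \<in> hom cSet X Y ==> x \<in> fobj X n ==> ap f n x \<in> fobj Y n"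
  using natm_el[OF ap_natm] by simp

lemma ap_rs: "f \<in> hom cSet X Y ==> a \<in> cub m n ==> x \<in> fobj X n ==>
    ap f m (rs (cs X) a x) = rs (cs Y) a (ap f n x)"
  using natm_rs[OF ap_natm] by simp

lemma category_cSet: "category cSet"
proof
  fix f assume "f \<in> Arr cSet"
  then have f: "f \<in> hom cSet (src f) (tgt f)" by (rule Arr_hom)
  then show "Dom cSet f \<in> Obj cSet" "Cod cSet f \<in> Obj cSet" using hom_Obj by auto
next
  fix f A B assume f: "f \<in> hom cSet A B"
  note A = hom_Obj(1)[OF f] and B = hom_Obj(2)[OF f]
  show "Idn cSet B \<cdot>\<^bsub>cSet\<^esub> f = f"
    by (rule hom_ext[OF comp_hom[OF f id_hom'[OF B]] f]) (simp add: ap_comp[OF f] B ap_el[OF f])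
  show "f \<cdot>\<^bsub>cSet\<^esub> Idn cSet A = f"
    by (rule hom_ext[OF comp_hom[OF id_hom'[OF A] f] f]) (simp add: ap_comp[OF id_hom'[OF A]] A)
next
  fix f g h A B D E
  assume f: "f \<in> hom cSet A B" and g: "g \<in> hom cSet B D" and h: "h \<in> hom cSet D E"
  show "h \<cdot>\<^bsub>cSet\<^esub> g \<cdot>\<^bsub>cSet\<^esub> f = h \<cdot>\<^bsub>cSet\<^esub> (g \<cdot>\<^bsub>cSet\<^esub> f)"
    by (rule hom_ext[OF comp_hom[OF f comp_hom[OF g h]] comp_hom[OF comp_hom[OF f g] h]])
      (simp add: ap_comp[OF f] ap_comp[OF g] ap_comp[OF comp_hom[OF f g]] ap_el[OF f])
qed (auto intro: id_hom' comp_hom)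

interpretation cSet: category cSet
  by (rule category_cSet)

context universe
begin

definition tinyp :: "'z psh => bool" where
  "tinyp P \<longleftrightarrow> psh P \<and> (\<forall>n. tiny (el P n))"

lemma tinyp_psh: "tinyp P ==> psh P" and tinyp_el: "tinyp P ==> tiny (el P n)"
  by (simp_all add: tinyp_def)

lemma tinyp_cs: "X \<in> Obj cSet ==> tinyp (cs (X :: 'u cset))"
  by (auto simp: tinyp_def psh_cs cSet_Obj_iff functor_iff small_iff_tiny[symmetric])

lemma tiny_cub: "tiny (cub m n)"
  by (rule tiny_countable[OF countable_subset[OF _ countable_Cube]]) (auto simp: hom_def)

lemma tiny_Cube: "tiny (Arr Cube)"
  by (rule tiny_countable[OF countable_Cube])

lemma tinyp_yo: "tinyp (yo n)"
  by (simp add: tinyp_def psh_yo tiny_cub)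

lemma tinyp_prodp: "tinyp P ==> tinyp Q ==> tinyp (P \<otimes> Q)"
  by (simp add: tinyp_def psh_prodp tiny_Times)

lemma tinyp_restr: "tinyp P ==> subf P A ==> tinyp (restr P A)"
  using tiny_subset psh_restr unfolding tinyp_def subf_def by (metis el_restr)

text \<open>Choose an injection into the universe at each stage and transport the restriction maps along
  these injections.\<close>

lemma cset_coding:
  assumes P: "tinyp P"
  shows "\<exists>X \<in> Obj (cSet :: ('u cset, 'u cmap) cat). \<exists>e d. natiso P (cs X) e d"
proof -
  have "\<forall>n. \<exists>f :: 'a => 'u. inj_on f (el P n)" using tiny_code tinyp_el[OF P] by blast
  then obtain c :: "nat => 'a => 'u" where c: "\<And>n. inj_on (c n) (el P n)" by metis
  note ps = tinyp_psh[OF P]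
  define d where "d n = inv_into (el P n) (c n)" for n
  have dc [simp]: "d n (c n z) = z" if "z \<in> el P n" for n z
    using that c by (simp add: d_def inv_into_f_f)
  define X where "X = Fctr (\<lambda>n. c n ` el P n)
    (\<lambda>a\<in>Arr Cube. Arrow (c (Cod Cube a) ` el P (Cod Cube a)) (c (Dom Cube a) ` el P (Dom Cube a))
      (\<lambda>x\<in>c (Cod Cube a) ` el P (Cod Cube a). c (Dom Cube a) (rs P a (d (Cod Cube a) x))))"
  have fo: "fobj X n = c n ` el P n" for n by (simp add: X_def)
  have fa: "farr X a = Arrow (c n ` el P n) (c m ` el P m) (\<lambda>x\<in>c n ` el P n. c m (rs P a (d n x)))"
    if "a \<in> cub m n" for a m n
    using that by (auto simp: X_def hom_def)
  have X: "X \<in> Obj cSet"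
    unfolding cSet_Obj_iff functor_iff
  proof (intro conjI allI ballI)
    show "farr X \<in> extensional (Arr Cube)" by (simp add: X_def)
    show sm: "small (fobj X n)" for n
      using tinyp_el[OF P] by (simp add: fo small_iff_tiny tiny_image)
    show "farr X a \<in> hom SET (fobj X n) (fobj X m)" if "a \<in> cub m n" for m n a
      using sm[of m] sm[of n] rs_el[OF ps that] by (auto simp: hom_SET_iff fa[OF that] fo)
    show "farr X (cid n) = Idn SET (fobj X n)" for n
      by (auto simp: SET_id fa[OF cid_cub] fo rs_id[OF ps] fun_eq_iff)
    show "farr X (b \<odot> a) = farr X a \<cdot>\<^bsub>SET\<^esub> farr X b" if "a \<in> cub l m" "b \<in> cub m n" for l m n a b
    proof -
      have "c m (rs P b (d n x)) \<in> c m ` el P m" if "x \<in> c n ` el P n" for x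
        using that rs_el[OF ps \<open>b \<in> cub m n\<close>] by auto
      then show ?thesis
        by (auto simp: SET_comp fa[OF that(1)] fa[OF that(2)] fa[OF comp_cub[OF that]] compose_def
            rs_comp[OF ps that] rs_el[OF ps that(2)] intro!: restrict_ext)
    qed
  qed
  have "natiso P (cs X) c d"
  proof (rule natm_inverse)
    show "natm P (cs X) c"
      by (rule natmI) (auto simp: fo rs_cs fa)
  qed (use ps in \<open>auto simp: fo\<close>)
  then show ?thesis using X by blast
qed

end


section \<open>Representables and elements\<close>

context universe
begin

abbreviation (input) cS :: "('u cset, 'u cmap) cat" where
  "cS \<equiv> cSet"

abbreviation (input) comp_cS :: "'u cmap => 'u cmap => 'u cmap"  (infixl "\<bullet>" 70) where
  "g \<bullet> f \<equiv> g \<cdot>\<^bsub>cSet\<^esub> f"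


lemma inj_enc: "inj_on (enc :: cube_arrow => 'u) (Arr Cube)"
  unfolding enc_def using someI_ex[OF tiny_code[OF tiny_Cube]] .

lemma dec_enc [simp]: "a \<in> cub m n ==> dec (enc a :: 'u) = a"
  unfolding dec_def by (rule inv_into_f_f[OF inj_enc cub_Arr])

lemma enc_inj: "a \<in> cub m n ==> b \<in> cub k l ==> (enc a :: 'u) = enc b ==> a = b"
  by (metis dec_enc)

lemma fobj_cube: "fobj (cube n) k = enc ` cub k n"
  by (simp add: cube_def)

lemma farr_cube: "a \<in> cub k l ==> farr (cube n) a = Arrow (enc ` cub l n) (enc ` cub k n)
    (\<lambda>x \<in> enc ` cub l n. enc (dec x \<odot> a))"
  by (auto simp: cube_def hom_def)

lemma dec_cub: "(x :: 'u) \<in> fobj (cube n) k ==> dec x \<in> cub k n"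
  by (auto simp: fobj_cube)

lemma enc_el: "a \<in> cub k n ==> (enc a :: 'u) \<in> fobj (cube n) k"
  by (simp add: fobj_cube)

lemma enc_dec: "(x :: 'u) \<in> fobj (cube n) k ==> enc (dec x) = x"
  by (auto simp: fobj_cube)

lemma rs_cube: "a \<in> cub k l ==> t \<in> cub l n ==>
    rs (cs (cube n :: 'u cset)) a (enc t) = enc (t \<odot> a)"
  by (simp add: rs_cs farr_cube)

lemma cube_Obj: "(cube n :: 'u cset) \<in> Obj cS"
  unfolding cSet_Obj_iff functor_iff
proof (intro conjI allI ballI)
  show "farr (cube n :: 'u cset) \<in> extensional (Arr Cube)" by (simp add: cube_def)
  show sm: "small (fobj (cube n :: 'u cset) k)" for k
    by (simp add: fobj_cube small_iff_tiny tiny_image tiny_cub)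
  show "farr (cube n :: 'u cset) a \<in> hom SET (fobj (cube n) l) (fobj (cube n) k)"
    if "a \<in> cub k l" for k l a
    using sm[of k] sm[of l] that by (auto simp: hom_SET_iff farr_cube fobj_cube)
  show "farr (cube n :: 'u cset) (cid k) = Idn SET (fobj (cube n) k)" for k
    by (auto simp: SET_id farr_cube[OF cid_cub] fobj_cube cub_idr intro!: restrict_ext)
  show "farr (cube n :: 'u cset) (b \<odot> a) = farr (cube n) a \<cdot>\<^bsub>SET\<^esub> farr (cube n) b"
    if a: "a \<in> cub j k" and b: "b \<in> cub k l" for j k l a b
  proof -
    have "(enc (t \<odot> b) :: 'u) \<in> enc ` cub k n" if "t \<in> cub l n" for t
      using that b by auto
    then show ?thesis
      using a b by (auto simp: SET_comp farr_cube[OF a] farr_cube[OF b] farr_cube[OF comp_cub[OF a b]]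
          compose_def cub_assoc[OF a b] dec_enc[OF comp_cub[OF b]] intro!: restrict_ext)
  qed
qed

lemma cube_iso: "natiso (yo n) (cs (cube n :: 'u cset)) (\<lambda>k. enc) (\<lambda>k. dec)"
  by (rule natm_inverse[OF natmI psh_yo]) (auto simp: enc_el rs_cube dec_cub enc_dec)

text \<open>The Yoneda lemma: the map \<open>I\<^sup>n \<rightarrow> X\<close> that corresponds to the
  element \<open>x\<close>.\<close>

definition yon :: "'u cset => nat => 'u => 'u cmap" where
  "yon X n x = mp (cube n) X (\<lambda>k t. rs (cs X) (dec t) x)"

lemma yon_hom:
  assumes X: "X \<in> Obj cS" and x: "x \<in> fobj X n"
  shows "yon X n x \<in> hom cS (cube n) X"
  unfolding yon_def
proof (intro mp_hom cube_Obj X natmI)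
  show "rs (cs X) (dec t) x \<in> el (cs X) k" if "t \<in> el (cs (cube n :: 'u cset)) k" for k t
    using rs_el[OF psh_cs[OF X] dec_cub, of t n k x] that x by simp
  fix m k a t assume a: "a \<in> cub m k" and "t \<in> el (cs (cube n :: 'u cset)) k"
  then obtain b where b: "b \<in> cub k n" "t = enc b" by (auto simp: fobj_cube)
  show "rs (cs X) (dec (rs (cs (cube n)) a t)) x = rs (cs X) a (rs (cs X) (dec t) x)"
    using a b x by (simp add: rs_cube dec_enc[OF comp_cub[OF a b(1)]] rs_comp[OF psh_cs[OF X] a b(1)])
qed

lemma ap_yon: "t \<in> cub k n ==> ap (yon X n x) k (enc t) = rs (cs X) t x"
  by (simp add: yon_def fobj_cube)

lemma ap_yon_id: "X \<in> Obj cS ==> x \<in> fobj X n ==> ap (yon X n x) n (enc (cid n)) = x"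
  by (simp add: ap_yon[OF cid_cub] rs_id[OF psh_cs])

lemma cube_hom_ext:
  assumes f: "f \<in> hom cS (cube n) X" and g: "g \<in> hom cS (cube n) X"
    and eq: "ap f n (enc (cid n)) = ap g n (enc (cid n))"
  shows "f = g"
proof (rule hom_ext[OF f g])
  fix k and x :: 'u assume "x \<in> fobj (cube n) k"
  then obtain t where t: "t \<in> cub k n" "x = enc t" by (auto simp: fobj_cube)
  then have "x = rs (cs (cube n)) t (enc (cid n))" by (simp add: rs_cube[OF _ cid_cub] cub_idl)
  then show "ap f k x = ap g k x"
    using ap_rs[OF f t(1) enc_el[OF cid_cub]] ap_rs[OF g t(1) enc_el[OF cid_cub]] eq by simp
qed

lemma comp_yon: "f \<in> hom cS X Y ==> x \<in> fobj X n ==>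
    f \<bullet> yon X n x = yon Y n (ap f n x)"
  by (rule cube_hom_ext[of _ n Y])
    (auto intro!: comp_hom yon_hom ap_el
      simp: hom_Obj ap_comp[OF yon_hom enc_el[OF cid_cub]] ap_yon_id ap_el)

text \<open>An element is a map out of a representable, so cancelling a monomorphism gives
  injectivity.\<close>

lemma monic_iff:
  assumes c: "c \<in> hom cS A Z"
  shows "monic cS c \<longleftrightarrow> (\<forall>n. inj_on (ap c n) (fobj A n))"
proof
  note sr = hom_src[OF c]
  assume m: "monic cS (c :: 'u cmap)"
  show "\<forall>n. inj_on (ap c n) (fobj A n)"
  proof (intro allI inj_onI)
    fix n x y assume x: "x \<in> fobj A n" and y: "y \<in> fobj A n" and e: "ap c n x = ap c n y"
    have "c \<bullet> yon A n x = c \<bullet> yon A n y"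
      using comp_yon[OF c] x y e by simp
    moreover have "yon A n x \<in> hom cS (cube n) A" "yon A n y \<in> hom cS (cube n) A"
      using yon_hom hom_Obj(1)[OF c] x y by blast+
    ultimately have "yon A n x = yon A n y"
      using m unfolding monic_def cSet_simps sr by blast
    then show "x = y" using ap_yon_id hom_Obj(1)[OF c] x y by metis
  qed
next
  assume i: "\<forall>n. inj_on (ap c n) (fobj A n)"
  show "monic cS c"
    unfolding monic_def cSet_simps hom_src[OF c]
  proof (intro conjI allI ballI impI hom_Arr[OF c])
    fix B f g assume f: "f \<in> hom cS B A" and g: "g \<in> hom cS B A"
      and e: "c \<bullet> f = c \<bullet> g"
    show "f = g"
    proof (rule hom_ext[OF f g])
      fix n x assume x: "x \<in> fobj B n"
      have "ap c n (ap f n x) = ap c n (ap g n x)"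
        using arg_cong[OF e, of "\<lambda>h. ap h n x"] ap_comp[OF f x] ap_comp[OF g x] by simp
      then show "ap f n x = ap g n x" using i ap_el[OF f x] ap_el[OF g x] by (meson inj_onD)
    qed
  qed
qed

definition empty_cset :: "'u cset => bool" where
  "empty_cset Z \<longleftrightarrow> Z \<in> Obj cS \<and> (\<forall>n. fobj Z n = {})"

lemma initial_empty: "empty_cset Z ==> initial cS Z"
  unfolding initial_def
proof (intro conjI ballI)
  assume Z: "empty_cset Z"
  then show "Z \<in> Obj cS" by (simp add: empty_cset_def)
  fix A :: "'u cset" assume A: "A \<in> Obj cS"
  have "mp Z A (\<lambda>n x. x) \<in> hom cS Z A"
    using Z A by (intro mp_hom natmI) (auto simp: empty_cset_def)
  moreover have "f = g" if "f \<in> hom cS Z A" "g \<in> hom cS Z A" for f g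
    using that by (rule hom_ext) (use Z in \<open>auto simp: empty_cset_def\<close>)
  ultimately show "\<exists>!f. f \<in> hom cS Z A" by blast
qed

text \<open>A square of cubical sets is a pullback iff it is one on elements.\<close>

lemma is_pullbackI:
  assumes f: "f \<in> hom cS X Y" and g: "g \<in> hom cS Z Y"
    and p: "p \<in> hom cS P X" and q: "q \<in> hom cS P Z"
    and sq: "\<And>n w. w \<in> fobj P n ==> ap f n (ap p n w) = ap g n (ap q n w)"
    and ex: "\<And>n x z. x \<in> fobj X n ==> z \<in> fobj Z n ==> ap f n x = ap g n z ==>
      \<exists>w \<in> fobj P n. ap p n w = x \<and> ap q n w = z"
    and un: "\<And>n w w'. w \<in> fobj P n ==> w' \<in> fobj P n ==> ap p n w = ap p n w' ==>
      ap q n w = ap q n w' ==> w = w'"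
  shows "is_pullback cS f g p q"
  unfolding is_pullback_def cSet_simps hom_src[OF f] hom_src[OF g] hom_src[OF p]
proof (intro conjI ballI allI impI)
  show "f \<in> Arr cS" "g \<in> Arr cS" "tgt f = tgt g" "p \<in> hom cS P X" "q \<in> hom cS P Z"
    using f g p q by (auto simp: hom_Arr hom_tgt)
  show "f \<bullet> p = g \<bullet> q"
    by (rule hom_ext[OF comp_hom[OF p f] comp_hom[OF q g]]) (simp add: ap_comp[OF p] ap_comp[OF q] sq)
  fix A a b assume a: "a \<in> hom cS A X" and b: "b \<in> hom cS A Z"
    and e: "f \<bullet> a = g \<bullet> b"
  have e': "ap f n (ap a n y) = ap g n (ap b n y)" if y: "y \<in> fobj A n" for n y
    using arg_cong[OF e, of "\<lambda>h. ap h n y"] ap_comp[OF a y] ap_comp[OF b y] by simp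
  have "\<exists>w. w \<in> fobj P n \<and> ap p n w = ap a n y \<and> ap q n w = ap b n y" if y: "y \<in> fobj A n" for n y
    using ex[OF ap_el[OF a y] ap_el[OF b y] e'[OF y]] by blast
  note some = someI_ex[OF this]
  define h where "h n y = (SOME w. w \<in> fobj P n \<and> ap p n w = ap a n y \<and> ap q n w = ap b n y)" for n y
  have h: "h n y \<in> fobj P n" "ap p n (h n y) = ap a n y" "ap q n (h n y) = ap b n y"
    if "y \<in> fobj A n" for n y
    using some[OF that] unfolding h_def by auto
  note A = hom_Obj(1)[OF a] and P = hom_Obj(1)[OF p]
  have nat: "natm (cs A) (cs P) h"
  proof (rule natmI)
    fix m n c y assume c: "c \<in> cub m n" and y: "y \<in> el (cs A) n"
    then have y': "y \<in> fobj A n" and cy: "rs (cs A) c y \<in> fobj A m"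
      using rs_el[OF psh_cs[OF A] c y] by simp_all
    have ch: "rs (cs P) c (h n y) \<in> fobj P m" using rs_el[OF psh_cs[OF P] c] h(1)[OF y'] by simp
    show "h m (rs (cs A) c y) = rs (cs P) c (h n y)"
      by (rule un[OF h(1)[OF cy] ch])
        (simp_all add: h cy y' ap_rs[OF a c] ap_rs[OF b c] ap_rs[OF p c] ap_rs[OF q c])
  qed (simp add: h)
  show "\<exists>!k. k \<in> hom cS A P \<and> p \<bullet> k = a \<and> q \<bullet> k = b"
  proof (rule ex1I[of _ "mp A P h"])
    note hh = mp_hom[OF A P nat]
    have "p \<bullet> mp A P h = a"
      by (rule hom_ext[OF comp_hom[OF hh p] a]) (simp add: ap_comp[OF hh] h)
    moreover have "q \<bullet> mp A P h = b"
      by (rule hom_ext[OF comp_hom[OF hh q] b]) (simp add: ap_comp[OF hh] h)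
    ultimately show "mp A P h \<in> hom cS A P \<and> p \<bullet> mp A P h = a \<and> q \<bullet> mp A P h = b"
      using hh by blast
    fix k assume k: "k \<in> hom cS A P \<and> p \<bullet> k = a \<and> q \<bullet> k = b"
    show "k = mp A P h"
    proof (rule hom_ext[OF _ hh])
      fix n y assume y: "y \<in> fobj A n"
      have "ap p n (ap k n y) = ap a n y" "ap q n (ap k n y) = ap b n y"
        using k ap_comp[of k A P y n] y by auto
      then show "ap k n y = ap (mp A P h) n y"
        using un[of "ap k n y" n "h n y"] k y h ap_el[of k A P y n] by simp
    qed (use k in blast)
  qed
qed

lemma is_pullbackD:
  assumes pb: "is_pullback cS f g p q" and f: "f \<in> hom cS X Y" and g: "g \<in> hom cS Z Y"
    and P: "src p = P"
  shows "p \<in> hom cS P X" "q \<in> hom cS P Z"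
    and "w \<in> fobj P n ==> ap f n (ap p n w) = ap g n (ap q n w)"
    and "x \<in> fobj X n ==> z \<in> fobj Z n ==> ap f n x = ap g n z ==>
      \<exists>w \<in> fobj P n. ap p n w = x \<and> ap q n w = z"
    and "w \<in> fobj P n ==> w' \<in> fobj P n ==> ap p n w = ap p n w' ==>
      ap q n w = ap q n w' ==> w = (w' :: 'u)"
proof -
  note pb' = pb[unfolded is_pullback_def cSet_simps hom_src[OF f] hom_src[OF g] P]
  show p: "p \<in> hom cS P X" and q: "q \<in> hom cS P Z" using pb' by auto
  have e: "f \<bullet> p = g \<bullet> q" using pb' by auto
  show sq: "ap f n (ap p n w) = ap g n (ap q n w)" if "w \<in> fobj P n" for n w
    using arg_cong[OF e, of "\<lambda>h. ap h n w"] ap_comp[OF p that] ap_comp[OF q that] by simp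
  have up: "\<exists>!h. h \<in> hom cS A P \<and> p \<bullet> h = a \<and> q \<bullet> h = b"
    if "a \<in> hom cS A X" "b \<in> hom cS A Z" "f \<bullet> a = g \<bullet> b" for A a b
    using pb' that by blast
  note X = hom_Obj(1)[OF f] and Z = hom_Obj(1)[OF g] and PO = hom_Obj(1)[OF p]
  show "\<exists>w \<in> fobj P n. ap p n w = x \<and> ap q n w = z"
    if x: "x \<in> fobj X n" and z: "z \<in> fobj Z n" and xz: "ap f n x = ap g n z"
  proof -
    have "f \<bullet> yon X n x = g \<bullet> yon Z n z"
      using comp_yon[OF f x] comp_yon[OF g z] xz by simp
    then obtain h where h: "h \<in> hom cS (cube n) P" "p \<bullet> h = yon X n x" "q \<bullet> h = yon Z n z"
      using up[OF yon_hom[OF X x] yon_hom[OF Z z]] by blast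
    let ?i = "enc (cid n) :: 'u"
    have i: "?i \<in> fobj (cube n) n" by (rule enc_el) simp
    have "ap p n (ap h n ?i) = x" "ap q n (ap h n ?i) = z"
      using ap_comp[OF h(1) i, of p] ap_comp[OF h(1) i, of q] h ap_yon_id[OF X x] ap_yon_id[OF Z z]
      by simp_all
    then show ?thesis using ap_el[OF h(1) i] by blast
  qed
  show "w = w'" if w: "w \<in> fobj P n" and w': "w' \<in> fobj P n" and "ap p n w = ap p n w'"
      "ap q n w = ap q n w'"
  proof -
    let ?a = "yon X n (ap p n w)" and ?b = "yon Z n (ap q n w)"
    have "yon P n w \<in> hom cS (cube n) P \<and> p \<bullet> yon P n w = ?a \<and> q \<bullet> yon P n w = ?b"
      using comp_yon[OF p w] comp_yon[OF q w] yon_hom[OF PO w] by simp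
    moreover have "yon P n w' \<in> hom cS (cube n) P \<and> p \<bullet> yon P n w' = ?a \<and> q \<bullet> yon P n w' = ?b"
      using comp_yon[OF p w'] comp_yon[OF q w'] yon_hom[OF PO w'] that by simp
    moreover have "f \<bullet> ?a = g \<bullet> ?b"
      using comp_yon[OF f ap_el[OF p w]] comp_yon[OF g ap_el[OF q w]] sq[OF w] by simp
    ultimately have "yon P n w = yon P n w'"
      using up[of ?a "cube n" ?b] yon_hom[OF X ap_el[OF p w]] yon_hom[OF Z ap_el[OF q w]] by blast
    then show ?thesis using ap_yon_id[OF PO] w w' by metis
  qed
qed

lemma ex_pullback:
  assumes f: "f \<in> hom cS X Y" and g: "g \<in> hom cS Z Y"
  shows "\<exists>P p q. is_pullback cS f g p q \<and> p \<in> hom cS P X \<and> q \<in> hom cS (P :: 'u cset) Z"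
proof -
  note X = hom_Obj(1)[OF f] and Z = hom_Obj(1)[OF g]
  let ?A = "\<lambda>n. {(x, z). x \<in> fobj X n \<and> z \<in> fobj Z n \<and> ap f n x = ap g n z}"
  have sub: "subf (cs X \<otimes> cs Z) ?A"
    using rs_el[OF psh_cs[OF X]] rs_el[OF psh_cs[OF Z]]
    by (auto simp: subf_def ap_rs[OF f] ap_rs[OF g])
  have "tinyp (restr (cs X \<otimes> cs Z) ?A)"
    using sub by (intro tinyp_restr tinyp_prodp tinyp_cs X Z)
  then obtain P e d where P: "(P :: 'u cset) \<in> Obj cS"
    and ed: "natiso (restr (cs X \<otimes> cs Z) ?A) (cs P) e d"
    using cset_coding by blast
  from ed have e: "natm (restr (cs X \<otimes> cs Z) ?A) (cs P) e" and d: "natm (cs P) (restr (cs X \<otimes> cs Z) ?A) d"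
    and de: "\<And>n x z. x \<in> fobj X n ==> z \<in> fobj Z n ==> ap f n x = ap g n z ==> d n (e n (x, z)) = (x, z)"
    and eld: "\<And>n w. w \<in> fobj P n ==> e n (d n w) = w"
    unfolding natiso_def by auto
  have dA: "d n w \<in> ?A n" if "w \<in> fobj P n" for n w
    using natm_el[OF d] that by simp
  have dr: "d m (rs (cs P) a w) = (rs (cs X) a (fst (d n w)), rs (cs Z) a (snd (d n w)))"
    if "a \<in> cub m n" "w \<in> fobj P n" for m n a w
    using natm_rs[OF d, of a m n w] that by (cases "d n w") simp
  have p: "mp P X (\<lambda>n w. fst (d n w)) \<in> hom cS P X"
    using dA by (intro mp_hom P X natmI) (fastforce simp: dr)+
  have q: "mp P Z (\<lambda>n w. snd (d n w)) \<in> hom cS P Z"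
    using dA by (intro mp_hom P Z natmI) (fastforce simp: dr)+
  have "is_pullback cS f g (mp P X (\<lambda>n w. fst (d n w))) (mp P Z (\<lambda>n w. snd (d n w)))"
  proof (rule is_pullbackI[OF f g p q])
    show "ap f n (ap (mp P X (\<lambda>n w. fst (d n w))) n w) = ap g n (ap (mp P Z (\<lambda>n w. snd (d n w))) n w)"
      if "w \<in> fobj P n" for n w
      using that dA[OF that] by auto
    show "\<exists>w\<in>fobj P n. ap (mp P X (\<lambda>n w. fst (d n w))) n w = x \<and> ap (mp P Z (\<lambda>n w. snd (d n w))) n w = z"
      if "x \<in> fobj X n" "z \<in> fobj Z n" "ap f n x = ap g n z" for n x z
      using that de[OF that] natm_el[OF e, of "(x, z)" n] by (intro bexI[of _ "e n (x, z)"]) simp_all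
    show "w = w'" if "w \<in> fobj P n" "w' \<in> fobj P n"
      "ap (mp P X (\<lambda>n w. fst (d n w))) n w = ap (mp P X (\<lambda>n w. fst (d n w))) n w'"
      "ap (mp P Z (\<lambda>n w. snd (d n w))) n w = ap (mp P Z (\<lambda>n w. snd (d n w))) n w'" for n w w'
      using that eld[of w n] eld[of w' n] by (simp add: prod_eq_iff) (metis prod_eqI)
  qed
  then show ?thesis using p q by blast
qed

lemma one_el: "x \<in> fobj (one :: 'u cset) n \<longleftrightarrow> x = enc (bang n)"
  using cub_0 bang_cub by (auto simp: fobj_cube)

definition to_one :: "'u cset => 'u cmap" where
  "to_one X = mp X one (\<lambda>n x. enc (bang n))"

lemma to_one_hom: "X \<in> Obj cS ==> to_one X \<in> hom cS X one"
  unfolding to_one_def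
proof (intro mp_hom cube_Obj natmI)
  fix m n a z assume "a \<in> cub m n"
  then show "enc (bang m) = rs (cs one) a (enc (bang n) :: 'u)"
    using cub_0[OF comp_cub] bang_cub by (simp add: rs_cube)
qed (simp_all add: one_el)

lemma one_hom_ext: "f \<in> hom cS X one ==> g \<in> hom cS X one ==> f = (g :: 'u cmap)"
  using hom_ext ap_el one_el by metis

text \<open>Products are pullbacks over the terminal object, so that their existence and their elements
  are covered by the results on pullbacks.\<close>

lemma product_iff_pullback:
  assumes A: "A \<in> Obj cS" and B: "B \<in> Obj cS" and PO: "P \<in> Obj cS" "src p = P"
  shows "is_product cS A B p q \<longleftrightarrow> is_pullback cS (to_one A) (to_one B) p (q :: 'u cmap)"
proof -
  note t = to_one_hom[OF A] to_one_hom[OF B]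
  have E: "to_one A \<bullet> a = to_one B \<bullet> b"
    if "a \<in> hom cS Z A" "b \<in> hom cS Z B" for Z a b
    using one_hom_ext[OF comp_hom[OF that(1) t(1)] comp_hom[OF that(2) t(2)]] .
  show ?thesis
    unfolding is_product_def is_pullback_def cSet_simps PO(2) hom_src[OF t(1)] hom_src[OF t(2)]
      hom_tgt[OF t(1)] hom_tgt[OF t(2)]
    using hom_Arr[OF t(1)] hom_Arr[OF t(2)] by (simp add: E cong: conj_cong ball_cong)
qed

lemma prodc_product:
  assumes A: "A \<in> Obj cS" and B: "B \<in> Obj cS"
  shows "is_product cS A B (pr1 cS A B) (pr2 cS A (B :: 'u cset))"
proof -
  obtain P p q where "is_pullback cS (to_one A) (to_one B) p q" "p \<in> hom cS P A"
    using ex_pullback[OF to_one_hom[OF A] to_one_hom[OF B]] by blast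
  then have "is_product cS A B p q"
    using product_iff_pullback[OF A B hom_Obj(1) hom_src] by blast
  then have "\<exists>x. case x of (p, q) => is_product cS A B p q" by blast
  then have "case prodc cS A B of (p, q) => is_product cS A B p q"
    unfolding prodc_def by (rule someI_ex)
  then show ?thesis by (simp add: pr1_def pr2_def split_beta)
qed

lemma pr_hom:
  assumes A: "A \<in> Obj cS" and B: "B \<in> Obj cS"
  shows "pr1 cS A B \<in> hom cS (prod_obj cS A B) A"
    and "pr2 cS A B \<in> hom cS (prod_obj cS A B) (B :: 'u cset)"
    and "prod_obj cS A B \<in> Obj cS"
proof -
  show "pr1 cS A B \<in> hom cS (prod_obj cS A B) A" "pr2 cS A B \<in> hom cS (prod_obj cS A B) B"
    using prodc_product[OF A B] by (auto simp: is_product_def prod_obj_def)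
  then show "prod_obj cS A B \<in> Obj cS" using hom_Obj by blast
qed

text \<open>The element of the chosen product that represents a pair.\<close>

definition pe :: "'u cset => 'u cset => nat => 'u \<times> 'u => 'u" where
  "pe A B n xy = (SOME w. w \<in> fobj (prod_obj cS A B) n \<and>
    ap (pr1 cS A B) n w = fst xy \<and> ap (pr2 cS A B) n w = snd xy)"

lemma prod_elements:
  assumes A: "A \<in> Obj cS" and B: "B \<in> Obj cS"
  shows "x \<in> fobj A n ==> y \<in> fobj B n ==> pe A B n (x, y) \<in> fobj (prod_obj cS A B) n"
    and "x \<in> fobj A n ==> y \<in> fobj B n ==> ap (pr1 cS A B) n (pe A B n (x, y)) = x"
    and "x \<in> fobj A n ==> y \<in> fobj B n ==> ap (pr2 cS A B) n (pe A B n (x, y)) = y"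
    and "w \<in> fobj (prod_obj cS A B) n ==> w' \<in> fobj (prod_obj cS A B) n ==>
      ap (pr1 cS A B) n w = ap (pr1 cS A B) n w' ==>
      ap (pr2 cS A B) n w = ap (pr2 cS A B) n w' ==> w = w'"
proof -
  have pb: "is_pullback cS (to_one A) (to_one B) (pr1 cS A B) (pr2 cS A B)"
    using prodc_product[OF A B] product_iff_pullback[OF A B pr_hom(3)[OF A B], of "pr1 cS A B"]
    by (simp add: prod_obj_def)
  have src: "src (pr1 cS A B) = prod_obj cS A B" by (simp add: prod_obj_def)
  note D = is_pullbackD[OF pb to_one_hom[OF A] to_one_hom[OF B] src]
  have "\<exists>w. w \<in> fobj (prod_obj cS A B) n \<and>
      ap (pr1 cS A B) n w = fst (x, y) \<and> ap (pr2 cS A B) n w = snd (x, y)"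
    if "x \<in> fobj A n" "y \<in> fobj B n" for x y
    using D(4)[OF that] that by (auto simp: to_one_def)
  from someI_ex[OF this]
  show "x \<in> fobj A n ==> y \<in> fobj B n ==> pe A B n (x, y) \<in> fobj (prod_obj cS A B) n"
    "x \<in> fobj A n ==> y \<in> fobj B n ==> ap (pr1 cS A B) n (pe A B n (x, y)) = x"
    "x \<in> fobj A n ==> y \<in> fobj B n ==> ap (pr2 cS A B) n (pe A B n (x, y)) = y"
    unfolding pe_def by auto
  show "w \<in> fobj (prod_obj cS A B) n ==> w' \<in> fobj (prod_obj cS A B) n ==>
      ap (pr1 cS A B) n w = ap (pr1 cS A B) n w' ==>
      ap (pr2 cS A B) n w = ap (pr2 cS A B) n w' ==> w = w'"
    by (rule D(5))
qed

lemma prod_iso: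
  assumes A: "A \<in> Obj cS" and B: "B \<in> Obj cS"
  shows "natiso (cs A \<otimes> cs B) (cs (prod_obj cS A B)) (pe A B)
    (\<lambda>n w. (ap (pr1 cS A B) n w, ap (pr2 cS A B) n w))"
proof (rule natm_inverse[OF natmI])
  note E = prod_elements[OF A B] and pr = pr_hom[OF A B]
  note ps = psh_cs[OF A] psh_cs[OF B] psh_cs[OF pr(3)]
  show "psh (cs A \<otimes> cs B)" using ps by (intro psh_prodp)
  show "pe A B n z \<in> el (cs (prod_obj cS A B)) n" if "z \<in> el (cs A \<otimes> cs B) n" for n z
    using that E(1) by auto
  show "pe A B m (rs (cs A \<otimes> cs B) a z) = rs (cs (prod_obj cS A B)) a (pe A B n z)"
    if a: "a \<in> cub m n" and zP: "z \<in> el (cs A \<otimes> cs B) n" for m n a z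
  proof -
    obtain x y where z: "z = (x, y)" "x \<in> fobj A n" "y \<in> fobj B n" using zP by auto
    have r: "rs (cs A) a x \<in> fobj A m" "rs (cs B) a y \<in> fobj B m"
      "rs (cs (prod_obj cS A B)) a (pe A B n (x, y)) \<in> fobj (prod_obj cS A B) m"
      using rs_el[OF ps(1) a] rs_el[OF ps(2) a] rs_el[OF ps(3) a] z E(1) by simp_all
    show ?thesis
      unfolding z rs_prodp
      by (rule E(4)[OF E(1)[OF r(1,2)] r(3)])
        (simp_all add: E(1-3) r z ap_rs[OF pr(1) a] ap_rs[OF pr(2) a])
  qed
next
  note E = prod_elements[OF A B] and pr = pr_hom[OF A B]
  fix n w assume "w \<in> el (cs (prod_obj cS A B)) n"
  then have w: "w \<in> fobj (prod_obj cS A B) n" by simp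
  let ?x = "ap (pr1 cS A B) n w" and ?y = "ap (pr2 cS A B) n w"
  have xy: "?x \<in> fobj A n" "?y \<in> fobj B n" using ap_el[OF pr(1) w] ap_el[OF pr(2) w] .
  show "(?x, ?y) \<in> el (cs A \<otimes> cs B) n \<and> pe A B n (?x, ?y) = w"
    using xy E(4)[OF E(1)[OF xy] w] E(2,3)[OF xy] by simp
next
  fix n z assume "z \<in> el (cs A \<otimes> cs B) n"
  then show "(ap (pr1 cS A B) n (pe A B n z), ap (pr2 cS A B) n (pe A B n z)) = z"
    using prod_elements(2,3)[OF A B] by auto
qed

end


section \<open>Extension problems and cofibrant subpresheaves\<close>

text \<open>A lifting problem of \<open>r\<close> against the inclusion \<open>A \<subseteq> P\<close>.
  Stating it with natural functions leaves the element type of \<open>P\<close> free.\<close>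

definition ext :: "'u cmap => 'z psh => (nat => 'z set) => bool" where
  "ext r P A \<longleftrightarrow> (\<forall>u v. natm (restr P A) (cs (src r)) u \<longrightarrow> natm P (cs (tgt r)) v \<longrightarrow>
    (\<forall>n. \<forall>z \<in> A n. ap r n (u n z) = v n z) \<longrightarrow>
    (\<exists>w. natm P (cs (src r)) w \<and> (\<forall>n. \<forall>z \<in> A n. w n z = u n z) \<and>
      (\<forall>n. \<forall>z \<in> el P n. ap r n (w n z) = v n z)))"

lemma extD:
  assumes "ext r P A" "r \<in> hom cSet X Y"
    and "natm (restr P A) (cs X) u" "natm P (cs Y) v"
    and "\<And>n z. z \<in> A n ==> ap r n (u n z) = v n z"
  obtains w where "natm P (cs X) w" "\<And>n z. z \<in> A n ==> w n z = u n z"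
    "\<And>n z. z \<in> el P n ==> ap r n (w n z) = v n z"
  using assms unfolding ext_def by (metis hom_src hom_tgt)

lemma ext_iso:
  assumes iso: "natiso P Q e d" and psh: "psh P" "psh Q" and A: "subf P A" and B: "subf Q B"
    and AB: "\<And>n z. z \<in> el P n ==> z \<in> A n \<longleftrightarrow> e n z \<in> B n"
    and ext: "ext r Q B"
  shows "ext r P A"
  unfolding ext_def
proof (intro allI impI)
  fix u v
  assume u: "natm (restr P A) (cs (src r)) u" and v: "natm P (cs (tgt r)) v"
    and uv: "\<forall>n. \<forall>z \<in> A n. ap r n (u n z) = v n z"
  from iso have e: "natm P Q e" and d: "natm Q P d" and de: "\<And>n z. z \<in> el P n ==> d n (e n z) = z"
    and ed: "\<And>n z. z \<in> el Q n ==> e n (d n z) = z"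
    by (auto simp: natiso_def)
  have dB: "d n z \<in> A n" if "z \<in> B n" for n z
    using that AB[of "d n z" n] natm_el[OF d] ed subf_el[OF B that] by auto
  have "natm (restr Q B) (restr P A) d"
    using dB natm_rs[OF d] subf_el[OF B] by (intro natmI) auto
  from natm_comp[OF this u] have u': "natm (restr Q B) (cs (src r)) (\<lambda>n z. u n (d n z))" .
  note v' = natm_comp[OF d v]
  obtain w where w: "natm Q (cs (src r)) w" "\<forall>n. \<forall>z \<in> B n. w n z = u n (d n z)"
    "\<forall>n. \<forall>z \<in> el Q n. ap r n (w n z) = v n (d n z)"
    using ext[unfolded ext_def, rule_format, OF u' v'] uv dB by blast
  have "w n (e n z) = u n z" if "z \<in> A n" for n z
    using that w(2) AB subf_el[OF A that] de by simp
  moreover have "ap r n (w n (e n z)) = v n z" if "z \<in> el P n" for n z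
    using that w(3) natm_el[OF e that] de by simp
  ultimately show "\<exists>w. natm P (cs (src r)) w \<and> (\<forall>n. \<forall>z \<in> A n. w n z = u n z) \<and>
      (\<forall>n. \<forall>z \<in> el P n. ap r n (w n z) = v n z)"
    using natm_comp[OF e w(1)] by blast
qed

definition img :: "'u cmap => nat => 'u set" where
  "img c n = ap c n ` fobj (src c) n"

lemma img_subf: "c \<in> hom cSet A Z ==> subf (cs Z) (img c)"
  unfolding subf_def img_def
proof (intro conjI allI ballI)
  assume c: "c \<in> hom cSet A Z"
  show "ap c n ` fobj (src c) n \<subseteq> el (cs Z) n" for n
    using ap_el[OF c] hom_src[OF c] by auto
  fix m n a z assume a: "a \<in> cub m n" and "z \<in> ap c n ` fobj (src c) n"
  then obtain x where "x \<in> fobj A n" "z = ap c n x" using hom_src[OF c] by auto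
  then show "rs (cs Z) a z \<in> ap c m ` fobj (src c) m"
    using ap_rs[OF c a, of x] rs_el[OF psh_cs[OF hom_Obj(1)[OF c]] a, of x] hom_src[OF c] by force
qed

text \<open>A monomorphism is isomorphic to the inclusion of its image.\<close>

lemma lifts_iff_ext:
  assumes l: "l \<in> hom cSet A Z" and inj: "\<And>n. inj_on (ap l n) (fobj A n)"
    and r: "r \<in> hom cSet X Y"
  shows "lifts cSet l r \<longleftrightarrow> ext r (cs Z) (img l)"
proof
  note O = hom_Obj(1)[OF l] hom_Obj(2)[OF l] hom_Obj(1)[OF r] hom_Obj(2)[OF r]
  note src = hom_src[OF l] hom_src[OF r] hom_tgt[OF l] hom_tgt[OF r]
  assume L: "lifts cSet l r"
  show "ext r (cs Z) (img l)"
    unfolding ext_def src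
  proof (intro allI impI)
    fix u v assume u: "natm (restr (cs Z) (img l)) (cs X) u" and v: "natm (cs Z) (cs Y) v"
      and uv: "\<forall>n. \<forall>z \<in> img l n. ap r n (u n z) = v n z"
    have li: "natm (cs A) (restr (cs Z) (img l)) (ap l)"
      using ap_rs[OF l] by (intro natmI) (auto simp: img_def src)
    note U = mp_hom[OF O(1,3) natm_comp[OF li u]] and V = mp_hom[OF O(2,4) v]
    let ?U = "mp A X (\<lambda>n z. u n (ap l n z))" and ?V = "mp Z Y v"
    have im: "ap l n x \<in> img l n" if "x \<in> fobj A n" for n x using that by (auto simp: img_def src)
    have "r \<cdot>\<^bsub>cSet\<^esub> ?U = ?V \<cdot>\<^bsub>cSet\<^esub> l"
      by (rule hom_ext[OF comp_hom[OF U r] comp_hom[OF l V]])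
        (simp add: ap_comp[OF U] ap_comp[OF l] ap_el[OF l] uv im)
    then obtain d where d: "d \<in> hom cSet Z X" "d \<cdot>\<^bsub>cSet\<^esub> l = ?U" "r \<cdot>\<^bsub>cSet\<^esub> d = ?V"
      using L U V unfolding lifts_def cSet_simps src by blast
    have "ap d n z = u n z" if "z \<in> img l n" for n z
    proof -
      obtain x where x: "x \<in> fobj A n" "z = ap l n x" using \<open>z \<in> img l n\<close> by (auto simp: img_def src)
      then show ?thesis using ap_comp[OF l x(1), of d] d(2) by simp
    qed
    moreover have "ap r n (ap d n z) = v n z" if "z \<in> fobj Z n" for n z
      using ap_comp[OF d(1) that, of r] d(3) that by simp
    ultimately show "\<exists>w. natm (cs Z) (cs X) w \<and> (\<forall>n. \<forall>z \<in> img l n. w n z = u n z) \<and>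
      (\<forall>n. \<forall>z \<in> el (cs Z) n. ap r n (w n z) = v n z)"
      using ap_natm[OF d(1)] by (intro exI[of _ "ap d"]) simp
  qed
next
  note O = hom_Obj(1)[OF l] hom_Obj(2)[OF l] hom_Obj(1)[OF r] hom_Obj(2)[OF r]
  note src = hom_src[OF l] hom_src[OF r] hom_tgt[OF l] hom_tgt[OF r]
  assume E: "ext r (cs Z) (img l)"
  show "lifts cSet l r"
    unfolding lifts_def cSet_simps src
  proof (intro ballI impI)
    fix u v assume u: "u \<in> hom cSet A X" and v: "v \<in> hom cSet Z Y" and uv: "r \<cdot>\<^bsub>cSet\<^esub> u = v \<cdot>\<^bsub>cSet\<^esub> l"
    define g where "g n = inv_into (fobj A n) (ap l n)" for n
    have gl: "g n (ap l n x) = x" if "x \<in> fobj A n" for n x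
      using that inj by (simp add: g_def)
    have ru: "ap r n (ap u n x) = ap v n (ap l n x)" if "x \<in> fobj A n" for n x
      using ap_comp[OF u that, of r] ap_comp[OF l that, of v] uv by simp
    have U: "natm (restr (cs Z) (img l)) (cs X) (\<lambda>n z. ap u n (g n z))"
    proof (rule natmI)
      show "ap u n (g n z) \<in> el (cs X) n" if "z \<in> el (restr (cs Z) (img l)) n" for n z
        using that ap_el[OF u] by (auto simp: img_def src gl)
      fix m n a z assume a: "a \<in> cub m n" and "z \<in> el (restr (cs Z) (img l)) n"
      then obtain x where x: "x \<in> fobj A n" "z = ap l n x" by (auto simp: img_def src)
      have "rs (cs Z) a z = ap l m (rs (cs A) a x)" "rs (cs A) a x \<in> fobj A m"
        using ap_rs[OF l a x(1)] x rs_el[OF psh_cs[OF O(1)] a, of x] by simp_all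
      then show "ap u m (g m (rs (restr (cs Z) (img l)) a z)) = rs (cs X) a (ap u n (g n z))"
        using x by (simp add: gl ap_rs[OF u a])
    qed
    have "ap r n (ap u n (g n z)) = ap v n z" if "z \<in> img l n" for n z
      using that by (auto simp: img_def src gl ru)
    then obtain w where w: "natm (cs Z) (cs X) w" "\<And>n z. z \<in> img l n ==> w n z = ap u n (g n z)"
      "\<And>n z. z \<in> el (cs Z) n ==> ap r n (w n z) = ap v n z"
      using extD[OF E r U ap_natm[OF v]] by blast
    note W = mp_hom[OF O(2,3) w(1)]
    have "mp Z X w \<cdot>\<^bsub>cSet\<^esub> l = u"
      by (rule hom_ext[OF comp_hom[OF l W] u]) (simp add: ap_comp[OF l] ap_el[OF l] w(2) img_def src gl)
    moreover have "r \<cdot>\<^bsub>cSet\<^esub> mp Z X w = v"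
      by (rule hom_ext[OF comp_hom[OF W r] v]) (simp add: ap_comp[OF W] w)
    ultimately show "\<exists>d \<in> hom cSet Z X. d \<cdot>\<^bsub>cSet\<^esub> l = u \<and> r \<cdot>\<^bsub>cSet\<^esub> d = v" using W by blast
  qed
qed

context universe
begin

lemma ex_subobject:
  assumes Z: "Z \<in> Obj cS" and A: "subf (cs Z) A"
  shows "\<exists>L l. l \<in> hom cS L Z \<and> (\<forall>n. inj_on (ap l n) (fobj L n)) \<and> (\<forall>n. img l n = A n)"
proof -
  obtain L e d where L: "L \<in> Obj cS" and iso: "natiso (restr (cs Z) A) (cs L) e d"
    using cset_coding[OF tinyp_restr[OF tinyp_cs[OF Z] A]] by blast
  have e: "natm (restr (cs Z) A) (cs L) e" and d: "natm (cs L) (restr (cs Z) A) d"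
    and de: "\<And>n z. z \<in> A n ==> d n (e n z) = z" and ed: "\<And>n x. x \<in> fobj L n ==> e n (d n x) = x"
    using iso by (auto simp: natiso_def)
  have "natm (cs L) (cs Z) d"
    using natm_el[OF d] natm_rs[OF d] subf_el[OF A] by (intro natmI) auto
  note l = mp_hom[OF L Z this]
  have "inj_on (ap (mp L Z d) n) (fobj L n)" for n
    by (rule inj_on_inverseI[of _ "e n"]) (simp add: ed)
  moreover have "img (mp L Z d) n = A n" for n
  proof (intro equalityI subsetI)
    show "z \<in> A n" if "z \<in> img (mp L Z d) n" for z
      using that natm_el[OF d] by (auto simp: img_def)
    fix z assume z: "z \<in> A n"
    have "e n z \<in> fobj L n" "ap (mp L Z d) n (e n z) = z"
      using natm_el[OF e, of z n] z by (simp_all add: de)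
    then show "z \<in> img (mp L Z d) n" unfolding img_def src_mp by (metis image_eqI)
  qed
  ultimately show ?thesis using l by blast
qed

text \<open>Every inclusion of small presheaves is, up to isomorphism, a monomorphism of cubical sets.\<close>

lemma ex_inclusion:
  assumes P: "tinyp P" and A: "subf P A"
  shows "\<exists>L Z l e d. l \<in> hom cS L Z \<and> (\<forall>n. inj_on (ap l n) (fobj L n)) \<and>
    natiso P (cs Z) e d \<and> (\<forall>n. img l n = e n ` A n)"
proof -
  obtain Z e d where Z: "Z \<in> Obj cS" and iso: "natiso P (cs Z) e d"
    using cset_coding[OF P] by blast
  have e: "natm P (cs Z) e" using iso by (simp add: natiso_def)
  have "subf (cs Z) (\<lambda>n. e n ` A n)"
    unfolding subf_def
  proof (intro conjI allI ballI)
    show "e n ` A n \<subseteq> el (cs Z) n" for n using natm_el[OF e] subf_el[OF A] by blast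
    fix m n a z assume a: "a \<in> cub m n" and "z \<in> e n ` A n"
    then obtain y where y: "y \<in> A n" "z = e n y" by blast
    then show "rs (cs Z) a z \<in> e m ` A m"
      using natm_rs[OF e a subf_el[OF A y(1)]] subf_rs[OF A a y(1)] by (metis image_eqI)
  qed
  from ex_subobject[OF Z this] show ?thesis using iso by blast
qed

text \<open>The pullback of \<open>A \<subseteq> P\<close> along the map
  \<open>I\<^sup>n \<rightarrow> P\<close> given by \<open>z\<close>, as a sieve.\<close>

definition pbs :: "'z psh => (nat => 'z set) => nat => 'z => cube_arrow set" where
  "pbs P A n z = {a. \<exists>m. a \<in> cub m n \<and> rs P a z \<in> A m}"

lemma pbs_iff: "a \<in> cub m n ==> a \<in> pbs P A n z \<longleftrightarrow> rs P a z \<in> A m"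
  by (auto simp: pbs_def hom_def)

definition sieve :: "nat => cube_arrow set => bool" where
  "sieve n S \<longleftrightarrow> (\<forall>a \<in> S. \<exists>m. a \<in> cub m n) \<and> (\<forall>a \<in> S. \<forall>m k b. a \<in> cub m n \<longrightarrow> b \<in> cub k m \<longrightarrow> a \<odot> b \<in> S)"

lemma sieve_pbs:
  assumes P: "psh P" and A: "subf P A" and z: "z \<in> el P n"
  shows "sieve n (pbs P A n z)"
  unfolding sieve_def
proof (intro conjI ballI allI impI)
  fix a assume "a \<in> pbs P A n z"
  then show "\<exists>m. a \<in> cub m n" by (auto simp: pbs_def)
next
  fix a m k b assume "a \<in> pbs P A n z" "a \<in> cub m n" "b \<in> cub k m"
  then show "a \<odot> b \<in> pbs P A n z"
    using subf_rs[OF A] rs_comp[OF P _ _ z] by (simp add: pbs_iff[OF comp_cub] pbs_iff)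
qed

lemma sieve_eqI:
  assumes "sieve n S" "sieve n T" "\<And>m a. a \<in> cub m n ==> a \<in> S \<longleftrightarrow> a \<in> T"
  shows "S = T"
  using assms unfolding sieve_def by blast

text \<open>The pullback of a sieve along \<open>b\<close>.\<close>

definition pull :: "nat => cube_arrow => cube_arrow set => cube_arrow set" where
  "pull m b S = {a. \<exists>k. a \<in> cub k m \<and> b \<odot> a \<in> S}"

lemma pull_iff: "a \<in> cub k m ==> a \<in> pull m b S \<longleftrightarrow> b \<odot> a \<in> S"
  by (auto simp: pull_def)

lemma pull_pbs:
  assumes P: "psh P" and z: "z \<in> el P n" and b: "b \<in> cub m n"
  shows "pbs P A m (rs P b z) = pull m b (pbs P A n z)"
proof -
  have "a \<in> pbs P A m (rs P b z) \<longleftrightarrow> a \<in> pull m b (pbs P A n z)" if "a \<in> cub k m" for a k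
    using that rs_comp[OF P that b z] by (simp add: pbs_iff[OF that] pull_iff[OF that] pbs_iff[OF comp_cub[OF that b]])
  note eq = this
  show ?thesis
  proof (rule set_eqI)
    fix a show "a \<in> pbs P A m (rs P b z) \<longleftrightarrow> a \<in> pull m b (pbs P A n z)"
    proof (cases "\<exists>k. a \<in> cub k m")
      case False
      then show ?thesis by (auto simp: pbs_def pull_def)
    qed (use eq in blast)
  qed
qed

lemma sieve_cub: "sieve n S ==> a \<in> S ==> \<exists>m. a \<in> cub m n"
  and sieve_comp: "sieve n S ==> a \<in> S ==> a \<in> cub m n ==> b \<in> cub k m ==> a \<odot> b \<in> S"
  unfolding sieve_def by blast+

lemma sieve_pull:
  assumes S: "sieve n S" and b: "b \<in> cub m n"
  shows "sieve m (pull m b S)"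
  unfolding sieve_def
proof (intro conjI ballI allI impI)
  fix a k l c assume a: "a \<in> pull m b S" and ak: "a \<in> cub k m" and c: "c \<in> cub l k"
  have "b \<odot> a \<in> S" using a ak by (simp add: pull_iff)
  from sieve_comp[OF S this comp_cub[OF ak b] c] show "a \<odot> c \<in> pull m b S"
    by (simp add: pull_iff[OF comp_cub[OF c ak]] cub_assoc[OF c ak b])
qed (auto simp: pull_def)

end


section \<open>The sieves classified by the cofibration classifier\<close>

\<comment> \<open>keeps \<open>cub n 1\<close> from being rewritten to
  \<open>cub n (Suc 0)\<close>\<close>
declare One_nat_def [simp del]

context universe
begin

lemma pullback_img:
  assumes "is_pullback cS f c p q" "f \<in> hom cS X Y" "c \<in> hom cS Z Y" "src p = P"
  shows "img p k = {x \<in> fobj X k. ap f k x \<in> img c k}"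
proof -
  note D = is_pullbackD[OF assms]
  show ?thesis
  proof (intro equalityI subsetI)
    fix x assume "x \<in> img p k"
    then obtain w where w: "w \<in> fobj P k" "x = ap p k w" by (auto simp: img_def assms(4))
    then show "x \<in> {x \<in> fobj X k. ap f k x \<in> img c k}"
      using D(3)[OF w(1)] ap_el[OF D(1) w(1)] ap_el[OF D(2) w(1)] by (auto simp: img_def hom_src[OF assms(3)])
  next
    fix x assume "x \<in> {x \<in> fobj X k. ap f k x \<in> img c k}"
    then obtain z where "x \<in> fobj X k" "z \<in> fobj Z k" "ap f k x = ap c k z"
      by (auto simp: img_def hom_src[OF assms(3)])
    from D(4)[OF this] show "x \<in> img p k" by (auto simp: img_def assms(4))
  qed
qed

text \<open>A monomorphism with the image of a pullback is a pullback.\<close>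

lemma pullback_of_mono:
  assumes f: "f \<in> hom cS X Y" and c: "c \<in> hom cS Z Y" and p: "p \<in> hom cS P X"
    and ic: "\<And>n. inj_on (ap c n) (fobj Z n)" and ip: "\<And>n. inj_on (ap p n) (fobj P n)"
    and im: "\<And>k. img p k = {x \<in> fobj X k. ap f k x \<in> img c k}"
  shows "\<exists>q. q \<in> hom cS P Z \<and> is_pullback cS f c p q"
proof -
  note PO = hom_Obj(1)[OF p] and ZO = hom_Obj(1)[OF c]
  define g where "g n = inv_into (fobj Z n) (ap c n)" for n
  have gc: "g n (ap c n z) = z" if "z \<in> fobj Z n" for n z using that ic by (simp add: g_def)
  have fp: "\<exists>z \<in> fobj Z n. ap f n (ap p n w) = ap c n z" if "w \<in> fobj P n" for n w
  proof -
    have "ap p n w \<in> img p n" using that by (auto simp: img_def hom_src[OF p])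
    then show ?thesis using im[of n] by (auto simp: img_def hom_src[OF c])
  qed
  let ?q = "\<lambda>n w. g n (ap f n (ap p n w))"
  have q: "?q n w \<in> fobj Z n" "ap c n (?q n w) = ap f n (ap p n w)" if w: "w \<in> fobj P n" for n w
    using fp[OF w] gc by auto
  have "natm (cs P) (cs Z) ?q"
  proof (rule natmI)
    fix m n a w assume a: "a \<in> cub m n" and "w \<in> el (cs P) n"
    then have w: "w \<in> fobj P n" by simp
    obtain z where z: "z \<in> fobj Z n" "ap f n (ap p n w) = ap c n z" using fp[OF w] by blast
    have az: "rs (cs Z) a z \<in> fobj Z m" using rs_el[OF psh_cs[OF ZO] a, of z] z by simp
    show "?q m (rs (cs P) a w) = rs (cs Z) a (?q n w)"
      by (simp add: ap_rs[OF p a w] ap_rs[OF f a ap_el[OF p w]] z gc ap_rs[OF c a z(1), symmetric] az)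
  qed (simp add: q)
  note Q = mp_hom[OF PO ZO this]
  have "is_pullback cS f c p (mp P Z ?q)"
  proof (rule is_pullbackI[OF f c p Q])
    fix n x z assume "x \<in> fobj X n" "z \<in> fobj Z n" "ap f n x = ap c n z"
    then have "x \<in> img p n" unfolding im by (auto simp: img_def hom_src[OF c])
    then obtain w where "w \<in> fobj P n" "ap p n w = x" by (auto simp: img_def hom_src[OF p])
    then show "\<exists>w\<in>fobj P n. ap p n w = x \<and> ap (mp P Z ?q) n w = z"
      using \<open>ap f n x = ap c n z\<close> \<open>z \<in> fobj Z n\<close> by (auto simp: gc)
  qed (use ip q in \<open>auto simp: inj_on_def\<close>)
  then show ?thesis using Q by blast
qed

lemma factors_iff:
  assumes c: "c \<in> hom cS A Z" and j: "j \<in> hom cS J Z" and ij: "\<And>n. inj_on (ap j n) (fobj J n)"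
  shows "factors_through cS c j \<longleftrightarrow> (\<forall>n. img c n \<subseteq> img j n)"
proof
  assume "factors_through cS c j"
  then obtain h where h: "h \<in> hom cS A J" "j \<bullet> h = c"
    by (auto simp: factors_through_def hom_src[OF c] hom_src[OF j])
  have "ap c n x \<in> ap j n ` fobj J n" if "x \<in> fobj A n" for n x
    using ap_comp[OF h(1) that, of j] ap_el[OF h(1) that] h(2) by simp
  then show "\<forall>n. img c n \<subseteq> img j n"
    by (auto simp: img_def hom_src[OF c] hom_src[OF j])
next
  assume sub: "\<forall>n. img c n \<subseteq> img j n"
  define g where "g n = inv_into (fobj J n) (ap j n)" for n
  have cj: "\<exists>y \<in> fobj J n. ap c n x = ap j n y" if "x \<in> fobj A n" for n x
  proof -
    have "ap c n x \<in> img j n" using that sub by (auto simp: img_def hom_src[OF c])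
    then show ?thesis by (auto simp: img_def hom_src[OF j])
  qed
  have gj: "g n (ap j n y) = y" if "y \<in> fobj J n" for n y using that ij by (simp add: g_def)
  have g: "g n (ap c n x) \<in> fobj J n" "ap j n (g n (ap c n x)) = ap c n x" if "x \<in> fobj A n" for n x
    using cj[OF that] gj by auto
  have nat: "natm (cs A) (cs J) (\<lambda>n x. g n (ap c n x))"
  proof (rule natmI)
    fix m n a x assume a: "a \<in> cub m n" and "x \<in> el (cs A) n"
    then have x: "x \<in> fobj A n" by simp
    have r: "rs (cs J) a (g n (ap c n x)) \<in> fobj J m"
      using rs_el[OF psh_cs[OF hom_Obj(1)[OF j]] a] g[OF x] by simp
    have "ap c m (rs (cs A) a x) = ap j m (rs (cs J) a (g n (ap c n x)))"
      by (simp add: ap_rs[OF c a x] ap_rs[OF j a g(1)[OF x]] g[OF x])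
    then show "g m (ap c m (rs (cs A) a x)) = rs (cs J) a (g n (ap c n x))"
      by (simp add: gj[OF r])
  qed (simp add: g)
  note h = mp_hom[OF hom_Obj(1)[OF c] hom_Obj(1)[OF j] nat]
  have "j \<bullet> mp A J (\<lambda>n x. g n (ap c n x)) = c"
    by (rule hom_ext[OF comp_hom[OF h j] c]) (simp add: ap_comp[OF h] g)
  then show "factors_through cS c j"
    unfolding factors_through_def cSet_simps hom_src[OF c] hom_src[OF j] using h by blast
qed

text \<open>A sieve as a subpresheaf of the representable, whose elements are coded arrows.\<close>

definition senc :: "nat => cube_arrow set => nat => 'u set" where
  "senc n S k = enc ` (S \<inter> cub k n)"

lemma senc_iff: "a \<in> cub k n ==> enc a \<in> senc n S k \<longleftrightarrow> a \<in> S"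
  unfolding senc_def using enc_inj by blast

lemma senc_subf: "sieve n S ==> subf (cs (cube n)) (senc n S)"
  unfolding subf_def
proof (intro conjI allI ballI)
  assume S: "sieve n S"
  show "senc n S k \<subseteq> el (cs (cube n)) k" for k by (auto simp: senc_def fobj_cube)
  fix m k a z assume a: "a \<in> cub m k" and "z \<in> senc n S k"
  then obtain b where b: "b \<in> S" "b \<in> cub k n" "z = enc b" by (auto simp: senc_def)
  then show "rs (cs (cube n)) a z \<in> senc n S m"
    using sieve_comp[OF S b(1,2) a] a by (simp add: rs_cube senc_iff[OF comp_cub[OF a b(2)]])
qed

lemma pbs_senc: "b \<in> cub m n ==> pbs (cs (cube n)) (senc n S) m (enc b) = pull m b S"
  unfolding pbs_def pull_def by (auto simp: rs_cube senc_iff[OF comp_cub])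

end

locale cubical_cofibrations = universe U + cofibrations \<C>
  for U :: "'u itself" and \<C> :: "'u cmap set"
begin

lemma cof_hom: "c \<in> \<C> ==> c \<in> hom cS (src c) (tgt c)"
  using cof_monic Arr_hom unfolding monic_def by blast

lemma cof_inj: "c \<in> \<C> ==> inj_on (ap c n) (fobj (src c) n)"
  using cof_monic monic_iff cof_hom by blast

text \<open>The sieves whose inclusion into the cube is a cofibration. By
  \<open>cofibration_local\<close> they determine \<open>\<C>\<close>.\<close>

definition cofsieve :: "nat => cube_arrow set => bool" where
  "cofsieve n S \<longleftrightarrow> sieve n S \<and> (\<exists>c \<in> \<C>. c \<in> hom cS (src c) (cube n) \<and> (\<forall>k. img c k = senc n S k))"

lemma cofsieve_sieve: "cofsieve n S ==> sieve n S"
  by (simp add: cofsieve_def)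

lemma cofsieve_pbs:
  assumes c: "c \<in> \<C>" "c \<in> hom cS A Z" and z: "z \<in> fobj Z n"
  shows "cofsieve n (pbs (cs Z) (img c) n z)"
proof -
  note ZO = hom_Obj(2)[OF c(2)]
  note y = yon_hom[OF ZO z]
  obtain P p q where pb: "is_pullback cS (yon Z n z) c p q" "p \<in> hom cS P (cube n)"
    using ex_pullback[OF y c(2)] by blast
  have p: "p \<in> \<C>" using C3[OF c(1) pb(1)] .
  have im: "img p k = senc n (pbs (cs Z) (img c) n z) k" for k
    unfolding pullback_img[OF pb(1) y c(2) hom_src[OF pb(2)]] senc_def
    by (auto simp: fobj_cube ap_yon pbs_iff)
  have "sieve n (pbs (cs Z) (img c) n z)"
    using sieve_pbs[OF psh_cs[OF ZO] img_subf[OF c(2)]] z by simp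
  then show ?thesis
    unfolding cofsieve_def using p im pb(2) hom_src[OF pb(2)] by auto
qed

text \<open>A monomorphism is a cofibration as soon as its pullbacks to representables are: the
  classifying maps of these pullbacks are unique, hence assemble into a map to \<open>\<Phi>\<close> that
  classifies the whole monomorphism.\<close>

lemma cofibration_local:
  assumes c: "c \<in> hom cS A Z" and inj: "\<And>n. inj_on (ap c n) (fobj A n)"
    and loc: "\<And>n z. z \<in> fobj Z n ==> cofsieve n (pbs (cs Z) (img c) n z)"
  shows "c \<in> \<C>"
proof -
  from C4 obtain \<Phi> t where t: "t \<in> hom cS one \<Phi>" and tC: "t \<in> \<C>"
    and cl: "\<And>c. c \<in> \<C> ==> \<exists>!(x, y). x \<in> hom cS (Cod cS c) \<Phi> \<and> y \<in> hom cS (Dom cS c) one \<and>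
        is_pullback cS x t c y"
    by auto
  note \<Phi>O = hom_Obj(2)[OF t] and ZO = hom_Obj(2)[OF c]
  have it: "inj_on (ap t n) (fobj one n)" for n using cof_inj[OF tC] hom_src[OF t] by simp
  let ?S = "pbs (cs \<Phi>) (img t)"
  \<comment> \<open>An element of \<open>\<Phi>\<close> is determined by its sieve, since classifying
    maps are unique, \<dots>\<close>
  have S_unique: "f = g" if f: "f \<in> fobj \<Phi> n" and g: "g \<in> fobj \<Phi> n" and e: "?S n f = ?S n g" for n f g
  proof -
    obtain d where d: "d \<in> \<C>" "d \<in> hom cS (src d) (cube n)" "\<And>k. img d k = senc n (?S n f) k"
      using cofsieve_pbs[OF tC t f] unfolding cofsieve_def by blast
    have pb: "\<exists>q. q \<in> hom cS (src d) one \<and> is_pullback cS (yon \<Phi> n h) t d q"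
      if h: "h \<in> fobj \<Phi> n" and e: "?S n h = ?S n f" for h
    proof (rule pullback_of_mono[OF yon_hom[OF \<Phi>O h] t d(2) it cof_inj[OF d(1)]])
      show "img d k = {x \<in> fobj (cube n) k. ap (yon \<Phi> n h) k x \<in> img t k}" for k
        unfolding d(3) e[symmetric] senc_def by (auto simp: fobj_cube ap_yon pbs_iff)
    qed
    obtain q q' where "q \<in> hom cS (src d) one" "is_pullback cS (yon \<Phi> n f) t d q"
      "q' \<in> hom cS (src d) one" "is_pullback cS (yon \<Phi> n g) t d q'"
      using pb[OF f refl] pb[OF g e[symmetric]] by blast
    then have "yon \<Phi> n f = yon \<Phi> n g"
      using cl[OF d(1)] yon_hom[OF \<Phi>O f] yon_hom[OF \<Phi>O g] hom_tgt[OF d(2)]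
      unfolding cSet_simps by auto
    then show "f = g" using ap_yon_id[OF \<Phi>O] f g by metis
  qed
  \<comment> \<open>\<dots> and every cofibrant sieve occurs, since classifying maps exist.\<close>
  have S_exists: "\<exists>f \<in> fobj \<Phi> n. ?S n f = S" if "cofsieve n S" for n S
  proof -
    have S: "sieve n S" using cofsieve_sieve[OF that] .
    obtain d where d: "d \<in> \<C>" "d \<in> hom cS (src d) (cube n)" "\<And>k. img d k = senc n S k"
      using \<open>cofsieve n S\<close> unfolding cofsieve_def by blast
    obtain x y where x: "x \<in> hom cS (cube n) \<Phi>" and pb: "is_pullback cS x t d y"
      using cl[OF d(1)] hom_tgt[OF d(2)] by (auto simp del: split_paired_Ex)
    let ?f = "ap x n (enc (cid n))"
    have f: "?f \<in> fobj \<Phi> n" by (rule ap_el[OF x enc_el]) simp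
    have "a \<in> ?S n ?f \<longleftrightarrow> a \<in> S" if a: "a \<in> cub m n" for m a
    proof -
      have "rs (cs \<Phi>) a ?f = ap x m (enc a)"
        using ap_rs[OF x a enc_el[OF cid_cub]] by (simp add: rs_cube[OF a cid_cub] cub_idl[OF a])
      moreover have "ap x m (enc a) \<in> img t m \<longleftrightarrow> enc a \<in> img d m"
        using pullback_img[OF pb x t refl, of m] enc_el[OF a] by auto
      ultimately show ?thesis by (simp add: pbs_iff[OF a] d(3) senc_iff[OF a])
    qed
    then have "?S n ?f = S"
      using sieve_eqI[OF sieve_pbs[OF psh_cs[OF \<Phi>O] img_subf[OF t]] S] f by simp
    then show ?thesis using f by blast
  qed
  define \<chi> where "\<chi> n z = (SOME f. f \<in> fobj \<Phi> n \<and> ?S n f = pbs (cs Z) (img c) n z)" for n z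
  have \<chi>: "\<chi> n z \<in> fobj \<Phi> n" "?S n (\<chi> n z) = pbs (cs Z) (img c) n z" if "z \<in> fobj Z n" for n z
  proof -
    have "\<exists>f. f \<in> fobj \<Phi> n \<and> ?S n f = pbs (cs Z) (img c) n z" using S_exists[OF loc[OF that]] by blast
    from someI_ex[OF this] show "\<chi> n z \<in> fobj \<Phi> n" "?S n (\<chi> n z) = pbs (cs Z) (img c) n z"
      unfolding \<chi>_def by auto
  qed
  have nat: "natm (cs Z) (cs \<Phi>) \<chi>"
  proof (rule natmI)
    fix m n a z assume a: "a \<in> cub m n" and "z \<in> el (cs Z) n"
    then have z: "z \<in> el (cs Z) n" "z \<in> fobj Z n" by simp_all
    have az: "rs (cs Z) a z \<in> fobj Z m" using rs_el[OF psh_cs[OF ZO] a z(1)] by simp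
    have a\<chi>: "rs (cs \<Phi>) a (\<chi> n z) \<in> fobj \<Phi> m" using rs_el[OF psh_cs[OF \<Phi>O] a] \<chi>[OF z(2)] by simp
    show "\<chi> m (rs (cs Z) a z) = rs (cs \<Phi>) a (\<chi> n z)"
      using \<chi>(1)[OF z(2)]
      by (intro S_unique[OF \<chi>(1)[OF az] a\<chi>])
        (simp add: \<chi>(2)[OF az] pull_pbs[OF psh_cs[OF ZO] z(1) a]
          pull_pbs[OF psh_cs[OF \<Phi>O] _ a] \<chi>(2)[OF z(2)])
  qed (simp add: \<chi>)
  note X = mp_hom[OF ZO \<Phi>O nat]
  have "img c k = {x \<in> fobj Z k. ap (mp Z \<Phi> \<chi>) k x \<in> img t k}" for k
  proof -
    have "x \<in> img c k \<longleftrightarrow> \<chi> k x \<in> img t k" if x: "x \<in> fobj Z k" for x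
    proof -
      have "x \<in> img c k \<longleftrightarrow> cid k \<in> pbs (cs Z) (img c) k x"
        using x by (simp add: pbs_iff[OF cid_cub] rs_id[OF psh_cs[OF ZO]])
      also have "\<dots> \<longleftrightarrow> \<chi> k x \<in> img t k"
        using \<chi>(1)[OF x] by (simp add: \<chi>(2)[OF x, symmetric] pbs_iff[OF cid_cub] rs_id[OF psh_cs[OF \<Phi>O]])
      finally show ?thesis .
    qed
    note key = this
    have "x \<in> fobj Z k" if "x \<in> img c k" for x using img_subf[OF c] that by (auto simp: subf_def)
    with key have "img c k = {x \<in> fobj Z k. \<chi> k x \<in> img t k}" by blast
    also have "\<dots> = {x \<in> fobj Z k. ap (mp Z \<Phi> \<chi>) k x \<in> img t k}" by auto
    finally show ?thesis .
  qed
  then obtain q where "is_pullback cS (mp Z \<Phi> \<chi>) t c q"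
    using pullback_of_mono[OF X t c it inj] by blast
  then show ?thesis by (rule C3[OF tC])
qed

lemma cofsieve_pull: "cofsieve n S ==> b \<in> cub m n ==> cofsieve m (pull m b S)"
proof -
  assume S: "cofsieve n S" and b: "b \<in> cub m n"
  then obtain c where c: "c \<in> \<C>" "c \<in> hom cS (src c) (cube n)" "\<And>k. img c k = senc n S k"
    unfolding cofsieve_def by blast
  have "img c = senc n S" using c(3) by (rule HOL.ext)
  then show ?thesis using cofsieve_pbs[OF c(1,2) enc_el[OF b]] by (simp add: pbs_senc[OF b])
qed

lemma cofsieve_I: "sieve n S ==> c \<in> \<C> ==> c \<in> hom cS A (cube n) ==> (\<And>k. img c k = senc n S k) ==> cofsieve n S"
  unfolding cofsieve_def using hom_src by blast

lemma cofsieve_top: "cofsieve n {a. \<exists>m. a \<in> cub m n}"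
proof (rule cofsieve_I)
  note i = id_hom'[OF cube_Obj, of n]
  have "isomorphism cS (Idn cS (cube n))"
    unfolding isomorphism_def cSet_simps hom_src[OF i] hom_tgt[OF i]
    using i hom_Arr[OF i] category.id_left[OF category_cSet i] by blast
  then show "Idn cS (cube n) \<in> \<C>" by (rule C1)
  show "Idn cS (cube n) \<in> hom cS (cube n) (cube n)" by (rule i)
  show "img (Idn cS (cube n)) k = senc n {a. \<exists>m. a \<in> cub m n} k" for k
    by (auto simp: img_def hom_src[OF i] senc_def fobj_cube cube_Obj)
qed (auto simp: sieve_def)

lemma cofsieve_bot: "cofsieve n {}"
proof -
  have "tinyp (Psh (\<lambda>n. {} :: 'u set) (\<lambda>a z. z))"
    by (auto simp: tinyp_def psh_def tiny_countable)
  then obtain Z e d where Z: "Z \<in> Obj cS" "natiso (Psh (\<lambda>n. {} :: 'u set) (\<lambda>a z. z)) (cs Z) e d"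
    using cset_coding by blast
  then have em: "fobj Z k = {}" for k by (auto simp: natiso_def natm_def)
  have c: "mp Z (cube n) (\<lambda>k x. x) \<in> hom cS Z (cube n)"
    by (intro mp_hom Z cube_Obj natmI) (auto simp: em)
  have "mp Z (cube n) (\<lambda>k x. x) \<in> \<C>"
    using C0[OF initial_empty c] Z em by (simp add: empty_cset_def)
  from cofsieve_I[OF _ this c] show ?thesis by (auto simp: sieve_def img_def em senc_def)
qed

lemma cofsieve_union: "cofsieve n S ==> cofsieve n T ==> cofsieve n (S \<union> T)"
proof -
  assume S: "cofsieve n S" and T: "cofsieve n T"
  obtain c d where c: "c \<in> \<C>" "c \<in> hom cS (src c) (cube n)" "\<And>k. img c k = senc n S k"
    and d: "d \<in> \<C>" "d \<in> hom cS (src d) (cube n)" "\<And>k. img d k = senc n T k"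
    using S T unfolding cofsieve_def by blast
  have ST: "sieve n (S \<union> T)" using cofsieve_sieve[OF S] cofsieve_sieve[OF T] by (auto simp: sieve_def)
  obtain L l where l: "l \<in> hom cS L (cube n)" "\<And>k. inj_on (ap l k) (fobj L k)"
    "\<And>k. img l k = senc n (S \<union> T) k"
    using ex_subobject[OF cube_Obj senc_subf[OF ST]] by blast
  have "is_join cS (cube n) c d l"
    unfolding is_join_def cSet_simps hom_tgt[OF c(2)] hom_tgt[OF d(2)] hom_tgt[OF l(1)]
      factors_iff[OF c(2) l(1,2)] factors_iff[OF d(2) l(1,2)]
  proof (intro conjI allI impI refl)
    show "monic cS c" "monic cS d" using cof_monic c d by auto
    show "monic cS l" using monic_iff[OF l(1)] l(2) by blast
    show "img c k \<subseteq> img l k" "img d k \<subseteq> img l k" for k by (auto simp: c d l senc_def)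
    fix k assume k: "monic cS k \<and> tgt k = cube n \<and> factors_through cS c k \<and> factors_through cS d k"
    then have kh: "k \<in> hom cS (src k) (cube n)" using Arr_hom[of k] unfolding monic_def by auto
    then have ki: "inj_on (ap k m) (fobj (src k) m)" for m using monic_iff k by blast
    have "img c m \<subseteq> img k m" "img d m \<subseteq> img k m" for m
      using k factors_iff[OF c(2) kh ki] factors_iff[OF d(2) kh ki] by auto
    then show "factors_through cS l k"
      unfolding factors_iff[OF l(1) kh ki] c d l senc_def by blast
  qed
  then have "l \<in> \<C>" by (rule C6[OF c(1) d(1)])
  from cofsieve_I[OF ST this l(1,3)] show ?thesis .
qed

text \<open>A sieve inside a cofibrant sieve is cofibrant if it is so over each member of the latter: by
  locality its inclusion is a composite of two cofibrations.\<close>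

lemma cofsieve_trans:
  assumes S: "cofsieve n S" and T: "sieve n T" "T \<subseteq> S"
    and TS: "\<And>m a. a \<in> S ==> a \<in> cub m n ==> cofsieve m (pull m a T)"
  shows "cofsieve n T"
proof -
  obtain c where c: "c \<in> \<C>" "c \<in> hom cS (src c) (cube n)" "\<And>k. img c k = senc n S k"
    using S unfolding cofsieve_def by blast
  let ?A = "src c"
  note AO = hom_Obj(1)[OF c(2)]
  define B where "B k = {x \<in> fobj ?A k. ap c k x \<in> senc n T k}" for k
  have B: "subf (cs ?A) B"
    unfolding subf_def B_def
    using rs_el[OF psh_cs[OF AO]] ap_rs[OF c(2)] subf_rs[OF senc_subf[OF T(1)]] by auto
  obtain L l where l: "l \<in> hom cS L ?A" "\<And>k. inj_on (ap l k) (fobj L k)" "\<And>k. img l k = B k"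
    using ex_subobject[OF AO B] by blast
  have lB: "img l = B" using l(3) by (rule HOL.ext)
  have "l \<in> \<C>"
  proof (rule cofibration_local[OF l(1,2)])
    fix m x assume x: "x \<in> fobj ?A m"
    have "ap c m x \<in> senc n S m" using x c(3)[of m] by (auto simp: img_def)
    then obtain a where a: "a \<in> S" "a \<in> cub m n" "ap c m x = enc a" by (auto simp: senc_def)
    have "pbs (cs ?A) B m x = pull m a T"
      unfolding pbs_def pull_def
    proof (intro Collect_cong ex_cong1 conj_cong refl)
      fix b k assume b: "b \<in> cub k m"
      show "rs (cs ?A) b x \<in> B k \<longleftrightarrow> a \<odot> b \<in> T"
        using rs_el[OF psh_cs[OF AO] b, of x] x
        by (simp add: B_def ap_rs[OF c(2) b x] a(3) rs_cube[OF b a(2)] senc_iff[OF comp_cub[OF b a(2)]])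
    qed
    then show "cofsieve m (pbs (cs ?A) (img l) m x)" using TS[OF a(1,2)] by (simp add: lB)
  qed
  then have cl: "c \<bullet> l \<in> \<C>" using C2 c(1) l(1) by (simp add: hom_tgt[OF l(1)])
  note h = comp_hom[OF l(1) c(2)]
  have "img (c \<bullet> l) k = senc n T k" for k
  proof -
    have "img (c \<bullet> l) k = ap c k ` img l k"
      unfolding img_def hom_src[OF h] hom_src[OF l(1)] image_image
      using ap_comp[OF l(1)] by (rule image_cong[OF refl])
    also have "\<dots> = {y \<in> img c k. y \<in> senc n T k}" unfolding l(3) B_def img_def[of c] by auto
    also have "\<dots> = senc n T k" using T(2) by (auto simp: c(3) senc_def)
    finally show ?thesis .
  qed
  from cofsieve_I[OF T(1) cl h this] show ?thesis .
qed

text \<open>This is the pullback of the diagonal of the interval along \<open>(i, j)\<close>.\<close>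

lemma cofsieve_eq:
  assumes i: "i \<in> cub n 1" and j: "j \<in> cub n 1"
  shows "cofsieve n {a. (\<exists>m. a \<in> cub m n) \<and> i \<odot> a = j \<odot> a}"
proof -
  have I: "II \<in> Obj cS" by (rule cube_Obj)
  note E = prod_elements[OF I I] and pr = pr_hom[OF I I] and id = id_hom'[OF I]
  let ?PO = "prod_obj cS II II"
  have "\<exists>!h. h \<in> hom cS II ?PO \<and> pr1 cS II II \<bullet> h = Idn cS II \<and> pr2 cS II II \<bullet> h = Idn cS II"
    using prodc_product[OF I I] id unfolding is_product_def prod_obj_def by blast
  from theI'[OF this] have d: "diag \<in> hom cS II ?PO" "pr1 cS II II \<bullet> diag = Idn cS II"
    "pr2 cS II II \<bullet> diag = Idn cS II"
    unfolding diag_def pairing_def cSet_simps hom_src[OF id] hom_tgt[OF id] by auto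
  have im: "w \<in> img diag k \<longleftrightarrow> ap (pr1 cS II II) k w = ap (pr2 cS II II) k w"
    if w: "w \<in> fobj ?PO k" for k w
  proof
    assume "w \<in> img diag k"
    then obtain x where x: "x \<in> fobj II k" "w = ap diag k x" by (auto simp: img_def hom_src[OF d(1)])
    then show "ap (pr1 cS II II) k w = ap (pr2 cS II II) k w"
      using ap_comp[OF d(1) x(1), of "pr1 cS II II"] ap_comp[OF d(1) x(1), of "pr2 cS II II"] d by simp
  next
    assume e: "ap (pr1 cS II II) k w = ap (pr2 cS II II) k w"
    let ?x = "ap (pr1 cS II II) k w"
    have x: "?x \<in> fobj II k" by (rule ap_el[OF pr(1) w])
    have "ap diag k ?x = w"
      using ap_comp[OF d(1) x, of "pr1 cS II II"] ap_comp[OF d(1) x, of "pr2 cS II II"] d(2,3) x e I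
      by (intro E(4)[OF ap_el[OF d(1) x] w]) simp_all
    then show "w \<in> img diag k" unfolding img_def hom_src[OF d(1)] using x by (metis image_eqI)
  qed
  let ?z = "pe II II n (enc i, enc j)"
  have z: "?z \<in> fobj ?PO n" by (rule E(1)[OF enc_el[OF i] enc_el[OF j]])
  have "pbs (cs ?PO) (img diag) n ?z = {a. (\<exists>m. a \<in> cub m n) \<and> i \<odot> a = j \<odot> a}"
  proof -
    have "rs (cs ?PO) a ?z \<in> img diag m \<longleftrightarrow> i \<odot> a = j \<odot> a" if a: "a \<in> cub m n" for m a
    proof -
      have "rs (cs ?PO) a ?z \<in> fobj ?PO m" using rs_el[OF psh_cs[OF pr(3)] a] z by simp
      then show ?thesis
        using enc_inj[OF comp_cub[OF a i] comp_cub[OF a j]]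
        by (auto simp: im ap_rs[OF pr(1) a z] ap_rs[OF pr(2) a z] E(2,3) enc_el i j rs_cube[OF a])
    qed
    then show ?thesis by (auto simp: pbs_def)
  qed
  then show ?thesis using cofsieve_pbs[OF C7 d(1) z] by simp
qed


subsection \<open>Cofibrant subpresheaves\<close>

text \<open>A subpresheaf is called cofibrant if it is so locally. For cubical sets this characterizes
  the images of cofibrations (\<open>cofibration_iff\<close>).\<close>

definition cof :: "'z psh => (nat => 'z set) => bool" where
  "cof P A \<longleftrightarrow> subf P A \<and> (\<forall>n. \<forall>z \<in> el P n. cofsieve n (pbs P A n z))"

lemma cof_subf: "cof P A ==> subf P A"
  by (simp add: cof_def)

lemma cof_K: "cof P A ==> z \<in> el P n ==> cofsieve n (pbs P A n z)"
  by (simp add: cof_def)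

lemma cof_empty: "cof P (\<lambda>n. {})"
  by (simp add: cof_def subf_def pbs_def cofsieve_bot)

lemma cof_Un:
  assumes "cof P A" "cof P B"
  shows "cof P (\<lambda>n. A n \<union> B n)"
proof -
  have "pbs P (\<lambda>n. A n \<union> B n) n z = pbs P A n z \<union> pbs P B n z" for n z
    by (auto simp: pbs_def)
  then show ?thesis using assms cofsieve_union unfolding cof_def subf_def by auto
qed

lemma cof_preimage:
  assumes B: "cof Q B" and f: "natm P Q f" and P: "psh P"
  shows "cof P (\<lambda>n. {z \<in> el P n. f n z \<in> B n})"
  unfolding cof_def
proof (intro conjI allI ballI)
  show "subf P (\<lambda>n. {z \<in> el P n. f n z \<in> B n})"
    unfolding subf_def using rs_el[OF P] natm_rs[OF f] subf_rs[OF cof_subf[OF B]] by auto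
  fix n z assume z: "z \<in> el P n"
  have "pbs P (\<lambda>n. {z \<in> el P n. f n z \<in> B n}) n z = pbs Q B n (f n z)"
    unfolding pbs_def using rs_el[OF P] natm_rs[OF f] z by (auto intro!: Collect_cong ex_cong1)
  then show "cofsieve n (pbs P (\<lambda>n. {z \<in> el P n. f n z \<in> B n}) n z)"
    using cof_K[OF B natm_el[OF f z]] by simp
qed

lemma cof_eq:
  assumes f: "natm P Ip f" and g: "natm P Ip g" and P: "psh P"
  shows "cof P (\<lambda>n. {z \<in> el P n. f n z = g n z})"
  unfolding cof_def
proof (intro conjI allI ballI)
  show "subf P (\<lambda>n. {z \<in> el P n. f n z = g n z})"
    unfolding subf_def using rs_el[OF P] natm_rs[OF f] natm_rs[OF g] by auto
  fix n z assume z: "z \<in> el P n"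
  have "pbs P (\<lambda>n. {z \<in> el P n. f n z = g n z}) n z =
      {a. (\<exists>m. a \<in> cub m n) \<and> f n z \<odot> a = g n z \<odot> a}"
    unfolding pbs_def using rs_el[OF P] natm_rs[OF f] natm_rs[OF g] z by auto
  then show "cofsieve n (pbs P (\<lambda>n. {z \<in> el P n. f n z = g n z}) n z)"
    using cofsieve_eq[of "f n z" n "g n z"] natm_el[OF f z] natm_el[OF g z] by simp
qed

lemma cof_trans:
  assumes A: "cof P A" and B: "cof (restr P A) B" and P: "psh P"
  shows "cof P B"
  unfolding cof_def
proof (intro conjI allI ballI)
  have BA: "z \<in> A n" if "z \<in> B n" for z n using subf_el[OF cof_subf[OF B]] that by simp
  show sB: "subf P B"
    using cof_subf[OF B] cof_subf[OF A] unfolding subf_def el_restr rs_restr by blast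
  fix n z assume z: "z \<in> el P n"
  show "cofsieve n (pbs P B n z)"
  proof (rule cofsieve_trans[OF cof_K[OF A z] sieve_pbs[OF P sB z]])
    show "pbs P B n z \<subseteq> pbs P A n z" using BA by (auto simp: pbs_def)
    fix m a assume "a \<in> pbs P A n z" and a: "a \<in> cub m n"
    then have "rs P a z \<in> A m" by (simp add: pbs_iff)
    then have "cofsieve m (pbs (restr P A) B m (rs P a z))" using cof_K[OF B] by simp
    moreover have "pbs (restr P A) B m (rs P a z) = pbs P B m (rs P a z)" by (simp add: pbs_def)
    ultimately show "cofsieve m (pull m a (pbs P B n z))" by (simp add: pull_pbs[OF P z a])
  qed
qed

lemma cof_img: "c \<in> \<C> ==> cof (cs (tgt c)) (img c)"
  unfolding cof_def using img_subf[OF cof_hom] cofsieve_pbs[OF _ cof_hom] by auto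

lemma cofibration_iff:
  assumes c: "c \<in> hom cS A Z"
  shows "c \<in> \<C> \<longleftrightarrow> (\<forall>n. inj_on (ap c n) (fobj A n)) \<and> cof (cs Z) (img c)"
  using cof_img[of c] cof_inj[of c] cofibration_local[OF c] hom_src[OF c] hom_tgt[OF c]
  by (auto simp: cof_def)

text \<open>Coding a small presheaf as a cubical set turns the inclusion of a cofibrant subpresheaf into
  a cofibration.\<close>

lemma TFib_ext:
  assumes r: "r \<in> TFib \<C>" and P: "tinyp P" and A: "cof P A"
  shows "ext r P A"
proof -
  from ex_inclusion[OF P cof_subf[OF A]] obtain L Z l e d where
    "l \<in> hom cS L Z \<and> (\<forall>n. inj_on (ap l n) (fobj L n)) \<and>
    natiso P (cs Z) e d \<and> (\<forall>n. img l n = e n ` A n)"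
    by (elim exE)
  then have l: "l \<in> hom cS L Z" "\<And>n. inj_on (ap l n) (fobj L n)"
    and iso: "natiso P (cs Z) e d" and im: "\<And>n. img l n = e n ` A n"
    by simp_all
  have e: "natm P (cs Z) e" and d: "natm (cs Z) P d"
    and de: "\<And>n z. z \<in> el P n ==> d n (e n z) = z" and ed: "\<And>n z. z \<in> fobj Z n ==> e n (d n z) = z"
    using iso unfolding natiso_def by simp_all
  have mem: "e n z \<in> img l n \<longleftrightarrow> z \<in> A n" if "z \<in> el P n" for n z
  proof
    assume "e n z \<in> img l n"
    then obtain y where "y \<in> A n" "e n z = e n y" unfolding im by blast
    then show "z \<in> A n" using de[OF that] de[OF subf_el[OF cof_subf[OF A]]] by metis
  qed (simp add: im)
  have "l \<in> \<C>"
  proof (rule cofibration_local[OF l])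
    fix n z assume z: "z \<in> fobj Z n"
    have dz: "d n z \<in> el P n" using natm_el[OF d] z by simp
    have "rs (cs Z) a z \<in> img l m \<longleftrightarrow> rs P a (d n z) \<in> A m" if a: "a \<in> cub m n" for m a
      using natm_rs[OF e a dz] mem[OF rs_el[OF tinyp_psh[OF P] a dz]] ed[OF z] by simp
    then have "pbs (cs Z) (img l) n z = pbs P A n (d n z)"
      unfolding pbs_def by (intro Collect_cong ex_cong1) auto
    then show "cofsieve n (pbs (cs Z) (img l) n z)" using cof_K[OF A dz] by simp
  qed
  then have "lifts cS l r" using r by (simp add: TFib_def rlp_def)
  moreover have "r \<in> hom cS (src r) (tgt r)" using r Arr_hom by (auto simp: TFib_def rlp_def)
  ultimately have "ext r (cs Z) (img l)" using lifts_iff_ext[OF l] by blast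
  then show ?thesis
    using ext_iso[OF iso tinyp_psh[OF P] psh_cs[OF hom_Obj(2)[OF l(1)]] cof_subf[OF A] img_subf[OF l(1)]] mem
    by blast
qed

lemma TFib_I:
  assumes r: "r \<in> hom cS X Y" and e: "\<And>Z A. Z \<in> Obj cS ==> cof (cs Z) A ==> ext r (cs Z) A"
  shows "r \<in> TFib \<C>"
  unfolding TFib_def rlp_def
proof (intro CollectI conjI ballI hom_Arr[OF r])
  fix l assume l: "l \<in> \<C>"
  show "lifts cS l r"
    using e[OF hom_Obj(2)[OF cof_hom[OF l]] cof_img[OF l]] lifts_iff_ext[OF cof_hom[OF l] cof_inj[OF l] r]
    by blast
qed

end


section \<open>Dependent products and exponentials\<close>

definition sectdom :: "'x psh => 'e psh => (nat => 'e => 'x) => nat => 'x => cube_arrow => 'e => bool" where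
  "sectdom X E p n x a e \<longleftrightarrow> (\<exists>m. a \<in> cub m n \<and> e \<in> el E m \<and> p m e = rs X a x)"

text \<open>The presheaf of partial sections: over \<open>x\<close> lies a family
  \<open>\<sigma>\<close> that assigns an element of \<open>B\<close> to every element \<open>e\<close>
  of \<open>E\<close> over a restriction of \<open>x\<close>, compatibly with further restriction. The
  predicate \<open>ok\<close> constrains the values. If it says that a map on \<open>B\<close> agrees
  with a map on \<open>E\<close>, this is the dependent product along \<open>p\<close> of a pulled back
  family; if \<open>X\<close> is terminal and \<open>ok\<close> is true, it is the exponential
  \<open>B\<^sup>E\<close>. Values off the domain are normalized, so that sections are equal when they
  agree on it.\<close>

definition Sect :: "'x psh => 'e psh => (nat => 'e => 'x) => 'b psh => (nat => 'e => 'b => bool) =>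
    ('x \<times> (cube_arrow => 'e => 'b)) psh" where
  "Sect X E p B ok = Psh
    (\<lambda>n. {(x, \<sigma>). x \<in> el X n \<and>
      (\<forall>m. \<forall>a \<in> cub m n. \<forall>e \<in> el E m. p m e = rs X a x \<longrightarrow> \<sigma> a e \<in> el B m \<and> ok m e (\<sigma> a e)) \<and>
      (\<forall>m k. \<forall>a \<in> cub m n. \<forall>b \<in> cub k m. \<forall>e \<in> el E m. p m e = rs X a x \<longrightarrow>
        \<sigma> (a \<odot> b) (rs E b e) = rs B b (\<sigma> a e)) \<and>
      (\<forall>a e. \<not> sectdom X E p n x a e \<longrightarrow> \<sigma> a e = undefined)})
    (\<lambda>b (x, \<sigma>). (rs X b x,
      \<lambda>a e. if sectdom X E p (Dom Cube b) (rs X b x) a e then \<sigma> (b \<odot> a) e else undefined))"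

text \<open>Evaluation of a section at an element of the same stage.\<close>

definition sev :: "nat => 'x \<times> (cube_arrow => 'e => 'b) => 'e => 'b" where
  "sev n w e = snd w (cid n) e"

context
  fixes X :: "'x psh" and E :: "'e psh" and p :: "nat => 'e => 'x" and B :: "'b psh"
    and ok :: "nat => 'e => 'b => bool"
  assumes X: "psh X" and E: "psh E" and p: "natm E X p" and B: "psh B"
begin

lemma sectdom_iff: "a \<in> cub m n ==> sectdom X E p n x a e \<longleftrightarrow> e \<in> el E m \<and> p m e = rs X a x"
  by (auto simp: sectdom_def hom_def)

lemma Sect_D:
  assumes "(x, \<sigma>) \<in> el (Sect X E p B ok) n"
  shows "x \<in> el X n"
    and "a \<in> cub m n ==> e \<in> el E m ==> p m e = rs X a x ==> \<sigma> a e \<in> el B m"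
    and "a \<in> cub m n ==> e \<in> el E m ==> p m e = rs X a x ==> ok m e (\<sigma> a e)"
    and "a \<in> cub m n ==> b \<in> cub k m ==> e \<in> el E m ==> p m e = rs X a x ==>
      \<sigma> (a \<odot> b) (rs E b e) = rs B b (\<sigma> a e)"
    and "\<not> sectdom X E p n x a e ==> \<sigma> a e = undefined"
  using assms unfolding Sect_def psh.sel mem_Collect_eq split_beta fst_conv snd_conv by blast+

lemma Sect_I:
  assumes "x \<in> el X n"
    and "\<And>m a e. a \<in> cub m n ==> e \<in> el E m ==> p m e = rs X a x ==> \<sigma> a e \<in> el B m"
    and "\<And>m a e. a \<in> cub m n ==> e \<in> el E m ==> p m e = rs X a x ==> ok m e (\<sigma> a e)"
    and "\<And>m k a b e. a \<in> cub m n ==> b \<in> cub k m ==> e \<in> el E m ==> p m e = rs X a x ==>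
      \<sigma> (a \<odot> b) (rs E b e) = rs B b (\<sigma> a e)"
    and "\<And>a e. \<not> sectdom X E p n x a e ==> \<sigma> a e = undefined"
  shows "(x, \<sigma>) \<in> el (Sect X E p B ok) n"
  using assms unfolding Sect_def psh.sel mem_Collect_eq split_beta fst_conv snd_conv by blast

lemma rs_Sect: "b \<in> cub m n ==> rs (Sect X E p B ok) b (x, \<sigma>) = (rs X b x,
    \<lambda>a e. if sectdom X E p m (rs X b x) a e then \<sigma> (b \<odot> a) e else undefined)"
  by (simp add: Sect_def cub_Dom)

lemma psh_Sect: "psh (Sect X E p B ok)"
proof (rule pshI)
  fix m n b w assume b: "b \<in> cub m n" and w: "w \<in> el (Sect X E p B ok) n"
  obtain x \<sigma> where xs: "w = (x, \<sigma>)" by (cases w)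
  note D = Sect_D[OF w[unfolded xs]]
  have r: "rs X a (rs X b x) = rs X (b \<odot> a) x" if "a \<in> cub k m" for a k
    using rs_comp[OF X that b D(1)] by simp
  show "rs (Sect X E p B ok) b w \<in> el (Sect X E p B ok) m"
    unfolding xs rs_Sect[OF b]
  proof (rule Sect_I)
    show "rs X b x \<in> el X m" by (rule rs_el[OF X b D(1)])
    fix k a e assume a: "a \<in> cub k m" and e: "e \<in> el E k" "p k e = rs X a (rs X b x)"
    have e': "p k e = rs X (b \<odot> a) x" using e r[OF a] by simp
    have dom: "sectdom X E p m (rs X b x) a e" using sectdom_iff[OF a] e by simp
    show "(if sectdom X E p m (rs X b x) a e then \<sigma> (b \<odot> a) e else undefined) \<in> el B k"
      "ok k e (if sectdom X E p m (rs X b x) a e then \<sigma> (b \<odot> a) e else undefined)"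
      using dom D(2,3)[OF comp_cub[OF a b] e(1) e'] by simp_all
    fix l c assume c: "c \<in> cub l k"
    have "p l (rs E c e) = rs X (a \<odot> c) (rs X b x)"
      using natm_rs[OF p c e(1)] e(2) rs_comp[OF X c a rs_el[OF X b D(1)]] by simp
    then have "sectdom X E p m (rs X b x) (a \<odot> c) (rs E c e)"
      using sectdom_iff[OF comp_cub[OF c a]] rs_el[OF E c e(1)] by simp
    then show "(if sectdom X E p m (rs X b x) (a \<odot> c) (rs E c e) then \<sigma> (b \<odot> (a \<odot> c)) (rs E c e)
        else undefined) = rs B c (if sectdom X E p m (rs X b x) a e then \<sigma> (b \<odot> a) e else undefined)"
      using dom D(4)[OF comp_cub[OF a b] c e(1) e'] cub_assoc[OF c a b] by simp
  qed simp
next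
  fix n w assume w: "w \<in> el (Sect X E p B ok) n"
  obtain x \<sigma> where xs: "w = (x, \<sigma>)" by (cases w)
  note D = Sect_D[OF w[unfolded xs]]
  have "(if sectdom X E p n x a e then \<sigma> (cid n \<odot> a) e else undefined) = \<sigma> a e" for a e
    using D(5)[of a e] by (auto simp: sectdom_def cub_idl)
  then show "rs (Sect X E p B ok) (cid n) w = w"
    by (simp add: xs rs_Sect[OF cid_cub] rs_id[OF X D(1)])
next
  fix l m n a b w assume a: "a \<in> cub l m" and b: "b \<in> cub m n" and w: "w \<in> el (Sect X E p B ok) n"
  obtain x \<sigma> where xs: "w = (x, \<sigma>)" by (cases w)
  note D = Sect_D[OF w[unfolded xs]]
  have rr: "rs X (b \<odot> a) x = rs X a (rs X b x)" by (rule rs_comp[OF X a b D(1)])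
  have "sectdom X E p m (rs X b x) (a \<odot> c) e" "(b \<odot> a) \<odot> c = b \<odot> (a \<odot> c)"
    if sd: "sectdom X E p l (rs X a (rs X b x)) c e" for c e
  proof -
    obtain k where c: "c \<in> cub k l" "e \<in> el E k" "p k e = rs X c (rs X a (rs X b x))"
      using sd unfolding sectdom_def by blast
    then show "sectdom X E p m (rs X b x) (a \<odot> c) e" "(b \<odot> a) \<odot> c = b \<odot> (a \<odot> c)"
      using rs_comp[OF X c(1) a rs_el[OF X b D(1)]] cub_assoc[OF c(1) a b]
      by (simp_all add: sectdom_iff[OF comp_cub[OF c(1) a]])
  qed
  then show "rs (Sect X E p B ok) (b \<odot> a) w = rs (Sect X E p B ok) a (rs (Sect X E p B ok) b w)"
    by (simp add: xs rs_Sect[OF a] rs_Sect[OF b] rs_Sect[OF comp_cub[OF a b]] rr fun_eq_iff)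
qed

lemma Sect_fst: "natm (Sect X E p B ok) X (\<lambda>n. fst)"
proof (rule natmI)
  fix m n a z assume "a \<in> cub m n" "z \<in> el (Sect X E p B ok) n"
  then show "fst (rs (Sect X E p B ok) a z) = rs X a (fst z)" by (cases z) (simp add: rs_Sect)
qed (use Sect_D(1) in force)

lemma sev_rs:
  assumes b: "b \<in> cub m n" and e: "e \<in> el E m" "p m e = rs X b x" and x: "x \<in> el X n"
  shows "sev m (rs (Sect X E p B ok) b (x, \<sigma>)) e = \<sigma> b e"
  using e by (simp add: sev_def rs_Sect[OF b] sectdom_iff[OF cid_cub] rs_id[OF X] rs_el[OF X b x] cub_idr[OF b])

lemma sev:
  assumes w: "w \<in> el (Sect X E p B ok) n" and e: "e \<in> el E n" "p n e = fst w"
  shows "sev n w e \<in> el B n" "ok n e (sev n w e)"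
    and "a \<in> cub m n ==> sev m (rs (Sect X E p B ok) a w) (rs E a e) = rs B a (sev n w e)"
proof -
  obtain x \<sigma> where xs: "w = (x, \<sigma>)" by (cases w)
  note D = Sect_D[OF w[unfolded xs]]
  have e': "p n e = rs X (cid n) x" using e rs_id[OF X D(1)] xs by simp
  show "sev n w e \<in> el B n" "ok n e (sev n w e)"
    using D(2,3)[OF cid_cub e(1) e'] by (simp_all add: sev_def xs)
  assume a: "a \<in> cub m n"
  have "p m (rs E a e) = rs X a x" using natm_rs[OF p a e(1)] e xs by simp
  then show "sev m (rs (Sect X E p B ok) a w) (rs E a e) = rs B a (sev n w e)"
    using sev_rs[OF a rs_el[OF E a e(1)] _ D(1)] D(4)[OF cid_cub a e(1) e'] cub_idl[OF a]
    by (simp add: xs sev_def)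
qed

lemma Sect_eqI:
  assumes w: "w \<in> el (Sect X E p B ok) n" and w': "w' \<in> el (Sect X E p B ok) n"
    and f: "fst w = fst w'"
    and s: "\<And>m a e. a \<in> cub m n ==> e \<in> el E m ==> p m e = rs X a (fst w) ==>
      sev m (rs (Sect X E p B ok) a w) e = sev m (rs (Sect X E p B ok) a w') e"
  shows "w = w'"
proof -
  obtain x \<sigma> \<tau> where xs: "w = (x, \<sigma>)" "w' = (x, \<tau>)" using f by (cases w, cases w') simp
  note D = Sect_D[OF w[unfolded xs]] and D' = Sect_D[OF w'[unfolded xs]]
  have "\<sigma> a e = \<tau> a e" for a e
  proof (cases "sectdom X E p n x a e")
    case True
    then obtain m where a: "a \<in> cub m n" "e \<in> el E m" "p m e = rs X a x" unfolding sectdom_def by blast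
    then show ?thesis using s[OF a(1,2)] sev_rs[OF a D(1)] by (simp add: xs)
  qed (use D(5) D'(5) in simp)
  then show ?thesis by (simp add: xs fun_eq_iff)
qed

text \<open>The transpose of a map defined on a pullback.\<close>

definition sect_of :: "'z psh => (nat => 'z => 'x) => (nat => 'z => 'e => 'b) => nat => 'z =>
    'x \<times> (cube_arrow => 'e => 'b)" where
  "sect_of Z \<xi> g n z = (\<xi> n z, \<lambda>a e. if sectdom X E p n (\<xi> n z) a e
    then g (Dom Cube a) (rs Z a z) e else undefined)"

lemma sect_of:
  assumes Z: "psh Z" and \<xi>: "natm Z X \<xi>"
    and g: "\<And>n z e. z \<in> el Z n ==> e \<in> el E n ==> p n e = \<xi> n z ==> g n z e \<in> el B n"
    and gok: "\<And>n z e. z \<in> el Z n ==> e \<in> el E n ==> p n e = \<xi> n z ==> ok n e (g n z e)"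
    and gn: "\<And>m n a z e. a \<in> cub m n ==> z \<in> el Z n ==> e \<in> el E n ==> p n e = \<xi> n z ==>
      g m (rs Z a z) (rs E a e) = rs B a (g n z e)"
  shows "natm Z (Sect X E p B ok) (sect_of Z \<xi> g)"
    and "z \<in> el Z n ==> e \<in> el E n ==> p n e = \<xi> n z ==> sev n (sect_of Z \<xi> g n z) e = g n z e"
    and "fst (sect_of Z \<xi> g n z) = \<xi> n z"
proof -
  show "fst (sect_of Z \<xi> g n z) = \<xi> n z" for n z by (simp add: sect_of_def)
  show ev: "sev n (sect_of Z \<xi> g n z) e = g n z e"
    if z: "z \<in> el Z n" and e: "e \<in> el E n" "p n e = \<xi> n z" for n z e
    using e natm_el[OF \<xi> z]
    by (simp add: sev_def sect_of_def sectdom_iff[OF cid_cub] rs_id[OF X] rs_id[OF Z z] cub_Dom[OF cid_cub])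
  show "natm Z (Sect X E p B ok) (sect_of Z \<xi> g)"
  proof (rule natmI)
    fix n z assume z: "z \<in> el Z n"
    show "sect_of Z \<xi> g n z \<in> el (Sect X E p B ok) n"
      unfolding sect_of_def
    proof (rule Sect_I)
      show "\<xi> n z \<in> el X n" by (rule natm_el[OF \<xi> z])
      fix m a e assume a: "a \<in> cub m n" and e: "e \<in> el E m" "p m e = rs X a (\<xi> n z)"
      have e': "p m e = \<xi> m (rs Z a z)" using e natm_rs[OF \<xi> a z] by simp
      have dom: "sectdom X E p n (\<xi> n z) a e" using e by (simp add: sectdom_iff[OF a])
      note az = rs_el[OF Z a z]
      show "(if sectdom X E p n (\<xi> n z) a e then g (Dom Cube a) (rs Z a z) e else undefined) \<in> el B m"
        "ok m e (if sectdom X E p n (\<xi> n z) a e then g (Dom Cube a) (rs Z a z) e else undefined)"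
        using dom g[OF az e(1) e'] gok[OF az e(1) e'] by (simp_all add: cub_Dom[OF a])
      fix k b assume b: "b \<in> cub k m"
      have "p k (rs E b e) = rs X (a \<odot> b) (\<xi> n z)"
        using natm_rs[OF p b e(1)] e(2) rs_comp[OF X b a natm_el[OF \<xi> z]] by simp
      then have "sectdom X E p n (\<xi> n z) (a \<odot> b) (rs E b e)"
        using rs_el[OF E b e(1)] by (simp add: sectdom_iff[OF comp_cub[OF b a]])
      then show "(if sectdom X E p n (\<xi> n z) (a \<odot> b) (rs E b e)
          then g (Dom Cube (a \<odot> b)) (rs Z (a \<odot> b) z) (rs E b e) else undefined) =
        rs B b (if sectdom X E p n (\<xi> n z) a e then g (Dom Cube a) (rs Z a z) e else undefined)"
        using dom gn[OF b az e(1) e'] rs_comp[OF Z b a z]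
        by (simp add: cub_Dom[OF a] cub_Dom[OF comp_cub[OF b a]])
    qed simp
  next
    fix m n b z assume b: "b \<in> cub m n" and z: "z \<in> el Z n"
    have "sect_of Z \<xi> g m (rs Z b z) = (rs X b (\<xi> n z), \<lambda>a e. if sectdom X E p m (rs X b (\<xi> n z)) a e
      then g (Dom Cube a) (rs Z a (rs Z b z)) e else undefined)"
      by (simp add: sect_of_def natm_rs[OF \<xi> b z])
    also have "\<dots> = rs (Sect X E p B ok) b (sect_of Z \<xi> g n z)"
    proof -
      have "sectdom X E p n (\<xi> n z) (b \<odot> a) e \<and> Dom Cube (b \<odot> a) = Dom Cube a \<and>
          rs Z (b \<odot> a) z = rs Z a (rs Z b z)"
        if sd: "sectdom X E p m (rs X b (\<xi> n z)) a e" for a e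
      proof -
        obtain k where a: "a \<in> cub k m" "e \<in> el E k" "p k e = rs X a (rs X b (\<xi> n z))"
          using sd unfolding sectdom_def by blast
        then show ?thesis
          using rs_comp[OF X a(1) b natm_el[OF \<xi> z]] rs_comp[OF Z a(1) b z]
          by (simp add: sectdom_iff[OF comp_cub[OF a(1) b]] cub_Dom[OF a(1)] cub_Dom[OF comp_cub[OF a(1) b]])
      qed
      then show ?thesis by (simp add: sect_of_def rs_Sect[OF b] fun_eq_iff)
    qed
    finally show "sect_of Z \<xi> g m (rs Z b z) = rs (Sect X E p B ok) b (sect_of Z \<xi> g n z)" .
  qed
qed

end

context universe
begin

lemma tinyp_Sect:
  assumes X: "tinyp X" and E: "tinyp E" and p: "natm E X p" and B: "tinyp B"
  shows "tinyp (Sect X E p B ok)"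
  unfolding tinyp_def
proof (intro conjI allI)
  note ps = tinyp_psh[OF X] tinyp_psh[OF E] p tinyp_psh[OF B]
  show "psh (Sect X E p B ok)" by (rule psh_Sect[OF ps])
  fix n
  let ?D = "Arr Cube \<times> (\<Union>m. el E m)" and ?C = "insert undefined (\<Union>m. el B m)"
  let ?F = "(\<lambda>w. case_prod (snd w)) ` el (Sect X E p B ok) n"
  have tn: "tiny (UNIV :: nat set)" by (rule tiny_countable) simp
  have "tiny ?F"
  proof (rule tiny_functions)
    show "tiny ?D" by (intro tiny_Times tiny_Cube tiny_UN tn tinyp_el[OF E])
    have "tiny ({undefined} \<union> (\<Union>m. el B m))"
      by (intro tiny_Un tiny_UN tn tinyp_el[OF B] tiny_countable) simp
    then show "tiny ?C" by simp
    fix f d assume "f \<in> ?F"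
    then obtain x \<sigma> where f: "f = case_prod \<sigma>" "(x, \<sigma>) \<in> el (Sect X E p B ok) n" by auto
    note D = Sect_D[OF ps f(2)]
    have "\<sigma> a e \<in> ?C" for a e
    proof (cases "sectdom X E p n x a e")
      case True
      then show ?thesis unfolding sectdom_def using D(2) by blast
    qed (simp add: D(5))
    then show "f d \<in> ?C" by (cases d) (simp add: f)
  next
    fix f g assume "f \<in> ?F" "g \<in> ?F" and eq: "\<And>d. d \<in> ?D ==> f d = g d"
    then obtain x \<sigma> y \<tau> where f: "f = case_prod \<sigma>" "(x, \<sigma>) \<in> el (Sect X E p B ok) n"
      and g: "g = case_prod \<tau>" "(y, \<tau>) \<in> el (Sect X E p B ok) n" by auto
    note D = Sect_D[OF ps f(2)] and D' = Sect_D[OF ps g(2)]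
    have "f d = g d" for d
    proof (cases "d \<in> ?D")
      case False
      obtain a e where d: "d = (a, e)" by (cases d)
      then have "\<not> sectdom X E p n x a e" "\<not> sectdom X E p n y a e"
        using False cub_Arr unfolding sectdom_def by blast+
      then show ?thesis using D(5) D'(5) by (simp add: d f g)
    qed (rule eq)
    then show "f = g" by (rule HOL.ext)
  qed
  from tiny_Times[OF tinyp_el[OF X, of n] this]
  show "tiny (el (Sect X E p B ok) n)"
  proof (rule tiny_inj[rotated -1])
    show "inj_on (\<lambda>w. (fst w, case_prod (snd w))) (el (Sect X E p B ok) n)"
      by (rule inj_onI) (auto simp: prod_eq_iff fun_eq_iff)
    show "(\<lambda>w. (fst w, case_prod (snd w))) ` el (Sect X E p B ok) n \<subseteq> el X n \<times> ?F"
      using natm_el[OF Sect_fst[OF ps]] by auto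
  qed
qed

lemma pairing_hom:
  assumes a: "a \<in> hom cS Z A" and b: "b \<in> hom cS Z B"
  shows "pairing cS a b \<in> hom cS Z (prod_obj cS A B)"
    and "x \<in> fobj Z n ==> ap (pairing cS a b) n x = pe A B n (ap a n x, ap b n x)"
proof -
  note O = hom_Obj(2)[OF a] hom_Obj(2)[OF b]
  have "\<exists>!h. h \<in> hom cS Z (prod_obj cS A B) \<and> pr1 cS A B \<bullet> h = a \<and> pr2 cS A B \<bullet> h = b"
    using prodc_product[OF O] a b unfolding is_product_def prod_obj_def by blast
  from theI'[OF this] have h: "pairing cS a b \<in> hom cS Z (prod_obj cS A B)"
    "pr1 cS A B \<bullet> pairing cS a b = a" "pr2 cS A B \<bullet> pairing cS a b = b"
    unfolding pairing_def cSet_simps hom_src[OF a] hom_tgt[OF a] hom_tgt[OF b] by auto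
  show "pairing cS a b \<in> hom cS Z (prod_obj cS A B)" by (rule h)
  assume x: "x \<in> fobj Z n"
  note E = prod_elements[OF O, where n = n] and xx = ap_el[OF a x] ap_el[OF b x]
  show "ap (pairing cS a b) n x = pe A B n (ap a n x, ap b n x)"
    by (intro E(4)[OF ap_el[OF h(1) x] E(1)[OF xx]])
      (simp_all only: E(2,3)[OF xx] ap_comp[OF h(1) x, symmetric] h(2,3))
qed

lemma prod_map_hom:
  assumes f: "f \<in> hom cS A A'" and g: "g \<in> hom cS B B'"
  shows "prod_map cS f g \<in> hom cS (prod_obj cS A B) (prod_obj cS A' B')"
    and "x \<in> fobj A n ==> y \<in> fobj B n ==> ap (prod_map cS f g) n (pe A B n (x, y)) = pe A' B' n (ap f n x, ap g n y)"
proof -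
  note O = hom_Obj(1)[OF f] hom_Obj(1)[OF g]
  note pr = pr_hom[OF O]
  note h = pairing_hom[OF comp_hom[OF pr(1) f] comp_hom[OF pr(2) g]]
  show "prod_map cS f g \<in> hom cS (prod_obj cS A B) (prod_obj cS A' B')"
    using h(1) by (simp add: prod_map_def hom_src[OF f] hom_src[OF g])
  assume x: "x \<in> fobj A n" and y: "y \<in> fobj B n"
  note E = prod_elements[OF O, where n = n]
  show "ap (prod_map cS f g) n (pe A B n (x, y)) = pe A' B' n (ap f n x, ap g n y)"
    using h(2)[OF E(1)[OF x y]] E(1-3)[OF x y]
    by (simp add: prod_map_def hom_src[OF f] hom_src[OF g] ap_comp[OF pr(1)] ap_comp[OF pr(2)])
qed

lemma prod_el_cases:
  assumes "A \<in> Obj cS" "B \<in> Obj cS" "w \<in> fobj (prod_obj cS A B) n"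
  obtains x y where "x \<in> fobj A n" "y \<in> fobj B n" "w = pe A B n (x, y)"
proof -
  note pr = pr_hom[OF assms(1,2)] and E = prod_elements[OF assms(1,2), where n = n]
  have x: "ap (pr1 cS A B) n w \<in> fobj A n" and y: "ap (pr2 cS A B) n w \<in> fobj B n"
    using ap_el[OF pr(1) assms(3)] ap_el[OF pr(2) assms(3)] .
  have "w = pe A B n (ap (pr1 cS A B) n w, ap (pr2 cS A B) n w)"
    by (rule E(4)[OF assms(3) E(1)[OF x y]]) (simp_all add: E(2,3)[OF x y])
  then show ?thesis using that x y by blast
qed

lemma prod_hom_ext:
  assumes "A \<in> Obj cS" "B \<in> Obj cS" "f \<in> hom cS (prod_obj cS A B) X" "g \<in> hom cS (prod_obj cS A B) X"
    and "\<And>n x y. x \<in> fobj A n ==> y \<in> fobj B n ==> ap f n (pe A B n (x, y)) = ap g n (pe A B n (x, y))"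
  shows "f = g"
  by (rule hom_ext[OF assms(3,4)]) (metis prod_el_cases[OF assms(1,2)] assms(5))

definition punit :: "unit psh" where
  "punit = Psh (\<lambda>n. UNIV) (\<lambda>a z. z)"

lemma tinyp_punit: "tinyp punit"
  by (auto simp: tinyp_def punit_def psh_def tiny_countable)

text \<open>\<open>B\<^sup>A\<close> is the presheaf of sections for
  \<open>A \<rightarrow> 1\<close>.\<close>

lemma ex_exponential:
  assumes A: "A \<in> Obj cS" and B: "B \<in> Obj cS"
  shows "\<exists>E e. is_exponential cS A B E e"
proof -
  let ?p = "\<lambda>n z. ()" and ?ok = "\<lambda>n e b. True"
  let ?S = "Sect punit (cs A) ?p (cs B) ?ok"
  have p: "natm (cs A) punit ?p" by (simp add: natm_def punit_def)
  note ps = tinyp_psh[OF tinyp_punit] psh_cs[OF A] p psh_cs[OF B]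
  note ev = sev[OF ps]
  have "tinyp ?S" by (intro tinyp_Sect tinyp_punit tinyp_cs A B p)
  then obtain E c d where E: "E \<in> Obj cS" and iso: "natiso ?S (cs E) c d" using cset_coding by blast
  from iso have c: "natm ?S (cs E) c" and d: "natm (cs E) ?S d"
    and dc: "\<And>n z. z \<in> el ?S n ==> d n (c n z) = z" and cd: "\<And>n z. z \<in> fobj E n ==> c n (d n z) = z"
    unfolding natiso_def by simp_all
  note pr = pr_hom[OF E A] and pe = prod_elements[OF E A]
  define g where "g n w = sev n (d n (ap (pr1 cS E A) n w)) (ap (pr2 cS E A) n w)" for n w
  have dS: "d n y \<in> el ?S n" if "y \<in> fobj E n" for n y using natm_el[OF d] that by simp
  have g: "natm (cs (prod_obj cS E A)) (cs B) g"
  proof (rule natmI)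
    fix n w assume "w \<in> el (cs (prod_obj cS E A)) n"
    then have w: "w \<in> fobj (prod_obj cS E A) n" by simp
    note w1 = ap_el[OF pr(1) w] and w2 = ap_el[OF pr(2) w]
    show "g n w \<in> el (cs B) n" unfolding g_def by (rule ev(1)[OF dS[OF w1]]) (simp_all add: w2)
    fix m a assume a: "a \<in> cub m n"
    show "g m (rs (cs (prod_obj cS E A)) a w) = rs (cs B) a (g n w)"
      using ev(3)[OF dS[OF w1] _ _ a, of "ap (pr2 cS E A) n w"] w1 w2
      by (simp add: g_def ap_rs[OF pr(1) a w] ap_rs[OF pr(2) a w] natm_rs[OF d a])
  qed
  define e where "e = mp (prod_obj cS E A) B g"
  have e: "e \<in> hom cS (prod_obj cS E A) B" unfolding e_def by (rule mp_hom[OF pr(3) B g])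
  have e_pe: "ap e n (pe E A n (y, x)) = sev n (d n y) x" if "y \<in> fobj E n" "x \<in> fobj A n" for n y x
    using that by (simp add: e_def pe g_def)
  have "is_exponential cS A B E e"
    unfolding is_exponential_def
  proof (intro conjI ballI E e)
    fix Z k assume Z: "Z \<in> Obj cS" and k: "k \<in> hom cS (prod_obj cS Z A) B"
    note peZ = prod_elements[OF Z A] and prZ = pr_hom[OF Z A]
    let ?\<xi> = "\<lambda>n z. ()" and ?k = "\<lambda>n z x. ap k n (pe Z A n (z, x))"
    have pn: "pe Z A m (rs (cs Z) a z, rs (cs A) a x) = rs (cs (prod_obj cS Z A)) a (pe Z A n (z, x))"
      if "a \<in> cub m n" "z \<in> fobj Z n" "x \<in> fobj A n" for m n a z x
      using prod_iso[OF Z A] that unfolding natiso_def natm_def by auto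
    have xi: "natm (cs Z) punit ?\<xi>" by (simp add: natm_def punit_def)
    have kn: "?k m (rs (cs Z) a z) (rs (cs A) a x) = rs (cs B) a (?k n z x)"
      if "a \<in> cub m n" "z \<in> fobj Z n" "x \<in> fobj A n" for m n a z x
      using pn[OF that] ap_rs[OF k that(1) peZ(1)[OF that(2,3)]] by simp
    have so: "natm (cs Z) ?S (sect_of punit (cs A) ?p (cs Z) ?\<xi> ?k)"
      "z \<in> fobj Z n ==> x \<in> fobj A n ==> sev n (sect_of punit (cs A) ?p (cs Z) ?\<xi> ?k n z) x = ?k n z x" for n z x
      by (rule sect_of[OF ps psh_cs[OF Z] xi]; simp add: ap_el[OF k peZ(1)] kn)+
    let ?h = "mp Z E (\<lambda>n z. c n (sect_of punit (cs A) ?p (cs Z) ?\<xi> ?k n z))"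
    have h: "?h \<in> hom cS Z E" using natm_comp[OF so(1) c] by (intro mp_hom Z E)
    have dh: "sev n (d n (ap ?h n z)) x = ?k n z x" if "z \<in> fobj Z n" "x \<in> fobj A n" for n z x
      using that so(2)[of z n x] natm_el[OF so(1), of z n] by (simp add: dc)
    have comp: "ap (e \<bullet> prod_map cS h' (Idn cS A)) n (pe Z A n (z, x)) = sev n (d n (ap h' n z)) x"
      if h': "h' \<in> hom cS Z E" and "z \<in> fobj Z n" "x \<in> fobj A n" for h' n z x
      using that prod_map_hom[OF h' id_hom'[OF A]]
      by (simp add: ap_comp[OF prod_map_hom(1)[OF h' id_hom'[OF A]] peZ(1)] A e_pe ap_el[OF h'])
    show "\<exists>!h. h \<in> hom cS Z E \<and> e \<bullet> prod_map cS h (Idn cS A) = k"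
    proof (rule ex1I[of _ ?h])
      have "e \<bullet> prod_map cS ?h (Idn cS A) = k"
        by (rule prod_hom_ext[OF Z A comp_hom[OF prod_map_hom(1)[OF h id_hom'[OF A]] e] k])
          (simp add: comp[OF h] dh del: ap_mp)
      then show "?h \<in> hom cS Z E \<and> e \<bullet> prod_map cS ?h (Idn cS A) = k" using h by blast
      fix h' assume h': "h' \<in> hom cS Z E \<and> e \<bullet> prod_map cS h' (Idn cS A) = k"
      show "h' = ?h"
      proof (rule hom_ext[OF _ h])
        fix n z assume z: "z \<in> fobj Z n"
        have same: "sev m (d m (ap h' m y)) x = sev m (d m (ap ?h m y)) x"
          if "y \<in> fobj Z m" "x \<in> fobj A m" for m y x
          using comp[of h' y m x] h' that dh[OF that] by simp
        have z1: "ap h' n z \<in> fobj E n" and z2: "ap ?h n z \<in> fobj E n"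
          using ap_el[of h' Z E] ap_el[OF h] h' z by blast+
        have "d n (ap h' n z) = d n (ap ?h n z)"
        proof (rule Sect_eqI[OF ps dS[OF z1] dS[OF z2]])
          fix m a x assume a: "a \<in> cub m n" and x: "x \<in> el (cs A) m"
          have az: "rs (cs Z) a z \<in> fobj Z m" using rs_el[OF psh_cs[OF Z] a] z by simp
          show "sev m (rs ?S a (d n (ap h' n z))) x = sev m (rs ?S a (d n (ap ?h n z))) x"
            using natm_rs[OF d a] z1 z2 same[OF az] x ap_rs[of h' Z E a m n z] ap_rs[OF h a z] h' a z
            by (simp del: ap_mp)
        qed simp
        from arg_cong[OF this, of "c n"] show "ap h' n z = ap ?h n z"
          unfolding cd[OF z1] cd[OF z2] .
      qed (use h' in blast)
    qed
  qed
  then show ?thesis by blast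
qed

end


context universe
begin

lemma pullback_factor:
  assumes pb: "is_pullback cS f g p q" and f: "f \<in> hom cS X Y" and g: "g \<in> hom cS Z Y"
    and p: "p \<in> hom cS W X" and P: "psh P"
    and a: "natm P (cs X) a" and b: "natm P (cs Z) b"
    and ab: "\<And>n z. z \<in> el P n ==> ap f n (a n z) = ap g n (b n z)"
  shows "\<exists>h. natm P (cs W) h \<and> (\<forall>n. \<forall>z \<in> el P n. ap p n (h n z) = a n z \<and> ap q n (h n z) = b n z)"
proof -
  note D = is_pullbackD[OF pb f g hom_src[OF p]]
  define h where "h n z = (SOME w. w \<in> fobj W n \<and> ap p n w = a n z \<and> ap q n w = b n z)" for n z
  have h: "h n z \<in> fobj W n" "ap p n (h n z) = a n z" "ap q n (h n z) = b n z" if z: "z \<in> el P n" for n z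
  proof -
    have "\<exists>w. w \<in> fobj W n \<and> ap p n w = a n z \<and> ap q n w = b n z"
      using D(4)[of "a n z" n "b n z"] natm_el[OF a z] natm_el[OF b z] ab[OF z] by auto
    from someI_ex[OF this] show "h n z \<in> fobj W n" "ap p n (h n z) = a n z" "ap q n (h n z) = b n z"
      unfolding h_def by auto
  qed
  have "natm P (cs W) h"
  proof (rule natmI)
    fix m n c z assume c: "c \<in> cub m n" and z: "z \<in> el P n"
    note cz = rs_el[OF P c z]
    have "rs (cs W) c (h n z) \<in> fobj W m"
      using rs_el[OF psh_cs[OF hom_Obj(1)[OF p]] c] h(1)[OF z] by simp
    from D(5)[OF h(1)[OF cz] this] show "h m (rs P c z) = rs (cs W) c (h n z)"
      by (simp add: h[OF cz] h[OF z] ap_rs[OF p c] ap_rs[OF D(2) c] natm_rs[OF a c z] natm_rs[OF b c z])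
  qed (simp add: h)
  then show ?thesis using h by blast
qed

lemma pe_rs: "A \<in> Obj cS ==> B \<in> Obj cS ==> a \<in> cub m n ==> x \<in> fobj A n ==> y \<in> fobj B n ==>
    rs (cs (prod_obj cS A B)) a (pe A B n (x, y)) = pe A B m (rs (cs A) a x, rs (cs B) a y)"
  using prod_iso[of A B] unfolding natiso_def natm_def by auto

lemma pe_eq_iff: "A \<in> Obj cS ==> B \<in> Obj cS ==> x \<in> fobj A n ==> y \<in> fobj B n ==>
    x' \<in> fobj A n ==> y' \<in> fobj B n ==> pe A B n (x, y) = pe A B n (x', y') \<longleftrightarrow> x = x' \<and> y = y'"
  using prod_elements(2,3)[of A B] by metis

subsection \<open>Evaluation at elements\<close>

lemma exp_exponential:
  assumes "A \<in> Obj cS" "B \<in> Obj cS"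
  shows "is_exponential cS A B (exp_obj cS A B) (evalc cS A B)"
proof -
  have "\<exists>x. case x of (E, e) => is_exponential cS A B E e" using ex_exponential[OF assms] by blast
  then have "case expc cS A B of (E, e) => is_exponential cS A B E e"
    unfolding expc_def by (rule someI_ex)
  then show ?thesis by (simp add: exp_obj_def evalc_def split_beta)
qed

lemma exp_Obj: "A \<in> Obj cS ==> B \<in> Obj cS ==> exp_obj cS A B \<in> Obj cS"
  and evalc_hom: "A \<in> Obj cS ==> B \<in> Obj cS ==> evalc cS A B \<in> hom cS (prod_obj cS (exp_obj cS A B) A) B"
  using exp_exponential by (auto simp: is_exponential_def)

text \<open>The evaluation \<open>B\<^sup>A \<times> A \<rightarrow> B\<close> on elements.\<close>

definition evl :: "'u cset => 'u cset => nat => 'u => 'u => 'u" where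
  "evl A B n y x = ap (evalc cS A B) n (pe (exp_obj cS A B) A n (y, x))"

context
  fixes A B :: "'u cset"
  assumes A: "A \<in> Obj cSet" and B: "B \<in> Obj cSet"
begin

lemma evl_el: "y \<in> fobj (exp_obj cS A B) n ==> x \<in> fobj A n ==> evl A B n y x \<in> fobj B n"
  unfolding evl_def using ap_el[OF evalc_hom[OF A B]] prod_elements(1)[OF exp_Obj[OF A B] A] by blast

lemma evl_rs: "a \<in> cub m n ==> y \<in> fobj (exp_obj cS A B) n ==> x \<in> fobj A n ==>
    evl A B m (rs (cs (exp_obj cS A B)) a y) (rs (cs A) a x) = rs (cs B) a (evl A B n y x)"
  unfolding evl_def
  by (simp add: pe_rs[OF exp_Obj[OF A B] A, symmetric] prod_elements(1)[OF exp_Obj[OF A B] A]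
      ap_rs[OF evalc_hom[OF A B], symmetric])

lemma evl_comp:
  assumes "h \<in> hom cS Z (exp_obj cS A B)" "z \<in> fobj Z n" "x \<in> fobj A n"
  shows "ap (evalc cS A B \<bullet> prod_map cS h (Idn cS A)) n (pe Z A n (z, x)) = evl A B n (ap h n z) x"
  using prod_map_hom[OF assms(1) id_hom'[OF A]] prod_elements(1)[OF hom_Obj(1)[OF assms(1)] A] assms A
  by (simp add: ap_comp evl_def)

lemma curryc:
  assumes k: "k \<in> hom cS (prod_obj cS Z A) B" and Z: "Z \<in> Obj cS"
  shows "curryc cS Z A k \<in> hom cS Z (exp_obj cS A B)"
    and "z \<in> fobj Z n ==> x \<in> fobj A n ==> evl A B n (ap (curryc cS Z A k) n z) x = ap k n (pe Z A n (z, x))"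
proof -
  have "\<exists>!h. h \<in> hom cS Z (exp_obj cS A B) \<and> evalc cS A B \<bullet> prod_map cS h (Idn cS A) = k"
    using exp_exponential[OF A B] Z k unfolding is_exponential_def by blast
  from theI'[OF this] have c: "curryc cS Z A k \<in> hom cS Z (exp_obj cS A B)"
    "evalc cS A B \<bullet> prod_map cS (curryc cS Z A k) (Idn cS A) = k"
    unfolding curryc_def cSet_simps hom_tgt[OF k] by auto
  then show "curryc cS Z A k \<in> hom cS Z (exp_obj cS A B)" by simp
  show "z \<in> fobj Z n ==> x \<in> fobj A n ==> evl A B n (ap (curryc cS Z A k) n z) x = ap k n (pe Z A n (z, x))"
    using evl_comp[OF c(1)] c(2) by simp
qed

lemma exp_hom_eqI:
  assumes h: "h \<in> hom cS Z (exp_obj cS A B)" and h': "h' \<in> hom cS Z (exp_obj cS A B)"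
    and e: "\<And>n z x. z \<in> fobj Z n ==> x \<in> fobj A n ==> evl A B n (ap h n z) x = evl A B n (ap h' n z) x"
  shows "h = h'"
proof -
  note Z = hom_Obj(1)[OF h]
  let ?c = "\<lambda>h. evalc cS A B \<bullet> prod_map cS h (Idn cS A)"
  have k: "?c g \<in> hom cS (prod_obj cS Z A) B" if "g \<in> hom cS Z (exp_obj cS A B)" for g
    by (rule comp_hom[OF prod_map_hom(1)[OF that id_hom'[OF A]] evalc_hom[OF A B]])
  have "?c h = ?c h'"
    by (rule prod_hom_ext[OF Z A k[OF h] k[OF h']]) (simp add: evl_comp[OF h] evl_comp[OF h'] e)
  moreover have "\<exists>!g. g \<in> hom cS Z (exp_obj cS A B) \<and> ?c g = ?c h"
    using exp_exponential[OF A B] Z k[OF h] unfolding is_exponential_def by blast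
  ultimately show ?thesis using h h' by metis
qed

lemma evl_eqI:
  assumes y: "y \<in> fobj (exp_obj cS A B) n" and y': "y' \<in> fobj (exp_obj cS A B) n"
    and e: "\<And>m a x. a \<in> cub m n ==> x \<in> fobj A m ==>
      evl A B m (rs (cs (exp_obj cS A B)) a y) x = evl A B m (rs (cs (exp_obj cS A B)) a y') x"
  shows "y = y'"
proof -
  note E = exp_Obj[OF A B]
  have "yon (exp_obj cS A B) n y = yon (exp_obj cS A B) n y'"
    by (rule exp_hom_eqI[OF yon_hom[OF E y] yon_hom[OF E y']]) (auto simp: fobj_cube ap_yon e)
  then show ?thesis using ap_yon_id[OF E] y y' by metis
qed

text \<open>Transposition for a presheaf \<open>P\<close> over any type, by way of a cubical set that
  codes \<open>P\<close>.\<close>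

lemma exp_transpose:
  assumes P: "tinyp P" and g: "natm (P \<otimes> cs A) (cs B) g"
  shows "\<exists>h. natm P (cs (exp_obj cS A B)) h \<and>
    (\<forall>n. \<forall>z \<in> el P n. \<forall>x \<in> fobj A n. evl A B n (h n z) x = g n (z, x))"
proof -
  obtain Z e d where Z: "Z \<in> Obj cS" and iso: "natiso P (cs Z) e d" using cset_coding[OF P] by blast
  from iso have e: "natm P (cs Z) e" and d: "natm (cs Z) P d" and de: "\<And>n z. z \<in> el P n ==> d n (e n z) = z"
    unfolding natiso_def by simp_all
  note pr = pr_hom[OF Z A] and pe = prod_elements[OF Z A]
  let ?k = "\<lambda>n w. g n (d n (ap (pr1 cS Z A) n w), ap (pr2 cS Z A) n w)"
  have k: "natm (cs (prod_obj cS Z A)) (cs B) ?k"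
  proof (rule natm_comp[OF _ g], rule natmI)
    fix n w assume "w \<in> el (cs (prod_obj cS Z A)) n"
    then have w: "w \<in> fobj (prod_obj cS Z A) n" by simp
    note w1 = ap_el[OF pr(1) w] and w2 = ap_el[OF pr(2) w]
    show "(d n (ap (pr1 cS Z A) n w), ap (pr2 cS Z A) n w) \<in> el (P \<otimes> cs A) n"
      using natm_el[OF d, of _ n] w1 w2 by simp
    fix m a assume a: "a \<in> cub m n"
    show "(d m (ap (pr1 cS Z A) m (rs (cs (prod_obj cS Z A)) a w)), ap (pr2 cS Z A) m (rs (cs (prod_obj cS Z A)) a w)) =
      rs (P \<otimes> cs A) a (d n (ap (pr1 cS Z A) n w), ap (pr2 cS Z A) n w)"
      using natm_rs[OF d a] w1 by (simp add: ap_rs[OF pr(1) a w] ap_rs[OF pr(2) a w])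
  qed
  note kh = mp_hom[OF pr(3) B k]
  note c = curryc[OF kh Z]
  show ?thesis
  proof (intro exI conjI allI ballI)
    show "natm P (cs (exp_obj cS A B)) (\<lambda>n z. ap (curryc cS Z A (mp (prod_obj cS Z A) B ?k)) n (e n z))"
      by (rule natm_comp[OF e ap_natm[OF c(1)]])
    fix n z x assume z: "z \<in> el P n" and x: "x \<in> fobj A n"
    have ez: "e n z \<in> fobj Z n" using natm_el[OF e z] by simp
    show "evl A B n (ap (curryc cS Z A (mp (prod_obj cS Z A) B ?k)) n (e n z)) x = g n (z, x)"
      by (simp add: c(2)[OF ez x] pe(1-3)[OF ez x] de[OF z])
  qed
qed

end

text \<open>The value of a path at a point of the interval.\<close>

definition evI :: "'u cset => nat => 'u => cube_arrow => 'u" where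
  "evI X n y t = evl II X n y (enc t)"

abbreviation pathob :: "'u cset => 'u cset" where
  "pathob X \<equiv> exp_obj cSet II X"

lemma path_Obj: "X \<in> Obj cS ==> pathob X \<in> Obj cS"
  by (rule exp_Obj[OF cube_Obj])

lemma evI_el: "X \<in> Obj cS ==> y \<in> fobj (pathob X) n ==> t \<in> cub n 1 ==> evI X n y t \<in> fobj X n"
  unfolding evI_def by (intro evl_el cube_Obj enc_el)

lemma evI_rs:
  assumes X: "X \<in> Obj cS" and a: "a \<in> cub m n" and y: "y \<in> fobj (pathob X) n" and t: "t \<in> cub n 1"
  shows "evI X m (rs (cs (pathob X)) a y) (t \<odot> a) = rs (cs X) a (evI X n y t)"
  using evl_rs[OF cube_Obj X a y enc_el[OF t]] by (simp add: evI_def rs_cube[OF a t])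

lemma evI_eqI:
  assumes "X \<in> Obj cS" "y \<in> fobj (pathob X) n" "y' \<in> fobj (pathob X) n"
    and "\<And>m a t. a \<in> cub m n ==> t \<in> cub m 1 ==>
      evI X m (rs (cs (pathob X)) a y) t = evI X m (rs (cs (pathob X)) a y') t"
  shows "y = y'"
  using assms unfolding evI_def by (intro evl_eqI[OF cube_Obj assms(1-3)]) (auto simp: fobj_cube)

lemma path_transpose:
  assumes X: "X \<in> Obj cS" and P: "tinyp P" and g: "natm (P \<otimes> Ip) (cs X) g"
  shows "\<exists>h. natm P (cs (pathob X)) h \<and>
    (\<forall>n. \<forall>z \<in> el P n. \<forall>t \<in> cub n 1. evI X n (h n z) t = g n (z, t))"
proof -
  have "natm (P \<otimes> cs II) (P \<otimes> Ip) (\<lambda>n (z, x). (z, dec (x :: 'u)))"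
    using cube_iso[of 1] unfolding natiso_def natm_def by (auto simp: fobj_cube)
  from natm_comp[OF this g] have "natm (P \<otimes> cs II) (cs X) (\<lambda>n w. g n (case w of (z, x) => (z, dec (x :: 'u))))" .
  from exp_transpose[OF cube_Obj X P this] obtain h where h: "natm P (cs (pathob X)) h"
    "\<forall>n. \<forall>z \<in> el P n. \<forall>x \<in> fobj II n. evl II X n (h n z) x = g n (z, dec x)" by auto
  then have "\<forall>n. \<forall>z \<in> el P n. \<forall>t \<in> cub n 1. evI X n (h n z) t = g n (z, t)"
    by (auto simp: evI_def enc_el)
  then show ?thesis using h(1) by blast
qed

end


section \<open>Fibrations as box filling\<close>

text \<open>The open box \<open>A \<times> I \<union> graph i\<close>. Its bottom is the graph of an
  arbitrary \<open>i : P \<rightarrow> I\<close> instead of an endpoint, which is what makes the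
  fibrations unbiased.\<close>

definition box :: "'z psh => (nat => 'z => cube_arrow) => (nat => 'z set) => nat => ('z \<times> cube_arrow) set" where
  "box P i A n = {(z, t). z \<in> el P n \<and> t \<in> cub n 1 \<and> (z \<in> A n \<or> t = i n z)}"

lemma subf_box:
  assumes P: "psh P" and A: "subf P A" and i: "natm P Ip i"
  shows "subf (P \<otimes> Ip) (box P i A)"
  unfolding subf_def
proof (intro conjI allI ballI)
  show "box P i A n \<subseteq> el (P \<otimes> Ip) n" for n by (auto simp: box_def)
  fix m n a w assume a: "a \<in> cub m n" and "w \<in> box P i A n"
  then show "rs (P \<otimes> Ip) a w \<in> box P i A m"
    using rs_el[OF P a] subf_rs[OF A a] natm_rs[OF i a] comp_cub[OF a] by (auto simp: box_def)
qed

lemma natm_prodI: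
  assumes "\<And>n z t. z \<in> el P n ==> t \<in> cub n k ==> f n z t \<in> el Q n"
    and "\<And>m n a z t. a \<in> cub m n ==> z \<in> el P n ==> t \<in> cub n k ==> f m (rs P a z) (t \<odot> a) = rs Q a (f n z t)"
  shows "natm (P \<otimes> yo k) Q (\<lambda>n w. f n (fst w) (snd w))"
  using assms by (auto simp: natm_def)

context cubical_cofibrations
begin

text \<open>The graph of \<open>i\<close> is a pullback of the diagonal of the interval.\<close>

lemma cof_box:
  assumes P: "psh P" and A: "cof P A" and i: "natm P Ip i"
  shows "cof (P \<otimes> Ip) (box P i A)"
proof -
  have PI: "psh (P \<otimes> Ip)" by (intro psh_prodp P psh_yo)
  have f: "natm (P \<otimes> Ip) P (\<lambda>n w. fst w)" and s: "natm (P \<otimes> Ip) Ip (\<lambda>n w. snd w)"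
    by (auto simp: natm_def)
  have "box P i A = (\<lambda>n. {w \<in> el (P \<otimes> Ip) n. fst w \<in> A n} \<union> {w \<in> el (P \<otimes> Ip) n. snd w = i n (fst w)})"
    by (auto simp: box_def fun_eq_iff)
  then show ?thesis
    using cof_Un[OF cof_preimage[OF A f PI] cof_eq[OF s natm_comp[OF f i] PI]] by simp
qed

end

context universe
begin

text \<open>The chosen pullback, products and exponentials in \<open>gap f\<close> are described once by
  their elements: an element of the target is a path \<open>x\<close> in \<open>X\<close> with a point
  \<open>t\<close> of the interval and an element \<open>y\<close> of \<open>Y\<close> over the value of
  \<open>x\<close> at \<open>t\<close>.\<close>

lemma gap_facts:
  assumes f: "f \<in> hom cS Y X"
  obtains PB p q where
    "gap f \<in> hom cS (prod_obj cS (pathob Y) II) PB"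
    "p \<in> hom cS PB (prod_obj cS (pathob X) II)" "q \<in> hom cS PB (prod_obj cS Y II)"
    "\<And>n y t. y \<in> fobj (pathob Y) n ==> t \<in> cub n 1 ==>
      ap p n (ap (gap f) n (pe (pathob Y) II n (y, enc t))) = pe (pathob X) II n (ap (exp_post cS II f) n y, enc t) \<and>
      ap q n (ap (gap f) n (pe (pathob Y) II n (y, enc t))) = pe Y II n (evI Y n y t, enc t)"
    "\<And>n w. w \<in> fobj PB n ==> \<exists>x t y. x \<in> fobj (pathob X) n \<and> t \<in> cub n 1 \<and> y \<in> fobj Y n \<and>
      ap p n w = pe (pathob X) II n (x, enc t) \<and> ap q n w = pe Y II n (y, enc t) \<and> evI X n x t = ap f n y"
    "\<And>n w w'. w \<in> fobj PB n ==> w' \<in> fobj PB n ==> ap p n w = ap p n w' ==> ap q n w = ap q n w' ==> w = w'"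
    "\<And>(P :: 'z psh) x i y. psh P ==> natm P (cs (pathob X)) x ==> natm P Ip i ==> natm P (cs Y) y ==>
      (\<And>n z. z \<in> el P n ==> evI X n (x n z) (i n z) = ap f n (y n z)) ==>
      \<exists>h. natm P (cs PB) h \<and> (\<forall>n. \<forall>z \<in> el P n. ap p n (h n z) = pe (pathob X) II n (x n z, enc (i n z)) \<and>
        ap q n (h n z) = pe Y II n (y n z, enc (i n z)))"
    "exp_post cS II f \<in> hom cS (pathob Y) (pathob X)"
    "\<And>n y t. y \<in> fobj (pathob Y) n ==> t \<in> cub n 1 ==> evI X n (ap (exp_post cS II f) n y) t = ap f n (evI Y n y t)"
proof -
  note X = hom_Obj(2)[OF f] and Y = hom_Obj(1)[OF f] and I = cube_Obj[of 1]
  note XI = path_Obj[OF X] and YI = path_Obj[OF Y]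
  have ep: "eval_pr Z \<in> hom cS (prod_obj cS (pathob Z) II) (prod_obj cS Z II)"
    "\<And>n z t. z \<in> fobj (pathob Z) n ==> t \<in> cub n 1 ==>
      ap (eval_pr Z) n (pe (pathob Z) II n (z, enc t)) = pe Z II n (evI Z n z t, enc t)"
    if Z: "Z \<in> Obj cS" for Z
  proof -
    note h = pairing_hom[OF evalc_hom[OF I Z] pr_hom(2)[OF path_Obj[OF Z] I]]
    show "eval_pr Z \<in> hom cS (prod_obj cS (pathob Z) II) (prod_obj cS Z II)"
      using h(1) by (simp add: eval_pr_def)
    show "ap (eval_pr Z) n (pe (pathob Z) II n (z, enc t)) = pe Z II n (evI Z n z t, enc t)"
      if "z \<in> fobj (pathob Z) n" "t \<in> cub n 1" for n z t
      using h(2)[OF prod_elements(1)[OF path_Obj[OF Z] I that(1) enc_el[OF that(2)]]]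
        prod_elements(3)[OF path_Obj[OF Z] I that(1) enc_el[OF that(2)]]
      by (simp add: eval_pr_def evI_def evl_def)
  qed
  note fI = prod_map_hom[OF f id_hom'[OF I]]
  let ?f = "eval_pr X" and ?g = "prod_map cS f (Idn cS II)"
  have "\<exists>x. case x of (p, q) => is_pullback cS ?f ?g p q" using ex_pullback[OF ep(1)[OF X] fI(1)] by blast
  then have "case pb cS ?f ?g of (p, q) => is_pullback cS ?f ?g p q" unfolding pb_def by (rule someI_ex)
  then have pb: "is_pullback cS ?f ?g (fst (pb cS ?f ?g)) (snd (pb cS ?f ?g))" by (simp add: split_beta)
  let ?p = "fst (pb cS ?f ?g)" and ?q = "snd (pb cS ?f ?g)" and ?PB = "pb_obj cS ?f ?g"
  have sp: "src ?p = ?PB" by (simp add: pb_obj_def)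
  note D = is_pullbackD[OF pb ep(1)[OF X] fI(1) sp]
  have post: "exp_post cS II f \<in> hom cS (pathob Y) (pathob X)"
    "\<And>n y t. y \<in> fobj (pathob Y) n ==> t \<in> cub n 1 ==> evI X n (ap (exp_post cS II f) n y) t = ap f n (evI Y n y t)"
  proof -
    note c = curryc[OF I X comp_hom[OF evalc_hom[OF I Y] f] YI]
    show "exp_post cS II f \<in> hom cS (pathob Y) (pathob X)" using c(1) by (simp add: exp_post_def hom_src[OF f])
    show "evI X n (ap (exp_post cS II f) n y) t = ap f n (evI Y n y t)"
      if "y \<in> fobj (pathob Y) n" "t \<in> cub n 1" for n y t
      using c(2)[OF that(1) enc_el[OF that(2)]] prod_elements(1)[OF YI I that(1) enc_el[OF that(2)]]
      by (simp add: exp_post_def hom_src[OF f] evI_def evl_def ap_comp[OF evalc_hom[OF I Y]])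
  qed
  note pI = prod_map_hom[OF post(1) id_hom'[OF I]]
  let ?a = "prod_map cS (exp_post cS II f) (Idn cS II)"
  note ca = comp_hom[OF pI(1) ep(1)[OF X]] and cb = comp_hom[OF ep(1)[OF Y] fI(1)]
  have sq: "?f \<bullet> ?a = ?g \<bullet> eval_pr Y"
  proof (rule prod_hom_ext[OF YI I ca cb])
    fix n y and s :: 'u assume y: "y \<in> fobj (pathob Y) n" and "s \<in> fobj II n"
    then obtain t where t: "t \<in> cub n 1" "s = enc t" by (auto simp: fobj_cube)
    note w = prod_elements(1)[OF YI I y enc_el[OF t(1)]]
    show "ap (?f \<bullet> ?a) n (pe (pathob Y) II n (y, s)) = ap (?g \<bullet> eval_pr Y) n (pe (pathob Y) II n (y, s))"
      using t y
      by (simp add: ap_comp[OF pI(1) w] ap_comp[OF ep(1)[OF Y] w] pI(2) ep(2)[OF Y] ep(2)[OF X] I enc_el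
          ap_el[OF post(1)] post(2) fI(2) evI_el[OF Y])
  qed
  have "\<exists>!h. h \<in> hom cS (prod_obj cS (pathob Y) II) ?PB \<and> ?p \<bullet> h = ?a \<and> ?q \<bullet> h = eval_pr Y"
    using pb pI(1) ep(1)[OF Y] sq
    unfolding is_pullback_def cSet_simps sp hom_src[OF ep(1)[OF X]] hom_src[OF fI(1)] by blast
  from theI'[OF this] have gp: "gap f \<in> hom cS (prod_obj cS (pathob Y) II) ?PB"
    "?p \<bullet> gap f = ?a" "?q \<bullet> gap f = eval_pr Y"
    unfolding gap_def pb_pair_def cSet_simps hom_src[OF pI(1)] hom_src[OF f] hom_tgt[OF f] by auto
  show thesis
  proof (rule that[OF gp(1) D(1,2) _ _ D(5) _ post])
    show "ap ?p n (ap (gap f) n (pe (pathob Y) II n (y, enc t))) = pe (pathob X) II n (ap (exp_post cS II f) n y, enc t) \<and>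
      ap ?q n (ap (gap f) n (pe (pathob Y) II n (y, enc t))) = pe Y II n (evI Y n y t, enc t)"
      if y: "y \<in> fobj (pathob Y) n" and t: "t \<in> cub n 1" for n y t
      using ap_comp[OF gp(1) prod_elements(1)[OF YI I y enc_el[OF t]], of ?p]
        ap_comp[OF gp(1) prod_elements(1)[OF YI I y enc_el[OF t]], of ?q]
      unfolding gp(2,3) using y t by (simp add: pI(2) ep(2)[OF Y] enc_el I)
    show "\<exists>x t y. x \<in> fobj (pathob X) n \<and> t \<in> cub n 1 \<and> y \<in> fobj Y n \<and>
      ap ?p n w = pe (pathob X) II n (x, enc t) \<and> ap ?q n w = pe Y II n (y, enc t) \<and> evI X n x t = ap f n y"
      if w: "w \<in> fobj ?PB n" for n w
    proof -
      obtain x s where x: "x \<in> fobj (pathob X) n" and s: "s \<in> fobj II n" and pw: "ap ?p n w = pe (pathob X) II n (x, s)"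
        using prod_el_cases[OF XI I ap_el[OF D(1) w]] by blast
      obtain y s' where y: "y \<in> fobj Y n" "s' \<in> fobj II n" and qw: "ap ?q n w = pe Y II n (y, s')"
        using prod_el_cases[OF Y I ap_el[OF D(2) w]] by blast
      obtain t t' where t: "t \<in> cub n 1" "s = enc t" "t' \<in> cub n 1" "s' = enc t'"
        using s y(2) by (auto simp: fobj_cube)
      have "pe X II n (evI X n x t, enc t) = pe X II n (ap f n y, enc t')"
        using D(3)[OF w] x y t by (simp add: pw qw ep(2)[OF X] fI(2) enc_el I)
      then have e: "evI X n x t = ap f n y" and "enc t = (enc t' :: 'u)"
        using pe_eq_iff[OF X I evI_el[OF X x t(1)] enc_el[OF t(1)] ap_el[OF f y(1)] enc_el[OF t(3)]] by simp_all
      then have "t' = t" using enc_inj[OF t(1,3)] by simp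
      then show ?thesis
        using x y(1) t(1) pw qw e unfolding t(2,4) by (intro exI[of _ x] exI[of _ t] exI[of _ y]) simp
    qed
    fix P :: "'z psh" and x i y
    assume P: "psh P" and x: "natm P (cs (pathob X)) x" and i: "natm P Ip i" and y: "natm P (cs Y) y"
      and c: "\<And>n z. z \<in> el P n ==> evI X n (x n z) (i n z) = ap f n (y n z)"
    have el: "x n z \<in> fobj (pathob X) n" "i n z \<in> cub n 1" "y n z \<in> fobj Y n" if "z \<in> el P n" for n z
      using natm_el[OF x that] natm_el[OF i that] natm_el[OF y that] by simp_all
    show "\<exists>h. natm P (cs ?PB) h \<and> (\<forall>n. \<forall>z \<in> el P n. ap ?p n (h n z) = pe (pathob X) II n (x n z, enc (i n z)) \<and>
        ap ?q n (h n z) = pe Y II n (y n z, enc (i n z)))"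
    proof (rule pullback_factor[OF pb ep(1)[OF X] fI(1) D(1) P])
      show "natm P (cs (prod_obj cS (pathob X) II)) (\<lambda>n z. pe (pathob X) II n (x n z, enc (i n z)))"
        by (rule natmI) (simp_all add: el prod_elements(1)[OF XI I] enc_el pe_rs[OF XI I] rs_cube natm_rs[OF x] natm_rs[OF i])
      show "natm P (cs (prod_obj cS Y II)) (\<lambda>n z. pe Y II n (y n z, enc (i n z)))"
        by (rule natmI) (simp_all add: el prod_elements(1)[OF Y I] enc_el pe_rs[OF Y I] rs_cube natm_rs[OF y] natm_rs[OF i])
      show "ap ?f n (pe (pathob X) II n (x n z, enc (i n z))) = ap ?g n (pe Y II n (y n z, enc (i n z)))"
        if "z \<in> el P n" for n z
        using el[OF that] c[OF that] by (simp add: ep(2)[OF X] fI(2) enc_el I)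
    qed
  qed
qed

end


context universe
begin

text \<open>A problem for \<open>gap f\<close> gives a point \<open>i\<close> of the interval, a path in
  \<open>X\<close>, a lift of its value at \<open>i\<close>, and over \<open>A\<close> a lift of the
  whole path. After transposition the last two are a map on the box and the path is a map on
  \<open>P \<times> I\<close>.\<close>

lemma gap_ext:
  assumes f: "f \<in> hom cS Y X" and P: "tinyp P" and A: "subf P A"
  shows "ext (gap f) P A \<longleftrightarrow> (\<forall>i. natm P Ip i \<longrightarrow> ext f (P \<otimes> Ip) (box P i A))"
proof -
  note X = hom_Obj(2)[OF f] and Y = hom_Obj(1)[OF f] and I = cube_Obj[of 1]
  note XI = path_Obj[OF X] and YI = path_Obj[OF Y]
  note ps = tinyp_psh[OF P] and rp = tinyp_restr[OF P A]
  obtain PB p q where g: "gap f \<in> hom cS (prod_obj cS (pathob Y) II) PB"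
    and p: "p \<in> hom cS PB (prod_obj cS (pathob X) II)" and q: "q \<in> hom cS PB (prod_obj cS Y II)"
    and ga: "\<And>n y t. y \<in> fobj (pathob Y) n ==> t \<in> cub n 1 ==>
      ap p n (ap (gap f) n (pe (pathob Y) II n (y, enc t))) = pe (pathob X) II n (ap (exp_post cS II f) n y, enc t) \<and>
      ap q n (ap (gap f) n (pe (pathob Y) II n (y, enc t))) = pe Y II n (evI Y n y t, enc t)"
    and PBc: "\<And>n w. w \<in> fobj PB n ==> \<exists>x t y. x \<in> fobj (pathob X) n \<and> t \<in> cub n 1 \<and> y \<in> fobj Y n \<and>
      ap p n w = pe (pathob X) II n (x, enc t) \<and> ap q n w = pe Y II n (y, enc t) \<and> evI X n x t = ap f n y"
    and PBe: "\<And>n w w'. w \<in> fobj PB n ==> w' \<in> fobj PB n ==> ap p n w = ap p n w' ==> ap q n w = ap q n w' ==> w = w'"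
    and PBf: "\<And>x i y. natm P (cs (pathob X)) x ==> natm P Ip i ==> natm P (cs Y) y ==>
      (\<And>n z. z \<in> el P n ==> evI X n (x n z) (i n z) = ap f n (y n z)) ==>
      \<exists>h. natm P (cs PB) h \<and> (\<forall>n. \<forall>z \<in> el P n. ap p n (h n z) = pe (pathob X) II n (x n z, enc (i n z)) \<and>
        ap q n (h n z) = pe Y II n (y n z, enc (i n z)))"
    and po: "exp_post cS II f \<in> hom cS (pathob Y) (pathob X)"
    and poe: "\<And>n y t. y \<in> fobj (pathob Y) n ==> t \<in> cub n 1 ==>
      evI X n (ap (exp_post cS II f) n y) t = ap f n (evI Y n y t)"
    by (rule gap_facts[OF f, where ?'z = 'a]) (use ps in blast)+
  note G = hom_src[OF g] hom_tgt[OF g] and F = hom_src[OF f] hom_tgt[OF f]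
  let ?W = "prod_obj cS (pathob Y) II" and ?pW = "pe (pathob Y) II"
  note prW = pr_hom[OF YI I] and peW = prod_elements[OF YI I]
  have peWt: "?pW n (y, enc t) \<in> fobj ?W n" "ap (pr1 cS (pathob Y) II) n (?pW n (y, enc t)) = y"
    "ap (pr2 cS (pathob Y) II) n (?pW n (y, enc t)) = enc t"
    if "y \<in> fobj (pathob Y) n" "t \<in> cub n 1" for n y t
    using peW(1-3)[OF that(1) enc_el[OF that(2)]] by simp_all
  have Wc: "\<exists>y t. y \<in> fobj (pathob Y) n \<and> t \<in> cub n 1 \<and> w = ?pW n (y, enc t)" if wW: "w \<in> fobj ?W n" for n w
  proof -
    obtain y s where ys: "y \<in> fobj (pathob Y) n" "s \<in> fobj II n" "w = ?pW n (y, s)"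
      using prod_el_cases[OF YI I wW] by blast
    then show ?thesis by (auto simp: fobj_cube)
  qed
  have pXe: "x = x' \<and> t = t'" if "pe (pathob X) II n (x, enc t) = pe (pathob X) II n (x', enc t')"
    "x \<in> fobj (pathob X) n" "x' \<in> fobj (pathob X) n" "t \<in> cub n 1" "t' \<in> cub n 1" for n x x' t t'
    using pe_eq_iff[OF XI I that(2) enc_el[OF that(4)] that(3) enc_el[OF that(5)]] that(1) enc_inj[OF that(4,5)] by auto
  have pYe: "x = x'" if "pe Y II n (x, enc t) = pe Y II n (x', enc t')"
    "x \<in> fobj Y n" "x' \<in> fobj Y n" "t \<in> cub n 1" "t' \<in> cub n 1" for n x x' t t'
    using pe_eq_iff[OF Y I that(2) enc_el[OF that(4)] that(3) enc_el[OF that(5)]] that(1) by auto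
  show ?thesis
  proof (intro iffI allI impI)
    assume E: "ext (gap f) P A"
    fix i assume i: "natm P Ip i"
    have iel: "i n z \<in> cub n 1" if "z \<in> el P n" for n z using natm_el[OF i that] by simp
    show "ext f (P \<otimes> Ip) (box P i A)"
      unfolding ext_def F
    proof (intro allI impI)
      fix u v assume u: "natm (restr (P \<otimes> Ip) (box P i A)) (cs Y) u" and v: "natm (P \<otimes> Ip) (cs X) v"
        and uv: "\<forall>n. \<forall>z \<in> box P i A n. ap f n (u n z) = v n z"
      have "natm (restr P A \<otimes> Ip) (cs Y) u"
      proof (rule natmI)
        show "u n z \<in> el (cs Y) n" if "z \<in> el (restr P A \<otimes> Ip) n" for n z
          using natm_el[OF u, of z n] that subf_el[OF A] by (auto simp: box_def)
        show "u m (rs (restr P A \<otimes> Ip) a z) = rs (cs Y) a (u n z)"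
          if "a \<in> cub m n" "z \<in> el (restr P A \<otimes> Ip) n" for m n a z
          using natm_rs[OF u that(1), of z] that subf_el[OF A] by (auto simp: box_def)
      qed
      then obtain u' where u': "natm (restr P A) (cs (pathob Y)) u'"
        "\<And>n z t. z \<in> A n ==> t \<in> cub n 1 ==> evI Y n (u' n z) t = u n (z, t)"
        using path_transpose[OF Y rp] by (metis el_restr)
      obtain v' where v': "natm P (cs (pathob X)) v'"
        "\<And>n z t. z \<in> el P n ==> t \<in> cub n 1 ==> evI X n (v' n z) t = v n (z, t)"
        using path_transpose[OF X P v] by metis
      have ui: "natm P (cs Y) (\<lambda>n z. u n (z, i n z))"
      proof (rule natmI)
        show "u n (z, i n z) \<in> el (cs Y) n" if "z \<in> el P n" for n z
          using natm_el[OF u, of "(z, i n z)" n] that iel[OF that] by (simp add: box_def)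
        show "u m (rs P a z, i m (rs P a z)) = rs (cs Y) a (u n (z, i n z))"
          if "a \<in> cub m n" "z \<in> el P n" for m n a z
          using natm_rs[OF u that(1), of "(z, i n z)"] that iel[OF that(2)] natm_rs[OF i that] by (simp add: box_def)
      qed
      have u'el: "u' n z \<in> fobj (pathob Y) n" if "z \<in> A n" for n z using natm_el[OF u'(1), of z n] that by simp
      have v'el: "v' n z \<in> fobj (pathob X) n" if "z \<in> el P n" for n z using natm_el[OF v'(1) that] by simp
      have uil: "u n (z, i n z) \<in> fobj Y n" if "z \<in> el P n" for n z using natm_el[OF ui that] by simp
      obtain V where V: "natm P (cs PB) V"
        "\<And>n z. z \<in> el P n ==> ap p n (V n z) = pe (pathob X) II n (v' n z, enc (i n z))"
        "\<And>n z. z \<in> el P n ==> ap q n (V n z) = pe Y II n (u n (z, i n z), enc (i n z))"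
        using PBf[OF v'(1) i ui] uv iel v'(2) by (auto simp: box_def)
      have U: "natm (restr P A) (cs ?W) (\<lambda>n z. ?pW n (u' n z, enc (i n z)))"
        by (rule natmI)
          (use natm_rs[OF u'(1)] natm_rs[OF i] iel subf_el[OF A]
            in \<open>auto simp: u'el peWt pe_rs[OF YI I] enc_el rs_cube\<close>)
      have post: "ap (exp_post cS II f) n (u' n z) = v' n z" if z: "z \<in> A n" for n z
      proof (rule evI_eqI[OF X ap_el[OF po u'el[OF z]] v'el[OF subf_el[OF A z]]])
        fix m a t assume a: "a \<in> cub m n" and t: "t \<in> cub m 1"
        note az = subf_rs[OF A a z]
        have "evI X m (ap (exp_post cS II f) m (u' m (rs P a z))) t = evI X m (v' m (rs P a z)) t"
          using uv az subf_el[OF A az] t by (simp add: poe u'el u'(2) v'(2) box_def)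
        then show "evI X m (rs (cs (pathob X)) a (ap (exp_post cS II f) n (u' n z))) t =
            evI X m (rs (cs (pathob X)) a (v' n z)) t"
          using natm_rs[OF u'(1) a] z natm_rs[OF v'(1) a subf_el[OF A z]]
          by (simp add: ap_rs[OF po a, symmetric] u'el)
      qed
      have "ap (gap f) n (?pW n (u' n z, enc (i n z))) = V n z" if z: "z \<in> A n" for n z
      proof (rule PBe)
        note zP = subf_el[OF A z]
        show "ap (gap f) n (?pW n (u' n z, enc (i n z))) \<in> fobj PB n"
          by (rule ap_el[OF g peWt(1)[OF u'el[OF z] iel[OF zP]]])
        show "V n z \<in> fobj PB n" using natm_el[OF V(1) zP] by simp
      qed (use z subf_el[OF A z] iel in \<open>simp_all add: ga u'el V post u'(2)\<close>)
      then obtain w where w: "natm P (cs ?W) w" "\<And>n z. z \<in> A n ==> w n z = ?pW n (u' n z, enc (i n z))"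
        "\<And>n z. z \<in> el P n ==> ap (gap f) n (w n z) = V n z"
        using extD[OF E g U V(1)] by blast
      define y where "y n z = ap (pr1 cS (pathob Y) II) n (w n z)" for n z
      have y: "natm P (cs (pathob Y)) y" unfolding y_def by (rule natm_comp[OF w(1) ap_natm[OF prW(1)]])
      have yel: "y n z \<in> fobj (pathob Y) n" if "z \<in> el P n" for n z using natm_el[OF y that] by simp
      have yz: "ap (exp_post cS II f) n (y n z) = v' n z \<and> evI Y n (y n z) (i n z) = u n (z, i n z)"
        if z: "z \<in> el P n" for n z
      proof -
        have "w n z \<in> fobj ?W n" using natm_el[OF w(1) z] by simp
        then obtain y' t where yt: "y' \<in> fobj (pathob Y) n" "t \<in> cub n 1" "w n z = ?pW n (y', enc t)" using Wc by blast
        then have y': "y n z = y'" by (simp add: y_def peWt)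
        have e1: "pe (pathob X) II n (ap (exp_post cS II f) n y', enc t) = pe (pathob X) II n (v' n z, enc (i n z))"
          and e2: "pe Y II n (evI Y n y' t, enc t) = pe Y II n (u n (z, i n z), enc (i n z))"
          using w(3)[OF z] ga[OF yt(1,2)] V(2,3)[OF z] yt(3) by simp_all
        from pXe[OF e1 ap_el[OF po yt(1)] v'el[OF z] yt(2) iel[OF z]]
        have "ap (exp_post cS II f) n y' = v' n z" "t = i n z" by auto
        moreover from pYe[OF e2 evI_el[OF Y yt(1,2)] uil[OF z] yt(2) iel[OF z]]
        have "evI Y n y' t = u n (z, i n z)" .
        ultimately show ?thesis by (simp add: y')
      qed
      let ?w = "\<lambda>n zt. evI Y n (y n (fst zt)) (snd zt)"
      have "natm (P \<otimes> Ip) (cs Y) ?w"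
        by (rule natm_prodI) (simp_all add: evI_el[OF Y yel] natm_rs[OF y] evI_rs[OF Y _ yel])
      moreover have "?w n zt = u n zt" if "zt \<in> box P i A n" for n zt
      proof -
        obtain z t where zt: "zt = (z, t)" "z \<in> el P n" "t \<in> cub n 1" "z \<in> A n \<or> t = i n z"
          using \<open>zt \<in> box P i A n\<close> by (auto simp: box_def)
        show ?thesis
        proof (cases "z \<in> A n")
          case True
          then have "y n z = u' n z" using zt iel by (simp add: y_def w(2) peWt u'el)
          then show ?thesis using True zt by (simp add: u'(2))
        qed (use zt yz in auto)
      qed
      moreover have "ap f n (?w n zt) = v n zt" if "zt \<in> el (P \<otimes> Ip) n" for n zt
        using that yz v'(2) by (auto simp: poe[symmetric] yel)
      ultimately show "\<exists>w. natm (P \<otimes> Ip) (cs Y) w \<and> (\<forall>n. \<forall>z \<in> box P i A n. w n z = u n z) \<and>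
          (\<forall>n. \<forall>z \<in> el (P \<otimes> Ip) n. ap f n (w n z) = v n z)"
        by (intro exI[of _ ?w]) blast
    qed
  next
    assume E: "\<forall>i. natm P Ip i \<longrightarrow> ext f (P \<otimes> Ip) (box P i A)"
    show "ext (gap f) P A"
      unfolding ext_def G
    proof (intro allI impI)
      fix u v assume u: "natm (restr P A) (cs ?W) u" and v: "natm P (cs PB) v"
        and uv: "\<forall>n. \<forall>z \<in> A n. ap (gap f) n (u n z) = v n z"
      define x where "x n z = ap (pr1 cS (pathob X) II) n (ap p n (v n z))" for n z
      define i where "i n z = dec (ap (pr2 cS (pathob X) II) n (ap p n (v n z)))" for n z
      define y where "y n z = ap (pr1 cS Y II) n (ap q n (v n z))" for n z
      have vc: "x n z \<in> fobj (pathob X) n" "i n z \<in> cub n 1" "y n z \<in> fobj Y n"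
          "ap p n (v n z) = pe (pathob X) II n (x n z, enc (i n z))"
          "ap q n (v n z) = pe Y II n (y n z, enc (i n z))" "evI X n (x n z) (i n z) = ap f n (y n z)"
        if z: "z \<in> el P n" for n z
      proof -
        have "v n z \<in> fobj PB n" using natm_el[OF v z] by simp
        from PBc[OF this] obtain x' t' y' where 1: "x' \<in> fobj (pathob X) n" "t' \<in> cub n 1" "y' \<in> fobj Y n"
          "ap p n (v n z) = pe (pathob X) II n (x', enc t')" "ap q n (v n z) = pe Y II n (y', enc t')"
          "evI X n x' t' = ap f n y'" by blast
        have "x n z = x'" "i n z = t'" "y n z = y'"
          unfolding x_def i_def y_def 1(4,5)
          using prod_elements(2,3)[OF XI I 1(1) enc_el[OF 1(2)]] prod_elements(2)[OF Y I 1(3) enc_el[OF 1(2)]] 1(2)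
          by simp_all
        then show "x n z \<in> fobj (pathob X) n" "i n z \<in> cub n 1" "y n z \<in> fobj Y n"
          "ap p n (v n z) = pe (pathob X) II n (x n z, enc (i n z))"
          "ap q n (v n z) = pe Y II n (y n z, enc (i n z))" "evI X n (x n z) (i n z) = ap f n (y n z)"
          using 1 by simp_all
      qed
      have x: "natm P (cs (pathob X)) x" unfolding x_def
        by (rule natm_comp[OF v natm_comp[OF ap_natm[OF p] ap_natm[OF pr_hom(1)[OF XI I]]]])
      have "natm P (cs II) (\<lambda>n z. ap (pr2 cS (pathob X) II) n (ap p n (v n z)))"
        by (rule natm_comp[OF v natm_comp[OF ap_natm[OF p] ap_natm[OF pr_hom(2)[OF XI I]]]])
      moreover have "natm (cs II) Ip (\<lambda>k x. dec (x :: 'u))"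
        using cube_iso[of 1] unfolding natiso_def by blast
      ultimately have i: "natm P Ip i" unfolding i_def by (rule natm_comp)
      have y: "natm P (cs Y) y" unfolding y_def
        by (rule natm_comp[OF v natm_comp[OF ap_natm[OF q] ap_natm[OF pr_hom(1)[OF Y I]]]])
      define u' where "u' n z = ap (pr1 cS (pathob Y) II) n (u n z)" for n z
      have u': "natm (restr P A) (cs (pathob Y)) u'" unfolding u'_def by (rule natm_comp[OF u ap_natm[OF prW(1)]])
      have u'el: "u' n z \<in> fobj (pathob Y) n" if "z \<in> A n" for n z using natm_el[OF u', of z n] that by simp
      have uA: "u n z = ?pW n (u' n z, enc (i n z))" "ap (exp_post cS II f) n (u' n z) = x n z"
        "evI Y n (u' n z) (i n z) = y n z" if z: "z \<in> A n" for n z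
      proof -
        note zP = subf_el[OF A z]
        have "u n z \<in> fobj ?W n" using natm_el[OF u, of z n] z by simp
        then obtain y' t where yt: "y' \<in> fobj (pathob Y) n" "t \<in> cub n 1" "u n z = ?pW n (y', enc t)" using Wc by blast
        then have y': "u' n z = y'" by (simp add: u'_def peWt)
        have e1: "pe (pathob X) II n (ap (exp_post cS II f) n y', enc t) = pe (pathob X) II n (x n z, enc (i n z))"
          and e2: "pe Y II n (evI Y n y' t, enc t) = pe Y II n (y n z, enc (i n z))"
          using uv[rule_format, OF z] ga[OF yt(1,2)] vc(4,5)[OF zP] yt(3) by simp_all
        from pXe[OF e1 ap_el[OF po yt(1)] vc(1)[OF zP] yt(2) vc(2)[OF zP]]
        have 2: "ap (exp_post cS II f) n y' = x n z" "t = i n z" by auto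
        from pYe[OF e2 evI_el[OF Y yt(1,2)] vc(3)[OF zP] yt(2) vc(2)[OF zP]]
        have 3: "evI Y n y' t = y n z" .
        show "u n z = ?pW n (u' n z, enc (i n z))" "ap (exp_post cS II f) n (u' n z) = x n z"
          "evI Y n (u' n z) (i n z) = y n z" using 2 3 yt(3) by (simp_all add: y')
      qed
      let ?u = "\<lambda>n zt. if fst zt \<in> A n then evI Y n (u' n (fst zt)) (snd zt) else y n (fst zt)"
      let ?v = "\<lambda>n zt. evI X n (x n (fst zt)) (snd zt)"
      have V: "natm (P \<otimes> Ip) (cs X) ?v"
        by (rule natm_prodI) (simp_all add: evI_el[OF X vc(1)] natm_rs[OF x] evI_rs[OF X _ vc(1)])
      have U: "natm (restr (P \<otimes> Ip) (box P i A)) (cs Y) ?u"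
      proof (rule natmI)
        fix n zt assume "zt \<in> el (restr (P \<otimes> Ip) (box P i A)) n"
        then obtain z t where zt: "zt = (z, t)" "z \<in> el P n" "t \<in> cub n 1" "z \<in> A n \<or> t = i n z"
          by (auto simp: box_def)
        then show "?u n zt \<in> el (cs Y) n" using evI_el[OF Y u'el] vc(3) by simp
        fix m a assume a: "a \<in> cub m n"
        have zt': "rs (restr (P \<otimes> Ip) (box P i A)) a zt = (rs P a z, t \<odot> a)" by (simp add: zt)
        show "?u m (rs (restr (P \<otimes> Ip) (box P i A)) a zt) = rs (cs Y) a (?u n zt)"
        proof (cases "z \<in> A n")
          case True
          have "u' m (rs P a z) = rs (cs (pathob Y)) a (u' n z)" using natm_rs[OF u' a] True by simp
          then show ?thesis
            using True subf_rs[OF A a True] evI_rs[OF Y a u'el[OF True] zt(3)] unfolding zt' zt by simp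
        next
          case False
          then have t: "t = i n z" using zt by simp
          note az = rs_el[OF ps a zt(2)]
          have "evI Y m (u' m (rs P a z)) (t \<odot> a) = y m (rs P a z)" if "rs P a z \<in> A m"
            using uA(3)[OF that] natm_rs[OF i a zt(2)] t by simp
          then show ?thesis using False natm_rs[OF y a zt(2)] unfolding zt' zt by simp
        qed
      qed
      have UV: "ap f n (?u n zt) = ?v n zt" if bz: "zt \<in> box P i A n" for n zt
      proof -
        obtain z t where zt: "zt = (z, t)" "z \<in> el P n" "t \<in> cub n 1" "z \<in> A n \<or> t = i n z"
          using bz by (auto simp: box_def)
        show ?thesis
        proof (cases "z \<in> A n")
          case True
          then show ?thesis using poe[OF u'el[OF True] zt(3)] uA(2)[OF True] zt by simp
        qed (use zt vc(6)[OF zt(2)] in simp)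
      qed
      obtain w where w: "natm (P \<otimes> Ip) (cs Y) w" "\<And>n zt. zt \<in> box P i A n ==> w n zt = ?u n zt"
        "\<And>n zt. zt \<in> el (P \<otimes> Ip) n ==> ap f n (w n zt) = ?v n zt"
        using extD[OF E[rule_format, OF i] f U V UV] by blast
      obtain w' where w': "natm P (cs (pathob Y)) w'"
        "\<And>n z t. z \<in> el P n ==> t \<in> cub n 1 ==> evI Y n (w' n z) t = w n (z, t)"
        using path_transpose[OF Y P w(1)] by metis
      have w'el: "w' n z \<in> fobj (pathob Y) n" if "z \<in> el P n" for n z using natm_el[OF w'(1) that] by simp
      let ?w = "\<lambda>n z. ?pW n (w' n z, enc (i n z))"
      have "natm P (cs ?W) ?w"
        by (rule natmI) (simp_all add: w'el vc peWt pe_rs[OF YI I] enc_el rs_cube natm_rs[OF w'(1)] natm_rs[OF i])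
      moreover have "?w n z = u n z" if z: "z \<in> A n" for n z
      proof -
        note zP = subf_el[OF A z]
        have "w' n z = u' n z"
        proof (rule evI_eqI[OF Y w'el[OF zP] u'el[OF z]])
          fix m a t assume a: "a \<in> cub m n" and t: "t \<in> cub m 1"
          note az = subf_rs[OF A a z]
          have "evI Y m (w' m (rs P a z)) t = evI Y m (u' m (rs P a z)) t"
            using w'(2)[OF subf_el[OF A az] t] w(2)[of "(rs P a z, t)" m] az subf_el[OF A az] t by (simp add: box_def)
          then show "evI Y m (rs (cs (pathob Y)) a (w' n z)) t = evI Y m (rs (cs (pathob Y)) a (u' n z)) t"
            using natm_rs[OF w'(1) a zP] natm_rs[OF u' a] z by simp
        qed
        then show ?thesis using uA(1)[OF z] by simp
      qed
      moreover have "ap (gap f) n (?w n z) = v n z" if z: "z \<in> el P n" for n z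
      proof (rule PBe)
        show "ap (gap f) n (?w n z) \<in> fobj PB n" by (rule ap_el[OF g peWt(1)[OF w'el[OF z] vc(2)[OF z]]])
        show "v n z \<in> fobj PB n" using natm_el[OF v z] by simp
        have "ap (exp_post cS II f) n (w' n z) = x n z"
        proof (rule evI_eqI[OF X ap_el[OF po w'el[OF z]] vc(1)[OF z]])
          fix m a t assume a: "a \<in> cub m n" and t: "t \<in> cub m 1"
          note az = rs_el[OF ps a z]
          have "evI X m (ap (exp_post cS II f) m (w' m (rs P a z))) t = evI X m (x m (rs P a z)) t"
            using w(3)[of "(rs P a z, t)" m] az t by (simp add: poe w'el w'(2))
          then show "evI X m (rs (cs (pathob X)) a (ap (exp_post cS II f) n (w' n z))) t = evI X m (rs (cs (pathob X)) a (x n z)) t"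
            using natm_rs[OF w'(1) a z] natm_rs[OF x a z] by (simp add: ap_rs[OF po a, symmetric] w'el z)
        qed
        moreover have "evI Y n (w' n z) (i n z) = y n z"
          using w'(2)[OF z vc(2)[OF z]] w(2)[of "(z, i n z)" n] z vc(2)[OF z] uA(3) by (simp add: box_def)
        ultimately show "ap p n (ap (gap f) n (?w n z)) = ap p n (v n z)" "ap q n (ap (gap f) n (?w n z)) = ap q n (v n z)"
          using ga[OF w'el[OF z] vc(2)[OF z]] vc(4,5)[OF z] by simp_all
      qed
      ultimately show "\<exists>w. natm P (cs ?W) w \<and> (\<forall>n. \<forall>z \<in> A n. w n z = u n z) \<and>
          (\<forall>n. \<forall>z \<in> el P n. ap (gap f) n (w n z) = v n z)"
        by (intro exI[of _ ?w]) blast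
    qed
  qed
qed

lemma gap_hom:
  assumes f: "f \<in> hom cS Y X"
  shows "gap f \<in> Arr cS"
  by (rule gap_facts[OF f, where ?'z = unit]) (rule hom_Arr)

end

context cubical_cofibrations
begin

lemma Fib_hom: "f \<in> Fib \<C> ==> f \<in> hom cS (src f) (tgt f)"
  using Arr_hom by (auto simp: Fib_def)

lemma Fib_ext:
  assumes "f \<in> Fib \<C>" "tinyp P" "cof P A" "natm P Ip i"
  shows "ext f (P \<otimes> Ip) (box P i A)"
  using gap_ext[OF Fib_hom[OF assms(1)] assms(2) cof_subf[OF assms(3)]] TFib_ext[OF _ assms(2,3)] assms(1,4)
  by (auto simp: Fib_def)

lemma Fib_I:
  assumes f: "f \<in> hom cS Y X"
    and e: "\<And>Z A i. Z \<in> Obj cS ==> cof (cs Z) A ==> natm (cs Z) Ip i ==> ext f (cs Z \<otimes> Ip) (box (cs Z) i A)"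
  shows "f \<in> Fib \<C>"
proof -
  have g: "gap f \<in> hom cS (src (gap f)) (tgt (gap f))" using gap_hom[OF f] Arr_hom by blast
  have "gap f \<in> TFib \<C>"
    by (rule TFib_I[OF g]) (use gap_ext[OF f tinyp_cs cof_subf] e in blast)
  then show ?thesis using hom_Arr[OF f] by (simp add: Fib_def)
qed

text \<open>The form in which fibrations are used, with the base and the interval coordinate as separate
  arguments.\<close>

lemma Fib_fill:
  assumes f: "f \<in> Fib \<C>" "f \<in> hom cS Y X" and P: "tinyp P" and A: "cof P A" and i: "natm P Ip i"
    and uel: "\<And>n z t. z \<in> el P n ==> t \<in> cub n 1 ==> z \<in> A n \<or> t = i n z ==> u n z t \<in> fobj Y n"
    and urs: "\<And>m n a z t. a \<in> cub m n ==> z \<in> el P n ==> t \<in> cub n 1 ==> z \<in> A n \<or> t = i n z ==>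
      u m (rs P a z) (t \<odot> a) = rs (cs Y) a (u n z t)"
    and vel: "\<And>n z t. z \<in> el P n ==> t \<in> cub n 1 ==> v n z t \<in> fobj X n"
    and vrs: "\<And>m n a z t. a \<in> cub m n ==> z \<in> el P n ==> t \<in> cub n 1 ==>
      v m (rs P a z) (t \<odot> a) = rs (cs X) a (v n z t)"
    and uv: "\<And>n z t. z \<in> el P n ==> t \<in> cub n 1 ==> z \<in> A n \<or> t = i n z ==> ap f n (u n z t) = v n z t"
  obtains w where "\<And>n z t. z \<in> el P n ==> t \<in> cub n 1 ==> w n z t \<in> fobj Y n"
    and "\<And>m n a z t. a \<in> cub m n ==> z \<in> el P n ==> t \<in> cub n 1 ==>
      w m (rs P a z) (t \<odot> a) = rs (cs Y) a (w n z t)"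
    and "\<And>n z t. z \<in> el P n ==> t \<in> cub n 1 ==> z \<in> A n \<or> t = i n z ==> w n z t = u n z t"
    and "\<And>n z t. z \<in> el P n ==> t \<in> cub n 1 ==> ap f n (w n z t) = v n z t"
proof -
  have U: "natm (restr (P \<otimes> Ip) (box P i A)) (cs Y) (\<lambda>n w. u n (fst w) (snd w))"
    by (rule natmI) (auto simp: box_def uel urs)
  have V: "natm (P \<otimes> Ip) (cs X) (\<lambda>n w. v n (fst w) (snd w))"
    by (rule natm_prodI) (simp_all add: vel vrs)
  obtain w where w: "natm (P \<otimes> Ip) (cs Y) w" "\<And>n z. z \<in> box P i A n ==> w n z = u n (fst z) (snd z)"
    "\<And>n z. z \<in> el (P \<otimes> Ip) n ==> ap f n (w n z) = v n (fst z) (snd z)"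
    by (rule extD[OF Fib_ext[OF f(1) P A i] f(2) U V]) (auto simp: box_def uv)
  show thesis
    by (rule that[of "\<lambda>n z t. w n (z, t)"])
      (use natm_el[OF w(1)] natm_rs[OF w(1)] w(2,3) in \<open>fastforce simp: box_def\<close>)+
qed

lemma TFib_Arr: "f \<in> TFib \<C> ==> f \<in> Arr cS"
  by (simp add: TFib_def rlp_def)

text \<open>Box inclusions are cofibrations.\<close>

lemma TFib_Fib: "TFib \<C> \<subseteq> Fib \<C>"
proof
  fix f assume f: "f \<in> TFib \<C>"
  show "f \<in> Fib \<C>"
  proof (rule Fib_I[OF Arr_hom[OF TFib_Arr[OF f]]])
    fix Z A i assume "Z \<in> Obj cS" "cof (cs Z) A" "natm (cs Z) Ip i"
    then show "ext f (cs Z \<otimes> Ip) (box (cs Z) i A)"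
      by (intro TFib_ext[OF f] tinyp_prodp tinyp_cs tinyp_yo cof_box psh_cs)
  qed
qed

end


section \<open>The factorization into a cofibration and a trivial fibration\<close>

lemma extI:
  assumes "r \<in> hom cSet X Y"
    and "\<And>u v. natm (restr P A) (cs X) u ==> natm P (cs Y) v ==> (\<And>n z. z \<in> A n ==> ap r n (u n z) = v n z) ==>
      \<exists>w. natm P (cs X) w \<and> (\<forall>n. \<forall>z \<in> A n. w n z = u n z) \<and> (\<forall>n. \<forall>z \<in> el P n. ap r n (w n z) = v n z)"
  shows "ext r P A"
  unfolding ext_def hom_src[OF assms(1)] hom_tgt[OF assms(1)] using assms(2) by blast

context universe
begin

lemma inclusion_lifts:
  assumes P: "tinyp P" and A: "subf P A"
  shows "\<exists>l \<in> Arr cS. \<forall>r \<in> Arr cS. lifts cS l r \<longleftrightarrow> ext r P A"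
proof -
  from ex_inclusion[OF P A] obtain L Z l e d where
    "l \<in> hom cS L Z \<and> (\<forall>n. inj_on (ap l n) (fobj L n)) \<and> natiso P (cs Z) e d \<and> (\<forall>n. img l n = e n ` A n)"
    by (elim exE)
  then have l: "l \<in> hom cS L Z" "\<And>n. inj_on (ap l n) (fobj L n)"
    and iso: "natiso P (cs Z) e d" and im: "\<And>n. img l n = e n ` A n" by simp_all
  have iso': "natiso (cs Z) P d e" using iso by (simp add: natiso_def)
  have d: "natm (cs Z) P d" and de: "\<And>n z. z \<in> el P n ==> d n (e n z) = z"
    and ed: "\<And>n z. z \<in> fobj Z n ==> e n (d n z) = z"
    using iso unfolding natiso_def by simp_all
  note ps = tinyp_psh[OF P] psh_cs[OF hom_Obj(2)[OF l(1)]]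
  note Z = img_subf[OF l(1)]
  have m1: "z \<in> A n \<longleftrightarrow> e n z \<in> img l n" if z: "z \<in> el P n" for n z
  proof
    assume "e n z \<in> img l n"
    then obtain y where "y \<in> A n" "e n z = e n y" unfolding im by blast
    then show "z \<in> A n" using de[OF z] de[OF subf_el[OF A]] by metis
  qed (simp add: im)
  have m2: "z \<in> img l n \<longleftrightarrow> d n z \<in> A n" if z: "z \<in> el (cs Z) n" for n z
    using m1[OF natm_el[OF d z]] ed z by simp
  have "lifts cS l r \<longleftrightarrow> ext r P A" if r: "r \<in> Arr cS" for r
    using lifts_iff_ext[OF l Arr_hom[OF r]] ext_iso[OF iso ps A Z m1] ext_iso[OF iso' ps(2,1) Z A m2]
    by blast
  then show ?thesis using hom_Arr[OF l(1)] by blast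
qed

end

context universe
begin

lemma pull_cid: "sieve n S ==> pull n (cid n) S = S"
  by (rule sieve_eqI[OF sieve_pull[OF _ cid_cub]]) (auto simp: pull_iff cub_idl)

lemma pull_comp: "sieve n S ==> a \<in> cub l m ==> b \<in> cub m n ==> pull l (b \<odot> a) S = pull l a (pull m b S)"
proof (rule sieve_eqI[OF sieve_pull[of n] sieve_pull[OF sieve_pull[of n]]])
  fix k c assume a: "a \<in> cub l m" and b: "b \<in> cub m n" and c: "c \<in> cub k l"
  show "c \<in> pull l (b \<odot> a) S \<longleftrightarrow> c \<in> pull l a (pull m b S)"
    by (simp add: pull_iff[OF c] pull_iff[OF comp_cub[OF c a]] cub_assoc[OF c a b])
qed auto

end

context cubical_cofibrations
begin

context
  fixes X Y :: "'u cset" and f :: "'u cmap"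
  assumes f: "f \<in> hom cSet X Y"
begin

text \<open>A partial element of \<open>X\<close> over an element \<open>y\<close> of \<open>Y\<close>:
  a compatible family of elements over the restrictions of \<open>y\<close> along the arrows of a
  cofibrant sieve \<open>S\<close>, its extent. Values off \<open>S\<close> are normalized.\<close>

definition partial_el :: "nat => cube_arrow set \<times> (cube_arrow => 'u) \<times> 'u => bool" where
  "partial_el n = (\<lambda>(S, s, y). cofsieve n S \<and> y \<in> fobj Y n \<and>
    (\<forall>m. \<forall>a \<in> S \<inter> cub m n. s a \<in> fobj X m \<and> ap f m (s a) = rs (cs Y) a y \<and>
      (\<forall>k. \<forall>b \<in> cub k m. s (a \<odot> b) = rs (cs X) b (s a))) \<and>
    (\<forall>a. a \<notin> S \<longrightarrow> s a = undefined))"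

definition partial_rs :: "cube_arrow => cube_arrow set \<times> (cube_arrow => 'u) \<times> 'u =>
    cube_arrow set \<times> (cube_arrow => 'u) \<times> 'u" where
  "partial_rs b = (\<lambda>(S, s, y). (pull (Dom Cube b) b S,
    \<lambda>a. if a \<in> pull (Dom Cube b) b S then s (b \<odot> a) else undefined, rs (cs Y) b y))"

definition partial :: "(cube_arrow set \<times> (cube_arrow => 'u) \<times> 'u) psh" where
  "partial = Psh (\<lambda>n. Collect (partial_el n)) partial_rs"

lemma partial_rs_eq: "b \<in> cub m n ==> partial_rs b (S, s, y) =
    (pull m b S, \<lambda>a. if a \<in> pull m b S then s (b \<odot> a) else undefined, rs (cs Y) b y)"
  by (simp add: partial_rs_def cub_Dom)

lemma partial_el_D:
  assumes "partial_el n (S, s, y)"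
  shows "cofsieve n S" "y \<in> fobj Y n"
    and "a \<in> S ==> a \<in> cub m n ==> s a \<in> fobj X m"
    and "a \<in> S ==> a \<in> cub m n ==> ap f m (s a) = rs (cs Y) a y"
    and "a \<in> S ==> a \<in> cub m n ==> b \<in> cub k m ==> s (a \<odot> b) = rs (cs X) b (s a)"
    and "a \<notin> S ==> s a = undefined"
  using assms unfolding partial_el_def by auto

lemma partial_el_I:
  assumes "cofsieve n S" "y \<in> fobj Y n"
    and "\<And>a m. a \<in> S ==> a \<in> cub m n ==> s a \<in> fobj X m"
    and "\<And>a m. a \<in> S ==> a \<in> cub m n ==> ap f m (s a) = rs (cs Y) a y"
    and "\<And>a m b k. a \<in> S ==> a \<in> cub m n ==> b \<in> cub k m ==> s (a \<odot> b) = rs (cs X) b (s a)"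
    and "\<And>a. a \<notin> S ==> s a = undefined"
  shows "partial_el n (S, s, y)"
  using assms unfolding partial_el_def by auto

lemma psh_partial: "psh partial"
proof (rule pshI)
  note Y = psh_cs[OF hom_Obj(2)[OF f]]
  fix m n b w assume b: "b \<in> cub m n" and "w \<in> el partial n"
  then obtain S s y where w: "w = (S, s, y)" "partial_el n (S, s, y)" by (cases w) (auto simp: partial_def)
  note D = partial_el_D[OF w(2)]
  have "partial_el m (partial_rs b w)"
    unfolding w(1) partial_rs_eq[OF b]
  proof (rule partial_el_I)
    show "cofsieve m (pull m b S)" by (rule cofsieve_pull[OF D(1) b])
    show "rs (cs Y) b y \<in> fobj Y m" using rs_el[OF Y b] D(2) by simp
    fix a k assume a: "a \<in> pull m b S" and ak: "a \<in> cub k m"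
    have ba: "b \<odot> a \<in> S" "b \<odot> a \<in> cub k n" using a ak b by (auto simp: pull_iff)
    show "(if a \<in> pull m b S then s (b \<odot> a) else undefined) \<in> fobj X k"
      "ap f k (if a \<in> pull m b S then s (b \<odot> a) else undefined) = rs (cs Y) a (rs (cs Y) b y)"
      using a D(3,4)[OF ba] rs_comp[OF Y ak b] D(2) by simp_all
    fix c l assume c: "c \<in> cub l k"
    have "a \<odot> c \<in> pull m b S"
      using sieve_comp[OF sieve_pull[OF cofsieve_sieve[OF D(1)] b] a ak c] .
    then show "(if a \<odot> c \<in> pull m b S then s (b \<odot> (a \<odot> c)) else undefined) =
        rs (cs X) c (if a \<in> pull m b S then s (b \<odot> a) else undefined)"
      using a D(5)[OF ba c] cub_assoc[OF c ak b] by simp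
  qed simp
  then show "rs partial b w \<in> el partial m" by (simp add: partial_def)
next
  note Y = psh_cs[OF hom_Obj(2)[OF f]]
  fix n w assume "w \<in> el partial n"
  then obtain S s y where w: "w = (S, s, y)" "partial_el n (S, s, y)" by (cases w) (auto simp: partial_def)
  note D = partial_el_D[OF w(2)] and S = cofsieve_sieve[OF partial_el_D(1)[OF w(2)]]
  have "(if a \<in> S then s (cid n \<odot> a) else undefined) = s a" for a
    using D(6)[of a] sieve_cub[OF S, of a] cub_idl by auto
  then show "rs partial (cid n) w = w"
    using rs_id[OF Y] D(2) by (simp add: partial_def w(1) partial_rs_eq[OF cid_cub] pull_cid[OF S])
next
  note Y = psh_cs[OF hom_Obj(2)[OF f]]
  fix l m n a b w assume a: "a \<in> cub l m" and b: "b \<in> cub m n" and "w \<in> el partial n"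
  then obtain S s y where w: "w = (S, s, y)" "partial_el n (S, s, y)" by (cases w) (auto simp: partial_def)
  note D = partial_el_D[OF w(2)] and S = cofsieve_sieve[OF partial_el_D(1)[OF w(2)]]
  have "a \<odot> c \<in> pull m b S \<and> (b \<odot> a) \<odot> c = b \<odot> (a \<odot> c)" if c: "c \<in> pull l a (pull m b S)" for c
  proof -
    obtain k where k: "c \<in> cub k l" using c by (auto simp: pull_def)
    then show ?thesis using c cub_assoc[OF k a b] by (simp add: pull_iff)
  qed
  then show "rs partial (b \<odot> a) w = rs partial a (rs partial b w)"
    using rs_comp[OF Y a b] D(2)
    by (simp add: partial_def w(1) partial_rs_eq[OF a] partial_rs_eq[OF b] partial_rs_eq[OF comp_cub[OF a b]]
        pull_comp[OF S a b] fun_eq_iff)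
qed

lemma tinyp_partial: "tinyp partial"
  unfolding tinyp_def
proof (intro conjI allI psh_partial)
  fix n
  note X = hom_Obj(1)[OF f] and Y = hom_Obj(2)[OF f]
  have tn: "tiny (UNIV :: nat set)" by (rule tiny_countable) simp
  let ?F = "(\<lambda>w. fst (snd w)) ` el partial n" and ?B = "{undefined} \<union> (\<Union>m. fobj X m)"
  have B: "tiny ?B"
    using tinyp_el[OF tinyp_cs[OF X]] by (intro tiny_Un tiny_UN tn) (simp_all add: tiny_countable)
  have F: "\<exists>S y. partial_el n (S, s, y)" if "s \<in> ?F" for s
  proof -
    from that obtain w where "partial_el n w" "s = fst (snd w)" by (auto simp: partial_def simp del: split_paired_All)
    then show ?thesis by (intro exI[of _ "fst w"] exI[of _ "snd (snd w)"]) simp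
  qed
  have "tiny ?F"
  proof (rule tiny_functions[OF tiny_Cube B])
    fix s a assume "s \<in> ?F"
    then obtain S y where "partial_el n (S, s, y)" using F by blast
    note D = partial_el_D[OF this]
    show "s a \<in> ?B"
    proof (cases "a \<in> S")
      case True
      then show ?thesis using D(3)[OF True] sieve_cub[OF cofsieve_sieve[OF D(1)] True] by auto
    qed (simp add: D(6))
  next
    fix s s' assume s: "s \<in> ?F" and s': "s' \<in> ?F" and eq: "\<And>a. a \<in> Arr Cube ==> s a = s' a"
    from F[OF s] obtain S y where p1: "partial_el n (S, s, y)" by (elim exE)
    from F[OF s'] obtain S' y' where p2: "partial_el n (S', s', y')" by (elim exE)
    note p = p1 p2
    have "s a = s' a" for a
    proof (cases "a \<in> Arr Cube")
      case False
      then have "a \<notin> S" "a \<notin> S'"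
        using sieve_cub[OF cofsieve_sieve[OF partial_el_D(1)[OF p(1)]]] sieve_cub[OF cofsieve_sieve[OF partial_el_D(1)[OF p(2)]]]
          cub_Arr by blast+
      then show ?thesis using partial_el_D(6)[OF p(1)] partial_el_D(6)[OF p(2)] by simp
    qed (rule eq)
    then show "s = s'" by (rule HOL.ext)
  qed
  then have t: "tiny (Pow (Arr Cube) \<times> ?F \<times> fobj Y n)"
    using tinyp_el[OF tinyp_cs[OF Y], of n] by (intro tiny_Times tiny_Pow tiny_Cube) simp_all
  have "el partial n \<subseteq> Pow (Arr Cube) \<times> ?F \<times> fobj Y n"
  proof
    fix w assume w: "w \<in> el partial n"
    then obtain S s y where w': "w = (S, s, y)" "partial_el n (S, s, y)" by (cases w) (auto simp: partial_def)
    have "S \<subseteq> Arr Cube" using sieve_cub[OF cofsieve_sieve[OF partial_el_D(1)[OF w'(2)]]] cub_Arr by blast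
    moreover have "s \<in> ?F" using w w'(1) by (metis fst_conv snd_conv image_eqI)
    ultimately show "w \<in> Pow (Arr Cube) \<times> ?F \<times> fobj Y n"
      using partial_el_D(2)[OF w'(2)] w'(1) by simp
  qed
  then show "tiny (el partial n)" by (rule tiny_subset[OF t])
qed

text \<open>An element of \<open>X\<close>, as a partial element whose extent is everything.\<close>

definition total_el :: "nat => 'u => cube_arrow set \<times> (cube_arrow => 'u) \<times> 'u" where
  "total_el n x = ({a. \<exists>m. a \<in> cub m n}, \<lambda>a. if \<exists>m. a \<in> cub m n then rs (cs X) a x else undefined, ap f n x)"

lemma total_natm: "natm (cs X) partial total_el"
proof (rule natmI)
  note X = psh_cs[OF hom_Obj(1)[OF f]]
  fix n x assume "x \<in> el (cs X) n"
  then have x: "x \<in> fobj X n" by simp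
  have "partial_el n (total_el n x)"
    unfolding total_el_def
  proof (rule partial_el_I)
    fix a m assume a: "a \<in> cub m n"
    show "(if \<exists>m. a \<in> cub m n then rs (cs X) a x else undefined) \<in> fobj X m"
      "ap f m (if \<exists>m. a \<in> cub m n then rs (cs X) a x else undefined) = rs (cs Y) a (ap f n x)"
      using a rs_el[OF X a] x ap_rs[OF f a x] by auto
    fix b k assume b: "b \<in> cub k m"
    show "(if \<exists>m. a \<odot> b \<in> cub m n then rs (cs X) (a \<odot> b) x else undefined) =
        rs (cs X) b (if \<exists>m. a \<in> cub m n then rs (cs X) a x else undefined)"
      using a comp_cub[OF b a] rs_comp[OF X b a] x by auto
  qed (use cofsieve_top ap_el[OF f x] in auto)
  then show "total_el n x \<in> el partial n" by (simp add: partial_def)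
  fix m b assume b: "b \<in> cub m n"
  have p: "pull m b {a. \<exists>m. a \<in> cub m n} = {a. \<exists>k. a \<in> cub k m}"
    unfolding pull_def using comp_cub[OF _ b] by blast
  have "rs (cs X) a (rs (cs X) b x) = rs (cs X) (b \<odot> a) x \<and> (\<exists>m. b \<odot> a \<in> cub m n)" if a: "\<exists>k. a \<in> cub k m" for a
  proof -
    obtain k where k: "a \<in> cub k m" using a by blast
    then show ?thesis using rs_comp[OF X k b] x comp_cub[OF k b] by auto
  qed
  then show "total_el m (rs (cs X) b x) = rs partial b (total_el n x)"
    by (auto simp: partial_def total_el_def partial_rs_eq[OF b] p ap_rs[OF f b x] fun_eq_iff)
qed

text \<open>A sieve that contains the identity contains everything.\<close>

lemma total_iff:
  assumes w: "partial_el n (S, s, y)"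
  shows "cid n \<in> S \<longleftrightarrow> (\<exists>x \<in> fobj X n. (S, s, y) = total_el n x)"
    and "cid n \<in> S ==> (S, s, y) = total_el n (s (cid n))"
proof -
  note D = partial_el_D[OF w]
  show eq: "(S, s, y) = total_el n (s (cid n))" if c: "cid n \<in> S"
  proof -
    have S: "a \<in> S \<longleftrightarrow> (\<exists>m. a \<in> cub m n)" for a
      using sieve_cub[OF cofsieve_sieve[OF D(1)]] sieve_comp[OF cofsieve_sieve[OF D(1)] c cid_cub] cub_idl by metis
    have "s a = rs (cs X) a (s (cid n))" if "a \<in> cub m n" for m a
      using D(5)[OF c cid_cub that] cub_idl[OF that] by simp
    moreover have "ap f n (s (cid n)) = y"
      using D(4)[OF c cid_cub] rs_id[OF psh_cs[OF hom_Obj(2)[OF f]]] D(2) by simp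
    ultimately show ?thesis using D(6) S by (auto simp: total_el_def fun_eq_iff)
  qed
  show "cid n \<in> S \<longleftrightarrow> (\<exists>x \<in> fobj X n. (S, s, y) = total_el n x)"
    using eq D(3)[OF _ cid_cub] cid_cub unfolding total_el_def by blast
qed

lemma total_inj: "x \<in> fobj X n ==> x' \<in> fobj X n ==> total_el n x = total_el n x' ==> x = x'"
proof -
  assume x: "x \<in> fobj X n" "x' \<in> fobj X n" and "total_el n x = total_el n x'"
  then have "fst (snd (total_el n x)) (cid n) = fst (snd (total_el n x')) (cid n)" by simp
  moreover have "\<exists>m. cid n \<in> cub m n" using cid_cub by blast
  ultimately show "x = x'"
    using x rs_id[OF psh_cs[OF hom_Obj(1)[OF f]]] by (simp add: total_el_def)
qed

text \<open>A partial element becomes total upon restriction along exactly the arrows in its extent,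
  which is a cofibrant sieve.\<close>

lemma cof_total: "cof partial (\<lambda>n. {w \<in> el partial n. cid n \<in> fst w})"
  unfolding cof_def
proof (intro conjI allI ballI)
  have key: "cid m \<in> fst (rs partial a w) \<longleftrightarrow> a \<in> fst w" if "a \<in> cub m n" for m n a w
    using that by (cases w) (simp add: partial_def partial_rs_eq[OF that] pull_iff[OF cid_cub] cub_idr)
  show sub: "subf partial (\<lambda>n. {w \<in> el partial n. cid n \<in> fst w})"
    unfolding subf_def
  proof (intro conjI allI ballI)
    fix m n a w assume a: "a \<in> cub m n" and w: "w \<in> {w \<in> el partial n. cid n \<in> fst w}"
    then obtain S s y where w': "w = (S, s, y)" "partial_el n (S, s, y)" by (cases w) (auto simp: partial_def)
    have "a \<in> S" using sieve_comp[OF cofsieve_sieve[OF partial_el_D(1)[OF w'(2)]] _ cid_cub a] w w'(1) cub_idl[OF a] by simp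
    then show "rs partial a w \<in> {w \<in> el partial m. cid m \<in> fst w}"
      using rs_el[OF psh_partial a] w key[OF a, of w] w'(1) by simp
  qed auto
  fix n w assume w: "w \<in> el partial n"
  then obtain S s y where w': "w = (S, s, y)" "partial_el n (S, s, y)" by (cases w) (auto simp: partial_def)
  have "pbs partial (\<lambda>n. {w \<in> el partial n. cid n \<in> fst w}) n w = S"
    using rs_el[OF psh_partial _ w] key w'(1)
    by (intro sieve_eqI[OF sieve_pbs[OF psh_partial sub w] cofsieve_sieve[OF partial_el_D(1)[OF w'(2)]]])
      (simp add: pbs_iff)
  then show "cofsieve n (pbs partial (\<lambda>n. {w \<in> el partial n. cid n \<in> fst w}) n w)"
    using partial_el_D(1)[OF w'(2)] by simp
qed

text \<open>Partial elements classify partial maps with cofibrant domain. A map from \<open>A\<close> to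
  the object of partial elements is a partial map to \<open>X\<close> defined on the cofibrant part
  \<open>B\<close> of \<open>A\<close> where it is total; as \<open>B\<close> is then cofibrant in the
  whole of \<open>Z\<close>, the same partial map gives the extension to \<open>Z\<close>.\<close>

lemma factor_C_TFib: "\<exists>i \<in> \<C>. \<exists>p \<in> TFib \<C>. Cod cS i = Dom cS p \<and> f = p \<bullet> i"
proof -
  note X = hom_Obj(1)[OF f] and Y = hom_Obj(2)[OF f]
  obtain M e d where M: "M \<in> Obj cS" and iso: "natiso partial (cs M) e d" using cset_coding[OF tinyp_partial] by blast
  have e: "natm partial (cs M) e" and d: "natm (cs M) partial d" and de: "\<And>n w. w \<in> el partial n ==> d n (e n w) = w"
    and ed: "\<And>n x. x \<in> fobj M n ==> e n (d n x) = x"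
    using iso unfolding natiso_def by simp_all
  have del: "d n x \<in> el partial n" if "x \<in> fobj M n" for n x using natm_el[OF d] that by simp
  have tel: "total_el n x \<in> el partial n" if "x \<in> fobj X n" for n x using natm_el[OF total_natm] that by simp
  have out: "natm partial (cs Y) (\<lambda>n w. snd (snd w))"
  proof (rule natmI)
    show "snd (snd w) \<in> el (cs Y) n" if "w \<in> el partial n" for n w
      using that partial_el_D(2) by (cases w) (auto simp: partial_def)
    show "snd (snd (rs partial a w)) = rs (cs Y) a (snd (snd w))" if "a \<in> cub m n" for m n a w
      using that by (cases w) (simp add: partial_def partial_rs_eq[OF that])
  qed
  let ?i = "mp X M (\<lambda>n x. e n (total_el n x))" and ?p = "mp M Y (\<lambda>n x. snd (snd (d n x)))"
  have i: "?i \<in> hom cS X M" by (rule mp_hom[OF X M natm_comp[OF total_natm e]])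
  have p: "?p \<in> hom cS M Y" by (rule mp_hom[OF M Y natm_comp[OF d out]])
  have imi: "img ?i n = {x \<in> el (cs M) n. d n x \<in> {w \<in> el partial n. cid n \<in> fst w}}" for n
  proof (intro equalityI subsetI)
    fix x assume "x \<in> img ?i n"
    then obtain x' where x': "x' \<in> fobj X n" "x = e n (total_el n x')" by (auto simp: img_def)
    then show "x \<in> {x \<in> el (cs M) n. d n x \<in> {w \<in> el partial n. cid n \<in> fst w}}"
      using natm_el[OF e tel[OF x'(1)]] tel[OF x'(1)] cid_cub by (auto simp: de total_el_def)
  next
    fix x assume "x \<in> {x \<in> el (cs M) n. d n x \<in> {w \<in> el partial n. cid n \<in> fst w}}"
    then have x: "x \<in> fobj M n" "cid n \<in> fst (d n x)" by auto
    obtain S s y where w: "d n x = (S, s, y)" by (cases "d n x")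
    then have "partial_el n (S, s, y)" using del[OF x(1)] by (simp add: partial_def)
    then obtain x' where "x' \<in> fobj X n" "d n x = total_el n x'" using total_iff(1) x(2) w by auto
    then show "x \<in> img ?i n" using ed[OF x(1)] by (auto simp: img_def intro!: image_eqI[of _ _ x'])
  qed
  have "?i \<in> \<C>"
    unfolding cofibration_iff[OF i]
  proof (intro conjI allI)
    show "inj_on (ap ?i n) (fobj X n)" for n
    proof (rule inj_onI)
      fix x x' assume x: "x \<in> fobj X n" "x' \<in> fobj X n" and "ap ?i n x = ap ?i n x'"
      then have "e n (total_el n x) = e n (total_el n x')" by simp
      from arg_cong[OF this, of "d n"] show "x = x'"
        unfolding de[OF tel[OF x(1)]] de[OF tel[OF x(2)]] by (rule total_inj[OF x])
    qed
    have "img ?i = (\<lambda>n. {x \<in> el (cs M) n. d n x \<in> {w \<in> el partial n. cid n \<in> fst w}})" using imi by (rule HOL.ext)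
    then show "cof (cs M) (img ?i)" using cof_preimage[OF cof_total d psh_cs[OF M]] by simp
  qed
  moreover have "?p \<in> TFib \<C>"
  proof (rule TFib_I[OF p], rule extI[OF p])
    fix Z A u v assume Z: "Z \<in> Obj cS" and A: "cof (cs Z) A" and u: "natm (restr (cs Z) A) (cs M) u"
      and v: "natm (cs Z) (cs Y) v" and uv: "\<And>n z. z \<in> A n ==> ap ?p n (u n z) = v n z"
    note ps = psh_cs[OF Z]
    note du = natm_comp[OF u d]
    have dul: "d n (u n z) \<in> el partial n" if "z \<in> A n" for n z using natm_el[OF du, of z n] that by simp
    have uM: "u n z \<in> fobj M n" if "z \<in> A n" for n z using natm_el[OF u, of z n] that by simp
    have v': "snd (snd (d n (u n z))) = v n z" if "z \<in> A n" for n z using uv[OF that] uM[OF that] by simp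
    define B where "B n = {z \<in> el (restr (cs Z) A) n. d n (u n z) \<in> {w \<in> el partial n. cid n \<in> fst w}}" for n
    have Bz: "z \<in> B n \<longleftrightarrow> z \<in> A n \<and> cid n \<in> fst (d n (u n z))" for n z
      using dul by (auto simp: B_def)
    have B: "cof (cs Z) B"
      unfolding B_def by (rule cof_trans[OF A cof_preimage[OF cof_total du psh_restr[OF ps cof_subf[OF A]]] ps])
    define x where "x n z = fst (snd (d n (u n z))) (cid n)" for n z
    have tot: "d n (u n z) = total_el n (x n z)" "x n z \<in> fobj X n" if z: "z \<in> B n" for n z
    proof -
      obtain S s y where w: "d n (u n z) = (S, s, y)" by (cases "d n (u n z)")
      then have pe: "partial_el n (S, s, y)" "cid n \<in> S" using dul[of z n] Bz[of z n] z by (auto simp: partial_def)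
      have xs: "x n z = s (cid n)" by (simp add: x_def w)
      show "d n (u n z) = total_el n (x n z)" unfolding xs w by (rule total_iff(2)[OF pe])
      show "x n z \<in> fobj X n" unfolding xs by (rule partial_el_D(3)[OF pe cid_cub])
    qed
    have xrs: "x m (rs (cs Z) a z) = rs (cs X) a (x n z)" if a: "a \<in> cub m n" and z: "z \<in> B n" for m n a z
    proof -
      note az = subf_rs[OF cof_subf[OF B] a z]
      have "total_el m (x m (rs (cs Z) a z)) = rs partial a (total_el n (x n z))"
        using natm_rs[OF du a, of z] z Bz tot(1)[OF az] tot(1)[OF z] by simp
      also have "\<dots> = total_el m (rs (cs X) a (x n z))" using natm_rs[OF total_natm a] tot(2)[OF z] by simp
      finally show ?thesis
        using total_inj[OF tot(2)[OF az]] rs_el[OF psh_cs[OF X] a] tot(2)[OF z] by simp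
    qed
    let ?S = "pbs (cs Z) B"
    \<comment> \<open>the extent at \<open>z\<close> consists of the restrictions of \<open>z\<close>
      that lie in \<open>B\<close>\<close>
    define w where "w n z = (?S n z, \<lambda>a. if a \<in> ?S n z then x (Dom Cube a) (rs (cs Z) a z) else undefined, v n z)" for n z
    have wel: "w n z \<in> el partial n" if z: "z \<in> el (cs Z) n" for n z
    proof -
      have "partial_el n (w n z)"
        unfolding w_def
      proof (rule partial_el_I)
        show "cofsieve n (?S n z)" by (rule cof_K[OF B z])
        show "v n z \<in> fobj Y n" using natm_el[OF v z] by simp
        fix a m assume a: "a \<in> ?S n z" and am: "a \<in> cub m n"
        then have az: "rs (cs Z) a z \<in> B m" by (simp add: pbs_iff)
        have "ap f m (x m (rs (cs Z) a z)) = v m (rs (cs Z) a z)"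
          using tot[OF az] v'[of "rs (cs Z) a z" m] az Bz by (simp add: total_el_def)
        then show "(if a \<in> ?S n z then x (Dom Cube a) (rs (cs Z) a z) else undefined) \<in> fobj X m"
          "ap f m (if a \<in> ?S n z then x (Dom Cube a) (rs (cs Z) a z) else undefined) = rs (cs Y) a (v n z)"
          using a tot(2)[OF az] natm_rs[OF v am z] by (simp_all add: cub_Dom[OF am])
        fix b k assume b: "b \<in> cub k m"
        have "a \<odot> b \<in> ?S n z" by (rule sieve_comp[OF cofsieve_sieve[OF cof_K[OF B z]] a am b])
        then show "(if a \<odot> b \<in> ?S n z then x (Dom Cube (a \<odot> b)) (rs (cs Z) (a \<odot> b) z) else undefined) =
            rs (cs X) b (if a \<in> ?S n z then x (Dom Cube a) (rs (cs Z) a z) else undefined)"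
          using a xrs[OF b az] rs_comp[OF ps b am z] by (simp add: cub_Dom[OF am] cub_Dom[OF comp_cub[OF b am]])
      qed simp
      then show ?thesis by (simp add: partial_def)
    qed
    have w: "natm (cs Z) partial w"
    proof (rule natmI)
      fix m n b z assume b: "b \<in> cub m n" and z: "z \<in> el (cs Z) n"
      have "x (Dom Cube a) (rs (cs Z) a (rs (cs Z) b z)) = x (Dom Cube (b \<odot> a)) (rs (cs Z) (b \<odot> a) z) \<and> b \<odot> a \<in> ?S n z"
        if a: "a \<in> pull m b (?S n z)" for a
      proof -
        obtain k where k: "a \<in> cub k m" "b \<odot> a \<in> ?S n z" using a by (auto simp: pull_def)
        then show ?thesis using rs_comp[OF ps k(1) b z] by (simp add: cub_Dom[OF k(1)] cub_Dom[OF comp_cub[OF k(1) b]])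
      qed
      then show "w m (rs (cs Z) b z) = rs partial b (w n z)"
        by (simp add: w_def partial_def partial_rs_eq[OF b] pull_pbs[OF ps z b] natm_rs[OF v b z] fun_eq_iff)
    qed (rule wel)
    show "\<exists>w. natm (cs Z) (cs M) w \<and> (\<forall>n. \<forall>z \<in> A n. w n z = u n z) \<and> (\<forall>n. \<forall>z \<in> el (cs Z) n. ap ?p n (w n z) = v n z)"
    proof (intro exI conjI allI ballI)
      show "natm (cs Z) (cs M) (\<lambda>n z. e n (w n z))" by (rule natm_comp[OF w e])
      show "ap ?p n (e n (w n z)) = v n z" if z: "z \<in> el (cs Z) n" for n z
        using natm_el[OF e wel[OF z]] de[OF wel[OF z]] by (simp add: w_def)
      fix n z assume z: "z \<in> A n"
      obtain S s y where dw: "d n (u n z) = (S, s, y)" by (cases "d n (u n z)")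
      then have pe: "partial_el n (S, s, y)" using dul[OF z] by (auto simp: partial_def)
      note D = partial_el_D[OF pe]
      have zZ: "z \<in> el (cs Z) n" using subf_el[OF cof_subf[OF A] z] .
      have da: "d m (u m (rs (cs Z) a z)) = partial_rs a (S, s, y)" if "a \<in> cub m n" for m a
        using natm_rs[OF du that, of z] z dw by (simp add: partial_def)
      have S: "?S n z = S"
      proof (rule sieve_eqI[OF cofsieve_sieve[OF cof_K[OF B zZ]] cofsieve_sieve[OF D(1)]])
        fix m a assume a: "a \<in> cub m n"
        show "a \<in> ?S n z \<longleftrightarrow> a \<in> S"
          using subf_rs[OF cof_subf[OF A] a z]
          by (simp add: pbs_iff[OF a] Bz da[OF a] partial_rs_eq[OF a] pull_iff[OF cid_cub] cub_idr[OF a])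
      qed
      have "(if a \<in> S then x (Dom Cube a) (rs (cs Z) a z) else undefined) = s a" for a
      proof (cases "a \<in> S")
        case True
        obtain m where m: "a \<in> cub m n" using sieve_cub[OF cofsieve_sieve[OF D(1)] True] by blast
        then show ?thesis
          using True by (simp add: cub_Dom[OF m] x_def da[OF m] partial_rs_eq[OF m] pull_iff[OF cid_cub] cub_idr[OF m])
      qed (simp add: D(6))
      moreover have "v n z = y" using v'[OF z] dw by simp
      ultimately have "w n z = d n (u n z)" by (simp add: w_def S dw)
      then show "e n (w n z) = u n z" using ed[OF uM[OF z]] by simp
    qed
  qed
  moreover have "f = ?p \<bullet> ?i"
  proof (rule hom_ext[OF f comp_hom[OF i p]])
    fix n x assume x: "x \<in> fobj X n"
    have "e n (total_el n x) \<in> fobj M n" "snd (snd (total_el n x)) = ap f n x"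
      using natm_el[OF e tel[OF x]] by (simp_all add: total_el_def)
    then show "ap f n x = ap (?p \<bullet> ?i) n x" by (simp add: ap_comp[OF i x] x de[OF tel[OF x]])
  qed
  ultimately show ?thesis by (intro bexI[of _ ?i] bexI[of _ ?p]) simp_all
qed

end

end


section \<open>The factorization into a trivial cofibration and a fibration\<close>

subsection \<open>The presheaf of box filling problems\<close>

text \<open>Membership of \<open>(a, r)\<close> in the open box on the cube \<open>I\<^sup>n\<close>
  with sieve \<open>S\<close> and bottom \<open>i\<close>.\<close>

definition open_box :: "nat => cube_arrow set => cube_arrow => cube_arrow => cube_arrow => bool" where
  "open_box n S i a r \<longleftrightarrow> (\<exists>m. a \<in> cub m n \<and> r \<in> cub m 1 \<and> (a \<in> S \<or> r = i \<odot> a))"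

text \<open>Maps out of \<open>I\<^sup>n \<times> I\<close> and out of boxes are represented by
  functions on arrows. Values off the domain are normalized by \<open>ynorm\<close> and
  \<open>snorm\<close>, so that equal maps are equal functions.\<close>

definition ynorm :: "nat => (cube_arrow => cube_arrow => 'y) => cube_arrow => cube_arrow => 'y" where
  "ynorm n y = (\<lambda>a r. if \<exists>m. a \<in> cub m n \<and> r \<in> cub m 1 then y a r else undefined)"

definition snorm :: "nat => cube_arrow set => cube_arrow => (cube_arrow => cube_arrow => 'e) =>
    cube_arrow => cube_arrow => 'e" where
  "snorm n S i s = (\<lambda>a r. if open_box n S i a r then s a r else undefined)"

lemma ynorm_eq [simp]: "a \<in> cub m n ==> r \<in> cub m 1 ==> ynorm n y a r = y a r"
  by (auto simp: ynorm_def)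

lemma snorm_eq: "a \<in> cub m n ==> r \<in> cub m 1 ==> a \<in> S \<or> r = i \<odot> a ==> snorm n S i s a r = s a r"
  by (auto simp: snorm_def open_box_def)

lemma ynorm_cong: "(\<And>m a r. a \<in> cub m n ==> r \<in> cub m 1 ==> y a r = y' a r) ==> ynorm n y = ynorm n y'"
  by (auto simp: ynorm_def fun_eq_iff)

lemma snorm_cong: "(\<And>m a r. a \<in> cub m n ==> r \<in> cub m 1 ==> a \<in> S \<or> r = i \<odot> a ==> s a r = s' a r) ==>
    snorm n S i s = snorm n S i s'"
  by (auto simp: snorm_def open_box_def fun_eq_iff)

context cubical_cofibrations
begin

text \<open>A box filling problem at stage \<open>n\<close> for \<open>q : E \<rightarrow> Y\<close>: a
  map \<open>y\<close> from \<open>I\<^sup>n \<times> I\<close> to \<open>Y\<close> with a lift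
  \<open>s\<close> of it to \<open>E\<close> on the box.\<close>

definition problem :: "'u cset => 'e psh => (nat => 'e => 'u) => nat => cube_arrow set => cube_arrow =>
    (cube_arrow => cube_arrow => 'u) => (cube_arrow => cube_arrow => 'e) => bool" where
  "problem Y E q n S i y s \<longleftrightarrow> cofsieve n S \<and> i \<in> cub n 1 \<and>
    (\<forall>m. \<forall>a \<in> cub m n. \<forall>r \<in> cub m 1. y a r \<in> fobj Y m \<and>
      (\<forall>k. \<forall>b \<in> cub k m. y (a \<odot> b) (r \<odot> b) = rs (cs Y) b (y a r))) \<and>
    (\<forall>m. \<forall>a \<in> cub m n. \<forall>r \<in> cub m 1. a \<in> S \<or> r = i \<odot> a \<longrightarrow> s a r \<in> el E m \<and> q m (s a r) = y a r \<and>
      (\<forall>k. \<forall>b \<in> cub k m. s (a \<odot> b) (r \<odot> b) = rs E b (s a r)))"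

lemma problem_D:
  assumes "problem Y E q n S i y s"
  shows "cofsieve n S" "i \<in> cub n 1"
    and "a \<in> cub m n ==> r \<in> cub m 1 ==> y a r \<in> fobj Y m"
    and "a \<in> cub m n ==> r \<in> cub m 1 ==> b \<in> cub k m ==> y (a \<odot> b) (r \<odot> b) = rs (cs Y) b (y a r)"
    and "a \<in> cub m n ==> r \<in> cub m 1 ==> a \<in> S \<or> r = i \<odot> a ==> s a r \<in> el E m"
    and "a \<in> cub m n ==> r \<in> cub m 1 ==> a \<in> S \<or> r = i \<odot> a ==> q m (s a r) = y a r"
    and "a \<in> cub m n ==> r \<in> cub m 1 ==> a \<in> S \<or> r = i \<odot> a ==> b \<in> cub k m ==>
      s (a \<odot> b) (r \<odot> b) = rs E b (s a r)"
  using assms unfolding problem_def by blast+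

lemma problem_I:
  assumes "cofsieve n S" "i \<in> cub n 1"
    and "\<And>m a r. a \<in> cub m n ==> r \<in> cub m 1 ==> y a r \<in> fobj Y m"
    and "\<And>m k a r b. a \<in> cub m n ==> r \<in> cub m 1 ==> b \<in> cub k m ==> y (a \<odot> b) (r \<odot> b) = rs (cs Y) b (y a r)"
    and "\<And>m a r. a \<in> cub m n ==> r \<in> cub m 1 ==> a \<in> S \<or> r = i \<odot> a ==> s a r \<in> el E m"
    and "\<And>m a r. a \<in> cub m n ==> r \<in> cub m 1 ==> a \<in> S \<or> r = i \<odot> a ==> q m (s a r) = y a r"
    and "\<And>m k a r b. a \<in> cub m n ==> r \<in> cub m 1 ==> a \<in> S \<or> r = i \<odot> a ==> b \<in> cub k m ==>
      s (a \<odot> b) (r \<odot> b) = rs E b (s a r)"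
  shows "problem Y E q n S i y s"
  unfolding problem_def by (intro conjI allI ballI impI; rule assms; assumption)

lemma box_shift:
  assumes "sieve n S" "i \<in> cub n 1" "a \<in> cub m n" "b \<in> cub k m" "a \<in> S \<or> r = i \<odot> a"
  shows "a \<odot> b \<in> S \<or> r \<odot> b = i \<odot> (a \<odot> b)"
  using assms sieve_comp[OF assms(1) _ assms(3,4)] cub_assoc[OF assms(4,3,2)] by auto

lemma box_pull:
  assumes "i \<in> cub n 1" "b \<in> cub m n" "a \<in> cub k m"
  shows "a \<in> pull m b S \<or> r = (i \<odot> b) \<odot> a \<longleftrightarrow> b \<odot> a \<in> S \<or> r = i \<odot> (b \<odot> a)"
  using cub_assoc[OF assms(3,2,1)] by (simp add: pull_iff[OF assms(3)])

lemma problem_cong: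
  assumes p: "problem Y E q n S i y s"
    and y: "\<And>m a r. a \<in> cub m n ==> r \<in> cub m 1 ==> y' a r = y a r"
    and s: "\<And>m a r. a \<in> cub m n ==> r \<in> cub m 1 ==> a \<in> S \<or> r = i \<odot> a ==> s' a r = s a r"
  shows "problem Y E q n S i y' s'"
proof (rule problem_I)
  note D = problem_D[OF p]
  show "cofsieve n S" "i \<in> cub n 1" by (rule D)+
  fix m a r assume a: "a \<in> cub m n" and r: "r \<in> cub m 1"
  show "y' a r \<in> fobj Y m" using y[OF a r] D(3)[OF a r] by simp
  show "y' (a \<odot> b) (r \<odot> b) = rs (cs Y) b (y' a r)" if b: "b \<in> cub k m" for k b
    using y[OF a r] y[OF comp_cub[OF b a] comp_cub[OF b r]] D(4)[OF a r b] by simp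
  assume ar: "a \<in> S \<or> r = i \<odot> a"
  show "s' a r \<in> el E m" "q m (s' a r) = y' a r"
    using s[OF a r ar] y[OF a r] D(5,6)[OF a r ar] by simp_all
  show "s' (a \<odot> b) (r \<odot> b) = rs E b (s' a r)" if b: "b \<in> cub k m" for k b
    using s[OF a r ar] s[OF comp_cub[OF b a] comp_cub[OF b r] box_shift[OF cofsieve_sieve[OF D(1)] D(2) a b ar]]
      D(7)[OF a r ar b] by simp
qed

lemma problem_norm: "problem Y E q n S i y s ==> problem Y E q n S i (ynorm n y) (snorm n S i s)"
  by (erule problem_cong) (simp_all add: snorm_eq)

lemma problem_shift:
  assumes p: "problem Y E q n S i y s" and b: "b \<in> cub m n"
  shows "problem Y E q m (pull m b S) (i \<odot> b) (\<lambda>a r. y (b \<odot> a) r) (\<lambda>a r. s (b \<odot> a) r)"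
proof (rule problem_I)
  note D = problem_D[OF p]
  show "cofsieve m (pull m b S)" "i \<odot> b \<in> cub m 1" using cofsieve_pull[OF D(1) b] comp_cub[OF b D(2)] .
  fix k a r assume a: "a \<in> cub k m" and r: "r \<in> cub k 1"
  note ba = comp_cub[OF a b]
  show "y (b \<odot> a) r \<in> fobj Y k" by (rule D(3)[OF ba r])
  show "y (b \<odot> (a \<odot> c)) (r \<odot> c) = rs (cs Y) c (y (b \<odot> a) r)" if c: "c \<in> cub l k" for l c
    using D(4)[OF ba r c] cub_assoc[OF c a b] by simp
  assume "a \<in> pull m b S \<or> r = (i \<odot> b) \<odot> a"
  then have ar: "b \<odot> a \<in> S \<or> r = i \<odot> (b \<odot> a)" using box_pull[OF D(2) b a] by simp
  show "s (b \<odot> a) r \<in> el E k" "q k (s (b \<odot> a) r) = y (b \<odot> a) r" using D(5,6)[OF ba r ar] .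
  show "s (b \<odot> (a \<odot> c)) (r \<odot> c) = rs E c (s (b \<odot> a) r)" if c: "c \<in> cub l k" for l c
    using D(7)[OF ba r ar c] cub_assoc[OF c a b] by simp
qed

lemma norm_shift:
  assumes i: "i \<in> cub n 1" and b: "b \<in> cub m n"
  shows "ynorm m (\<lambda>a r. ynorm n y (b \<odot> a) r) = ynorm m (\<lambda>a r. y (b \<odot> a) r)"
    and "snorm m (pull m b S) (i \<odot> b) (\<lambda>a r. snorm n S i s (b \<odot> a) r) = snorm m (pull m b S) (i \<odot> b) (\<lambda>a r. s (b \<odot> a) r)"
proof -
  show "ynorm m (\<lambda>a r. ynorm n y (b \<odot> a) r) = ynorm m (\<lambda>a r. y (b \<odot> a) r)"
    using ynorm_eq[OF comp_cub[OF _ b]] by (rule ynorm_cong)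
  show "snorm m (pull m b S) (i \<odot> b) (\<lambda>a r. snorm n S i s (b \<odot> a) r) = snorm m (pull m b S) (i \<odot> b) (\<lambda>a r. s (b \<odot> a) r)"
  proof (rule snorm_cong)
    fix k a r assume a: "a \<in> cub k m" and r: "r \<in> cub k 1" and "a \<in> pull m b S \<or> r = (i \<odot> b) \<odot> a"
    then show "snorm n S i s (b \<odot> a) r = s (b \<odot> a) r"
      using snorm_eq[OF comp_cub[OF a b] r] box_pull[OF i b a] by simp
  qed
qed

lemma ynorm_idem: "ynorm n (ynorm n y) = ynorm n y" and snorm_idem: "snorm n S i (snorm n S i s) = snorm n S i s"
  by (simp_all add: ynorm_def snorm_def fun_eq_iff)

text \<open>Over this presheaf lies the universal filling problem. Solving that one problem gives
  solutions of all problems which are compatible with restriction.\<close>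

definition Prob :: "'u cset => 'e psh => (nat => 'e => 'u) =>
    (cube_arrow set \<times> cube_arrow \<times> (cube_arrow => cube_arrow => 'u) \<times> (cube_arrow => cube_arrow => 'e)) psh" where
  "Prob Y E q = Psh
    (\<lambda>n. {(S, i, y, s). problem Y E q n S i y s \<and> ynorm n y = y \<and> snorm n S i s = s})
    (\<lambda>b (S, i, y, s). (pull (Dom Cube b) b S, i \<odot> b, ynorm (Dom Cube b) (\<lambda>a r. y (b \<odot> a) r),
      snorm (Dom Cube b) (pull (Dom Cube b) b S) (i \<odot> b) (\<lambda>a r. s (b \<odot> a) r)))"

lemma el_Prob: "(S, i, y, s) \<in> el (Prob Y E q) n \<longleftrightarrow> problem Y E q n S i y s \<and> ynorm n y = y \<and> snorm n S i s = s"
  by (simp add: Prob_def)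

lemma rs_Prob: "b \<in> cub m n ==> rs (Prob Y E q) b (S, i, y, s) = (pull m b S, i \<odot> b, ynorm m (\<lambda>a r. y (b \<odot> a) r),
      snorm m (pull m b S) (i \<odot> b) (\<lambda>a r. s (b \<odot> a) r))"
  by (simp add: Prob_def cub_Dom)

lemma Prob_cases:
  assumes "w \<in> el (Prob Y E q) n"
  obtains S i y s where "w = (S, i, y, s)" "problem Y E q n S i y s" "ynorm n y = y" "snorm n S i s = s"
  using assms by (cases w) (auto simp: el_Prob)

lemma psh_Prob: "psh (Prob Y E q)"
proof (rule pshI)
  fix m n b w assume b: "b \<in> cub m n" and "w \<in> el (Prob Y E q) n"
  then obtain S i y s where w: "w = (S, i, y, s)" "problem Y E q n S i y s" using Prob_cases by metis
  then show "rs (Prob Y E q) b w \<in> el (Prob Y E q) m"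
    using problem_norm[OF problem_shift[OF w(2) b]] by (simp add: rs_Prob[OF b] el_Prob ynorm_idem snorm_idem)
next
  fix n w assume "w \<in> el (Prob Y E q) n"
  then obtain S i y s where w: "w = (S, i, y, s)" "problem Y E q n S i y s" "ynorm n y = y" "snorm n S i s = s"
    by (rule Prob_cases)
  note D = problem_D[OF w(2)]
  have "ynorm n (\<lambda>a r. y (cid n \<odot> a) r) = ynorm n y" by (rule ynorm_cong) (simp add: cub_idl)
  moreover have "snorm n S i (\<lambda>a r. s (cid n \<odot> a) r) = snorm n S i s" by (rule snorm_cong) (simp add: cub_idl)
  ultimately show "rs (Prob Y E q) (cid n) w = w"
    using w(3,4) by (simp add: w(1) rs_Prob[OF cid_cub] pull_cid[OF cofsieve_sieve[OF D(1)]] cub_idr[OF D(2)])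
next
  fix l m n a b w assume a: "a \<in> cub l m" and b: "b \<in> cub m n" and "w \<in> el (Prob Y E q) n"
  then obtain S i y s where w: "w = (S, i, y, s)" "problem Y E q n S i y s" using Prob_cases by metis
  note D = problem_D[OF w(2)]
  have "ynorm l (\<lambda>c r. y ((b \<odot> a) \<odot> c) r) = ynorm l (\<lambda>c r. y (b \<odot> (a \<odot> c)) r)"
    by (rule ynorm_cong) (simp add: cub_assoc[OF _ a b])
  moreover have "snorm l T j (\<lambda>c r. s ((b \<odot> a) \<odot> c) r) = snorm l T j (\<lambda>c r. s (b \<odot> (a \<odot> c)) r)" for T j
    by (rule snorm_cong) (simp add: cub_assoc[OF _ a b])
  ultimately show "rs (Prob Y E q) (b \<odot> a) w = rs (Prob Y E q) a (rs (Prob Y E q) b w)"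
    by (simp add: norm_shift[OF comp_cub[OF b D(2)] a] w(1) rs_Prob[OF a] rs_Prob[OF b] rs_Prob[OF comp_cub[OF a b]] pull_comp[OF cofsieve_sieve[OF D(1)] a b]
        cub_assoc[OF a b D(2), symmetric])
qed

lemma tiny_functions2:
  assumes B: "tiny B" and F: "\<And>s a r. s \<in> F ==> s a r \<in> B"
    and u: "\<And>s a r. s \<in> F ==> \<not> (a \<in> Arr Cube \<and> r \<in> Arr Cube) ==> s a r = undefined"
  shows "tiny (F :: (cube_arrow => cube_arrow => 'b) set)"
proof -
  have "tiny (case_prod ` F)"
  proof (rule tiny_functions[OF tiny_Times[OF tiny_Cube tiny_Cube] B])
    show "f d \<in> B" if "f \<in> case_prod ` F" for f d using that F by (auto simp: split_beta)
    fix f g assume "f \<in> case_prod ` F" "g \<in> case_prod ` F" and eq: "\<And>d. d \<in> Arr Cube \<times> Arr Cube ==> f d = g d"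
    then obtain s t where st: "s \<in> F" "t \<in> F" "f = case_prod s" "g = case_prod t" by auto
    have "s a r = t a r" for a r
      using eq[of "(a, r)"] u[OF st(1), of a r] u[OF st(2), of a r] st(3,4)
      by (cases "a \<in> Arr Cube \<and> r \<in> Arr Cube") auto
    then show "f = g" by (simp add: st fun_eq_iff)
  qed
  then show ?thesis by (rule tiny_inj[rotated -1]) (auto simp: inj_on_def fun_eq_iff)
qed

lemma tinyp_Prob:
  assumes Y: "Y \<in> Obj cS" and E: "tinyp E"
  shows "tinyp (Prob Y E q)"
  unfolding tinyp_def
proof (intro conjI allI psh_Prob)
  fix n
  have tn: "tiny (UNIV :: nat set)" by (rule tiny_countable) simp
  let ?Fy = "{y. (\<forall>a r. y a r \<in> {undefined} \<union> (\<Union>m. fobj Y m)) \<and> (\<forall>a r. \<not> (a \<in> Arr Cube \<and> r \<in> Arr Cube) \<longrightarrow> y a r = undefined)}"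
  let ?Fs = "{y. (\<forall>a r. y a r \<in> {undefined} \<union> (\<Union>m. el E m)) \<and> (\<forall>a r. \<not> (a \<in> Arr Cube \<and> r \<in> Arr Cube) \<longrightarrow> y a r = undefined)}"
  have "tiny ({undefined} \<union> (\<Union>m. fobj Y m))"
    using tinyp_el[OF tinyp_cs[OF Y]] by (intro tiny_Un tiny_UN tn) (simp_all add: tiny_countable)
  then have y: "tiny ?Fy" by (rule tiny_functions2) blast+
  have "tiny ({undefined} \<union> (\<Union>m. el E m))"
    using tinyp_el[OF E] by (intro tiny_Un tiny_UN tn) (simp_all add: tiny_countable)
  then have s: "tiny ?Fs" by (rule tiny_functions2) blast+
  have "el (Prob Y E q) n \<subseteq> Pow (Arr Cube) \<times> Arr Cube \<times> ?Fy \<times> ?Fs"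
  proof
    fix w assume "w \<in> el (Prob Y E q) n"
    then obtain S i y s where w: "w = (S, i, y, s)" "problem Y E q n S i y s" "ynorm n y = y" "snorm n S i s = s"
      by (rule Prob_cases)
    note D = problem_D[OF w(2)]
    have "S \<subseteq> Arr Cube" using sieve_cub[OF cofsieve_sieve[OF D(1)]] cub_Arr by blast
    moreover have "i \<in> Arr Cube" using D(2) by (rule cub_Arr)
    moreover have "y a r \<in> {undefined} \<union> (\<Union>m. fobj Y m)" "\<not> (a \<in> Arr Cube \<and> r \<in> Arr Cube) ==> y a r = undefined" for a r
    proof -
      have e: "y a r = (if \<exists>m. a \<in> cub m n \<and> r \<in> cub m 1 then y a r else undefined)"
        using fun_cong[OF fun_cong[OF w(3)], of a r] by (simp add: ynorm_def)
      show "y a r \<in> {undefined} \<union> (\<Union>m. fobj Y m)"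
        using D(3) e by (cases "\<exists>m. a \<in> cub m n \<and> r \<in> cub m 1") auto
      show "\<not> (a \<in> Arr Cube \<and> r \<in> Arr Cube) ==> y a r = undefined"
        using e cub_Arr by (cases "\<exists>m. a \<in> cub m n \<and> r \<in> cub m 1") auto
    qed
    moreover have "s a r \<in> {undefined} \<union> (\<Union>m. el E m)" "\<not> (a \<in> Arr Cube \<and> r \<in> Arr Cube) ==> s a r = undefined" for a r
    proof -
      have e: "s a r = (if open_box n S i a r then s a r else undefined)"
        using fun_cong[OF fun_cong[OF w(4)], of a r] by (simp add: snorm_def)
      show "s a r \<in> {undefined} \<union> (\<Union>m. el E m)"
      proof (cases "open_box n S i a r")
        case True
        then obtain m where "a \<in> cub m n" "r \<in> cub m 1" "a \<in> S \<or> r = i \<odot> a" unfolding open_box_def by blast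
        from D(5)[OF this] show ?thesis by blast
      qed (use e in simp)
      assume "\<not> (a \<in> Arr Cube \<and> r \<in> Arr Cube)"
      then have "\<not> open_box n S i a r" using cub_Arr unfolding open_box_def by blast
      then show "s a r = undefined" using e by simp
    qed
    ultimately show "w \<in> Pow (Arr Cube) \<times> Arr Cube \<times> ?Fy \<times> ?Fs" by (simp add: w(1))
  qed
  then show "tiny (el (Prob Y E q) n)"
    by (rule tiny_subset[rotated]) (intro tiny_Times tiny_Pow tiny_Cube y s)
qed

lemma cof_Prob: "cof (Prob Y E q) (\<lambda>n. {w \<in> el (Prob Y E q) n. cid n \<in> fst w})"
proof -
  have key: "cid m \<in> fst (rs (Prob Y E q) a w) \<longleftrightarrow> a \<in> fst w" if "a \<in> cub m n" for m n a w
    using that by (cases w) (simp add: rs_Prob[OF that] pull_iff[OF cid_cub] cub_idr)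
  have cofsieve: "cofsieve n (fst w)" if "w \<in> el (Prob Y E q) n" for n w
    using that by (rule Prob_cases) (simp add: problem_D(1))
  have sub: "subf (Prob Y E q) (\<lambda>n. {w \<in> el (Prob Y E q) n. cid n \<in> fst w})"
    unfolding subf_def
  proof (intro conjI allI ballI)
    fix m n a w assume a: "a \<in> cub m n" and w: "w \<in> {w \<in> el (Prob Y E q) n. cid n \<in> fst w}"
    then have "a \<in> fst w" using sieve_comp[OF cofsieve_sieve[OF cofsieve] _ cid_cub a, of w] cub_idl[OF a] by simp
    then show "rs (Prob Y E q) a w \<in> {w \<in> el (Prob Y E q) m. cid m \<in> fst w}"
      using rs_el[OF psh_Prob a, of w] w key[OF a, of w] by simp
  qed auto
  show ?thesis
    unfolding cof_def
  proof (intro conjI allI ballI sub)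
    fix n w assume w: "w \<in> el (Prob Y E q) n"
    have "pbs (Prob Y E q) (\<lambda>n. {w \<in> el (Prob Y E q) n. cid n \<in> fst w}) n w = fst w"
      using rs_el[OF psh_Prob _ w] key
      by (intro sieve_eqI[OF sieve_pbs[OF psh_Prob sub w] cofsieve_sieve[OF cofsieve[OF w]]]) (simp add: pbs_iff)
    then show "cofsieve n (pbs (Prob Y E q) (\<lambda>n. {w \<in> el (Prob Y E q) n. cid n \<in> fst w}) n w)" using cofsieve[OF w] by simp
  qed
qed

end


subsection \<open>Well-founded trees of formal box fillings\<close>

text \<open>A leaf is an element of \<open>X\<close>. A node is the value at the point \<open>t\<close>
  of a formal filler for the box \<open>(S, i)\<close> over \<open>y\<close> whose faces are the trees
  \<open>s\<close>.\<close>

datatype 'u tree =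
    Leaf 'u
  | Node "cube_arrow set" cube_arrow cube_arrow "cube_arrow => cube_arrow => 'u" "cube_arrow => cube_arrow => 'u tree"

text \<open>On the box itself a filler agrees with the given face. Returning the face in that case keeps
  all trees in normal form, so that no quotient is needed.\<close>

definition node :: "nat => cube_arrow set => cube_arrow => cube_arrow => (cube_arrow => cube_arrow => 'u) =>
    (cube_arrow => cube_arrow => 'u tree) => 'u tree" where
  "node n S i t y s = (if cid n \<in> S \<or> t = i then s (cid n) t else Node S i t (ynorm n y) (snorm n S i s))"

primrec tree_path :: "'u tree => (cube_arrow \<times> cube_arrow) list =>
    'u + cube_arrow set \<times> cube_arrow \<times> cube_arrow \<times> (cube_arrow => cube_arrow => 'u)" where
  "tree_path (Leaf x) = (\<lambda>p. Inl x)"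
| "tree_path (Node S i t y s) = (\<lambda>p. case p of [] => Inr (S, i, t, y) | (a, r) # p' => tree_path (s a r) p')"

text \<open>Each face is passed on together with its value, since the box to be filled lives over the
  trees.\<close>

primrec tree_rec :: "(nat => 'u => 'u) =>
    (nat => cube_arrow set \<times> cube_arrow \<times> (cube_arrow => cube_arrow => 'u) \<times> (cube_arrow => cube_arrow => 'u tree \<times> 'u)
      => cube_arrow => 'u) => 'u tree => nat => 'u" where
  "tree_rec u fill (Leaf x) = (\<lambda>n. u n x)"
| "tree_rec u fill (Node S i t y s) =
    (\<lambda>n. fill n (S, i, y, snorm n S i (\<lambda>a r. (s a r, tree_rec u fill (s a r) (Dom Cube a)))) t)"

lemma node_cong:
  assumes "\<And>m a r. a \<in> cub m n ==> r \<in> cub m 1 ==> y a r = y' a r"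
    and "\<And>m a r. a \<in> cub m n ==> r \<in> cub m 1 ==> a \<in> S \<or> r = i \<odot> a ==> s a r = s' a r"
    and i: "i \<in> cub n 1" and t: "t \<in> cub n 1"
  shows "node n S i t y s = node n S i t y' s'"
proof -
  have "cid n \<in> S \<or> t = i ==> cid n \<in> S \<or> t = i \<odot> cid n" using cub_idr[OF i] by auto
  note e = assms(2)[OF cid_cub t this]
  have y: "ynorm n y = ynorm n y'" by (rule ynorm_cong) (rule assms(1))
  have s: "snorm n S i s = snorm n S i s'" by (rule snorm_cong) (rule assms(2))
  show ?thesis unfolding node_def y s using e by auto
qed

context cubical_cofibrations
begin

context
  fixes X Y :: "'u cset" and f :: "'u cmap"
  assumes f: "f \<in> hom cSet X Y"
begin

text \<open>Restriction of trees. It is not recursive: a face of the restriction along \<open>b\<close>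
  is a face of the original, reindexed along \<open>b\<close>.\<close>

definition tr :: "cube_arrow => 'u tree => 'u tree" where
  "tr b w = (case w of Leaf x => Leaf (rs (cs X) b x)
    | Node S i t y s => node (Dom Cube b) (pull (Dom Cube b) b S) (i \<odot> b) (t \<odot> b)
        (\<lambda>a r. y (b \<odot> a) r) (\<lambda>a r. s (b \<odot> a) r))"

text \<open>The element of \<open>Y\<close> under a tree.\<close>

definition ov :: "nat => 'u tree => 'u" where
  "ov n w = (case w of Leaf x => ap f n x | Node S i t y s => y (cid n) t)"

text \<open>A node is well formed if its faces form a filling problem over \<open>y\<close> and its
  point \<open>t\<close> lies off the box. Well-foundedness of the trees makes recursion over them
  possible.\<close>

inductive wft :: "nat => 'u tree => bool" where
  wft_Leaf: "x \<in> fobj X n ==> wft n (Leaf x)"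
| wft_Node: "cofsieve n S ==> i \<in> cub n 1 ==> t \<in> cub n 1 ==> cid n \<notin> S ==> t \<noteq> i ==>
    (\<And>m a r. a \<in> cub m n ==> r \<in> cub m 1 ==> y a r \<in> fobj Y m) ==>
    (\<And>m k a r b. a \<in> cub m n ==> r \<in> cub m 1 ==> b \<in> cub k m ==> y (a \<odot> b) (r \<odot> b) = rs (cs Y) b (y a r)) ==>
    (\<And>m a r. a \<in> cub m n ==> r \<in> cub m 1 ==> a \<in> S \<or> r = i \<odot> a ==> wft m (s a r)) ==>
    (\<And>m a r. a \<in> cub m n ==> r \<in> cub m 1 ==> a \<in> S \<or> r = i \<odot> a ==> ov m (s a r) = y a r) ==>
    (\<And>m k a r b. a \<in> cub m n ==> r \<in> cub m 1 ==> a \<in> S \<or> r = i \<odot> a ==> b \<in> cub k m ==>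
      s (a \<odot> b) (r \<odot> b) = tr b (s a r)) ==>
    ynorm n y = y ==> snorm n S i s = s ==> wft n (Node S i t y s)"

definition Wp :: "'u tree psh" where
  "Wp = Psh (\<lambda>n. Collect (wft n)) tr"

lemma el_Wp [simp]: "w \<in> el Wp n \<longleftrightarrow> wft n w" and rs_Wp [simp]: "rs Wp = tr"
  by (simp_all add: Wp_def)

abbreviation tree_problem where "tree_problem \<equiv> problem Y Wp ov"

lemma wft_Node_I:
  assumes p: "tree_problem n S i y s" and "t \<in> cub n 1" "cid n \<notin> S" "t \<noteq> i" "ynorm n y = y" "snorm n S i s = s"
  shows "wft n (Node S i t y s)"
proof -
  note D = problem_D[OF p]
  show ?thesis
    by (rule wft_Node[OF D(1,2) assms(2-4) D(3,4) _ D(6) _ assms(5,6)]) (use D(5,7) in simp_all)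
qed

lemma wft_NodeD:
  assumes "wft n (Node S i t y s)"
  shows "tree_problem n S i y s" "t \<in> cub n 1" "cid n \<notin> S" "t \<noteq> i" "ynorm n y = y" "snorm n S i s = s"
proof -
  from assms show "tree_problem n S i y s" by (cases rule: wft.cases) (rule problem_I; simp)
  from assms show "t \<in> cub n 1" "cid n \<notin> S" "t \<noteq> i" "ynorm n y = y" "snorm n S i s = s"
    by (auto elim: wft.cases)
qed

lemma node_wft:
  assumes p: "tree_problem n S i y s" and t: "t \<in> cub n 1"
  shows "wft n (node n S i t y s)" and "ov n (node n S i t y s) = y (cid n) t"
proof -
  note D = problem_D[OF p]
  have "wft n (node n S i t y s) \<and> ov n (node n S i t y s) = y (cid n) t"
  proof (cases "cid n \<in> S \<or> t = i")
    case True
    then have "cid n \<in> S \<or> t = i \<odot> cid n" using cub_idr[OF D(2)] by auto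
    with True show ?thesis using D(5,6)[OF cid_cub t] by (simp add: node_def)
  next
    case False
    then show ?thesis
      using wft_Node_I[OF problem_norm[OF p] t _ _ ynorm_idem snorm_idem] t
      by (simp add: node_def ov_def ynorm_eq[OF cid_cub])
  qed
  then show "wft n (node n S i t y s)" "ov n (node n S i t y s) = y (cid n) t" by auto
qed

text \<open>Restriction commutes with forming nodes also where a node collapses to a face.\<close>

lemma tr_node:
  assumes p: "tree_problem n S i y s" and t: "t \<in> cub n 1" and b: "b \<in> cub m n"
  shows "tr b (node n S i t y s) = node m (pull m b S) (i \<odot> b) (t \<odot> b) (\<lambda>a r. y (b \<odot> a) r) (\<lambda>a r. s (b \<odot> a) r)"
proof -
  note D = problem_D[OF p]
  show ?thesis
  proof (cases "cid n \<in> S \<or> t = i")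
    case True
    then have "cid n \<in> S \<or> t = i \<odot> cid n" using cub_idr[OF D(2)] by auto
    from D(7)[OF cid_cub t this b] have "tr b (s (cid n) t) = s b (t \<odot> b)" by (simp add: cub_idl[OF b])
    moreover have "b \<in> S \<or> t \<odot> b = i \<odot> b"
      using True sieve_comp[OF cofsieve_sieve[OF D(1)] _ cid_cub b] cub_idl[OF b] by auto
    ultimately show ?thesis using True by (simp add: node_def pull_iff[OF cid_cub] cub_idr[OF b])
  next
    case False
    have "tr b (node n S i t y s) =
        node m (pull m b S) (i \<odot> b) (t \<odot> b) (\<lambda>a r. ynorm n y (b \<odot> a) r) (\<lambda>a r. snorm n S i s (b \<odot> a) r)"
      using False by (simp add: node_def[of n] tr_def cub_Dom[OF b])
    also have "\<dots> = node m (pull m b S) (i \<odot> b) (t \<odot> b) (\<lambda>a r. y (b \<odot> a) r) (\<lambda>a r. s (b \<odot> a) r)"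
    proof (rule node_cong[OF _ _ comp_cub[OF b D(2)] comp_cub[OF b t]])
      fix k a r assume a: "a \<in> cub k m" and r: "r \<in> cub k 1"
      note ba = comp_cub[OF a b]
      show "ynorm n y (b \<odot> a) r = y (b \<odot> a) r" by (rule ynorm_eq[OF ba r])
      assume "a \<in> pull m b S \<or> r = (i \<odot> b) \<odot> a"
      then show "snorm n S i s (b \<odot> a) r = s (b \<odot> a) r"
        using snorm_eq[OF ba r] box_pull[OF D(2) b a] by simp
    qed
    finally show ?thesis .
  qed
qed

lemma wft_node_eq: "wft n (Node S i t y s) ==> node n S i t y s = Node S i t y s"
  using wft_NodeD[of n S i t y s] by (simp add: node_def)

lemma tr_wft:
  assumes "wft n w" and b: "b \<in> cub m n"
  shows "wft m (tr b w)" and "ov m (tr b w) = rs (cs Y) b (ov n w)"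
proof -
  have "wft m (tr b w) \<and> ov m (tr b w) = rs (cs Y) b (ov n w)"
  proof (cases w)
    case (Leaf x)
    then have x: "x \<in> fobj X n" using assms(1) by (auto elim: wft.cases)
    then show ?thesis
      using Leaf rs_el[OF psh_cs[OF hom_Obj(1)[OF f]] b, of x] ap_rs[OF f b x] by (simp add: tr_def ov_def wft_Leaf)
  next
    case (Node S i t y s)
    note N = wft_NodeD[OF assms(1)[unfolded Node]]
    note D = problem_D[OF N(1)]
    have "tr b w = node m (pull m b S) (i \<odot> b) (t \<odot> b) (\<lambda>a r. y (b \<odot> a) r) (\<lambda>a r. s (b \<odot> a) r)"
      by (simp add: Node tr_def cub_Dom[OF b])
    then show ?thesis
      using node_wft[OF problem_shift[OF N(1) b] comp_cub[OF b N(2)]] D(4)[OF cid_cub N(2) b]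
      by (simp add: Node ov_def cub_idr[OF b] cub_idl[OF b])
  qed
  then show "wft m (tr b w)" "ov m (tr b w) = rs (cs Y) b (ov n w)" by auto
qed

lemma psh_Wp: "psh Wp"
proof (rule pshI)
  show "rs Wp b w \<in> el Wp m" if "b \<in> cub m n" "w \<in> el Wp n" for m n b w
    using tr_wft(1) that by simp
next
  fix n w assume "w \<in> el Wp n"
  then have w: "wft n w" by simp
  show "rs Wp (cid n) w = w"
  proof (cases w)
    case (Leaf x)
    then have "x \<in> fobj X n" using w by (auto elim: wft.cases)
    then show ?thesis using Leaf rs_id[OF psh_cs[OF hom_Obj(1)[OF f]], of x] by (simp add: tr_def)
  next
    case (Node S i t y s)
    note N = wft_NodeD[OF w[unfolded Node]]
    note D = problem_D[OF N(1)]
    have "tr (cid n) w = node n S i t (\<lambda>a r. y (cid n \<odot> a) r) (\<lambda>a r. s (cid n \<odot> a) r)"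
      by (simp add: Node tr_def cub_Dom[OF cid_cub] pull_cid[OF cofsieve_sieve[OF D(1)]] cub_idr[OF D(2)] cub_idr[OF N(2)])
    also have "\<dots> = node n S i t y s" by (rule node_cong[OF _ _ D(2) N(2)]) (simp_all add: cub_idl)
    finally show ?thesis using wft_node_eq[OF w[unfolded Node]] Node by simp
  qed
next
  fix l m n a b w assume a: "a \<in> cub l m" and b: "b \<in> cub m n" and "w \<in> el Wp n"
  then have w: "wft n w" by simp
  show "rs Wp (b \<odot> a) w = rs Wp a (rs Wp b w)"
  proof (cases w)
    case (Leaf x)
    then have "x \<in> fobj X n" using w by (auto elim: wft.cases)
    then show ?thesis using Leaf rs_comp[OF psh_cs[OF hom_Obj(1)[OF f]] a b, of x] by (simp add: tr_def)
  next
    case (Node S i t y s)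
    note N = wft_NodeD[OF w[unfolded Node]]
    note D = problem_D[OF N(1)]
    have "tr a (tr b w) = tr a (node m (pull m b S) (i \<odot> b) (t \<odot> b) (\<lambda>a r. y (b \<odot> a) r) (\<lambda>a r. s (b \<odot> a) r))"
      by (simp add: Node tr_def[of b] cub_Dom[OF b])
    also have "\<dots> = node l (pull l a (pull m b S)) ((i \<odot> b) \<odot> a) ((t \<odot> b) \<odot> a)
        (\<lambda>c r. y (b \<odot> (a \<odot> c)) r) (\<lambda>c r. s (b \<odot> (a \<odot> c)) r)"
      by (rule tr_node[OF problem_shift[OF N(1) b] comp_cub[OF b N(2)] a])
    also have "\<dots> = node l (pull l (b \<odot> a) S) (i \<odot> (b \<odot> a)) (t \<odot> (b \<odot> a))
        (\<lambda>c r. y ((b \<odot> a) \<odot> c) r) (\<lambda>c r. s ((b \<odot> a) \<odot> c) r)"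
      unfolding pull_comp[OF cofsieve_sieve[OF D(1)] a b] cub_assoc[OF a b D(2)] cub_assoc[OF a b N(2)]
      by (rule node_cong) (use comp_cub[OF comp_cub[OF a b]] D(2) N(2) in \<open>simp_all add: cub_assoc[OF _ a b]\<close>)
    also have "\<dots> = tr (b \<odot> a) w" by (simp add: Node tr_def cub_Dom[OF comp_cub[OF a b]])
    finally show ?thesis by simp
  qed
qed

lemma ov_natm: "natm Wp (cs Y) ov"
proof (rule natmI)
  show "ov n w \<in> el (cs Y) n" if "w \<in> el Wp n" for n w
  proof (cases w)
    case (Leaf x)
    then have "x \<in> fobj X n" using that by (auto elim: wft.cases)
    then show ?thesis using ap_el[OF f] Leaf by (simp add: ov_def)
  next
    case (Node S i t y s)
    then have "wft n (Node S i t y s)" using that by simp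
    note N = wft_NodeD[OF this]
    show ?thesis using problem_D(3)[OF N(1) cid_cub N(2)] by (simp add: Node ov_def)
  qed
qed (simp add: tr_wft)

text \<open>A tree is determined by the labels along finite paths, of which there are countably many.\<close>

lemma tree_path_inj:
  assumes "wft n w" "wft n w'"
    and "\<And>p. p \<in> lists (Arr Cube \<times> Arr Cube) ==> tree_path w p = tree_path w' p"
  shows "w = w'"
  using assms
proof (induction n w arbitrary: w' rule: wft.induct)
  case (wft_Leaf x n)
  have "tree_path (Leaf x) [] = tree_path w' []" by (rule wft_Leaf(3)) simp
  then show ?case by (cases w') auto
next
  case (wft_Node n S i t y s)
  have e: "tree_path (Node S i t y s) [] = tree_path w' []" by (rule wft_Node.prems(2)) simp
  then obtain s' where w': "w' = Node S i t y s'" by (cases w') auto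
  note N = wft_NodeD[OF wft_Node.prems(1)[unfolded w']]
  have "s a r = s' a r" if a: "a \<in> cub m n" and r: "r \<in> cub m 1" and ar: "a \<in> S \<or> r = i \<odot> a" for m a r
  proof (rule wft_Node.IH(1)[OF a r ar])
    show "wft m (s' a r)" using problem_D(5)[OF N(1) a r ar] by simp
    fix p assume "p \<in> lists (Arr Cube \<times> Arr Cube)"
    then have "(a, r) # p \<in> lists (Arr Cube \<times> Arr Cube)" using cub_Arr[OF a] cub_Arr[OF r] by simp
    from wft_Node.prems(2)[OF this] show "tree_path (s a r) p = tree_path (s' a r) p" by (simp add: w')
  qed
  then have "snorm n S i s = snorm n S i s'" by (rule snorm_cong)
  then show ?case using wft_Node.hyps N(6) by (simp add: w')
qed

lemma tinyp_Wp: "tinyp Wp"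
  unfolding tinyp_def
proof (intro conjI allI psh_Wp)
  fix n
  note X = hom_Obj(1)[OF f] and Y = hom_Obj(2)[OF f]
  have tn: "tiny (UNIV :: nat set)" by (rule tiny_countable) simp
  let ?F = "{y. (\<forall>a r. y a r \<in> {undefined} \<union> (\<Union>m. fobj Y m)) \<and> (\<forall>a r. \<not> (a \<in> Arr Cube \<and> r \<in> Arr Cube) \<longrightarrow> y a r = undefined)}"
  let ?P = "lists (Arr Cube \<times> Arr Cube)"
  let ?L = "Inl ` (\<Union>m. fobj X m) \<union> Inr ` (Pow (Arr Cube) \<times> Arr Cube \<times> Arr Cube \<times> ?F) \<union> tree_path undefined ` ?P"
  have P: "tiny ?P" by (intro tiny_countable countable_lists countable_SIGMA countable_Cube)
  have "tiny ({undefined} \<union> (\<Union>m. fobj Y m))"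
    using tinyp_el[OF tinyp_cs[OF Y]] by (intro tiny_Un tiny_UN tn) (simp_all add: tiny_countable)
  then have F: "tiny ?F" by (rule tiny_functions2) blast+
  have L: "tiny ?L"
    using tinyp_el[OF tinyp_cs[OF X]]
    by (intro tiny_Un tiny_image tiny_UN tn tiny_Times tiny_Pow tiny_Cube F P) simp
  have val: "tree_path w p \<in> ?L" if "wft n w" "p \<in> ?P" for n w p
    using that
  proof (induction n w arbitrary: p rule: wft.induct)
    case (wft_Leaf x n)
    then have "x \<in> (\<Union>m. fobj X m)" by blast
    then show ?case by (simp add: image_iff)
  next
    case (wft_Node n S i t y s)
    show ?case
    proof (cases p)
      case Nil
      have "S \<subseteq> Arr Cube" using sieve_cub[OF cofsieve_sieve[OF wft_Node.hyps(1)]] cub_Arr by blast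
      moreover have "i \<in> Arr Cube" "t \<in> Arr Cube" using wft_Node.hyps(2,3) cub_Arr by blast+
      moreover have "y \<in> ?F"
      proof -
        have e: "y a r = (if \<exists>m. a \<in> cub m n \<and> r \<in> cub m 1 then y a r else undefined)" for a r
          using fun_cong[OF fun_cong[OF wft_Node.hyps(11)], of a r] by (simp add: ynorm_def)
        have "y a r \<in> {undefined} \<union> (\<Union>m. fobj Y m)" for a r
          using wft_Node.hyps(6) e[of a r] by (cases "\<exists>m. a \<in> cub m n \<and> r \<in> cub m 1") auto
        moreover have "y a r = undefined" if "\<not> (a \<in> Arr Cube \<and> r \<in> Arr Cube)" for a r
          using e[of a r] cub_Arr that by (cases "\<exists>m. a \<in> cub m n \<and> r \<in> cub m 1") auto
        ultimately show ?thesis by blast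
      qed
      ultimately show ?thesis by (simp add: Nil)
    next
      case (Cons ar q)
      obtain a r where ar: "ar = (a, r)" by (cases ar)
      have q: "q \<in> ?P" using wft_Node.prems Cons by simp
      have e: "s a r = (if open_box n S i a r then s a r else undefined)"
        using fun_cong[OF fun_cong[OF wft_Node.hyps(12)], of a r] by (simp add: snorm_def)
      have "tree_path (s a r) q \<in> ?L"
      proof (cases "open_box n S i a r")
        case True
        then obtain m where "a \<in> cub m n" "r \<in> cub m 1" "a \<in> S \<or> r = i \<odot> a" unfolding open_box_def by blast
        from wft_Node.IH(1)[OF this q] show ?thesis .
      next
        case False
        then have "s a r = undefined" using e by simp
        then show ?thesis using q by simp
      qed
      then show ?thesis by (simp add: Cons ar)
    qed
  qed
  have "tiny ((\<lambda>w. restrict (tree_path w) ?P) ` el Wp n)"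
  proof (rule tiny_functions[OF P L])
    fix g p assume "g \<in> (\<lambda>w. restrict (tree_path w) ?P) ` el Wp n" and p: "p \<in> ?P"
    then obtain w where w: "wft n w" "g = restrict (tree_path w) ?P" by auto
    have "g p = tree_path w p" unfolding w(2) using p by (rule restrict_apply')
    then show "g p \<in> ?L" using val[OF w(1) p] by simp
  next
    fix g h assume "g \<in> (\<lambda>w. restrict (tree_path w) ?P) ` el Wp n" "h \<in> (\<lambda>w. restrict (tree_path w) ?P) ` el Wp n"
      and eq: "\<And>p. p \<in> ?P ==> g p = h p"
    then obtain w w' where gh: "g = restrict (tree_path w) ?P" "h = restrict (tree_path w') ?P" by blast
    show "g = h" unfolding gh
    proof (rule restrict_ext)
      fix p assume p: "p \<in> ?P"
      show "tree_path w p = tree_path w' p" using eq[OF p] unfolding gh restrict_apply'[OF p] .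
    qed
  qed
  then show "tiny (el Wp n)"
  proof (rule tiny_inj[rotated -1])
    show "inj_on (\<lambda>w. restrict (tree_path w) ?P) (el Wp n)"
    proof (rule inj_onI)
      fix w w' assume "w \<in> el Wp n" "w' \<in> el Wp n" and e: "restrict (tree_path w) ?P = restrict (tree_path w') ?P"
      moreover have "tree_path w p = tree_path w' p" if "p \<in> ?P" for p
        using fun_cong[OF e, of p] that by simp
      ultimately show "w = w'" using tree_path_inj by simp
    qed
  qed simp
qed

end

end


context cubical_cofibrations
begin

text \<open>The middle object consists of the well-formed trees. It is fibrant over \<open>Y\<close>
  since \<open>node\<close> fills every box of trees. To lift the inclusion of the leaves against a
  fibration \<open>g\<close>, fill the universal box for pairs of a tree and an element of the source of
  \<open>g\<close> with the same image, and recurse over trees with this filler.\<close>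

lemma factor_TCof_Fib:
  assumes f: "f \<in> hom cS X Y"
  shows "\<exists>l \<in> TCof \<C>. \<exists>r \<in> Fib \<C>. Cod cS l = Dom cS r \<and> f = r \<bullet> l"
proof -
  note X = hom_Obj(1)[OF f] and Y = hom_Obj(2)[OF f]
  let ?W = "Wp X Y f" and ?wft = "wft X Y f" and ?ov = "ov f" and ?tr = "tr X"
  note node_wft = node_wft[OF f] and tr_node = tr_node[OF f] and ov_natm = ov_natm[OF f]
  note el_Wp = el_Wp[OF f] and rs_Wp = rs_Wp[OF f]
  obtain M e d where M: "M \<in> Obj cS" and iso: "natiso ?W (cs M) e d" using cset_coding[OF tinyp_Wp[OF f]] by blast
  have e: "natm ?W (cs M) e" and d: "natm (cs M) ?W d" and de: "\<And>n w. ?wft n w ==> d n (e n w) = w"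
    and ed: "\<And>n x. x \<in> fobj M n ==> e n (d n x) = x"
    using iso unfolding natiso_def by (simp_all add: el_Wp)
  have ew: "e n w \<in> fobj M n" if "?wft n w" for n w using natm_el[OF e] that by (simp add: el_Wp)
  have dw: "?wft n (d n x)" if "x \<in> fobj M n" for n x using natm_el[OF d] that by (simp add: el_Wp)
  have lf: "natm (cs X) ?W (\<lambda>n x. Leaf x)"
    by (rule natmI) (simp_all add: el_Wp rs_Wp wft_Leaf[OF f] tr_def[OF f])
  let ?l = "mp X M (\<lambda>n x. e n (Leaf x))" and ?r = "mp M Y (\<lambda>n x. ?ov n (d n x))"
  have l: "?l \<in> hom cS X M" by (rule mp_hom[OF X M natm_comp[OF lf e]])
  have r: "?r \<in> hom cS M Y" by (rule mp_hom[OF M Y natm_comp[OF d ov_natm]])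
  have "?r \<in> Fib \<C>"
  proof (rule Fib_I[OF r], rule extI[OF r])
    fix Z A i u v assume Z: "Z \<in> Obj cS" and A: "cof (cs Z) A" and i: "natm (cs Z) Ip i"
      and u: "natm (restr (cs Z \<otimes> Ip) (box (cs Z) i A)) (cs M) u" and v: "natm (cs Z \<otimes> Ip) (cs Y) v"
      and uv: "\<And>n z. z \<in> box (cs Z) i A n ==> ap ?r n (u n z) = v n z"
    note ps = psh_cs[OF Z]
    let ?S = "pbs (cs Z) A"
    define y where "y z a r = v (Dom Cube a) (rs (cs Z) a z, r)" for z a r
    define s where "s z a r = d (Dom Cube a) (u (Dom Cube a) (rs (cs Z) a z, r))" for z a r
    have bx: "(rs (cs Z) a z, r) \<in> box (cs Z) i A m"
      if "z \<in> el (cs Z) n" "a \<in> cub m n" "r \<in> cub m 1" "a \<in> ?S n z \<or> r = i n z \<odot> a" for n z m a r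
      using that natm_rs[OF i that(2,1)] rs_el[OF ps that(2,1)] by (auto simp: box_def pbs_iff)
    have p: "problem Y ?W ?ov n (?S n z) (i n z) (y z) (s z)" if z: "z \<in> el (cs Z) n" for n z
    proof (rule problem_I)
      show "cofsieve n (?S n z)" "i n z \<in> cub n 1" using cof_K[OF A z] natm_el[OF i z] by simp_all
      fix m a r assume a: "a \<in> cub m n" and r: "r \<in> cub m 1"
      note az = rs_el[OF ps a z]
      show "y z a r \<in> fobj Y m" using natm_el[OF v, of "(rs (cs Z) a z, r)" m] az r by (simp add: y_def cub_Dom[OF a])
      show "y z (a \<odot> b) (r \<odot> b) = rs (cs Y) b (y z a r)" if b: "b \<in> cub k m" for k b
        using natm_rs[OF v b, of "(rs (cs Z) a z, r)"] az r rs_comp[OF ps b a z]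
        by (simp add: y_def cub_Dom[OF a] cub_Dom[OF comp_cub[OF b a]])
      assume "a \<in> ?S n z \<or> r = i n z \<odot> a"
      note bz = bx[OF z a r this]
      have uM: "u m (rs (cs Z) a z, r) \<in> fobj M m" using natm_el[OF u, of _ m] bz by simp
      show "s z a r \<in> el ?W m" using dw[OF uM] by (simp add: s_def cub_Dom[OF a] el_Wp)
      show "?ov m (s z a r) = y z a r" using uv[OF bz] uM by (simp add: s_def y_def cub_Dom[OF a])
      show "s z (a \<odot> b) (r \<odot> b) = rs ?W b (s z a r)" if b: "b \<in> cub k m" for k b
        using natm_rs[OF u b, of "(rs (cs Z) a z, r)"] bz natm_rs[OF d b, of "u m (rs (cs Z) a z, r)"] uM
          rs_comp[OF ps b a z]
        by (simp add: s_def cub_Dom[OF a] cub_Dom[OF comp_cub[OF b a]])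
    qed
    define w where "w n z t = node n (?S n z) (i n z) t (y z) (s z)" for n z t
    have ww: "?wft n (w n z t)" "?ov n (w n z t) = v n (z, t)" if "z \<in> el (cs Z) n" "t \<in> cub n 1" for n z t
      using node_wft[OF p[OF that(1)] that(2)] rs_id[OF ps that(1)] by (simp_all add: w_def y_def cub_Dom[OF cid_cub])
    have wn: "natm (cs Z \<otimes> Ip) ?W (\<lambda>n zt. w n (fst zt) (snd zt))"
    proof (rule natm_prodI)
      show "w n z t \<in> el ?W n" if "z \<in> el (cs Z) n" "t \<in> cub n 1" for n z t using ww that by (simp add: el_Wp)
      fix m n b z t assume b: "b \<in> cub m n" and z: "z \<in> el (cs Z) n" and t: "t \<in> cub n 1"
      note iz = problem_D(2)[OF p[OF z]]
      have "?tr b (w n z t) = node m (pull m b (?S n z)) (i n z \<odot> b) (t \<odot> b) (\<lambda>a r. y z (b \<odot> a) r) (\<lambda>a r. s z (b \<odot> a) r)"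
        unfolding w_def by (rule tr_node[OF p[OF z] t b])
      also have "\<dots> = w m (rs (cs Z) b z) (t \<odot> b)"
        unfolding w_def pull_pbs[OF ps z b] natm_rs[OF i b z] rs_yo
        by (rule node_cong[OF _ _ comp_cub[OF b iz] comp_cub[OF b t]])
          (simp_all add: y_def s_def cub_Dom comp_cub[OF _ b, THEN cub_Dom] rs_comp[OF ps _ b z])
      finally show "w m (rs (cs Z) b z) (t \<odot> b) = rs ?W b (w n z t)" by (simp add: rs_Wp)
    qed
    show "\<exists>w. natm (cs Z \<otimes> Ip) (cs M) w \<and> (\<forall>n. \<forall>z \<in> box (cs Z) i A n. w n z = u n z) \<and>
        (\<forall>n. \<forall>z \<in> el (cs Z \<otimes> Ip) n. ap ?r n (w n z) = v n z)"
    proof (intro exI conjI allI ballI)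
      show "natm (cs Z \<otimes> Ip) (cs M) (\<lambda>n zt. e n (w n (fst zt) (snd zt)))" by (rule natm_comp[OF wn e])
      show "ap ?r n (e n (w n (fst zt) (snd zt))) = v n zt" if "zt \<in> el (cs Z \<otimes> Ip) n" for n zt
        using that ww ew de by auto
      fix n zt assume zt: "zt \<in> box (cs Z) i A n"
      then obtain z t where z: "zt = (z, t)" "z \<in> el (cs Z) n" "t \<in> cub n 1" "z \<in> A n \<or> t = i n z"
        by (auto simp: box_def)
      have "cid n \<in> ?S n z \<or> t = i n z" using z(4) rs_id[OF ps z(2)] by (simp add: pbs_iff[OF cid_cub])
      then have "w n z t = d n (u n (z, t))"
        using rs_id[OF ps z(2)] by (simp add: w_def node_def s_def cub_Dom[OF cid_cub])
      moreover have "u n (z, t) \<in> fobj M n" using natm_el[OF u, of zt n] zt z(1) by simp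
      ultimately show "e n (w n (fst zt) (snd zt)) = u n zt" by (simp add: z(1) ed)
    qed
  qed
  moreover have "?l \<in> TCof \<C>"
    unfolding TCof_def llp_def
  proof (intro CollectI conjI ballI hom_Arr[OF l])
    fix g assume gF: "g \<in> Fib \<C>"
    obtain B D where g: "g \<in> hom cS B D" using Fib_hom[OF gF] by blast
    note BO = hom_Obj(1)[OF g] and DO = hom_Obj(2)[OF g]
    show "lifts cS ?l g"
      unfolding lifts_def cSet_simps src_mp tgt_mp hom_src[OF g] hom_tgt[OF g]
    proof (intro ballI impI)
      fix u v assume u: "u \<in> hom cS X B" and v: "v \<in> hom cS M D" and sq: "g \<bullet> u = v \<bullet> ?l"
      define V where "V n w = ap v n (e n w)" for n w
      have V: "natm ?W (cs D) V" unfolding V_def by (rule natm_comp[OF e ap_natm[OF v]])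
      have gu: "ap g n (ap u n x) = V n (Leaf x)" if "x \<in> fobj X n" for n x
        using ap_comp[OF u that, of g] ap_comp[OF l that, of v] sq that by (simp add: V_def)
      define EA where "EA n = {(w, b). ?wft n w \<and> b \<in> fobj B n \<and> ap g n b = V n w}" for n
      have sub: "subf (?W \<otimes> cs B) EA"
        unfolding subf_def
      proof (intro conjI allI ballI)
        show "EA n \<subseteq> el (?W \<otimes> cs B) n" for n by (auto simp: EA_def el_Wp)
        fix m n a p assume a: "a \<in> cub m n" and "p \<in> EA n"
        then obtain w b where p: "p = (w, b)" "w \<in> el ?W n" "b \<in> fobj B n" "ap g n b = V n w"
          by (auto simp: EA_def el_Wp)
        then show "rs (?W \<otimes> cs B) a p \<in> EA m"
          using rs_el[OF psh_Wp[OF f] a p(2)] rs_el[OF psh_cs[OF BO] a, of b] ap_rs[OF g a p(3)] natm_rs[OF V a p(2)]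
          by (simp add: EA_def el_Wp)
      qed
      let ?E = "restr (?W \<otimes> cs B) EA" and ?q = "\<lambda>n p. ?ov n (fst p)"
      have tE: "tinyp ?E" by (intro tinyp_restr tinyp_prodp tinyp_Wp[OF f] tinyp_cs BO sub)
      \<comment> \<open>\<open>?E\<close> consists of pairs of a tree and an element of \<open>B\<close>
        with the same image in \<open>D\<close>. The filler of the universal box for \<open>?E\<close>
        over \<open>Y\<close> is to lie over the node built from the first components
        (\<open>ctr\<close>), and on the box it is given by the second components
        (\<open>bd\<close>).\<close>
      let ?Q = "Prob Y ?E ?q"
      have proj: "problem Y ?W ?ov n S i y (\<lambda>a r. fst (s a r))" if p: "problem Y ?E ?q n S i y s" for n S i y s
      proof -
        note P = problem_D[OF p]
        show ?thesis
        proof (rule problem_I)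
          fix m a r assume ar: "a \<in> cub m n" "r \<in> cub m 1" "a \<in> S \<or> r = i \<odot> a"
          show "fst (s a r) \<in> el ?W m" using P(5)[OF ar] by (auto simp: EA_def el_Wp)
          show "fst (s (a \<odot> b) (r \<odot> b)) = rs ?W b (fst (s a r))" if "b \<in> cub k m" for k b
            using P(7)[OF ar that] by (cases "s a r") simp
        qed (use P in simp_all)
      qed
      have sE: "fst (s a r) \<in> el ?W m" "snd (s a r) \<in> fobj B m" "ap g m (snd (s a r)) = V m (fst (s a r))"
        "b \<in> cub k m ==> snd (s (a \<odot> b) (r \<odot> b)) = rs (cs B) b (snd (s a r))"
        if p: "problem Y ?E ?q n S i y s" and ar: "a \<in> cub m n" "r \<in> cub m 1" "a \<in> S \<or> r = i \<odot> a" for n S i y s m a r b k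
        using problem_D(5,7)[OF p ar] by (auto simp: EA_def el_Wp split_beta) (metis rs_prodp prod.collapse snd_conv)
      define ctr where "ctr n q t = node n (fst q) (fst (snd q)) t (fst (snd (snd q))) (\<lambda>a r. fst (snd (snd (snd q)) a r))"
        for n and q :: "cube_arrow set \<times> cube_arrow \<times> (cube_arrow => cube_arrow => 'u) \<times>
          (cube_arrow => cube_arrow => 'u tree \<times> 'u)" and t
      define bd where "bd n q t = snd (snd (snd (snd q)) (cid n) t)"
        for n and q :: "cube_arrow set \<times> cube_arrow \<times> (cube_arrow => cube_arrow => 'u) \<times>
          (cube_arrow => cube_arrow => 'u tree \<times> 'u)" and t
      have idx: "natm ?Q Ip (\<lambda>n q. fst (snd q))"
        by (rule natmI) (auto elim!: Prob_cases simp: problem_D(2) rs_Prob)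
      have cs: "cid n \<in> S \<or> t = i \<odot> cid n" if "problem Y ?E ?q n S i y s" "cid n \<in> S \<or> t = i" for n S i y s t
        using that(2) cub_idr[OF problem_D(2)[OF that(1)]] by auto
      have bds: "bd m (rs ?Q a (S, i, y, s)) (t \<odot> a) = snd (s a (t \<odot> a))"
        if p: "problem Y ?E ?q n S i y s" and a: "a \<in> cub m n" and t: "t \<in> cub n 1" and c: "a \<in> S \<or> t \<odot> a = i \<odot> a"
        for m n a S i y s t
      proof -
        have "cid m \<in> pull m a S \<or> t \<odot> a = (i \<odot> a) \<odot> cid m"
          using c cub_idr[OF a] cub_idr[OF comp_cub[OF a problem_D(2)[OF p]]] by (simp add: pull_iff[OF cid_cub])
        note e = snorm_eq[OF cid_cub comp_cub[OF a t] this]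
        show ?thesis by (simp add: bd_def rs_Prob[OF a] cub_idr[OF a] e)
      qed
      obtain fill where
        fel: "\<And>n q t. q \<in> el ?Q n ==> t \<in> cub n 1 ==> fill n q t \<in> fobj B n" and
        frs: "\<And>m n a q t. a \<in> cub m n ==> q \<in> el ?Q n ==> t \<in> cub n 1 ==> fill m (rs ?Q a q) (t \<odot> a) = rs (cs B) a (fill n q t)" and
        fbd: "\<And>n q t. q \<in> el ?Q n ==> t \<in> cub n 1 ==> q \<in> {q \<in> el ?Q n. cid n \<in> fst q} \<or> t = fst (snd q) ==> fill n q t = bd n q t" and
        fov: "\<And>n q t. q \<in> el ?Q n ==> t \<in> cub n 1 ==> ap g n (fill n q t) = V n (ctr n q t)"
      proof (rule Fib_fill[OF gF g tinyp_Prob[OF Y tE] cof_Prob idx, where u = bd and v = "\<lambda>n q t. V n (ctr n q t)"])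
        fix n q t assume q: "q \<in> el ?Q n" and t: "t \<in> cub n 1"
        then obtain S i y s where Q: "q = (S, i, y, s)" "problem Y ?E ?q n S i y s" by (auto elim: Prob_cases)
        note P = problem_D[OF Q(2)] and pj = proj[OF Q(2)]
        show "V n (ctr n q t) \<in> fobj D n"
          using natm_el[OF V, of "ctr n q t" n] node_wft(1)[OF pj t] by (simp add: ctr_def Q(1) el_Wp)
        show "V m (ctr m (rs ?Q a q) (t \<odot> a)) = rs (cs D) a (V n (ctr n q t))" if a: "a \<in> cub m n" for m a
        proof -
          have "?tr a (ctr n q t) = node m (pull m a S) (i \<odot> a) (t \<odot> a) (\<lambda>c r. y (a \<odot> c) r) (\<lambda>c r. fst (s (a \<odot> c) r))"
            unfolding ctr_def Q(1) fst_conv snd_conv by (rule tr_node[OF pj t a])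
          also have "\<dots> = ctr m (rs ?Q a q) (t \<odot> a)"
            unfolding ctr_def Q(1) rs_Prob[OF a] fst_conv snd_conv
            by (rule node_cong) (use comp_cub[OF a P(2)] comp_cub[OF a t] in \<open>simp_all add: snorm_eq\<close>)
          finally show ?thesis
            using natm_rs[OF V a, of "ctr n q t"] node_wft(1)[OF pj t] by (simp add: ctr_def Q(1) el_Wp rs_Wp)
        qed
        assume "q \<in> {q \<in> el ?Q n. cid n \<in> fst q} \<or> t = fst (snd q)"
        then have c: "cid n \<in> S \<or> t = i" by (auto simp: Q(1))
        note c' = cs[OF Q(2) c]
        show "bd n q t \<in> fobj B n" using sE(2)[OF Q(2) cid_cub t c'] by (simp add: bd_def Q(1))
        show "ap g n (bd n q t) = V n (ctr n q t)"
          using sE(3)[OF Q(2) cid_cub t c'] c by (simp add: bd_def ctr_def node_def Q(1))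
        show "bd m (rs ?Q a q) (t \<odot> a) = rs (cs B) a (bd n q t)" if a: "a \<in> cub m n" for m a
        proof -
          have "a \<in> S \<or> t \<odot> a = i \<odot> a"
            using c sieve_comp[OF cofsieve_sieve[OF P(1)] _ cid_cub a] cub_idl[OF a] by auto
          from bds[OF Q(2) a t this] show ?thesis
            using sE(4)[OF Q(2) cid_cub t c' a] cub_idl[OF a] by (simp add: Q(1) bd_def)
        qed
      qed (rule that; assumption)
      define h where "h = tree_rec (ap u) fill"
      \<comment> \<open>Naturality is proved together with the typing, as the faces of a node enter the
        box with their values.\<close>
      have main: "h w n \<in> fobj B n \<and> ap g n (h w n) = V n w \<and>
          (\<forall>m. \<forall>b \<in> cub m n. h (?tr b w) m = rs (cs B) b (h w n))" if "?wft n w" for n w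
        using that
      proof (induction n w rule: wft.induct[OF f, consumes 1, case_names Leaf Node])
        case (Leaf x n)
        then show ?case using ap_el[OF u] gu ap_rs[OF u] by (simp add: h_def tr_def[OF f])
      next
        case (Node n S i t y s)
        note i = Node.hyps(2) and t = Node.hyps(3)
        have tp: "problem Y ?W ?ov n S i y s"
          by (rule problem_I) (use Node.hyps in \<open>simp_all add: el_Wp rs_Wp\<close>)
        note S = cofsieve_sieve[OF Node.hyps(1)]
        have wN: "?wft n (tree.Node S i t y s)" by (rule wft_Node_I[OF f tp t Node.hyps(4,5,11,12)])
        define s2 where "s2 a r = (s a r, h (s a r) (Dom Cube a))" for a r
        have hN: "h (tree.Node S i t y s) n = fill n (S, i, y, snorm n S i s2) t"
          by (simp add: h_def s2_def[abs_def])
        have p2: "problem Y ?E ?q n S i y s2"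
        proof (rule problem_I)
          fix m a r assume ar: "a \<in> cub m n" "r \<in> cub m 1" "a \<in> S \<or> r = i \<odot> a"
          note IH = Node.IH(1)[OF ar] and sw = Node.hyps(8)[OF ar]
          show "s2 a r \<in> el ?E m" using IH sw by (simp add: EA_def s2_def cub_Dom[OF ar(1)])
          show "s2 (a \<odot> b) (r \<odot> b) = rs ?E b (s2 a r)" if b: "b \<in> cub k m" for k b
            using IH b Node.hyps(10)[OF ar b] by (simp add: s2_def cub_Dom[OF ar(1)] cub_Dom[OF comp_cub[OF b ar(1)]] rs_Wp)
        qed (use problem_D[OF tp] in \<open>simp_all add: s2_def\<close>)
        let ?prob = "(S, i, y, snorm n S i s2)"
        have p3: "problem Y ?E ?q n S i y (snorm n S i s2)" using problem_norm[OF p2] Node.hyps(11) by simp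
        have q0: "?prob \<in> el ?Q n" using p3 Node.hyps(11) by (simp add: el_Prob snorm_idem)
        have "ctr n ?prob t = node n S i t y s"
          unfolding ctr_def fst_conv snd_conv
          by (rule node_cong[OF _ _ i t]) (simp_all add: snorm_eq s2_def)
        then have ctr: "ctr n ?prob t = tree.Node S i t y s" using wft_node_eq[OF f wN] by simp
        have "h (?tr b (tree.Node S i t y s)) m = rs (cs B) b (h (tree.Node S i t y s) n)" if b: "b \<in> cub m n" for m b
        proof -
          have trb: "?tr b (tree.Node S i t y s) = node m (pull m b S) (i \<odot> b) (t \<odot> b) (\<lambda>a r. y (b \<odot> a) r) (\<lambda>a r. s (b \<odot> a) r)"
            by (simp add: tr_def[OF f] cub_Dom[OF b])
          note tb = comp_cub[OF b t]
          have "h (?tr b (tree.Node S i t y s)) m = fill m (rs ?Q b ?prob) (t \<odot> b)"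
          \<comment> \<open>A restriction of a node may collapse to a face; there the filler agrees with
            the box.\<close>
          proof (cases "cid m \<in> pull m b S \<or> t \<odot> b = i \<odot> b")
            case True
            then have c: "b \<in> S \<or> t \<odot> b = i \<odot> b" by (simp add: pull_iff[OF cid_cub] cub_idr[OF b])
            have "fill m (rs ?Q b ?prob) (t \<odot> b) = bd m (rs ?Q b ?prob) (t \<odot> b)"
              using True by (intro fbd[OF rs_el[OF psh_Prob b q0] tb]) (use rs_el[OF psh_Prob b q0] in \<open>auto simp: rs_Prob[OF b]\<close>)
            also have "\<dots> = snd (snorm n S i s2 b (t \<odot> b))" by (rule bds[OF p3 b t c])
            also have "\<dots> = h (s b (t \<odot> b)) m" by (simp add: snorm_eq[OF b tb c] s2_def cub_Dom[OF b])
            finally show ?thesis using True by (simp add: trb node_def cub_idr[OF b])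
          next
            case False
            let ?T = "pull m b S" and ?s = "\<lambda>a r. s (b \<odot> a) r"
            have "snorm m ?T (i \<odot> b) (\<lambda>a r. (snorm m ?T (i \<odot> b) ?s a r, h (snorm m ?T (i \<odot> b) ?s a r) (Dom Cube a))) =
              snorm m ?T (i \<odot> b) (\<lambda>a r. snorm n S i s2 (b \<odot> a) r)"
            proof (rule snorm_cong)
              fix k a r assume a: "a \<in> cub k m" and r: "r \<in> cub k 1" and c: "a \<in> ?T \<or> r = (i \<odot> b) \<odot> a"
              show "(snorm m ?T (i \<odot> b) ?s a r, h (snorm m ?T (i \<odot> b) ?s a r) (Dom Cube a)) = snorm n S i s2 (b \<odot> a) r"
                using snorm_eq[OF a r c, of ?s] snorm_eq[OF comp_cub[OF a b] r, of S i s2] c box_pull[OF i b a]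
                by (simp add: s2_def cub_Dom[OF a] cub_Dom[OF comp_cub[OF a b]])
            qed
            then show ?thesis using False by (simp add: trb node_def h_def rs_Prob[OF b])
          qed
          then show ?thesis using frs[OF b q0 t] hN by simp
        qed
        then show ?case using fel[OF q0 t] fov[OF q0 t] ctr hN by simp
      qed
      let ?h = "mp M B (\<lambda>n x. h (d n x) n)"
      have "natm (cs M) (cs B) (\<lambda>n x. h (d n x) n)"
        by (rule natmI) (use main dw natm_rs[OF d] in \<open>simp_all add: rs_Wp\<close>)
      note H = mp_hom[OF M BO this]
      have wl: "?wft n (Leaf x)" if "x \<in> fobj X n" for n x by (rule wft_Leaf[OF f that])
      have "?h \<bullet> ?l = u"
        by (rule hom_ext[OF comp_hom[OF l H] u]) (simp add: ap_comp[OF l] ew[OF wl] de[OF wl] h_def)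
      moreover have "g \<bullet> ?h = v"
        by (rule hom_ext[OF comp_hom[OF H g] v]) (simp add: ap_comp[OF H] main[OF dw] V_def ed)
      ultimately show "\<exists>d \<in> hom cS M B. d \<bullet> ?l = u \<and> g \<bullet> d = v" using H by blast
    qed
  qed
  moreover have "f = ?r \<bullet> ?l"
  proof (rule hom_ext[OF f comp_hom[OF l r]])
    fix n x assume x: "x \<in> fobj X n"
    note w = wft_Leaf[OF f x]
    show "ap f n x = ap (?r \<bullet> ?l) n x"
      by (simp add: ap_comp[OF l x] x ew[OF w] de[OF w] ov_def[OF f])
  qed
  ultimately show ?thesis by (intro bexI[of _ ?l] bexI[of _ ?r]) simp_all
qed

end


section \<open>The two weak factorization systems and their interaction\<close>

context universe
begin

lemma liftsD:
  assumes "lifts cS l r" "l \<in> hom cS A Z" "r \<in> hom cS X Y" "u \<in> hom cS A X" "v \<in> hom cS Z Y"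
    "r \<bullet> u = v \<bullet> l"
  obtains d where "d \<in> hom cS Z X" "d \<bullet> l = u" "r \<bullet> d = v"
  using assms(1,4-6) unfolding lifts_def cSet_simps hom_src[OF assms(2)] hom_tgt[OF assms(2)]
    hom_src[OF assms(3)] hom_tgt[OF assms(3)] by blast

lemma liftsI:
  assumes "l \<in> hom cS A Z" "r \<in> hom cS X Y"
    and "\<And>u v. u \<in> hom cS A X ==> v \<in> hom cS Z Y ==> r \<bullet> u = v \<bullet> l ==>
      \<exists>d \<in> hom cS Z X. d \<bullet> l = u \<and> r \<bullet> d = v"
  shows "lifts cS l r"
  using assms(3) unfolding lifts_def cSet_simps hom_src[OF assms(1)] hom_tgt[OF assms(1)]
    hom_src[OF assms(2)] hom_tgt[OF assms(2)] by blast

lemma comp_assoc: "f \<in> hom cS A B ==> g \<in> hom cS B D ==> h \<in> hom cS D E ==>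
    (h \<bullet> g) \<bullet> f = h \<bullet> (g \<bullet> f)"
  by (rule category.assoc[OF category_cSet])

lemma comp_idl: "f \<in> hom cS A B ==> Idn cS B \<bullet> f = f"
  and comp_idr: "f \<in> hom cS A B ==> f \<bullet> Idn cS A = f"
  using category.id_left[OF category_cSet] category.id_right[OF category_cSet] by blast+

text \<open>The retract argument: \<open>f\<close> is a retract of \<open>g\<close>.\<close>

lemma rlp_retract:
  assumes h: "h \<in> hom cS X M" and g: "g \<in> hom cS M Y" "g \<in> rlp cS L"
    and f: "g \<bullet> h = f" and l: "lifts cS h f" and L: "L \<subseteq> Arr cS"
  shows "f \<in> rlp cS L"
proof -
  have fh: "f \<in> hom cS X Y" using comp_hom[OF h g(1)] f by simp
  have "f \<bullet> Idn cS X = g \<bullet> h" using comp_idr[OF fh] f by simp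
  from liftsD[OF l h fh id_hom'[OF hom_Obj(1)[OF h]] g(1) this]
  obtain d where d: "d \<in> hom cS M X" "d \<bullet> h = Idn cS X" "f \<bullet> d = g" .
  have "lifts cS c f" if c: "c \<in> L" for c
  proof -
    have ch: "c \<in> hom cS (src c) (tgt c)" using c L Arr_hom by blast
    show ?thesis
    proof (rule liftsI[OF ch fh])
      fix u v assume u: "u \<in> hom cS (src c) X" and v: "v \<in> hom cS (tgt c) Y" and uv: "f \<bullet> u = v \<bullet> c"
      have "g \<bullet> (h \<bullet> u) = v \<bullet> c" using comp_assoc[OF u h g(1)] f uv by simp
      moreover have "lifts cS c g" using g(2) c by (simp add: rlp_def)
      ultimately obtain k where k: "k \<in> hom cS (tgt c) M" "k \<bullet> c = h \<bullet> u" "g \<bullet> k = v"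
        using liftsD[OF _ ch g(1) comp_hom[OF u h] v] by blast
      have "(d \<bullet> k) \<bullet> c = u"
        using comp_assoc[OF ch k(1) d(1)] k(2) comp_assoc[OF u h d(1)] d(2) comp_idl[OF u] by simp
      moreover have "f \<bullet> (d \<bullet> k) = v" using comp_assoc[OF k(1) d(1) fh] d(3) k(3) by simp
      ultimately show "\<exists>d \<in> hom cS (tgt c) X. d \<bullet> c = u \<and> f \<bullet> d = v"
        using comp_hom[OF k(1) d(1)] by blast
    qed
  qed
  then show ?thesis using hom_Arr[OF fh] by (simp add: rlp_def)
qed

text \<open>The retract argument: \<open>f\<close> is a retract of \<open>h\<close>.\<close>

lemma llp_retract:
  assumes h: "h \<in> hom cS X M" "h \<in> llp cS R" and g: "g \<in> hom cS M Y"
    and f: "g \<bullet> h = f" and l: "lifts cS f g" and R: "R \<subseteq> Arr cS"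
  shows "f \<in> llp cS R"
proof -
  have fh: "f \<in> hom cS X Y" using comp_hom[OF h(1) g] f by simp
  have "g \<bullet> h = Idn cS Y \<bullet> f" using comp_idl[OF fh] f by simp
  from liftsD[OF l fh g h(1) id_hom'[OF hom_Obj(2)[OF g]] this]
  obtain d where d: "d \<in> hom cS Y M" "d \<bullet> f = h" "g \<bullet> d = Idn cS Y" .
  have "lifts cS f r" if r: "r \<in> R" for r
  proof -
    have rh: "r \<in> hom cS (src r) (tgt r)" using r R Arr_hom by blast
    show ?thesis
    proof (rule liftsI[OF fh rh])
      fix u v assume u: "u \<in> hom cS X (src r)" and v: "v \<in> hom cS Y (tgt r)" and uv: "r \<bullet> u = v \<bullet> f"
      have "r \<bullet> u = (v \<bullet> g) \<bullet> h" using comp_assoc[OF h(1) g v] f uv by simp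
      moreover have "lifts cS h r" using h(2) r by (simp add: llp_def)
      ultimately obtain k where k: "k \<in> hom cS M (src r)" "k \<bullet> h = u" "r \<bullet> k = v \<bullet> g"
        using liftsD[OF _ h(1) rh u comp_hom[OF g v]] by blast
      have "(k \<bullet> d) \<bullet> f = u" using comp_assoc[OF fh d(1) k(1)] d(2) k(2) by simp
      moreover have "r \<bullet> (k \<bullet> d) = v"
        using comp_assoc[OF d(1) k(1) rh] k(3) comp_assoc[OF d(1) g v] d(3) comp_idr[OF v] by simp
      ultimately show "\<exists>d \<in> hom cS Y (src r). d \<bullet> f = u \<and> r \<bullet> d = v"
        using comp_hom[OF d(1) k(1)] by blast
    qed
  qed
  then show ?thesis using hom_Arr[OF fh] by (simp add: llp_def)
qed

lemma rlp_comp: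
  assumes f: "f \<in> rlp cS L" "f \<in> hom cS X Y" and g: "g \<in> rlp cS L" "g \<in> hom cS Y Z" and L: "L \<subseteq> Arr cS"
  shows "g \<bullet> f \<in> rlp cS L"
proof -
  note gf = comp_hom[OF f(2) g(2)]
  have "lifts cS c (g \<bullet> f)" if c: "c \<in> L" for c
  proof -
    have ch: "c \<in> hom cS (src c) (tgt c)" using c L Arr_hom by blast
    have cf: "lifts cS c f" and cg: "lifts cS c g" using f(1) g(1) c by (simp_all add: rlp_def)
    show ?thesis
    proof (rule liftsI[OF ch gf])
      fix u v assume u: "u \<in> hom cS (src c) X" and v: "v \<in> hom cS (tgt c) Z" and uv: "(g \<bullet> f) \<bullet> u = v \<bullet> c"
      obtain k where k: "k \<in> hom cS (tgt c) Y" "k \<bullet> c = f \<bullet> u" "g \<bullet> k = v"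
        using liftsD[OF cg ch g(2) comp_hom[OF u f(2)] v] uv comp_assoc[OF u f(2) g(2)] by auto
      obtain d where d: "d \<in> hom cS (tgt c) X" "d \<bullet> c = u" "f \<bullet> d = k"
        using liftsD[OF cf ch f(2) u k(1)] k(2) by auto
      then show "\<exists>d \<in> hom cS (tgt c) X. d \<bullet> c = u \<and> (g \<bullet> f) \<bullet> d = v"
        using comp_assoc[OF d(1) f(2) g(2)] k(3) by auto
    qed
  qed
  then show ?thesis using hom_Arr[OF gf] by (simp add: rlp_def)
qed

lemma rlp_pullback:
  assumes r: "r \<in> rlp cS L" and L: "L \<subseteq> Arr cS" and pb: "is_pullback cS e r p q"
    and e: "e \<in> hom cS X X'" and rh: "r \<in> hom cS Y' X'"
  shows "p \<in> rlp cS L"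
proof -
  have p: "p \<in> hom cS (src p) X" and q: "q \<in> hom cS (src p) Y'" and sq: "e \<bullet> p = r \<bullet> q"
    and up: "\<And>A a b. a \<in> hom cS A X ==> b \<in> hom cS A Y' ==> e \<bullet> a = r \<bullet> b ==>
      \<exists>!h. h \<in> hom cS A (src p) \<and> p \<bullet> h = a \<and> q \<bullet> h = b"
    using pb unfolding is_pullback_def cSet_simps hom_src[OF e] hom_src[OF rh] by blast+
  have "lifts cS c p" if c: "c \<in> L" for c
  proof -
    have ch: "c \<in> hom cS (src c) (tgt c)" using c L Arr_hom by blast
    have cr: "lifts cS c r" using r c by (simp add: rlp_def)
    show ?thesis
    proof (rule liftsI[OF ch p])
      fix u v assume u: "u \<in> hom cS (src c) (src p)" and v: "v \<in> hom cS (tgt c) X" and uv: "p \<bullet> u = v \<bullet> c"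
      have "r \<bullet> (q \<bullet> u) = (e \<bullet> v) \<bullet> c"
        using comp_assoc[OF u q rh] comp_assoc[OF u p e] comp_assoc[OF ch v e] sq uv by simp
      from liftsD[OF cr ch rh comp_hom[OF u q] comp_hom[OF v e] this]
      obtain k where k: "k \<in> hom cS (tgt c) Y'" "k \<bullet> c = q \<bullet> u" "r \<bullet> k = e \<bullet> v" .
      obtain d where d: "d \<in> hom cS (tgt c) (src p)" "p \<bullet> d = v" "q \<bullet> d = k"
        using up[OF v k(1) k(3)[symmetric]] by blast
      have c1: "p \<bullet> (d \<bullet> c) = p \<bullet> u" "q \<bullet> (d \<bullet> c) = q \<bullet> u"
        using comp_assoc[OF ch d(1) p] comp_assoc[OF ch d(1) q] d k uv by simp_all
      have "e \<bullet> (p \<bullet> u) = r \<bullet> (q \<bullet> u)"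
        using comp_assoc[OF u q rh] comp_assoc[OF u p e] sq by simp
      from up[OF comp_hom[OF u p] comp_hom[OF u q] this] have "d \<bullet> c = u"
        using c1 u comp_hom[OF ch d(1)] by blast
      then show "\<exists>d \<in> hom cS (tgt c) (src p). d \<bullet> c = u \<and> p \<bullet> d = v" using d by blast
    qed
  qed
  then show ?thesis using hom_Arr[OF p] by (simp add: rlp_def)
qed

end

context cubical_cofibrations
begin

lemma C_Arr: "\<C> \<subseteq> Arr cS" and Fib_Arrs: "Fib \<C> \<subseteq> Arr cS" and TFib_Arrs: "TFib \<C> \<subseteq> Arr cS"
  and TCof_Arrs: "TCof \<C> \<subseteq> Arr cS"
  using cof_monic by (auto simp: monic_def Fib_def TFib_def rlp_def TCof_def llp_def)

text \<open>Factor \<open>f = p \<cdot> i\<close> and lift. Besides being a retract of the cofibration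
  \<open>i\<close>, \<open>f\<close> is the pullback of \<open>i\<close> along the section
  \<open>d\<close> of \<open>p\<close>, so stability under pullback suffices.\<close>

lemma C_llp: "\<C> = llp cS (TFib \<C>)"
proof
  show "\<C> \<subseteq> llp cS (TFib \<C>)" using C_Arr by (auto simp: llp_def TFib_def rlp_def)
  show "llp cS (TFib \<C>) \<subseteq> \<C>"
  proof
    fix f assume f: "f \<in> llp cS (TFib \<C>)"
    then have fh: "f \<in> hom cS (src f) (tgt f)" using Arr_hom[of f] by (simp add: llp_def)
    obtain i p where ip: "i \<in> \<C>" "p \<in> TFib \<C>" "tgt i = src p" "f = p \<bullet> i"
      using factor_C_TFib[OF fh] by auto
    have "src f = src i" "tgt f = tgt p" using ip(4) by (simp_all add: cSet_comp)
    then have i: "i \<in> hom cS (src f) (src p)" and p: "p \<in> hom cS (src p) (tgt f)"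
      using cof_hom[OF ip(1)] Arr_hom[OF TFib_Arr[OF ip(2)]] ip(3) by simp_all
    have "lifts cS f p" using f ip(2) by (simp add: llp_def)
    moreover have "p \<bullet> i = Idn cS (tgt f) \<bullet> f" using comp_idl[OF fh] ip(4) by simp
    ultimately obtain d where d: "d \<in> hom cS (tgt f) (src p)" "d \<bullet> f = i" "p \<bullet> d = Idn cS (tgt f)"
      using liftsD[OF _ fh p i id_hom'[OF hom_Obj(2)[OF fh]]] by blast
    note X = hom_Obj(1)[OF fh] and Y = hom_Obj(2)[OF fh]
    have df: "ap d n (ap f n x) = ap i n x" if "x \<in> fobj (src f) n" for n x
      using ap_comp[OF fh that, of d] d(2) by simp
    have pd: "ap p n (ap d n y) = y" if "y \<in> fobj (tgt f) n" for n y
      using ap_comp[OF d(1) that, of p] d(3) that Y by simp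
    have "is_pullback cS d i f (Idn cS (src f))"
    proof (rule is_pullbackI[OF d(1) i fh id_hom'[OF X]])
      fix n y x assume y: "y \<in> fobj (tgt f) n" and x: "x \<in> fobj (src f) n" and e: "ap d n y = ap i n x"
      have "ap f n x = y" using pd[OF y] pd[OF ap_el[OF fh x]] df[OF x] e by simp
      then show "\<exists>w\<in>fobj (src f) n. ap f n w = y \<and> ap (Idn cS (src f)) n w = x" using x X by auto
    qed (use df X in auto)
    then show "f \<in> \<C>" by (rule C3[OF ip(1)])
  qed
qed

lemma TCof_C: "TCof \<C> \<subseteq> \<C>"
  using TFib_Fib unfolding TCof_def by (subst C_llp) (auto simp: llp_def)

text \<open>Box inclusions are trivial cofibrations, and they detect fibrations.\<close>

lemma Fib_rlp: "Fib \<C> = rlp cS (TCof \<C>)"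
proof
  show "Fib \<C> \<subseteq> rlp cS (TCof \<C>)" using Fib_Arrs by (auto simp: rlp_def TCof_def llp_def)
  show "rlp cS (TCof \<C>) \<subseteq> Fib \<C>"
  proof
    fix r assume r: "r \<in> rlp cS (TCof \<C>)"
    then have rh: "r \<in> hom cS (src r) (tgt r)" using Arr_hom[of r] by (simp add: rlp_def)
    show "r \<in> Fib \<C>"
    proof (rule Fib_I[OF rh])
      fix Z A i assume Z: "Z \<in> Obj cS" and A: "cof (cs Z) A" and i: "natm (cs Z) Ip i"
      obtain l where l: "l \<in> Arr cS" "\<And>r. r \<in> Arr cS ==> lifts cS l r \<longleftrightarrow> ext r (cs Z \<otimes> Ip) (box (cs Z) i A)"
        using inclusion_lifts[OF tinyp_prodp[OF tinyp_cs[OF Z] tinyp_yo] subf_box[OF psh_cs[OF Z] cof_subf[OF A] i]]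
        by blast
      have "l \<in> TCof \<C>"
        using l Fib_ext[OF _ tinyp_cs[OF Z] A i] Fib_Arrs by (auto simp: TCof_def llp_def)
      then have "lifts cS l r" using r by (simp add: rlp_def)
      then show "ext r (cs Z \<otimes> Ip) (box (cs Z) i A)" using l(2)[OF hom_Arr[OF rh]] by blast
    qed
  qed
qed

lemma WEq_I: "h \<in> TCof \<C> ==> g \<in> TFib \<C> ==> tgt h = src g ==> g \<bullet> h \<in> WEq \<C>"
  unfolding WEq_def by auto

lemma WEq_E:
  assumes "f \<in> WEq \<C>" "f \<in> hom cS X Y"
  obtains M h g where "h \<in> TCof \<C>" "g \<in> TFib \<C>" "h \<in> hom cS X M" "g \<in> hom cS M Y" "f = g \<bullet> h"
proof -
  obtain g h where gh: "f = g \<bullet> h" "h \<in> TCof \<C>" "g \<in> TFib \<C>" "tgt h = src g"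
    using assms(1) by (auto simp: WEq_def)
  have "src h = X" "tgt g = Y" using gh(1) hom_src[OF assms(2)] hom_tgt[OF assms(2)] by (simp_all add: cSet_comp)
  then have "h \<in> hom cS X (src g)" "g \<in> hom cS (src g) Y"
    using Arr_hom[of h] Arr_hom[of g] TCof_Arrs TFib_Arrs gh by auto
  then show ?thesis using that gh by blast
qed

lemma id_TCof: "X \<in> Obj cS ==> Idn cS X \<in> TCof \<C>"
proof -
  assume X: "X \<in> Obj cS"
  note i = id_hom'[OF X]
  have "lifts cS (Idn cS X) r" if r: "r \<in> Fib \<C>" for r
  proof (rule liftsI[OF i Fib_hom[OF r]])
    fix u v assume u: "u \<in> hom cS X (src r)" and v: "v \<in> hom cS X (tgt r)" and "r \<bullet> u = v \<bullet> Idn cS X"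
    then show "\<exists>d \<in> hom cS X (src r). d \<bullet> Idn cS X = u \<and> r \<bullet> d = v"
      using comp_idr[OF u] comp_idr[OF v] by auto
  qed
  then show ?thesis using hom_Arr[OF i] by (simp add: TCof_def llp_def)
qed

lemma id_TFib: "X \<in> Obj cS ==> Idn cS X \<in> TFib \<C>"
proof -
  assume X: "X \<in> Obj cS"
  note i = id_hom'[OF X]
  have "lifts cS l (Idn cS X)" if l: "l \<in> \<C>" for l
  proof (rule liftsI[OF cof_hom[OF l] i])
    fix u v assume u: "u \<in> hom cS (src l) X" and v: "v \<in> hom cS (tgt l) X" and "Idn cS X \<bullet> u = v \<bullet> l"
    then show "\<exists>d \<in> hom cS (tgt l) X. d \<bullet> l = u \<and> Idn cS X \<bullet> d = v"
      using comp_idl[OF u] comp_idl[OF v] by auto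
  qed
  then show ?thesis using hom_Arr[OF i] by (simp add: TFib_def rlp_def)
qed

lemma TCof_WEq: "TCof \<C> \<subseteq> WEq \<C>"
proof
  fix h assume h: "h \<in> TCof \<C>"
  then have hh: "h \<in> hom cS (src h) (tgt h)" using TCof_Arrs Arr_hom by blast
  note i = id_TFib[OF hom_Obj(2)[OF hh]] id_hom'[OF hom_Obj(2)[OF hh]]
  show "h \<in> WEq \<C>" using WEq_I[OF h i(1)] hom_src[OF i(2)] comp_idl[OF hh] by simp
qed

lemma TFib_WEq: "TFib \<C> \<subseteq> WEq \<C>"
proof
  fix g assume g: "g \<in> TFib \<C>"
  then have gh: "g \<in> hom cS (src g) (tgt g)" using TFib_Arrs Arr_hom by blast
  note i = id_TCof[OF hom_Obj(1)[OF gh]] id_hom'[OF hom_Obj(1)[OF gh]]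
  show "g \<in> WEq \<C>" using WEq_I[OF i(1) g] hom_tgt[OF i(2)] comp_idr[OF gh] by simp
qed

lemma WEq_Arrs: "WEq \<C> \<subseteq> Arr cS"
proof
  fix f assume "f \<in> WEq \<C>"
  then obtain g h where gh: "f = g \<bullet> h" "h \<in> TCof \<C>" "g \<in> TFib \<C>" "tgt h = src g"
    by (auto simp: WEq_def)
  then have "h \<in> hom cS (src h) (src g)" "g \<in> hom cS (src g) (tgt g)"
    using Arr_hom[of h] Arr_hom[of g] TCof_Arrs TFib_Arrs by auto
  from hom_Arr[OF comp_hom[OF this]] show "f \<in> Arr cS" using gh(1) by simp
qed

lemma WEq_Fib: "WEq \<C> \<inter> Fib \<C> = TFib \<C>"
proof
  show "TFib \<C> \<subseteq> WEq \<C> \<inter> Fib \<C>" using TFib_WEq TFib_Fib by blast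
  show "WEq \<C> \<inter> Fib \<C> \<subseteq> TFib \<C>"
  proof
    fix f assume f: "f \<in> WEq \<C> \<inter> Fib \<C>"
    then obtain M h g where gh: "h \<in> TCof \<C>" "g \<in> TFib \<C>" "h \<in> hom cS (src f) M" "g \<in> hom cS M (tgt f)" "f = g \<bullet> h"
      using WEq_E[OF _ Fib_hom] by blast
    have "lifts cS h f" using gh(1) f by (simp add: TCof_def llp_def)
    then show "f \<in> TFib \<C>"
      using rlp_retract[OF gh(3,4) _ gh(5)[symmetric] _ C_Arr] gh(2) by (simp add: TFib_def)
  qed
qed

lemma C_WEq: "\<C> \<inter> WEq \<C> = TCof \<C>"
proof
  show "TCof \<C> \<subseteq> \<C> \<inter> WEq \<C>" using TCof_WEq TCof_C by blast
  show "\<C> \<inter> WEq \<C> \<subseteq> TCof \<C>"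
  proof
    fix f assume f: "f \<in> \<C> \<inter> WEq \<C>"
    then obtain M h g where gh: "h \<in> TCof \<C>" "g \<in> TFib \<C>" "h \<in> hom cS (src f) M" "g \<in> hom cS M (tgt f)" "f = g \<bullet> h"
      using WEq_E[OF _ cof_hom] by blast
    have "lifts cS f g" using gh(2) f by (simp add: TFib_def rlp_def)
    then show "f \<in> TCof \<C>"
      using llp_retract[OF gh(3) _ gh(4) gh(5)[symmetric] _ Fib_Arrs] gh(1) by (simp add: TCof_def)
  qed
qed

lemma wfs_C_TFib: "weak_factorization_system cS \<C> (TFib \<C>)"
  unfolding weak_factorization_system_def
  using C_llp factor_C_TFib[OF Arr_hom] by (simp add: TFib_def)

lemma wfs_TCof_Fib: "weak_factorization_system cS (TCof \<C>) (Fib \<C>)"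
  unfolding weak_factorization_system_def
  using Fib_rlp factor_TCof_Fib[OF Arr_hom] by (simp add: TCof_def)

end


section \<open>Homotopy classes of maps into fibrant objects\<close>

definition htp :: "'u cset => 'u cset => 'u cmap => 'u cmap => bool" where
  "htp Y K a b \<longleftrightarrow> a \<in> hom cSet Y K \<and> b \<in> hom cSet Y K \<and>
    (\<exists>H. natm (cs Y \<otimes> Ip) (cs K) H \<and>
      (\<forall>n. \<forall>y \<in> fobj Y n. H n (y, e0 n) = ap a n y \<and> H n (y, e1 n) = ap b n y))"

text \<open>The relation \<open>htp\<close> need not be symmetric or transitive. The classes of the
  equivalence that it generates are the connected components of \<open>K\<^sup>Y\<close>.\<close>

abbreviation heq :: "'u cset => 'u cset => 'u cmap => 'u cmap => bool" where
  "heq Y K \<equiv> equivclp (htp Y K)"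

text \<open>A homotopy together with a choice of direction: \<open>p\<close> and \<open>q\<close> are the two endpoints.\<close>

definition ends :: "(nat => cube_arrow) => (nat => cube_arrow) => bool" where
  "ends p q \<longleftrightarrow> (p = e0 \<and> q = e1) \<or> (p = e1 \<and> q = e0)"

lemma ends_cub: "ends p q ==> p n \<in> cub n 1" "ends p q ==> q n \<in> cub n 1"
  by (auto simp: ends_def)

lemma ends_comp: "ends p q ==> a \<in> cub m n ==> p n \<odot> a = p m" "ends p q ==> a \<in> cub m n ==> q n \<odot> a = q m"
  by (auto simp: ends_def e0_comp e1_comp)

lemma symclp_htp:
  assumes "symclp (htp Y K) a b"
  obtains p q H where "ends p q" "a \<in> hom cSet Y K" "b \<in> hom cSet Y K"
    "\<And>n y t. y \<in> fobj Y n ==> t \<in> cub n 1 ==> H n y t \<in> fobj K n"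
    "\<And>m n c y t. c \<in> cub m n ==> y \<in> fobj Y n ==> t \<in> cub n 1 ==> H m (rs (cs Y) c y) (t \<odot> c) = rs (cs K) c (H n y t)"
    "\<And>n y. y \<in> fobj Y n ==> H n y (p n) = ap a n y" "\<And>n y. y \<in> fobj Y n ==> H n y (q n) = ap b n y"
proof -
  have nat: "(\<forall>n y t. y \<in> fobj Y n \<longrightarrow> t \<in> cub n 1 \<longrightarrow> H n (y, t) \<in> fobj K n) \<and>
    (\<forall>m n c y t. c \<in> cub m n \<longrightarrow> y \<in> fobj Y n \<longrightarrow> t \<in> cub n 1 \<longrightarrow> H m (rs (cs Y) c y, t \<odot> c) = rs (cs K) c (H n (y, t)))"
    if "natm (cs Y \<otimes> Ip) (cs K) H" for H
    using natm_el[OF that] natm_rs[OF that] by fastforce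
  from assms consider "htp Y K a b" | "htp Y K b a" by (auto simp: symclp_def)
  then show ?thesis
  proof cases
    case 1
    then obtain H where H: "natm (cs Y \<otimes> Ip) (cs K) H" "a \<in> hom cSet Y K" "b \<in> hom cSet Y K"
      "\<And>n y. y \<in> fobj Y n ==> H n (y, e0 n) = ap a n y" "\<And>n y. y \<in> fobj Y n ==> H n (y, e1 n) = ap b n y"
      by (auto simp: htp_def)
    show ?thesis by (rule that[of e0 e1 "\<lambda>n y t. H n (y, t)"]) (use H nat[OF H(1)] in \<open>auto simp: ends_def\<close>)
  next
    case 2
    then obtain H where H: "natm (cs Y \<otimes> Ip) (cs K) H" "b \<in> hom cSet Y K" "a \<in> hom cSet Y K"
      "\<And>n y. y \<in> fobj Y n ==> H n (y, e0 n) = ap b n y" "\<And>n y. y \<in> fobj Y n ==> H n (y, e1 n) = ap a n y"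
      by (auto simp: htp_def)
    show ?thesis by (rule that[of e1 e0 "\<lambda>n y t. H n (y, t)"]) (use H nat[OF H(1)] in \<open>auto simp: ends_def\<close>)
  qed
qed

lemma symclp_htpI:
  assumes "ends p q" "a \<in> hom cSet Y K" "b \<in> hom cSet Y K"
    "\<And>n y t. y \<in> fobj Y n ==> t \<in> cub n 1 ==> H n y t \<in> fobj K n"
    "\<And>m n c y t. c \<in> cub m n ==> y \<in> fobj Y n ==> t \<in> cub n 1 ==> H m (rs (cs Y) c y) (t \<odot> c) = rs (cs K) c (H n y t)"
    "\<And>n y. y \<in> fobj Y n ==> H n y (p n) = ap a n y" "\<And>n y. y \<in> fobj Y n ==> H n y (q n) = ap b n y"
  shows "symclp (htp Y K) a b"
proof -
  have "natm (cs Y \<otimes> Ip) (cs K) (\<lambda>n w. H n (fst w) (snd w))" by (rule natm_prodI) (simp_all add: assms)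
  note H = this
  from assms(1) consider "p = e0" "q = e1" | "p = e1" "q = e0" by (auto simp: ends_def)
  then show ?thesis
  proof cases
    case 1
    have "htp Y K a b" unfolding htp_def using assms(2,3,6,7) H 1
      by (intro conjI exI[of _ "\<lambda>n w. H n (fst w) (snd w)"]) simp_all
    then show ?thesis by (simp add: symclp_def)
  next
    case 2
    have "htp Y K b a" unfolding htp_def using assms(2,3,6,7) H 2
      by (intro conjI exI[of _ "\<lambda>n w. H n (fst w) (snd w)"]) simp_all
    then show ?thesis by (simp add: symclp_def)
  qed
qed

lemma htp_hom: "htp Y K a b ==> a \<in> hom cSet Y K" "htp Y K a b ==> b \<in> hom cSet Y K"
  by (auto simp: htp_def)

lemma equivclp_map:
  assumes "equivclp r a b" "\<And>a b. r a b ==> equivclp s (f a) (f b)"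
  shows "equivclp s (f a) (f b)"
  using assms(1)
proof (induction rule: equivclp_induct)
  case base
  then show ?case by simp
next
  case (step y z)
  then show ?case using assms(2)[of y z] assms(2)[of z y] by (meson equivclp_sym equivclp_trans)
qed

context universe
begin

lemma heq_post:
  assumes "heq Y K a b" and k: "k \<in> hom cS K L"
  shows "heq Y L (k \<bullet> a) (k \<bullet> b)"
  using assms(1)
proof (rule equivclp_map)
  fix a b assume h: "htp Y K a b"
  note ab = htp_hom[OF h]
  obtain H where H: "natm (cs Y \<otimes> Ip) (cs K) H"
    "\<forall>n. \<forall>y \<in> fobj Y n. H n (y, e0 n) = ap a n y \<and> H n (y, e1 n) = ap b n y"
    using h by (auto simp: htp_def)
  have "htp Y L (k \<bullet> a) (k \<bullet> b)"
    unfolding htp_def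
    using comp_hom[OF ab(1) k] comp_hom[OF ab(2) k] natm_comp[OF H(1) ap_natm[OF k]] H(2)
    by (auto intro!: exI[of _ "\<lambda>n w. ap k n (H n w)"] simp: ap_comp[OF ab(1)] ap_comp[OF ab(2)])
  then show "heq Y L (k \<bullet> a) (k \<bullet> b)" by (rule r_into_equivclp)
qed

lemma heq_pre:
  assumes "heq Y K a b" and f: "f \<in> hom cS X Y"
  shows "heq X K (a \<bullet> f) (b \<bullet> f)"
  using assms(1)
proof (rule equivclp_map)
  fix a b assume h: "htp Y K a b"
  note ab = htp_hom[OF h]
  obtain H where H: "natm (cs Y \<otimes> Ip) (cs K) H"
    "\<forall>n. \<forall>y \<in> fobj Y n. H n (y, e0 n) = ap a n y \<and> H n (y, e1 n) = ap b n y"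
    using h by (auto simp: htp_def)
  have "natm (cs X \<otimes> Ip) (cs Y \<otimes> Ip) (\<lambda>n w. (ap f n (fst w), snd w))"
    using ap_natm[OF f] by (auto simp: natm_def)
  from natm_comp[OF this H(1)] have "htp X K (a \<bullet> f) (b \<bullet> f)"
    unfolding htp_def
    using comp_hom[OF f ab(1)] comp_hom[OF f ab(2)] H(2) ap_el[OF f]
    by (auto intro!: exI[of _ "\<lambda>n w. H n (ap f n (fst w), snd w)"] simp: ap_comp[OF f])
  then show "heq X K (a \<bullet> f) (b \<bullet> f)" by (rule r_into_equivclp)
qed

end

context cubical_cofibrations
begin

text \<open>The maps that induce bijections of homotopy classes \<open>[Y, K] \<rightarrow> [X, K]\<close> for fibrant \<open>K\<close>.\<close>

definition whe :: "'u cset => 'u cset => 'u cmap => bool" where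
  "whe X Y f \<longleftrightarrow> f \<in> hom cS X Y \<and> (\<forall>K. fibrant \<C> K \<longrightarrow>
    (\<forall>a \<in> hom cS X K. \<exists>b \<in> hom cS Y K. heq X K (b \<bullet> f) a) \<and>
    (\<forall>b \<in> hom cS Y K. \<forall>b' \<in> hom cS Y K. heq X K (b \<bullet> f) (b' \<bullet> f) \<longrightarrow> heq Y K b b'))"

lemma wheD:
  assumes "whe X Y f"
  shows "f \<in> hom cS X Y"
    and "fibrant \<C> K ==> a \<in> hom cS X K ==> \<exists>b \<in> hom cS Y K. heq X K (b \<bullet> f) a"
    and "fibrant \<C> K ==> b \<in> hom cS Y K ==> b' \<in> hom cS Y K ==> heq X K (b \<bullet> f) (b' \<bullet> f) ==> heq Y K b b'"
  using assms unfolding whe_def by blast+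

lemma wheI:
  assumes "f \<in> hom cS X Y"
    and "\<And>K a. fibrant \<C> K ==> a \<in> hom cS X K ==> \<exists>b \<in> hom cS Y K. heq X K (b \<bullet> f) a"
    and "\<And>K b b'. fibrant \<C> K ==> b \<in> hom cS Y K ==> b' \<in> hom cS Y K ==> heq X K (b \<bullet> f) (b' \<bullet> f) ==> heq Y K b b'"
  shows "whe X Y f"
  using assms unfolding whe_def by blast

lemma whe_comp:
  assumes f: "whe X Y f" and g: "whe Y Z g"
  shows "whe X Z (g \<bullet> f)"
proof (rule wheI)
  note F = wheD[OF f] and G = wheD[OF g]
  show "g \<bullet> f \<in> hom cS X Z" by (rule comp_hom[OF F(1) G(1)])
  fix K assume K: "fibrant \<C> K"
  show "\<exists>c \<in> hom cS Z K. heq X K (c \<bullet> (g \<bullet> f)) a" if a: "a \<in> hom cS X K" for a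
  proof -
    obtain b where b: "b \<in> hom cS Y K" "heq X K (b \<bullet> f) a" using F(2)[OF K a] by blast
    obtain c where c: "c \<in> hom cS Z K" "heq Y K (c \<bullet> g) b" using G(2)[OF K b(1)] by blast
    have "heq X K ((c \<bullet> g) \<bullet> f) a" using equivclp_trans[OF heq_pre[OF c(2) F(1)] b(2)] .
    then show ?thesis using c(1) comp_assoc[OF F(1) G(1) c(1)] by auto
  qed
  show "heq Z K c c'" if c: "c \<in> hom cS Z K" and c': "c' \<in> hom cS Z K"
      and e: "heq X K (c \<bullet> (g \<bullet> f)) (c' \<bullet> (g \<bullet> f))" for c c'
    using e F(3)[OF K comp_hom[OF G(1) c] comp_hom[OF G(1) c']] G(3)[OF K c c']
    by (simp add: comp_assoc[OF F(1) G(1) c] comp_assoc[OF F(1) G(1) c'])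
qed

lemma whe_cancel_right:
  assumes f: "whe X Y f" and g: "g \<in> hom cS Y Z" and gf: "whe X Z (g \<bullet> f)"
  shows "whe Y Z g"
proof (rule wheI[OF g])
  note F = wheD[OF f] and GF = wheD[OF gf]
  fix K assume K: "fibrant \<C> K"
  show "\<exists>c \<in> hom cS Z K. heq Y K (c \<bullet> g) b" if b: "b \<in> hom cS Y K" for b
  proof -
    obtain c where c: "c \<in> hom cS Z K" "heq X K (c \<bullet> (g \<bullet> f)) (b \<bullet> f)"
      using GF(2)[OF K comp_hom[OF F(1) b]] by blast
    then show ?thesis
      using F(3)[OF K comp_hom[OF g c(1)] b] by (auto simp: comp_assoc[OF F(1) g c(1)])
  qed
  show "heq Z K c c'" if c: "c \<in> hom cS Z K" and c': "c' \<in> hom cS Z K" and e: "heq Y K (c \<bullet> g) (c' \<bullet> g)" for c c'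
    using heq_pre[OF e F(1)] GF(3)[OF K c c'] by (simp add: comp_assoc[OF F(1) g c] comp_assoc[OF F(1) g c'])
qed

lemma whe_cancel_left:
  assumes f: "f \<in> hom cS X Y" and g: "whe Y Z g" and gf: "whe X Z (g \<bullet> f)"
  shows "whe X Y f"
proof (rule wheI[OF f])
  note G = wheD[OF g] and GF = wheD[OF gf]
  fix K assume K: "fibrant \<C> K"
  show "\<exists>b \<in> hom cS Y K. heq X K (b \<bullet> f) a" if a: "a \<in> hom cS X K" for a
  proof -
    obtain c where c: "c \<in> hom cS Z K" "heq X K (c \<bullet> (g \<bullet> f)) a" using GF(2)[OF K a] by blast
    then show ?thesis
      using comp_hom[OF G(1) c(1)] comp_assoc[OF f G(1) c(1)] by (intro bexI[of _ "c \<bullet> g"]) simp_all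
  qed
  show "heq Y K b b'" if b: "b \<in> hom cS Y K" and b': "b' \<in> hom cS Y K" and e: "heq X K (b \<bullet> f) (b' \<bullet> f)" for b b'
  proof -
    obtain c where c: "c \<in> hom cS Z K" "heq Y K (c \<bullet> g) b" using G(2)[OF K b] by blast
    obtain c' where c': "c' \<in> hom cS Z K" "heq Y K (c' \<bullet> g) b'" using G(2)[OF K b'] by blast
    have "heq X K ((c \<bullet> g) \<bullet> f) ((c' \<bullet> g) \<bullet> f)"
      using heq_pre[OF c(2) f] e heq_pre[OF c'(2) f] by (meson equivclp_sym equivclp_trans)
    then have "heq Z K c c'"
      using GF(3)[OF K c(1) c'(1)] by (simp add: comp_assoc[OF f G(1) c(1)] comp_assoc[OF f G(1) c'(1)])
    from heq_pre[OF this G(1)] show ?thesis using c(2) c'(2) by (meson equivclp_sym equivclp_trans)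
  qed
qed

lemma fibrant_to_one: "fibrant \<C> K ==> to_one K \<in> Fib \<C>" "fibrant \<C> K ==> K \<in> Obj cS"
  using one_hom_ext to_one_hom unfolding fibrant_def by metis+

lemma TCof_extend:
  assumes h: "h \<in> TCof \<C>" "h \<in> hom cS X Y" and K: "fibrant \<C> K" and a: "a \<in> hom cS X K"
  shows "\<exists>b \<in> hom cS Y K. b \<bullet> h = a"
proof -
  note f = fibrant_to_one[OF K]
  note t = to_one_hom[OF f(2)] and tY = to_one_hom[OF hom_Obj(2)[OF h(2)]]
  have "lifts cS h (to_one K)" using h f by (simp add: TCof_def llp_def)
  moreover have "to_one K \<bullet> a = to_one Y \<bullet> h"
    by (rule one_hom_ext[OF comp_hom[OF a t] comp_hom[OF h(2) tY]])
  ultimately show ?thesis using liftsD[OF _ h(2) t a tY] by metis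
qed

text \<open>The endpoint map of the path object.\<close>

definition ev01 :: "'u cset => 'u cmap" where
  "ev01 K = pairing cS (mp (pathob K) K (\<lambda>n y. evI K n y (e0 n))) (mp (pathob K) K (\<lambda>n y. evI K n y (e1 n)))"

lemma ev01:
  assumes K: "K \<in> Obj cS"
  shows "ev01 K \<in> hom cS (pathob K) (prod_obj cS K K)"
    and "y \<in> fobj (pathob K) n ==> ap (ev01 K) n y = pe K K n (evI K n y (e0 n), evI K n y (e1 n))"
proof -
  have "mp (pathob K) K (\<lambda>n y. evI K n y (p n)) \<in> hom cS (pathob K) K" if "ends p q" for p q
  proof (intro mp_hom path_Obj K natmI)
    show "evI K n y (p n) \<in> el (cs K) n" if "y \<in> el (cs (pathob K)) n" for n y
      using evI_el[OF K] that ends_cub(1)[OF \<open>ends p q\<close>] by simp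
    show "evI K m (rs (cs (pathob K)) a y) (p m) = rs (cs K) a (evI K n y (p n))"
      if "a \<in> cub m n" "y \<in> el (cs (pathob K)) n" for m n a y
      using evI_rs[OF K that(1) _ ends_cub(1)[OF \<open>ends p q\<close>], of y] ends_comp(1)[OF \<open>ends p q\<close> that(1)] that by simp
  qed
  from this[of e0 e1] this[of e1 e0] have e: "mp (pathob K) K (\<lambda>n y. evI K n y (e0 n)) \<in> hom cS (pathob K) K"
    "mp (pathob K) K (\<lambda>n y. evI K n y (e1 n)) \<in> hom cS (pathob K) K" by (simp_all add: ends_def)
  show "ev01 K \<in> hom cS (pathob K) (prod_obj cS K K)" unfolding ev01_def by (rule pairing_hom(1)[OF e])
  show "y \<in> fobj (pathob K) n ==> ap (ev01 K) n y = pe K K n (evI K n y (e0 n), evI K n y (e1 n))"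
    unfolding ev01_def by (simp add: pairing_hom(2)[OF e])
qed

text \<open>The ends of the cylinder are cut out by equations between points of the interval.\<close>

lemma cof_ends:
  assumes P: "psh P" and A: "cof P A"
  shows "cof (P \<otimes> Ip) (\<lambda>n. {(z, b). z \<in> el P n \<and> b \<in> cub n 1 \<and> (z \<in> A n \<or> b = e0 n \<or> b = e1 n)})"
proof -
  have PI: "psh (P \<otimes> Ip)" by (intro psh_prodp P psh_yo)
  have f: "natm (P \<otimes> Ip) P (\<lambda>n w. fst w)" and s: "natm (P \<otimes> Ip) Ip (\<lambda>n w. snd w)"
    and c0: "natm (P \<otimes> Ip) Ip (\<lambda>n w. e0 n)" and c1: "natm (P \<otimes> Ip) Ip (\<lambda>n w. e1 n)"
    by (auto simp: natm_def e0_comp e1_comp)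
  have "(\<lambda>n. {(z, b). z \<in> el P n \<and> b \<in> cub n 1 \<and> (z \<in> A n \<or> b = e0 n \<or> b = e1 n)}) =
    (\<lambda>n. {w \<in> el (P \<otimes> Ip) n. fst w \<in> A n} \<union> ({w \<in> el (P \<otimes> Ip) n. snd w = e0 n} \<union> {w \<in> el (P \<otimes> Ip) n. snd w = e1 n}))"
    by (auto simp: fun_eq_iff)
  then show ?thesis
    using cof_Un[OF cof_preimage[OF A f PI] cof_Un[OF cof_eq[OF s c0 PI] cof_eq[OF s c1 PI]]] by simp
qed

text \<open>The endpoint map of the path object of a fibrant object is a fibration: a box filling problem for it
  transposes, by exchanging the two interval coordinates, to one for \<open>K\<close> itself.\<close>

lemma ev01_Fib:
  assumes K: "fibrant \<C> K"
  shows "ev01 K \<in> Fib \<C>"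
proof -
  note KF = fibrant_to_one(1)[OF K] and KO = fibrant_to_one(2)[OF K]
  note r = ev01[OF KO] and pK = pr_hom[OF KO KO] and peK = prod_elements[OF KO KO]
  show ?thesis
  proof (rule Fib_I[OF r(1)], rule extI[OF r(1)])
    fix Z A i u v assume Z: "Z \<in> Obj cS" and A: "cof (cs Z) A" and i: "natm (cs Z) Ip i"
      and u: "natm (restr (cs Z \<otimes> Ip) (box (cs Z) i A)) (cs (pathob K)) u"
      and v: "natm (cs Z \<otimes> Ip) (cs (prod_obj cS K K)) v"
      and uv: "\<And>n z. z \<in> box (cs Z) i A n ==> ap (ev01 K) n (u n z) = v n z"
    note ps = psh_cs[OF Z]
    let ?P = "cs Z \<otimes> Ip"
    let ?A = "\<lambda>n. {(z, b). z \<in> el (cs Z) n \<and> b \<in> cub n 1 \<and> (z \<in> A n \<or> b = e0 n \<or> b = e1 n)}"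
    let ?i = "\<lambda>n w. i n (fst w)"
    let ?v1 = "\<lambda>n w. ap (pr1 cS K K) n (v n w)" and ?v2 = "\<lambda>n w. ap (pr2 cS K K) n (v n w)"
    have v1: "natm ?P (cs K) ?v1" and v2: "natm ?P (cs K) ?v2"
      using natm_comp[OF v ap_natm[OF pK(1)]] natm_comp[OF v ap_natm[OF pK(2)]] .
    have tP: "tinyp ?P" by (intro tinyp_prodp tinyp_cs Z tinyp_yo)
    have iP: "natm ?P Ip ?i" using i by (auto simp: natm_def)
    have bx: "(z, t) \<in> box (cs Z) i A n \<longleftrightarrow> z \<in> fobj Z n \<and> t \<in> cub n 1 \<and> (z \<in> A n \<or> t = i n z)" for n z t
      by (auto simp: box_def)
    have uel: "u n (z, t) \<in> fobj (pathob K) n" if "(z, t) \<in> box (cs Z) i A n" for n z t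
      using natm_el[OF u, of "(z, t)" n] that by simp
    have uvb: "evI K n (u n (z, t)) (e0 n) = ?v1 n (z, t)" "evI K n (u n (z, t)) (e1 n) = ?v2 n (z, t)"
      if b: "(z, t) \<in> box (cs Z) i A n" for n z t
      using uv[OF b, symmetric] r(2)[OF uel[OF b]] peK(2,3)[OF evI_el[OF KO uel[OF b] e0_cub] evI_el[OF KO uel[OF b] e1_cub]]
      by simp_all
    \<comment> \<open>The problem for \<open>K\<close> has the path coordinate \<open>b\<close> as part
      of the base: on the box of the given problem it is \<open>u\<close>, at the ends
      \<open>b = e0, e1\<close> it is prescribed by \<open>v\<close>.\<close>
    define U where "U n w t = (if (fst w, t) \<in> box (cs Z) i A n then evI K n (u n (fst w, t)) (snd w)
      else if snd w = e0 n then ?v1 n (fst w, t) else ?v2 n (fst w, t))" for n and w :: "'u \<times> cube_arrow" and t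
    have U0: "U n (z, e0 n) t = ?v1 n (z, t)" and U1: "U n (z, e1 n) t = ?v2 n (z, t)" for n z t
      using uvb[of z t n] e0_neq_e1[of n] by (auto simp: U_def)
    have sbox: "subf ?P (box (cs Z) i A)" by (rule subf_box[OF ps cof_subf[OF A] i])
    obtain w where wel: "\<And>n z t. z \<in> el ?P n ==> t \<in> cub n 1 ==> w n z t \<in> fobj K n"
      and wrs: "\<And>m n a z t. a \<in> cub m n ==> z \<in> el ?P n ==> t \<in> cub n 1 ==> w m (rs ?P a z) (t \<odot> a) = rs (cs K) a (w n z t)"
      and wU: "\<And>n z t. z \<in> el ?P n ==> t \<in> cub n 1 ==> z \<in> ?A n \<or> t = ?i n z ==> w n z t = U n z t"
    proof (rule Fib_fill[OF KF to_one_hom[OF KO] tP cof_ends[OF ps A] iP, where u = U and v = "\<lambda>n z t. enc (bang n)"])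
      fix n z t assume z: "z \<in> el ?P n" and t: "t \<in> cub n 1"
      obtain x b where z': "z = (x, b)" "x \<in> fobj Z n" "b \<in> cub n 1" using z by auto
      show one: "enc (bang n) \<in> fobj (one :: 'u cset) n" by (simp add: one_el)
      show "enc (bang m) = rs (cs one) a (enc (bang n) :: 'u)" if "a \<in> cub m n" for m a
        using cub_0[OF comp_cub[OF that bang_cub]] rs_cube[OF that bang_cub] by simp
      assume c: "z \<in> ?A n \<or> t = ?i n z"
      show UK: "U n z t \<in> fobj K n"
        using natm_el[OF v1, of "(x, t)" n] natm_el[OF v2, of "(x, t)" n] z' t evI_el[OF KO uel z'(3)]
        by (auto simp: U_def)
      show "ap (to_one K) n (U n z t) = enc (bang n)" using UK by (simp add: to_one_def)
      fix m a assume a: "a \<in> cub m n"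
      have xa: "rs (cs Z) a x \<in> fobj Z m" using rs_el[OF ps a] z' by simp
      show "U m (rs ?P a z) (t \<odot> a) = rs (cs K) a (U n z t)"
      proof (cases "(x, t) \<in> box (cs Z) i A n")
        case True
        have "(rs (cs Z) a x, t \<odot> a) \<in> box (cs Z) i A m" using subf_rs[OF sbox a True] by simp
        then show ?thesis
          using natm_rs[OF u a, of "(x, t)"] True evI_rs[OF KO a uel[OF True] z'(3)] by (simp add: U_def z'(1))
      next
        case False
        then have "b = e0 n \<or> b = e1 n" using c z' t by (auto simp: bx)
        then show ?thesis
          using U0 U1 natm_rs[OF v1 a, of "(x, t)"] natm_rs[OF v2 a, of "(x, t)"] z' t
          by (auto simp: e0_comp[OF a] e1_comp[OF a])
      qed
    qed (rule that; assumption)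
    have "natm (?P \<otimes> Ip) (cs K) (\<lambda>n p. w n (fst (fst p), snd p) (snd (fst p)))"
    proof (rule natm_prodI[where f = "\<lambda>n zt b. w n (fst zt, b) (snd zt)"])
      show "w n (fst zt, b) (snd zt) \<in> el (cs K) n" if "zt \<in> el ?P n" "b \<in> cub n 1" for n zt b
        using that wel by auto
      show "w m (fst (rs ?P a zt), b \<odot> a) (snd (rs ?P a zt)) = rs (cs K) a (w n (fst zt, b) (snd zt))"
        if "a \<in> cub m n" "zt \<in> el ?P n" "b \<in> cub n 1" for m n a zt b
        using wrs[OF that(1), of "(fst zt, b)" "snd zt"] that by auto
    qed
    from path_transpose[OF KO tP this] obtain W where W: "natm ?P (cs (pathob K)) W"
      "\<forall>n. \<forall>z \<in> el ?P n. \<forall>t \<in> cub n 1. evI K n (W n z) t = w n (fst (fst (z, t)), snd (z, t)) (snd (fst (z, t)))"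
      by blast
    have We: "evI K n (W n (z, t)) b = w n (z, b) t" if "z \<in> fobj Z n" "t \<in> cub n 1" "b \<in> cub n 1" for n z t b
      using W(2) that by auto
    have Wel: "W n (z, t) \<in> fobj (pathob K) n" if "z \<in> fobj Z n" "t \<in> cub n 1" for n z t
      using natm_el[OF W(1), of "(z, t)" n] that by simp
    show "\<exists>w. natm ?P (cs (pathob K)) w \<and> (\<forall>n. \<forall>z \<in> box (cs Z) i A n. w n z = u n z) \<and>
      (\<forall>n. \<forall>z \<in> el ?P n. ap (ev01 K) n (w n z) = v n z)"
    proof (intro exI[of _ W] conjI W(1) allI ballI)
      fix n zt assume ztb: "zt \<in> box (cs Z) i A n"
      then obtain z t where zt: "zt = (z, t)" "z \<in> fobj Z n" "t \<in> cub n 1" by (auto simp: box_def)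
      show "W n zt = u n zt"
        unfolding zt(1)
      proof (rule evI_eqI[OF KO Wel[OF zt(2,3)] uel[OF ztb[unfolded zt(1)]]])
        fix m a s assume a: "a \<in> cub m n" and s: "s \<in> cub m 1"
        have b': "(rs (cs Z) a z, t \<odot> a) \<in> box (cs Z) i A m" using subf_rs[OF sbox a ztb] by (simp add: zt(1))
        then have "w m (rs (cs Z) a z, s) (t \<odot> a) = evI K m (u m (rs (cs Z) a z, t \<odot> a)) s"
          using wU[of "(rs (cs Z) a z, s)" m "t \<odot> a"] s by (auto simp: bx U_def)
        then show "evI K m (rs (cs (pathob K)) a (W n (z, t))) s = evI K m (rs (cs (pathob K)) a (u n (z, t))) s"
          using natm_rs[OF W(1) a, of "(z, t)"] natm_rs[OF u a, of "(z, t)"] ztb zt We[of "rs (cs Z) a z" m "t \<odot> a" s] b' s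
          by (simp add: bx)
      qed
    next
      fix n zt assume "zt \<in> el ?P n"
      then obtain z t where zt: "zt = (z, t)" "z \<in> fobj Z n" "t \<in> cub n 1" by auto
      have e: "evI K n (W n (z, t)) (e0 n) = ?v1 n (z, t)" "evI K n (W n (z, t)) (e1 n) = ?v2 n (z, t)"
        using We[OF zt(2,3)] wU[of "(z, e0 n)" n t] wU[of "(z, e1 n)" n t] U0 U1 zt by simp_all
      have vz: "v n (z, t) \<in> fobj (prod_obj cS K K) n" using natm_el[OF v, of "(z, t)" n] zt by simp
      note q = ap_el[OF pK(1) vz] ap_el[OF pK(2) vz]
      have "pe K K n (?v1 n (z, t), ?v2 n (z, t)) = v n (z, t)"
        by (rule peK(4)[OF peK(1)[OF q] vz]) (simp_all add: peK(2,3)[OF q])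
      then show "ap (ev01 K) n (W n zt) = v n zt"
        using r(2)[OF Wel[OF zt(2,3)]] by (simp add: zt(1) e)
    qed
  qed
qed

text \<open>A homotopy is a map into the path object, and extending it with fixed endpoints is a lifting
  problem against \<open>ev01 K\<close>.\<close>

lemma TCof_htp:
  assumes h: "h \<in> TCof \<C>" "h \<in> hom cS X Y" and K: "fibrant \<C> K" and b: "b \<in> hom cS Y K" "b' \<in> hom cS Y K"
    and H: "htp X K (b \<bullet> h) (b' \<bullet> h)"
  shows "htp Y K b b'"
proof -
  note KO = fibrant_to_one(2)[OF K] and X = hom_Obj(1)[OF h(2)] and Y = hom_Obj(2)[OF h(2)]
  note r = ev01[OF KO] and bb = pairing_hom[OF b] and peK = prod_elements[OF KO KO]
  obtain H where H: "natm (cs X \<otimes> Ip) (cs K) H"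
    "\<And>n x. x \<in> fobj X n ==> H n (x, e0 n) = ap b n (ap h n x)" "\<And>n x. x \<in> fobj X n ==> H n (x, e1 n) = ap b' n (ap h n x)"
    using H unfolding htp_def by (auto simp: ap_comp[OF h(2)])
  obtain u where u: "natm (cs X) (cs (pathob K)) u"
    "\<forall>n. \<forall>z \<in> el (cs X) n. \<forall>t \<in> cub n 1. evI K n (u n z) t = H n (z, t)"
    using path_transpose[OF KO tinyp_cs[OF X] H(1)] by blast
  note U = mp_hom[OF X path_Obj[OF KO] u(1)]
  have "ev01 K \<bullet> mp X (pathob K) u = pairing cS b b' \<bullet> h"
  proof (rule hom_ext[OF comp_hom[OF U r(1)] comp_hom[OF h(2) bb(1)]])
    fix n x assume x: "x \<in> fobj X n"
    have "u n x \<in> fobj (pathob K) n" using natm_el[OF u(1)] x by simp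
    then show "ap (ev01 K \<bullet> mp X (pathob K) u) n x = ap (pairing cS b b' \<bullet> h) n x"
      using u(2) x H(2,3)[OF x] by (simp add: ap_comp[OF U] ap_comp[OF h(2)] r(2) bb(2) ap_el[OF h(2)])
  qed
  moreover have "lifts cS h (ev01 K)" using h(1) ev01_Fib[OF K] by (simp add: TCof_def llp_def)
  ultimately obtain d where d: "d \<in> hom cS Y (pathob K)" "ev01 K \<bullet> d = pairing cS b b'"
    using liftsD[OF _ h(2) r(1) U bb(1)] by blast
  have de: "ap d n y \<in> fobj (pathob K) n" if "y \<in> fobj Y n" for n y using ap_el[OF d(1) that] .
  have e: "evI K n (ap d n y) (e0 n) = ap b n y \<and> evI K n (ap d n y) (e1 n) = ap b' n y" if y: "y \<in> fobj Y n" for n y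
  proof -
    have "pe K K n (evI K n (ap d n y) (e0 n), evI K n (ap d n y) (e1 n)) = pe K K n (ap b n y, ap b' n y)"
      using ap_comp[OF d(1) y, of "ev01 K"] r(2)[OF de[OF y]] bb(2)[OF y] d(2) by simp
    then show ?thesis
      using pe_eq_iff[OF KO KO evI_el[OF KO de[OF y] e0_cub] evI_el[OF KO de[OF y] e1_cub] ap_el[OF b(1) y] ap_el[OF b(2) y]]
      by simp
  qed
  have "natm (cs Y \<otimes> Ip) (cs K) (\<lambda>n w. evI K n (ap d n (fst w)) (snd w))"
    by (rule natm_prodI) (simp_all add: evI_el[OF KO de] ap_rs[OF d(1)] evI_rs[OF KO _ de])
  then show ?thesis unfolding htp_def using b e by (intro conjI exI[of _ "\<lambda>n w. evI K n (ap d n (fst w)) (snd w)"]) simp_all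
qed

lemma htp_refl:
  assumes a: "a \<in> hom cS Y K"
  shows "htp Y K a a"
proof -
  have "natm (cs Y \<otimes> Ip) (cs K) (\<lambda>n w. ap a n (fst w))"
    by (rule natm_prodI[where f = "\<lambda>n y t. ap a n y"]) (simp_all add: ap_el[OF a] ap_rs[OF a])
  then show ?thesis unfolding htp_def using a by (intro conjI exI[of _ "\<lambda>n w. ap a n (fst w)"]) simp_all
qed

text \<open>A chain of homotopies between restricted maps is extended step by step, choosing extensions
  of the intermediate maps.\<close>

lemma TCof_whe:
  assumes h: "h \<in> TCof \<C>" "h \<in> hom cS X Y"
  shows "whe X Y h"
proof (rule wheI[OF h(2)])
  fix K assume K: "fibrant \<C> K"
  show "\<exists>b\<in>hom cS Y K. heq X K (b \<bullet> h) a" if "a \<in> hom cS X K" for a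
    using TCof_extend[OF h K that] by (metis equivclp_refl)
  fix b b' assume b: "b \<in> hom cS Y K" and b': "b' \<in> hom cS Y K" and e: "heq X K (b \<bullet> h) (b' \<bullet> h)"
  have "\<forall>c \<in> hom cS Y K. c \<bullet> h = a \<longrightarrow> heq Y K b c" if "heq X K (b \<bullet> h) a" for a
    using that
  proof (induction rule: equivclp_induct)
    case base
    show ?case
      using TCof_htp[OF h K b] htp_refl[OF comp_hom[OF h(2) b]] by (auto intro!: r_into_equivclp)
  next
    case (step y z)
    have yh: "y \<in> hom cS X K" using step(2) htp_hom by auto
    obtain c0 where c0: "c0 \<in> hom cS Y K" "c0 \<bullet> h = y" using TCof_extend[OF h K yh] by blast
    show ?case
    proof (intro ballI impI)
      fix c assume c: "c \<in> hom cS Y K" "c \<bullet> h = z"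
      have "htp Y K c0 c \<or> htp Y K c c0"
        using step(2) TCof_htp[OF h K c0(1) c(1)] TCof_htp[OF h K c(1) c0(1)] c0(2) c(2) by auto
      then have "heq Y K c0 c" by (meson r_into_equivclp equivclp_sym)
      moreover have "heq Y K b c0" using step(3) c0 by blast
      ultimately show "heq Y K b c" by (meson equivclp_trans)
    qed
  qed
  from this[OF e] show "heq Y K b b'" using b' by blast
qed

text \<open>Lifting against \<open>0 \<rightarrow> Y\<close> gives a section, and lifting against the
  inclusion of both ends of \<open>X \<times> I\<close> a homotopy from \<open>s \<cdot> g\<close> to
  the identity.\<close>

lemma TFib_whe:
  assumes g: "g \<in> TFib \<C>" "g \<in> hom cS X Y"
  shows "whe X Y g"
proof -
  note X = hom_Obj(1)[OF g(2)] and Y = hom_Obj(2)[OF g(2)]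
  have "natm (restr (cs Y) (\<lambda>n. {})) (cs X) (\<lambda>n y. y)" by (simp add: natm_def)
  from extD[OF TFib_ext[OF g(1) tinyp_cs[OF Y] cof_empty] g(2) this natm_id]
  obtain s where s: "natm (cs Y) (cs X) s" "\<And>n z. z \<in> el (cs Y) n ==> ap g n (s n z) = z" by auto
  let ?s = "mp Y X s"
  note S = mp_hom[OF Y X s(1)]
  have gs: "g \<bullet> ?s = Idn cS Y"
    by (rule hom_ext[OF comp_hom[OF S g(2)] id_hom'[OF Y]]) (simp add: ap_comp[OF S] s(2) Y)
  let ?A = "\<lambda>n. {(x, b). x \<in> el (cs X) n \<and> b \<in> cub n 1 \<and> (x \<in> {} \<or> b = e0 n \<or> b = e1 n)}"
  let ?u = "\<lambda>n w. if snd w = e0 n then s n (ap g n (fst w)) else fst w"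
  have u: "natm (restr (cs X \<otimes> Ip) ?A) (cs X) ?u"
  proof (rule natmI)
    fix n w assume w: "w \<in> el (restr (cs X \<otimes> Ip) ?A) n"
    then show "?u n w \<in> el (cs X) n" using natm_el[OF s(1)] ap_el[OF g(2)] by auto
    fix m a assume a: "a \<in> cub m n"
    show "?u m (rs (restr (cs X \<otimes> Ip) ?A) a w) = rs (cs X) a (?u n w)"
      using w natm_rs[OF s(1) a] ap_el[OF g(2)] ap_rs[OF g(2) a] e0_neq_e1[of m] e0_neq_e1[of n]
      by (auto simp: e0_comp[OF a] e1_comp[OF a])
  qed
  have v: "natm (cs X \<otimes> Ip) (cs Y) (\<lambda>n w. ap g n (fst w))"
    by (rule natm_prodI[where f = "\<lambda>n x t. ap g n x"]) (simp_all add: ap_el[OF g(2)] ap_rs[OF g(2)])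
  have c: "cof (cs X \<otimes> Ip) ?A" by (rule cof_ends[OF psh_cs[OF X] cof_empty])
  have uv: "ap g n (?u n w) = ap g n (fst w)" if "w \<in> ?A n" for n w
    using that s(2) ap_el[OF g(2)] by auto
  note e = TFib_ext[OF g(1) tinyp_prodp[OF tinyp_cs[OF X] tinyp_yo] c]
  obtain H where H: "natm (cs X \<otimes> Ip) (cs X) H" "\<And>n w. w \<in> ?A n ==> H n w = ?u n w"
    by (rule extD[OF e g(2) u v]) (rule uv, assumption, rule that, assumption+)
  note sg = comp_hom[OF g(2) S]
  have "htp X X (?s \<bullet> g) (Idn cS X)"
    unfolding htp_def using sg id_hom'[OF X] H e0_neq_e1[symmetric]
    by (auto intro!: exI[of _ H] simp: ap_comp[OF g(2)] ap_el[OF g(2)] X)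
  then have sgi: "heq X X (?s \<bullet> g) (Idn cS X)" by (rule r_into_equivclp)
  show ?thesis
  proof (rule wheI[OF g(2)])
    fix K
    show "\<exists>b\<in>hom cS Y K. heq X K (b \<bullet> g) a" if a: "a \<in> hom cS X K" for a
      using heq_post[OF sgi a] comp_assoc[OF g(2) S a] comp_idr[OF a] comp_hom[OF S a]
      by (intro bexI[of _ "a \<bullet> ?s"]) simp_all
    show "heq Y K b b'" if b: "b \<in> hom cS Y K" "b' \<in> hom cS Y K" and e: "heq X K (b \<bullet> g) (b' \<bullet> g)" for b b'
      using heq_pre[OF e S] comp_assoc[OF S g(2) b(1)] comp_assoc[OF S g(2) b(2)] gs comp_idr[OF b(1)] comp_idr[OF b(2)]
      by simp
  qed
qed

lemma WEq_whe:
  assumes "f \<in> WEq \<C>" "f \<in> hom cS X Y"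
  shows "whe X Y f"
  using WEq_E[OF assms] TCof_whe TFib_whe whe_comp by metis

end


section \<open>Fibrations that are weak homotopy equivalences\<close>

context cubical_cofibrations
begin

lemma natm_const_end: "ends p q ==> natm P Ip (\<lambda>n z. p n)"
  by (auto simp: natm_def ends_cub ends_comp)

text \<open>The chain of homotopies is lifted one homotopy at a time, starting from
  \<open>s0\<close>.\<close>

lemma lift_homotopy:
  assumes p: "p \<in> Fib \<C>" "p \<in> hom cS Y X" and ac: "heq W X a c"
    and s0: "s0 \<in> hom cS W Y" "p \<bullet> s0 = a"
  shows "\<exists>s \<in> hom cS W Y. p \<bullet> s = c \<and> heq W Y s0 s"
  using ac
proof (induction rule: equivclp_induct)
  case base
  then show ?case using s0 by (intro bexI[of _ s0]) simp_all
next
  case (step y z)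
  then obtain s where s: "s \<in> hom cS W Y" "p \<bullet> s = y" "heq W Y s0 s" by blast
  note WO = hom_Obj(1)[OF s0(1)] and Y = hom_Obj(1)[OF p(2)]
  have "symclp (htp W X) y z" using step(2) by (auto simp: symclp_def)
  then obtain p0 q0 H where en: "ends p0 q0" and yz: "y \<in> hom cS W X" "z \<in> hom cS W X"
    and Hel: "\<And>n w t. w \<in> fobj W n ==> t \<in> cub n 1 ==> H n w t \<in> fobj X n"
    and Hrs: "\<And>m n c w t. c \<in> cub m n ==> w \<in> fobj W n ==> t \<in> cub n 1 ==> H m (rs (cs W) c w) (t \<odot> c) = rs (cs X) c (H n w t)"
    and H0: "\<And>n w. w \<in> fobj W n ==> H n w (p0 n) = ap y n w" and H1: "\<And>n w. w \<in> fobj W n ==> H n w (q0 n) = ap z n w"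
    by (rule symclp_htp) blast
  have psy: "ap p n (ap s n w) = ap y n w" if "w \<in> fobj W n" for n w
    using ap_comp[OF s(1) that, of p] s(2) by simp
  obtain G where Gel: "\<And>n w t. w \<in> el (cs W) n ==> t \<in> cub n 1 ==> G n w t \<in> fobj Y n"
    and Grs: "\<And>m n a w t. a \<in> cub m n ==> w \<in> el (cs W) n ==> t \<in> cub n 1 ==> G m (rs (cs W) a w) (t \<odot> a) = rs (cs Y) a (G n w t)"
    and G0: "\<And>n w t. w \<in> el (cs W) n ==> t \<in> cub n 1 ==> w \<in> {} \<or> t = p0 n ==> G n w t = ap s n w"
    and pG: "\<And>n w t. w \<in> el (cs W) n ==> t \<in> cub n 1 ==> ap p n (G n w t) = H n w t"
    by (rule Fib_fill[OF p tinyp_cs[OF WO] cof_empty natm_const_end[OF en], where u = "\<lambda>n w t. ap s n w" and v = H])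
      (auto simp: ap_el[OF s(1)] ap_rs[OF s(1)] Hel Hrs H0 psy)
  let ?s = "mp W Y (\<lambda>n w. G n w (q0 n))"
  have "natm (cs W) (cs Y) (\<lambda>n w. G n w (q0 n))"
  proof (rule natmI)
    show "G m (rs (cs W) a w) (q0 m) = rs (cs Y) a (G n w (q0 n))" if "a \<in> cub m n" "w \<in> el (cs W) n" for m n a w
      using Grs[OF that ends_cub(2)[OF en]] ends_comp(2)[OF en that(1)] by simp
  qed (use Gel ends_cub(2)[OF en] in simp)
  note S = mp_hom[OF WO Y this]
  have "p \<bullet> ?s = z"
    by (rule hom_ext[OF comp_hom[OF S p(2)] yz(2)]) (simp add: ap_comp[OF S] pG ends_cub(2)[OF en] H1)
  moreover have "symclp (htp W Y) s ?s"
    by (rule symclp_htpI[OF en s(1) S, of G]) (simp_all add: Gel Grs G0 ends_cub[OF en])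
  then have "heq W Y s ?s" by (auto simp: symclp_def intro: r_into_equivclp equivclp_sym)
  with s(3) have "heq W Y s0 ?s" by (rule equivclp_trans)
  ultimately show ?case using S by (intro bexI[of _ ?s]) simp_all
qed

text \<open>\<open>G\<close> is a homotopy from \<open>s \<cdot> p \<cdot> h\<close> to \<open>h\<close>
  that is constant over \<open>X\<close>.\<close>

definition fib_htp
  where "fib_htp Y p s h G \<longleftrightarrow>
    (\<forall>n y t. y \<in> fobj Y n \<longrightarrow> t \<in> cub n 1 \<longrightarrow> G n y t \<in> fobj Y n \<and> ap p n (G n y t) = ap p n (ap h n y)) \<and>
    (\<forall>m n a y t. a \<in> cub m n \<longrightarrow> y \<in> fobj Y n \<longrightarrow> t \<in> cub n 1 \<longrightarrow> G m (rs (cs Y) a y) (t \<odot> a) = rs (cs Y) a (G n y t)) \<and>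
    (\<forall>n y. y \<in> fobj Y n \<longrightarrow> G n y (e0 n) = ap s n (ap p n (ap h n y)) \<and> G n y (e1 n) = ap h n y)"

lemma fib_htpD:
  assumes "fib_htp Y p s h G"
  shows "y \<in> fobj Y n ==> t \<in> cub n 1 ==> G n y t \<in> fobj Y n"
    and "y \<in> fobj Y n ==> t \<in> cub n 1 ==> ap p n (G n y t) = ap p n (ap h n y)"
    and "a \<in> cub m n ==> y \<in> fobj Y n ==> t \<in> cub n 1 ==> G m (rs (cs Y) a y) (t \<odot> a) = rs (cs Y) a (G n y t)"
    and "y \<in> fobj Y n ==> G n y (e0 n) = ap s n (ap p n (ap h n y))"
    and "y \<in> fobj Y n ==> G n y (e1 n) = ap h n y"
  using assms unfolding fib_htp_def by blast+

text \<open>By induction along the chain of homotopies from \<open>s \<cdot> p\<close> to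
  \<open>h\<close>: an elementary homotopy \<open>H\<close> from \<open>h\<close> to \<open>h'\<close>
  carries a fibrewise homotopy for \<open>h\<close> to one for \<open>h'\<close>, by filling a box whose
  sides are \<open>s \<cdot> p \<cdot> H\<close> and \<open>H\<close> and whose bottom is the given
  fibrewise homotopy.\<close>

lemma fibrewise_contraction:
  assumes p: "p \<in> Fib \<C>" "p \<in> hom cS Y X" and s: "s \<in> hom cS X Y" "p \<bullet> s = Idn cS X"
    and h: "heq Y Y (s \<bullet> p) h"
  shows "\<exists>G. fib_htp Y p s h G"
  using h
proof (induction rule: equivclp_induct)
  case base
  note sp = comp_hom[OF p(2) s(1)]
  have "ap p n (ap s n x) = x" if "x \<in> fobj X n" for n x
    using ap_comp[OF s(1) that, of p] s(2) that hom_Obj(1)[OF s(1)] by simp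
  then show ?case
    by (intro exI[of _ "\<lambda>n y t. ap s n (ap p n y)"])
      (simp add: fib_htp_def ap_comp[OF p(2)] ap_el[OF p(2)] ap_el[OF s(1)] ap_rs[OF p(2)] ap_rs[OF s(1)])
next
  case (step h h')
  note Y = hom_Obj(1)[OF p(2)]
  have ps: "ap p n (ap s n x) = x" if "x \<in> fobj X n" for n x
    using ap_comp[OF s(1) that, of p] s(2) that hom_Obj(1)[OF s(1)] by simp
  have "symclp (htp Y Y) h h'" using step(2) by (auto simp: symclp_def)
  then obtain p0 q0 H where en: "ends p0 q0" and hh: "h \<in> hom cS Y Y" "h' \<in> hom cS Y Y"
    and Hel: "\<And>n w t. w \<in> fobj Y n ==> t \<in> cub n 1 ==> H n w t \<in> fobj Y n"
    and Hrs: "\<And>m n c w t. c \<in> cub m n ==> w \<in> fobj Y n ==> t \<in> cub n 1 ==> H m (rs (cs Y) c w) (t \<odot> c) = rs (cs Y) c (H n w t)"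
    and H0: "\<And>n w. w \<in> fobj Y n ==> H n w (p0 n) = ap h n w" and H1: "\<And>n w. w \<in> fobj Y n ==> H n w (q0 n) = ap h' n w"
    by (rule symclp_htp) blast
  from step(3) obtain G where G: "fib_htp Y p s h G" by blast
  note Gel = fib_htpD(1)[OF G] and pG = fib_htpD(2)[OF G] and Grs = fib_htpD(3)[OF G]
    and G0 = fib_htpD(4)[OF G] and G1 = fib_htpD(5)[OF G]
  let ?P = "cs Y \<otimes> Ip"
  let ?A = "\<lambda>n. {(z, b). z \<in> el (cs Y) n \<and> b \<in> cub n 1 \<and> (z \<in> {} \<or> b = e0 n \<or> b = e1 n)}"
  have tP: "tinyp ?P" by (intro tinyp_prodp tinyp_cs Y tinyp_yo)
  have cA: "cof ?P ?A" by (rule cof_ends[OF psh_cs[OF Y] cof_empty])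
  \<comment> \<open>The coordinate \<open>b = snd w\<close> runs along the fibrewise homotopy and
    \<open>a\<close> along \<open>H\<close>.\<close>
  define U where "U n w a = (if snd w = e0 n then ap s n (ap p n (H n (fst w) a))
    else if snd w = e1 n then H n (fst w) a else G n (fst w) (snd w))" for n and w :: "'u \<times> cube_arrow" and a
  have U0: "U n (y, e0 n) a = ap s n (ap p n (H n y a))" and U1: "U n (y, e1 n) a = H n y a" for n y a
    using e0_neq_e1[of n] by (auto simp: U_def)
  have UG: "U n (y, b) (p0 n) = G n y b" if "y \<in> fobj Y n" for n y b
    using G0[OF that] G1[OF that] H0[OF that] by (auto simp: U_def)
  obtain F where Fel: "\<And>n w t. w \<in> el ?P n ==> t \<in> cub n 1 ==> F n w t \<in> fobj Y n"
    and Frs: "\<And>m n a w t. a \<in> cub m n ==> w \<in> el ?P n ==> t \<in> cub n 1 ==> F m (rs ?P a w) (t \<odot> a) = rs (cs Y) a (F n w t)"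
    and FU: "\<And>n w t. w \<in> el ?P n ==> t \<in> cub n 1 ==> w \<in> ?A n \<or> t = p0 n ==> F n w t = U n w t"
    and pF: "\<And>n w t. w \<in> el ?P n ==> t \<in> cub n 1 ==> ap p n (F n w t) = ap p n (H n (fst w) t)"
  proof (rule Fib_fill[OF p tP cA natm_const_end[OF en], where u = U and v = "\<lambda>n w t. ap p n (H n (fst w) t)"])
    fix n w t assume w: "w \<in> el ?P n" and t: "t \<in> cub n 1"
    obtain y b where w': "w = (y, b)" "y \<in> fobj Y n" "b \<in> cub n 1" using w by auto
    show "ap p n (H n (fst w) t) \<in> fobj X n" using ap_el[OF p(2) Hel] w' t by simp
    show "ap p m (H m (fst (rs ?P a w)) (t \<odot> a)) = rs (cs X) a (ap p n (H n (fst w) t))" if "a \<in> cub m n" for m a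
      using Hrs[OF that w'(2) t] ap_rs[OF p(2) that Hel[OF w'(2) t]] by (simp add: w'(1))
    assume c: "w \<in> ?A n \<or> t = p0 n"
    show "U n w t \<in> fobj Y n"
      using Hel[OF w'(2) t] Gel[OF w'(2,3)] ap_el[OF s(1) ap_el[OF p(2) Hel[OF w'(2) t]]] by (simp add: U_def w'(1))
    consider "b = e0 n" | "b = e1 n" | "t = p0 n" using c w' by auto
    then show "ap p n (U n w t) = ap p n (H n (fst w) t)"
      by cases (use U0 U1 UG[OF w'(2)] w' t Hel pG H0 in \<open>simp_all add: ps ap_el[OF p(2)]\<close>)
    fix m a assume a: "a \<in> cub m n"
    have ya: "rs (cs Y) a y \<in> fobj Y m" using rs_el[OF psh_cs[OF Y] a] w' by simp
    consider "b = e0 n" | "b = e1 n" | "t = p0 n" using c w' by auto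
    then show "U m (rs ?P a w) (t \<odot> a) = rs (cs Y) a (U n w t)"
    proof cases
      case 1
      then show ?thesis
        using Hel[OF w'(2) t] by (simp add: w'(1) e0_comp[OF a] U0 Hrs[OF a w'(2) t] ap_rs[OF p(2) a] ap_rs[OF s(1) a] ap_el[OF p(2)])
    next
      case 2
      then show ?thesis by (simp add: w'(1) e1_comp[OF a] U1 Hrs[OF a w'(2) t])
    next
      case 3
      then show ?thesis
        using Grs[OF a w'(2,3)] by (simp add: w'(1) ends_comp(1)[OF en a] UG[OF ya] UG[OF w'(2)])
    qed
  qed (rule that; assumption)
  have Fn: "F m (rs (cs Y) a y, b \<odot> a) (q0 m) = rs (cs Y) a (F n (y, b) (q0 n))"
    if "a \<in> cub m n" "y \<in> fobj Y n" "b \<in> cub n 1" for m n a y b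
    using Frs[OF that(1), of "(y, b)" "q0 n"] that ends_cub(2)[OF en] ends_comp(2)[OF en that(1)] by simp
  show ?case
    by (intro exI[of _ "\<lambda>n y b. F n (y, b) (q0 n)"])
      (use Fel Fn pF FU U0 U1 H1 ends_cub(2)[OF en] in \<open>simp add: fib_htp_def\<close>)
qed

text \<open>To extend a partial lift \<open>u\<close> of \<open>v\<close>, fill the box with bottom
  \<open>s \<cdot> v\<close> and with the contraction of \<open>u\<close> on the sides; its other end is
  the extension.\<close>

lemma TFib_of_contraction:
  assumes p: "p \<in> Fib \<C>" "p \<in> hom cS Y X" and s: "s \<in> hom cS X Y" "p \<bullet> s = Idn cS X"
    and h: "heq Y Y (s \<bullet> p) (Idn cS Y)"
  shows "p \<in> TFib \<C>"
proof (rule TFib_I[OF p(2)], rule extI[OF p(2)])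
  note Y = hom_Obj(1)[OF p(2)]
  have ps: "ap p n (ap s n x) = x" if "x \<in> fobj X n" for n x
    using ap_comp[OF s(1) that, of p] s(2) that hom_Obj(1)[OF s(1)] by simp
  from fibrewise_contraction[OF p s h] obtain G where G: "fib_htp Y p s (Idn cS Y) G" by blast
  note Gel = fib_htpD(1)[OF G] and Grs = fib_htpD(3)[OF G]
  have pG: "\<And>n y t. y \<in> fobj Y n ==> t \<in> cub n 1 ==> ap p n (G n y t) = ap p n y"
    and G0: "\<And>n y. y \<in> fobj Y n ==> G n y (e0 n) = ap s n (ap p n y)"
    and G1: "\<And>n y. y \<in> fobj Y n ==> G n y (e1 n) = y"
    using fib_htpD(2,4,5)[OF G] Y by simp_all
  fix Z A u v assume Z: "Z \<in> Obj cS" and A: "cof (cs Z) A" and u: "natm (restr (cs Z) A) (cs Y) u"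
    and v: "natm (cs Z) (cs X) v" and uv: "\<And>n z. z \<in> A n ==> ap p n (u n z) = v n z"
  have uel: "u n z \<in> fobj Y n" if "z \<in> A n" for n z using natm_el[OF u, of z n] that by simp
  have vel: "v n z \<in> fobj X n" if "z \<in> fobj Z n" for n z using natm_el[OF v, of z n] that by simp
  have en: "ends e0 e1" by (simp add: ends_def)
  \<comment> \<open>at \<open>e0\<close> both cases agree, so that this is \<open>s \<cdot> v\<close> on
    all of the bottom\<close>
  define U where "U n z t = (if z \<in> A n then G n (u n z) t else ap s n (v n z))" for n z t
  have Ue: "U n z (e0 n) = ap s n (v n z)" for n z using G0[OF uel] uv by (auto simp: U_def)
  obtain w where wel: "\<And>n z t. z \<in> el (cs Z) n ==> t \<in> cub n 1 ==> w n z t \<in> fobj Y n"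
    and wrs: "\<And>m n a z t. a \<in> cub m n ==> z \<in> el (cs Z) n ==> t \<in> cub n 1 ==> w m (rs (cs Z) a z) (t \<odot> a) = rs (cs Y) a (w n z t)"
    and wU: "\<And>n z t. z \<in> el (cs Z) n ==> t \<in> cub n 1 ==> z \<in> A n \<or> t = e0 n ==> w n z t = U n z t"
    and pw: "\<And>n z t. z \<in> el (cs Z) n ==> t \<in> cub n 1 ==> ap p n (w n z t) = v n z"
  proof (rule Fib_fill[OF p tinyp_cs[OF Z] A natm_const_end[OF en], where u = U and v = "\<lambda>n z t. v n z"])
    fix n z t assume z: "z \<in> el (cs Z) n" and t: "t \<in> cub n 1"
    then have z': "z \<in> fobj Z n" by simp
    show "v n z \<in> fobj X n" by (rule vel[OF z'])
    show "v m (rs (cs Z) a z) = rs (cs X) a (v n z)" if "a \<in> cub m n" for m a by (rule natm_rs[OF v that z])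
    assume c: "z \<in> A n \<or> t = e0 n"
    show "U n z t \<in> fobj Y n" using Gel[OF uel t] ap_el[OF s(1) vel[OF z']] by (simp add: U_def)
    show "ap p n (U n z t) = v n z" using pG[OF uel t] uv ps[OF vel[OF z']] by (simp add: U_def)
    fix m a assume a: "a \<in> cub m n"
    show "U m (rs (cs Z) a z) (t \<odot> a) = rs (cs Y) a (U n z t)"
    proof (cases "z \<in> A n")
      case True
      then show ?thesis
        using subf_rs[OF cof_subf[OF A] a True] natm_rs[OF u a, of z] Grs[OF a uel[OF True] t] by (simp add: U_def)
    next
      case False
      then have "t = e0 n" using c by simp
      then show ?thesis using natm_rs[OF v a z] ap_rs[OF s(1) a vel[OF z']] by (simp add: e0_comp[OF a] Ue)
    qed
  qed (rule that; assumption)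
  show "\<exists>w. natm (cs Z) (cs Y) w \<and> (\<forall>n. \<forall>z \<in> A n. w n z = u n z) \<and> (\<forall>n. \<forall>z \<in> el (cs Z) n. ap p n (w n z) = v n z)"
  proof (intro exI[of _ "\<lambda>n z. w n z (e1 n)"] conjI allI ballI)
    show "natm (cs Z) (cs Y) (\<lambda>n z. w n z (e1 n))"
    proof (rule natmI)
      show "w m (rs (cs Z) a z) (e1 m) = rs (cs Y) a (w n z (e1 n))" if "a \<in> cub m n" "z \<in> el (cs Z) n" for m n a z
        using wrs[OF that e1_cub] e1_comp[OF that(1)] by simp
    qed (use wel in simp)
    show "w n z (e1 n) = u n z" if "z \<in> A n" for n z
      using wU[OF subf_el[OF cof_subf[OF A] that] e1_cub] that G1[OF uel[OF that]] by (simp add: U_def)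
    show "ap p n (w n z (e1 n)) = v n z" if "z \<in> el (cs Z) n" for n z by (rule pw[OF that e1_cub])
  qed
qed

lemma fibrant_total:
  assumes p: "p \<in> Fib \<C>" "p \<in> hom cS Y X" and X: "fibrant \<C> X"
  shows "fibrant \<C> Y"
proof -
  note X' = fibrant_to_one[OF X]
  have "to_one X \<bullet> p \<in> Fib \<C>"
    using rlp_comp[OF _ p(2) _ to_one_hom[OF X'(2)] TCof_Arrs] p(1) X'(1) by (simp add: Fib_rlp)
  then show ?thesis using comp_hom[OF p(2) to_one_hom[OF X'(2)]] hom_Obj(1)[OF p(2)] by (auto simp: fibrant_def)
qed

text \<open>Surjectivity of \<open>whe\<close> at \<open>K = Y\<close> gives a left homotopy inverse
  \<open>s0\<close>, injectivity at \<open>K = X\<close> shows that it is also a right one.\<close>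

lemma Fib_whe_TFib:
  assumes p: "p \<in> Fib \<C>" "p \<in> hom cS Y X" and X: "fibrant \<C> X" and w: "whe Y X p"
  shows "p \<in> TFib \<C>"
proof -
  note FY = fibrant_total[OF p X] and XO = hom_Obj(2)[OF p(2)] and YO = hom_Obj(1)[OF p(2)]
  note W = wheD[OF w] and iX = id_hom'[OF XO] and iY = id_hom'[OF YO]
  obtain s0 where s0: "s0 \<in> hom cS X Y" "heq Y Y (s0 \<bullet> p) (Idn cS Y)" using W(2)[OF FY iY] by blast
  have "heq Y X ((p \<bullet> s0) \<bullet> p) (Idn cS X \<bullet> p)"
    using heq_post[OF s0(2) p(2)] comp_assoc[OF p(2) s0(1) p(2)] comp_idl[OF p(2)] comp_idr[OF p(2)] by simp
  then have "heq X X (p \<bullet> s0) (Idn cS X)" using W(3)[OF X comp_hom[OF s0(1) p(2)] iX] by simp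
  from lift_homotopy[OF p this s0(1) refl]
  obtain s where s: "s \<in> hom cS X Y" "p \<bullet> s = Idn cS X" "heq X Y s0 s" by blast
  have "heq Y Y (s \<bullet> p) (Idn cS Y)"
    using heq_pre[OF s(3) p(2)] s0(2) by (meson equivclp_sym equivclp_trans)
  from TFib_of_contraction[OF p s(1,2) this] show ?thesis .
qed


section \<open>The Frobenius property\<close>

text \<open>\<open>S\<close> is the dependent product along \<open>p\<close> of the pullback of
  \<open>g\<close> along \<open>v\<close>. A box in it is filled as follows. An element \<open>y\<close>
  of \<open>Y'\<close> over time \<open>t\<close> is transported along \<open>p\<close> to all times
  (\<open>\<phi>\<close>); evaluating the given sections there yields a box for \<open>g\<close>, whose
  filler \<open>\<beta>\<close> is evaluated back at time \<open>t\<close>.\<close>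

lemma pushforward_Fib:
  assumes p: "p \<in> Fib \<C>" "p \<in> hom cS Y' X'" and g: "g \<in> Fib \<C>" "g \<in> hom cS B D" and v: "v \<in> hom cS Y' D"
    and S: "S = Sect (cs X') (cs Y') (ap p) (cs B) (\<lambda>n y b. ap g n b = ap v n y)"
    and N: "N \<in> Obj cS" and iso: "natiso S (cs N) e d"
  shows "mp N X' (\<lambda>n w. fst (d n w)) \<in> hom cS N X'" and "mp N X' (\<lambda>n w. fst (d n w)) \<in> Fib \<C>"
proof -
  note X' = hom_Obj(2)[OF p(2)] and Y' = hom_Obj(1)[OF p(2)] and BO = hom_Obj(1)[OF g(2)] and DO = hom_Obj(2)[OF g(2)]
  note ps = psh_cs[OF X'] psh_cs[OF Y'] ap_natm[OF p(2)] psh_cs[OF BO]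
  note ev = sev[OF ps, where ok = "\<lambda>n y b. ap g n b = ap v n y", folded S]
  have e: "natm S (cs N) e" and d: "natm (cs N) S d" and de: "\<And>n z. z \<in> el S n ==> d n (e n z) = z"
    and ed: "\<And>n z. z \<in> fobj N n ==> e n (d n z) = z"
    using iso unfolding natiso_def by simp_all
  have dS: "d n w \<in> el S n" if "w \<in> fobj N n" for n w using natm_el[OF d] that by simp
  note fst = Sect_fst[OF ps, where ok = "\<lambda>n y b. ap g n b = ap v n y", folded S]
  let ?r = "mp N X' (\<lambda>n w. fst (d n w))"
  show r: "?r \<in> hom cS N X'" by (rule mp_hom[OF N X' natm_comp[OF d fst]])
  show "?r \<in> Fib \<C>"
  proof (rule Fib_I[OF r], rule extI[OF r])
    fix Z A i U V assume Z: "Z \<in> Obj cS" and A: "cof (cs Z) A" and i: "natm (cs Z) Ip i"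
      and U: "natm (restr (cs Z \<otimes> Ip) (box (cs Z) i A)) (cs N) U" and V: "natm (cs Z \<otimes> Ip) (cs X') V"
      and UV: "\<And>n z. z \<in> box (cs Z) i A n ==> ap ?r n (U n z) = V n z"
    note pZ = psh_cs[OF Z]
    let ?P = "cs Z \<otimes> Ip"
    have tP: "tinyp ?P" by (intro tinyp_prodp tinyp_cs Z tinyp_yo)
    have sbox: "subf ?P (box (cs Z) i A)" by (rule subf_box[OF pZ cof_subf[OF A] i])
    have Uel: "U n zt \<in> fobj N n" if "zt \<in> box (cs Z) i A n" for n zt using natm_el[OF U, of zt n] that by simp
    have Ufst: "fst (d n (U n zt)) = V n zt" if "zt \<in> box (cs Z) i A n" for n zt using UV[OF that] Uel[OF that] by simp
    have Vel: "V n (z, t) \<in> fobj X' n" if "z \<in> fobj Z n" "t \<in> cub n 1" for n z t using natm_el[OF V, of "(z, t)" n] that by simp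
    have Vrs: "V m (rs (cs Z) a z, t \<odot> a) = rs (cs X') a (V n (z, t))" if "a \<in> cub m n" "z \<in> fobj Z n" "t \<in> cub n 1" for m n a z t
      using natm_rs[OF V that(1), of "(z, t)"] that by simp
    define EA where "EA n = {(zt, y). zt \<in> el ?P n \<and> y \<in> fobj Y' n \<and> ap p n y = V n zt}" for n
    have sub: "subf (?P \<otimes> cs Y') EA"
      unfolding subf_def
    proof (intro conjI allI ballI)
      show "EA n \<subseteq> el (?P \<otimes> cs Y') n" for n by (auto simp: EA_def)
      fix m n a w assume a: "a \<in> cub m n" and "w \<in> EA n"
      then obtain zt y where w: "w = (zt, y)" "zt \<in> el ?P n" "y \<in> fobj Y' n" "ap p n y = V n zt" by (auto simp: EA_def)
      show "rs (?P \<otimes> cs Y') a w \<in> EA m"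
        using rs_el[OF tinyp_psh[OF tP] a w(2)] rs_el[OF psh_cs[OF Y'] a, of y] w natm_rs[OF V a w(2)] ap_rs[OF p(2) a w(3)]
        by (simp add: EA_def)
    qed
    let ?E = "restr (?P \<otimes> cs Y') EA"
    have tE: "tinyp ?E" by (intro tinyp_restr tinyp_prodp tP tinyp_cs Y' sub)
    have Ec: "\<exists>z t y. x = ((z, t), y) \<and> z \<in> fobj Z n \<and> t \<in> cub n 1 \<and> y \<in> fobj Y' n \<and> ap p n y = V n (z, t)"
      if "x \<in> el ?E n" for x n using that by (auto simp: EA_def)
    have E_I: "((z, t), y) \<in> el ?E n" if "z \<in> fobj Z n" "t \<in> cub n 1" "y \<in> fobj Y' n" "ap p n y = V n (z, t)" for n z t y
      using that by (simp add: EA_def)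
    have idx: "natm ?E Ip (\<lambda>n x. snd (fst x))" and zE: "natm ?E (cs Z) (\<lambda>n x. fst (fst x))"
      by (rule natmI; use Ec in fastforce)+
    obtain \<phi> where fel: "\<And>n x t. x \<in> el ?E n ==> t \<in> cub n 1 ==> \<phi> n x t \<in> fobj Y' n"
      and frs: "\<And>m n a x t. a \<in> cub m n ==> x \<in> el ?E n ==> t \<in> cub n 1 ==> \<phi> m (rs ?E a x) (t \<odot> a) = rs (cs Y') a (\<phi> n x t)"
      and f0: "\<And>n x t. x \<in> el ?E n ==> t \<in> cub n 1 ==> x \<in> {} \<or> t = snd (fst x) ==> \<phi> n x t = snd x"
      and pf: "\<And>n x t. x \<in> el ?E n ==> t \<in> cub n 1 ==> ap p n (\<phi> n x t) = V n (fst (fst x), t)"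
    proof (rule Fib_fill[OF p tE cof_empty idx, where u = "\<lambda>n x t. snd x" and v = "\<lambda>n x t. V n (fst (fst x), t)"])
      fix n x t assume "x \<in> el ?E n" and t: "t \<in> cub n 1"
      then obtain z s y where x: "x = ((z, s), y)" "z \<in> fobj Z n" "s \<in> cub n 1" "y \<in> fobj Y' n" "ap p n y = V n (z, s)"
        using Ec by blast
      show "V n (fst (fst x), t) \<in> fobj X' n" using Vel x t by simp
      show "V m (fst (fst (rs ?E a x)), t \<odot> a) = rs (cs X') a (V n (fst (fst x), t))" if "a \<in> cub m n" for m a
        using Vrs[OF that x(2) t] by (simp add: x(1))
      show "snd x \<in> fobj Y' n" using x by simp
      show "snd (rs ?E a x) = rs (cs Y') a (snd x)" for a by (simp add: x(1))
      assume "x \<in> {} \<or> t = snd (fst x)"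
      then show "ap p n (snd x) = V n (fst (fst x), t)" using x by simp
    qed (rule that; assumption)
    have cE: "cof ?E (\<lambda>n. {x \<in> el ?E n. fst (fst x) \<in> A n})" by (rule cof_preimage[OF A zE tinyp_psh[OF tE]])
    have iE: "natm ?E Ip (\<lambda>n x. i n (fst (fst x)))" by (rule natm_comp[OF zE i])
    obtain \<beta> where bel: "\<And>n x t. x \<in> el ?E n ==> t \<in> cub n 1 ==> \<beta> n x t \<in> fobj B n"
      and brs: "\<And>m n a x t. a \<in> cub m n ==> x \<in> el ?E n ==> t \<in> cub n 1 ==> \<beta> m (rs ?E a x) (t \<odot> a) = rs (cs B) a (\<beta> n x t)"
      and b0: "\<And>n x t. x \<in> el ?E n ==> t \<in> cub n 1 ==> x \<in> {x \<in> el ?E n. fst (fst x) \<in> A n} \<or> t = i n (fst (fst x)) ==>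
        \<beta> n x t = sev n (d n (U n (fst (fst x), t))) (\<phi> n x t)"
      and gb: "\<And>n x t. x \<in> el ?E n ==> t \<in> cub n 1 ==> ap g n (\<beta> n x t) = ap v n (\<phi> n x t)"
    proof (rule Fib_fill[OF g tE cE iE, where u = "\<lambda>n x t. sev n (d n (U n (fst (fst x), t))) (\<phi> n x t)"
          and v = "\<lambda>n x t. ap v n (\<phi> n x t)"])
      fix n x t assume xE: "x \<in> el ?E n" and t: "t \<in> cub n 1"
      then obtain z s y where x: "x = ((z, s), y)" "z \<in> fobj Z n" "s \<in> cub n 1" "y \<in> fobj Y' n" "ap p n y = V n (z, s)"
        using Ec by blast
      show "ap v n (\<phi> n x t) \<in> fobj D n" by (rule ap_el[OF v fel[OF xE t]])
      show "ap v m (\<phi> m (rs ?E a x) (t \<odot> a)) = rs (cs D) a (ap v n (\<phi> n x t))" if "a \<in> cub m n" for m a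
        using frs[OF that xE t] ap_rs[OF v that fel[OF xE t]] by simp
      assume "x \<in> {x \<in> el ?E n. fst (fst x) \<in> A n} \<or> t = i n (fst (fst x))"
      then have bz: "(z, t) \<in> box (cs Z) i A n" using x t by (auto simp: box_def)
      note UN = Uel[OF bz]
      have f': "\<phi> n x t \<in> el (cs Y') n" "ap p n (\<phi> n x t) = fst (d n (U n (z, t)))"
        using fel[OF xE t] pf[OF xE t] Ufst[OF bz] by (simp_all add: x(1))
      note E = ev[OF dS[OF UN] f']
      show "sev n (d n (U n (fst (fst x), t))) (\<phi> n x t) \<in> fobj B n" using E(1) by (simp add: x(1))
      show "ap g n (sev n (d n (U n (fst (fst x), t))) (\<phi> n x t)) = ap v n (\<phi> n x t)" using E(2) by (simp add: x(1))
      fix m a assume a: "a \<in> cub m n"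
      have "d m (U m (rs (cs Z) a z, t \<odot> a)) = rs S a (d n (U n (z, t)))"
        using natm_rs[OF U a, of "(z, t)"] bz natm_rs[OF d a, of "U n (z, t)"] UN by simp
      then show "sev m (d m (U m (fst (fst (rs ?E a x)), t \<odot> a))) (\<phi> m (rs ?E a x) (t \<odot> a)) =
          rs (cs B) a (sev n (d n (U n (fst (fst x), t))) (\<phi> n x t))"
        using E(3)[OF a] frs[OF a xE t] by (simp add: x(1))
    qed (rule that; assumption)
    define b where "b n zt y = \<beta> n (zt, y) (snd zt)" for n zt y
    have so: "natm ?P S (sect_of (cs X') (cs Y') (ap p) ?P V b)"
      "\<And>n zt y. zt \<in> el ?P n ==> y \<in> el (cs Y') n ==> ap p n y = V n zt ==>
        sev n (sect_of (cs X') (cs Y') (ap p) ?P V b n zt) y = b n zt y"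
      "\<And>n zt. fst (sect_of (cs X') (cs Y') (ap p) ?P V b n zt) = V n zt"
    proof -
      have b1: "b n zt y \<in> el (cs B) n" "ap g n (b n zt y) = ap v n y"
        if "zt \<in> el ?P n" "y \<in> el (cs Y') n" "ap p n y = V n zt" for n zt y
      proof -
        obtain z t where zt: "zt = (z, t)" "z \<in> fobj Z n" "t \<in> cub n 1" using \<open>zt \<in> el ?P n\<close> by auto
        have x: "(zt, y) \<in> el ?E n" unfolding zt(1) by (rule E_I[OF zt(2,3)]) (use that(2,3) zt(1) in simp_all)
        show "b n zt y \<in> el (cs B) n" "ap g n (b n zt y) = ap v n y"
          using bel[OF x zt(3)] gb[OF x zt(3)] f0[OF x zt(3)] by (simp_all add: b_def zt(1))
      qed
      have b2: "b m (rs ?P a zt) (rs (cs Y') a y) = rs (cs B) a (b n zt y)"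
        if a: "a \<in> cub m n" and "zt \<in> el ?P n" "y \<in> el (cs Y') n" "ap p n y = V n zt" for m n a zt y
      proof -
        obtain z t where zt: "zt = (z, t)" "z \<in> fobj Z n" "t \<in> cub n 1" using \<open>zt \<in> el ?P n\<close> by auto
        have x: "(zt, y) \<in> el ?E n" unfolding zt(1) by (rule E_I[OF zt(2,3)]) (use that(3,4) zt(1) in simp_all)
        show ?thesis using brs[OF a x zt(3)] by (simp add: b_def zt(1))
      qed
      show "natm ?P S (sect_of (cs X') (cs Y') (ap p) ?P V b)"
        unfolding S by (rule sect_of(1)[OF ps tinyp_psh[OF tP] V]) (use b1 b2 in auto)
      show "sev n (sect_of (cs X') (cs Y') (ap p) ?P V b n zt) y = b n zt y"
        if "zt \<in> el ?P n" "y \<in> el (cs Y') n" "ap p n y = V n zt" for n zt y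
        by (rule sect_of(2)[OF ps tinyp_psh[OF tP] V, where ok = "\<lambda>n y b. ap g n b = ap v n y"]) (use b1 b2 that in auto)
      show "fst (sect_of (cs X') (cs Y') (ap p) ?P V b n zt) = V n zt" for n zt
        by (simp add: sect_of_def[OF ps])
    qed
    let ?W = "sect_of (cs X') (cs Y') (ap p) ?P V b"
    show "\<exists>w. natm ?P (cs N) w \<and> (\<forall>n. \<forall>z \<in> box (cs Z) i A n. w n z = U n z) \<and>
      (\<forall>n. \<forall>z \<in> el ?P n. ap ?r n (w n z) = V n z)"
    proof (intro exI[of _ "\<lambda>n zt. e n (?W n zt)"] conjI allI ballI)
      show "natm ?P (cs N) (\<lambda>n zt. e n (?W n zt))" by (rule natm_comp[OF so(1) e])
      show "ap ?r n (e n (?W n zt)) = V n zt" if "zt \<in> el ?P n" for n zt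
        using natm_el[OF e natm_el[OF so(1) that]] de[OF natm_el[OF so(1) that]] so(3) by simp
      fix n zt assume bz: "zt \<in> box (cs Z) i A n"
      have ztP: "zt \<in> el ?P n" using subf_el[OF sbox bz] .
      note WS = natm_el[OF so(1) ztP] and US = dS[OF Uel[OF bz]]
      have "?W n zt = d n (U n zt)"
      proof (rule Sect_eqI[OF ps WS[unfolded S] US[unfolded S], folded S])
        show "fst (?W n zt) = fst (d n (U n zt))" using so(3) Ufst[OF bz] by simp
        fix m a y assume a: "a \<in> cub m n" and y: "y \<in> el (cs Y') m" and py: "ap p m y = rs (cs X') a (fst (?W n zt))"
        note abz = subf_rs[OF sbox a bz]
        note aP = subf_el[OF sbox abz]
        have py': "ap p m y = V m (rs ?P a zt)" using py so(3) natm_rs[OF V a ztP] by simp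
        obtain z t where zt: "rs ?P a zt = (z, t)" "z \<in> fobj Z m" "t \<in> cub m 1" using aP by auto
        have x: "((z, t), y) \<in> el ?E m" using E_I[OF zt(2,3)] y py' zt(1) by simp
        have "sev m (rs S a (?W n zt)) y = b m (z, t) y"
          using natm_rs[OF so(1) a ztP] so(2)[OF aP y py'] zt(1) by simp
        also have "\<dots> = sev m (d m (U m (z, t))) y"
          using b0[OF x zt(3)] f0[OF x zt(3)] abz zt(1) x by (auto simp: b_def box_def)
        also have "\<dots> = sev m (rs S a (d n (U n zt))) y"
          using natm_rs[OF U a, of zt] bz natm_rs[OF d a, of "U n zt"] Uel[OF bz] zt(1) by simp
        finally show "sev m (rs S a (?W n zt)) y = sev m (rs S a (d n (U n zt))) y" .
      qed
      then show "e n (?W n zt) = U n zt" using ed[OF Uel[OF bz]] by simp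
    qed
  qed
qed

text \<open>A lifting problem of \<open>q\<close> against \<open>g\<close> transposes to one of
  \<open>\<eta>\<close> against the dependent product of \<open>g\<close> along \<open>p\<close>, which
  is a fibration.\<close>

lemma frobenius:
  assumes \<eta>: "\<eta> \<in> TCof \<C>" "\<eta> \<in> hom cS X X'" and p: "p \<in> Fib \<C>" "p \<in> hom cS Y' X'"
    and pb: "is_pullback cS \<eta> p f q" and src: "src f = Y"
  shows "q \<in> TCof \<C>" and "q \<in> hom cS Y Y'"
proof -
  note Dp = is_pullbackD[OF pb \<eta>(2) p(2) src]
  note X = hom_Obj(1)[OF \<eta>(2)] and X' = hom_Obj(2)[OF \<eta>(2)] and Y = hom_Obj(1)[OF Dp(1)] and Y' = hom_Obj(1)[OF p(2)]
  show q: "q \<in> hom cS Y Y'" by (rule Dp(2))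
  have "lifts cS q g" if gF: "g \<in> Fib \<C>" for g
  proof -
    obtain B D where g: "g \<in> hom cS B D" using Fib_hom[OF gF] by blast
    note BO = hom_Obj(1)[OF g]
    show ?thesis
    proof (rule liftsI[OF q g])
      fix u v assume u: "u \<in> hom cS Y B" and v: "v \<in> hom cS Y' D" and uv: "g \<bullet> u = v \<bullet> q"
      define S where "S = Sect (cs X') (cs Y') (ap p) (cs B) (\<lambda>n y b. ap g n b = ap v n y)"
      note ps = psh_cs[OF X'] psh_cs[OF Y'] ap_natm[OF p(2)] psh_cs[OF BO]
      note ev = sev[OF ps, where ok = "\<lambda>n y b. ap g n b = ap v n y", folded S_def]
      have "tinyp S" unfolding S_def by (intro tinyp_Sect tinyp_cs X' Y' BO ap_natm[OF p(2)])
      then obtain N e d where N: "N \<in> Obj cS" and iso: "natiso S (cs N) e d" using cset_coding by blast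
      note r = pushforward_Fib[OF p gF g v S_def N iso]
      let ?r = "mp N X' (\<lambda>n w. fst (d n w))"
      have e: "natm S (cs N) e" and d: "natm (cs N) S d" and de: "\<And>n z. z \<in> el S n ==> d n (e n z) = z"
        using iso unfolding natiso_def by simp_all
      have dS: "d n w \<in> el S n" if "w \<in> fobj N n" for n w using natm_el[OF d] that by simp
      have guv: "ap g n (ap u n w) = ap v n (ap q n w)" if "w \<in> fobj Y n" for n w
        using ap_comp[OF u that, of g] ap_comp[OF q that, of v] uv by simp
      \<comment> \<open>the element of the pullback given by a pair\<close>
      define pw where "pw n x y = (SOME w. w \<in> fobj Y n \<and> ap f n w = x \<and> ap q n w = y)" for n x y
      have pw: "pw n x y \<in> fobj Y n" "ap f n (pw n x y) = x" "ap q n (pw n x y) = y"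
        if "x \<in> fobj X n" "y \<in> fobj Y' n" "ap p n y = ap \<eta> n x" for n x y
      proof -
        have "\<exists>w. w \<in> fobj Y n \<and> ap f n w = x \<and> ap q n w = y" using Dp(4)[OF that(1,2)] that(3) by auto
        from someI_ex[OF this] show "pw n x y \<in> fobj Y n" "ap f n (pw n x y) = x" "ap q n (pw n x y) = y"
          unfolding pw_def by auto
      qed
      have pwrs: "pw m (rs (cs X) a x) (rs (cs Y') a y) = rs (cs Y) a (pw n x y)"
        if a: "a \<in> cub m n" and x: "x \<in> fobj X n" and y: "y \<in> fobj Y' n" and e: "ap p n y = ap \<eta> n x" for m n a x y
      proof -
        have x': "rs (cs X) a x \<in> fobj X m" and y': "rs (cs Y') a y \<in> fobj Y' m"
          using rs_el[OF psh_cs[OF X] a] rs_el[OF psh_cs[OF Y'] a] x y by simp_all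
        have e': "ap p m (rs (cs Y') a y) = ap \<eta> m (rs (cs X) a x)" by (simp add: ap_rs[OF p(2) a y] ap_rs[OF \<eta>(2) a x] e)
        note 1 = pw[OF x y e] and 2 = pw[OF x' y' e']
        have w: "rs (cs Y) a (pw n x y) \<in> fobj Y m" using rs_el[OF psh_cs[OF Y] a] 1(1) by simp
        show ?thesis by (rule Dp(5)[OF 2(1) w]) (simp_all add: 2 ap_rs[OF Dp(1) a 1(1)] ap_rs[OF q a 1(1)] 1)
      qed
      let ?b = "\<lambda>n x y. ap u n (pw n x y)" and ?E = "ap \<eta>"
      let ?s = "sect_of (cs X') (cs Y') (ap p) (cs X) ?E ?b"
      have so: "natm (cs X) S ?s"
        unfolding S_def
        by (rule sect_of(1)[OF ps psh_cs[OF X] ap_natm[OF \<eta>(2)]])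
          (simp_all add: pw ap_el[OF u] guv pwrs ap_rs[OF u])
      have soe: "sev n (?s n x) y = ap u n (pw n x y)" if "x \<in> fobj X n" "y \<in> fobj Y' n" "ap p n y = ap \<eta> n x" for n x y
        by (rule sect_of(2)[OF ps psh_cs[OF X] ap_natm[OF \<eta>(2)], where ok = "\<lambda>n y b. ap g n b = ap v n y"])
          (simp_all add: pw ap_el[OF u] guv pwrs ap_rs[OF u] that)
      note u0 = mp_hom[OF X N natm_comp[OF so e]]
      let ?u = "mp X N (\<lambda>n x. e n (?s n x))"
      have sS: "?s n x \<in> el S n" if "x \<in> fobj X n" for n x using natm_el[OF so] that by simp
      have sfst: "fst (?s n x) = ap \<eta> n x" for n x by (simp add: sect_of_def[OF ps])
      have "?r \<bullet> ?u = Idn cS X' \<bullet> \<eta>"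
      proof (rule hom_ext[OF comp_hom[OF u0 r(1)] comp_hom[OF \<eta>(2) id_hom'[OF X']]])
        fix n x assume x: "x \<in> fobj X n"
        have "e n (?s n x) \<in> fobj N n" using natm_el[OF e sS[OF x]] by simp
        then show "ap (?r \<bullet> ?u) n x = ap (Idn cS X' \<bullet> \<eta>) n x"
          by (simp add: ap_comp[OF u0 x] ap_comp[OF \<eta>(2) x] x de[OF sS[OF x]] X' ap_el[OF \<eta>(2)] sfst)
      qed
      moreover have "lifts cS \<eta> ?r" using \<eta>(1) r(2) by (simp add: TCof_def llp_def)
      ultimately obtain k where k: "k \<in> hom cS X' N" "k \<bullet> \<eta> = ?u" "?r \<bullet> k = Idn cS X'"
        using liftsD[OF _ \<eta>(2) r(1) u0 id_hom'[OF X']] by blast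
      have kf: "d n (ap k n x) \<in> el S n" "fst (d n (ap k n x)) = x" if "x \<in> fobj X' n" for n x
        using dS ap_el[OF k(1) that] ap_comp[OF k(1) that, of ?r] k(3) that X' by simp_all
      let ?h = "\<lambda>n y. sev n (d n (ap k n (ap p n y))) y"
      have h: "?h n y \<in> fobj B n" "ap g n (?h n y) = ap v n y"
        "a \<in> cub m n ==> ?h m (rs (cs Y') a y) = rs (cs B) a (?h n y)" if y: "y \<in> fobj Y' n" for n y a m
      proof -
        note py = ap_el[OF p(2) y]
        have y': "y \<in> el (cs Y') n" "ap p n y = fst (d n (ap k n (ap p n y)))" using y kf(2)[OF py] by simp_all
        note E = ev[OF kf(1)[OF py] y']
        show "?h n y \<in> fobj B n" "ap g n (?h n y) = ap v n y" using E(1,2) by simp_all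
        show "?h m (rs (cs Y') a y) = rs (cs B) a (?h n y)" if a: "a \<in> cub m n"
          using E(3)[OF a] natm_rs[OF d a, of "ap k n (ap p n y)"] ap_el[OF k(1) py]
          by (simp add: ap_rs[OF p(2) a y] ap_rs[OF k(1) a py])
      qed
      have nat: "natm (cs Y') (cs B) ?h" by (rule natmI) (simp_all add: h)
      note H = mp_hom[OF Y' BO nat]
      have "mp Y' B ?h \<bullet> q = u"
      proof (rule hom_ext[OF comp_hom[OF q H] u])
        fix n w assume w: "w \<in> fobj Y n"
        note fw = ap_el[OF Dp(1) w] and qw = ap_el[OF q w]
        have e1: "ap p n (ap q n w) = ap \<eta> n (ap f n w)" using Dp(3)[OF w] by simp
        have "ap k n (ap \<eta> n (ap f n w)) = e n (?s n (ap f n w))"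
          using ap_comp[OF \<eta>(2) fw, of k] k(2) fw by simp
        then have "?h n (ap q n w) = sev n (?s n (ap f n w)) (ap q n w)" by (simp add: e1 de[OF sS[OF fw]])
        also have "\<dots> = ap u n (pw n (ap f n w) (ap q n w))" by (rule soe[OF fw qw e1])
        also have "pw n (ap f n w) (ap q n w) = w" by (rule Dp(5)[OF pw(1)[OF fw qw e1] w]) (simp_all add: pw(2,3)[OF fw qw e1])
        finally show "ap (mp Y' B ?h \<bullet> q) n w = ap u n w" by (simp add: ap_comp[OF q w] qw)
      qed
      moreover have "g \<bullet> mp Y' B ?h = v"
        by (rule hom_ext[OF comp_hom[OF H g] v]) (simp add: ap_comp[OF H] h)
      ultimately show "\<exists>d \<in> hom cS Y' B. d \<bullet> q = u \<and> g \<bullet> d = v" using H by blast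
    qed
  qed
  then show "q \<in> TCof \<C>" using hom_Arr[OF q] by (simp add: TCof_def llp_def)
qed

text \<open>Fibration extension along a fibrant replacement of the base reduces this to the case of a
  fibrant base; \<open>frobenius\<close> ensures that the extension is again a weak homotopy
  equivalence.\<close>

lemma whe_Fib_TFib:
  assumes fep: "fibration_extension_property cS (TCof \<C>) (Fib \<C>)"
    and p: "p \<in> Fib \<C>" "p \<in> hom cS Y X" and w: "whe Y X p"
  shows "p \<in> TFib \<C>"
proof -
  note X = hom_Obj(2)[OF p(2)]
  obtain \<eta> k where \<eta>: "\<eta> \<in> TCof \<C>" and k: "k \<in> Fib \<C>" and c: "tgt \<eta> = src k" "to_one X = k \<bullet> \<eta>"
    using factor_TCof_Fib[OF to_one_hom[OF X]] by auto
  have "src \<eta> = X" "tgt k = one" using c(2) hom_src[OF to_one_hom[OF X]] hom_tgt[OF to_one_hom[OF X]] by (simp_all add: cSet_comp)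
  then have \<eta>h: "\<eta> \<in> hom cS X (src k)" and kh: "k \<in> hom cS (src k) one"
    using Arr_hom[of \<eta>] TCof_Arrs \<eta> c(1) Fib_hom[OF k] by auto
  have X': "fibrant \<C> (src k)" using k kh hom_Obj(1)[OF kh] by (auto simp: fibrant_def)
  have "Dom cS \<eta> = Cod cS p" using hom_src[OF \<eta>h] hom_tgt[OF p(2)] by simp
  then obtain p' q where p': "p' \<in> Fib \<C>" "Cod cS p' = Cod cS \<eta>" and pb: "is_pullback cS \<eta> p' p q"
    using fep \<eta> p(1) unfolding fibration_extension_property_def by blast
  have p'h: "p' \<in> hom cS (src p') (src k)" using Fib_hom[OF p'(1)] p'(2) c(1) by simp
  note q = frobenius[OF \<eta> \<eta>h p'(1) p'h pb hom_src[OF p(2)]]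
  have "\<eta> \<bullet> p = p' \<bullet> q" using pb by (simp add: is_pullback_def)
  then have "whe Y (src k) (p' \<bullet> q)" using whe_comp[OF w TCof_whe[OF \<eta> \<eta>h]] by simp
  from whe_cancel_right[OF TCof_whe[OF q] p'h this] have "whe (src p') (src k) p'" .
  from Fib_whe_TFib[OF p'(1) p'h X' this] have "p' \<in> rlp cS \<C>" by (simp add: TFib_def)
  from rlp_pullback[OF this C_Arr pb \<eta>h p'h] show ?thesis by (simp add: TFib_def)
qed

text \<open>Conversely to \<open>WEq_whe\<close>, factor \<open>f\<close> into a trivial cofibration and
  a fibration; the latter satisfies \<open>whe\<close> by cancellation.\<close>

lemma WEq_iff_whe:
  assumes fep: "fibration_extension_property cS (TCof \<C>) (Fib \<C>)" and f: "f \<in> hom cS X Y"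
  shows "f \<in> WEq \<C> \<longleftrightarrow> whe X Y f"
proof
  assume w: "whe X Y f"
  obtain l r where l: "l \<in> TCof \<C>" and r: "r \<in> Fib \<C>" and c: "tgt l = src r" "f = r \<bullet> l"
    using factor_TCof_Fib[OF f] by auto
  have "src l = X" "tgt r = Y" using c(2) hom_src[OF f] hom_tgt[OF f] by (simp_all add: cSet_comp)
  then have lh: "l \<in> hom cS X (src r)" and rh: "r \<in> hom cS (src r) Y"
    using Arr_hom[of l] TCof_Arrs l c(1) Fib_hom[OF r] by auto
  have "whe (src r) Y r" using whe_cancel_right[OF TCof_whe[OF l lh] rh] w c(2) by simp
  from WEq_I[OF l whe_Fib_TFib[OF fep r rh this] c(1)] show "f \<in> WEq \<C>" using c(2) by simp
qed (rule WEq_whe[OF _ f])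

lemma three_for_two_WEq:
  assumes fep: "fibration_extension_property cS (TCof \<C>) (Fib \<C>)"
  shows "three_for_two cS (WEq \<C>)"
  unfolding three_for_two_def cSet_simps
proof (intro ballI impI)
  fix f g assume "f \<in> Arr cS" "g \<in> Arr cS" "tgt f = src g"
  then have f: "f \<in> hom cS (src f) (src g)" and g: "g \<in> hom cS (src g) (tgt g)" using Arr_hom[of f] Arr_hom[of g] by auto
  note iff = WEq_iff_whe[OF fep f] WEq_iff_whe[OF fep g] WEq_iff_whe[OF fep comp_hom[OF f g]]
  show "(f \<in> WEq \<C> \<and> g \<in> WEq \<C> \<longrightarrow> g \<bullet> f \<in> WEq \<C>) \<and> (f \<in> WEq \<C> \<and> g \<bullet> f \<in> WEq \<C> \<longrightarrow> g \<in> WEq \<C>) \<and>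
    (g \<in> WEq \<C> \<and> g \<bullet> f \<in> WEq \<C> \<longrightarrow> f \<in> WEq \<C>)"
    unfolding iff using whe_comp whe_cancel_right[OF _ g] whe_cancel_left[OF f] by blast
qed

end


section \<open>Connected components\<close>

lemma SET_hom:
  assumes "f \<in> hom SET A B"
  shows "src f = A" "tgt f = B" "small A" "small B" "x \<in> A ==> fn f x \<in> B" "f \<in> Arr SET"
  using assms by (auto simp: hom_def SET_def)

lemma SET_mk: "small A ==> small B ==> (\<And>x. x \<in> A ==> f x \<in> B) ==> Arrow A B (\<lambda>x\<in>A. f x) \<in> hom SET A B"
  by (auto simp: hom_SET_iff)

lemma SET_ext:
  assumes "f \<in> hom SET A B" "g \<in> hom SET A B" "\<And>x. x \<in> A ==> fn f x = fn g x"
  shows "f = g"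
proof -
  obtain f' g' where f': "f = Arrow A B f'" "f' \<in> A \<rightarrow>\<^sub>E B" and g': "g = Arrow A B g'" "g' \<in> A \<rightarrow>\<^sub>E B"
    using assms(1,2) by (auto simp: hom_SET_iff)
  have "f' = g'" by (rule PiE_ext[OF f'(2) g'(2)]) (use assms(3) f'(1) g'(1) in simp)
  then show ?thesis by (simp add: f'(1) g'(1))
qed

lemma SET_comp_hom: "f \<in> hom SET A B ==> g \<in> hom SET B D ==> g \<cdot>\<^bsub>SET\<^esub> f \<in> hom SET A D"
  by (auto simp: hom_SET_iff SET_comp compose_def)

lemma SET_comp_fn: "f \<in> hom SET A B ==> x \<in> A ==> fn (g \<cdot>\<^bsub>SET\<^esub> f) x = fn g (fn f x)"
  using SET_hom(1)[of f A B] by (simp add: SET_comp compose_def)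

lemma equivclp_invariant: "equivclp r x y ==> (\<And>x y. r x y ==> f x = f y) ==> f x = f y"
  by (induction rule: equivclp_induct) metis+

text \<open>Quotients by a generated equivalence relation are formed by chosen representatives, which keeps
  them inside the given set.\<close>

definition rep :: "('a => 'a => bool) => 'a => 'a" where
  "rep r x = (SOME z. equivclp r x z)"

lemma equivclp_rep: "equivclp r x (rep r x)"
  unfolding rep_def by (rule someI[of _ x]) simp

lemma rep_eq_iff: "rep r x = rep r y \<longleftrightarrow> equivclp r x y"
proof
  show "equivclp r x y" if "rep r x = rep r y"
    using equivclp_rep[of r x, unfolded that] equivclp_rep[of r y] by (rule equivclp_trans[OF _ equivclp_sym])
  assume xy: "equivclp r x y"
  have "equivclp r x z \<longleftrightarrow> equivclp r y z" for z
    using equivclp_trans[of r x y z] equivclp_trans[of r y x z] equivclp_sym[of r x y] xy by blast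
  then show "rep r x = rep r y" by (simp add: rep_def)
qed

text \<open>A coequalizer of \<open>u\<close> and \<open>v\<close> is a quotient by the generated equivalence relation. Any
  coequalizer is compared with the quotient formed by representatives.\<close>

lemma SET_coequalizer:
  assumes u: "u \<in> hom SET A B" and v: "v \<in> hom SET A B"
  defines "R \<equiv> equivclp (\<lambda>x y. \<exists>w \<in> A. x = fn u w \<and> y = fn v w)"
  shows "\<exists>q. is_coequalizer SET u v q"
    and "is_coequalizer SET u v q ==> q \<in> hom SET B (tgt q) \<and> fn q ` B = tgt q \<and>
      (\<forall>x \<in> B. \<forall>y \<in> B. fn q x = fn q y \<longleftrightarrow> R x y)"
proof -
  let ?r = "\<lambda>x y. \<exists>w \<in> A. x = fn u w \<and> y = fn v w"
  note uv = SET_hom(5)[OF u] SET_hom(5)[OF v]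
  have tgtu: "tgt u = B" and sB: "small B" using SET_hom[OF u] by simp_all
  have RB: "z \<in> B" if "R x z" "x \<in> B" for x z
    using equivclp_invariant[OF that(1)[unfolded R_def], of "\<lambda>z. z \<in> B"] that(2) uv by auto
  define c where "c = rep ?r"
  have Rc: "R x (c x)" and cc: "c x = c y \<longleftrightarrow> R x y" for x y
    by (simp_all add: c_def R_def equivclp_rep rep_eq_iff)
  have cB: "c ` B \<subseteq> B" using RB Rc by blast
  then have scB: "small (c ` B)"
    unfolding small_def by (meson card_of_image ordLeq_ordLess_trans sB small_def)
  let ?q = "Arrow B (c ` B) (\<lambda>x\<in>B. c x)"
  have q0: "?q \<in> hom SET B (c ` B)" by (rule SET_mk[OF sB scB]) simp
  have cuv: "c (fn u w) = c (fn v w)" if "w \<in> A" for w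
    unfolding cc R_def using that by (intro r_into_equivclp) blast
  have inv: "fn r x = fn r y" if r: "r \<in> hom SET B T" "r \<cdot>\<^bsub>SET\<^esub> u = r \<cdot>\<^bsub>SET\<^esub> v" and "R x y" for r T x y
  proof (rule equivclp_invariant[OF that(3)[unfolded R_def]])
    fix x y assume "\<exists>w \<in> A. x = fn u w \<and> y = fn v w"
    then show "fn r x = fn r y" using SET_comp_fn[OF u, of _ r] SET_comp_fn[OF v, of _ r] r(2) by auto
  qed
  have quv: "?q \<cdot>\<^bsub>SET\<^esub> u = ?q \<cdot>\<^bsub>SET\<^esub> v"
    by (rule SET_ext[OF SET_comp_hom[OF u q0] SET_comp_hom[OF v q0]])
      (simp add: SET_comp_fn[OF u] SET_comp_fn[OF v] uv cuv)
  have fact: "\<exists>h \<in> hom SET (c ` B) T. h \<cdot>\<^bsub>SET\<^esub> ?q = r"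
    if r: "r \<in> hom SET B T" "r \<cdot>\<^bsub>SET\<^esub> u = r \<cdot>\<^bsub>SET\<^esub> v" for r T
  proof (intro bexI)
    let ?h = "Arrow (c ` B) T (\<lambda>z\<in>c ` B. fn r z)"
    show h: "?h \<in> hom SET (c ` B) T" by (rule SET_mk[OF scB SET_hom(4)[OF r(1)]]) (use cB SET_hom(5)[OF r(1)] in blast)
    show "?h \<cdot>\<^bsub>SET\<^esub> ?q = r"
      by (rule SET_ext[OF SET_comp_hom[OF q0 h] r(1)]) (use inv[OF r Rc] in \<open>simp add: SET_comp_fn[OF q0]\<close>)
  qed
  have "is_coequalizer SET u v ?q"
    unfolding is_coequalizer_def
  proof (intro conjI allI ballI impI)
    show "?q \<in> Arr SET" by (rule SET_hom(6)[OF q0])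
    show "Dom SET ?q = Cod SET u" by (simp add: tgtu)
    show "?q \<cdot>\<^bsub>SET\<^esub> u = ?q \<cdot>\<^bsub>SET\<^esub> v" by (rule quv)
    fix T r assume "r \<in> hom SET (Cod SET u) T" and ruv: "r \<cdot>\<^bsub>SET\<^esub> u = r \<cdot>\<^bsub>SET\<^esub> v"
    then have r: "r \<in> hom SET B T" by (simp add: tgtu)
    from fact[OF r ruv] obtain h where h: "h \<in> hom SET (c ` B) T" "h \<cdot>\<^bsub>SET\<^esub> ?q = r" by blast
    show "\<exists>!h. h \<in> hom SET (Cod SET ?q) T \<and> h \<cdot>\<^bsub>SET\<^esub> ?q = r"
    proof (intro ex1I[of _ h] conjI)
      fix k assume "k \<in> hom SET (Cod SET ?q) T \<and> k \<cdot>\<^bsub>SET\<^esub> ?q = r"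
      then have k: "k \<in> hom SET (c ` B) T" "k \<cdot>\<^bsub>SET\<^esub> ?q = r" by simp_all
      show "k = h"
      proof (rule SET_ext[OF k(1) h(1)])
        fix z assume "z \<in> c ` B"
        then obtain x where "x \<in> B" "z = c x" by blast
        then show "fn k z = fn h z" using SET_comp_fn[OF q0, of x k] SET_comp_fn[OF q0, of x h] k(2) h(2) by simp
      qed
    qed (use h in simp_all)
  qed
  then show "\<exists>q. is_coequalizer SET u v q" by blast
  assume q: "is_coequalizer SET u v q"
  have qh: "q \<in> hom SET B (tgt q)" using q tgtu by (simp add: is_coequalizer_def hom_def)
  have quv': "q \<cdot>\<^bsub>SET\<^esub> u = q \<cdot>\<^bsub>SET\<^esub> v" using q by (simp add: is_coequalizer_def)
  have univ: "\<exists>!h. h \<in> hom SET (tgt q) T \<and> h \<cdot>\<^bsub>SET\<^esub> q = r" if "r \<in> hom SET B T" "r \<cdot>\<^bsub>SET\<^esub> u = r \<cdot>\<^bsub>SET\<^esub> v" for r T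
    using q that tgtu by (simp add: is_coequalizer_def)
  obtain h where h: "h \<in> hom SET (tgt q) (c ` B)" "h \<cdot>\<^bsub>SET\<^esub> q = ?q" using univ[OF q0 quv] by blast
  obtain k where k: "k \<in> hom SET (c ` B) (tgt q)" "k \<cdot>\<^bsub>SET\<^esub> ?q = q" using fact[OF qh quv'] by blast
  have hq: "fn h (fn q x) = c x" if "x \<in> B" for x using SET_comp_fn[OF qh that, of h] h(2) that by simp
  have kc: "fn k (c x) = fn q x" if "x \<in> B" for x using SET_comp_fn[OF q0 that, of k] k(2) that by simp
  have idq: "Arrow (tgt q) (tgt q) (\<lambda>x\<in>tgt q. x) \<in> hom SET (tgt q) (tgt q)"
    by (rule SET_mk) (use SET_hom(4)[OF qh] in simp_all)
  have "k \<cdot>\<^bsub>SET\<^esub> h = Arrow (tgt q) (tgt q) (\<lambda>x\<in>tgt q. x)"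
  proof -
    have "(k \<cdot>\<^bsub>SET\<^esub> h) \<cdot>\<^bsub>SET\<^esub> q = q"
      by (rule SET_ext[OF SET_comp_hom[OF qh SET_comp_hom[OF h(1) k(1)]] qh])
        (simp add: SET_comp_fn[OF qh] SET_comp_fn[OF h(1)] SET_hom(5)[OF qh] hq kc)
    moreover have "Arrow (tgt q) (tgt q) (\<lambda>x\<in>tgt q. x) \<cdot>\<^bsub>SET\<^esub> q = q"
      by (rule SET_ext[OF SET_comp_hom[OF qh idq] qh]) (simp add: SET_comp_fn[OF qh] SET_hom(5)[OF qh])
    ultimately show ?thesis using univ[OF qh quv'] SET_comp_hom[OF h(1) k(1)] idq by blast
  qed
  note kh = this
  have "z \<in> fn q ` B" if z: "z \<in> tgt q" for z
  proof -
    obtain x where x: "x \<in> B" "fn h z = c x" using SET_hom(5)[OF h(1) z] by blast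
    have "z = fn (k \<cdot>\<^bsub>SET\<^esub> h) z" using z by (simp add: kh)
    also have "\<dots> = fn q x" by (simp add: SET_comp_fn[OF h(1) z] x kc)
    finally show ?thesis using x by blast
  qed
  moreover have "fn q x = fn q y \<longleftrightarrow> R x y" if "x \<in> B" "y \<in> B" for x y
    using hq[OF that(1)] hq[OF that(2)] cc[of x y] inv[OF qh quv', of x y] by auto
  ultimately show "q \<in> hom SET B (tgt q) \<and> fn q ` B = tgt q \<and> (\<forall>x \<in> B. \<forall>y \<in> B. fn q x = fn q y \<longleftrightarrow> R x y)"
    using qh SET_hom(5)[OF qh] by blast
qed

text \<open>The kernel of the projection to the connected components.\<close>

definition conn :: "'u cset => 'u => 'u => bool" where
  "conn X = equivclp (\<lambda>x y. \<exists>w \<in> fobj X 1. x = rs (cs X) end0 w \<and> y = rs (cs X) end1 w)"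

context universe
begin

lemma comp_proj:
  assumes X: "X \<in> Obj cS"
  shows "is_coequalizer SET (farr X end0) (farr X end1) (comp_proj X)"
    and "comp_proj X \<in> hom SET (fobj X 0) (pi0 X)"
    and "fn (comp_proj X) ` fobj X 0 = pi0 X"
    and "x \<in> fobj X 0 ==> y \<in> fobj X 0 ==> fn (comp_proj X) x = fn (comp_proj X) y \<longleftrightarrow> conn X x y"
proof -
  note C = SET_coequalizer[OF farr_hom[OF X end0_cub] farr_hom[OF X end1_cub]]
  show q: "is_coequalizer SET (farr X end0) (farr X end1) (comp_proj X)"
    unfolding comp_proj_def coeq_def using someI_ex[OF C(1)] .
  note D = C(2)[OF q]
  show "comp_proj X \<in> hom SET (fobj X 0) (pi0 X)" "fn (comp_proj X) ` fobj X 0 = pi0 X"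
    using D by (simp_all add: pi0_def)
  show "fn (comp_proj X) x = fn (comp_proj X) y \<longleftrightarrow> conn X x y" if "x \<in> fobj X 0" "y \<in> fobj X 0"
    using D that by (simp add: conn_def rs_cs)
qed

lemma pi0_map:
  assumes f: "f \<in> hom cS X Y"
  shows "pi0_map f \<in> hom SET (pi0 X) (pi0 Y)"
    and "x \<in> fobj X 0 ==> fn (pi0_map f) (fn (comp_proj X) x) = fn (comp_proj Y) (ap f 0 x)"
proof -
  note X = hom_Obj(1)[OF f] and Y = hom_Obj(2)[OF f]
  note P = comp_proj[OF X] and Q = comp_proj[OF Y]
  note u = farr_hom[OF X end0_cub] and v = farr_hom[OF X end1_cub]
  have f0: "fn f 0 \<in> hom SET (fobj X 0) (fobj Y 0)" using f by (auto simp: hom_cSet_iff)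
  note r = SET_comp_hom[OF f0 Q(2)]
  have fap: "fn (fn f 0) = ap f 0" by (simp add: ap_def fun_eq_iff)
  have rs0: "fn (farr X a) w \<in> fobj X 0" "fn (fn f 0) (fn (farr X a) w) = rs (cs Y) a (ap f 1 w)"
    if "a \<in> cub 0 1" "w \<in> fobj X 1" for a w
    using ap_rs[OF f that] rs_el[OF psh_cs[OF X] that(1), of w] that(2) unfolding fap by (simp_all add: rs_cs)
  have "comp_proj Y \<cdot>\<^bsub>SET\<^esub> fn f 0 \<cdot>\<^bsub>SET\<^esub> farr X end0 = comp_proj Y \<cdot>\<^bsub>SET\<^esub> fn f 0 \<cdot>\<^bsub>SET\<^esub> farr X end1"
  proof (rule SET_ext[OF SET_comp_hom[OF u r] SET_comp_hom[OF v r]])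
    fix w assume w: "w \<in> fobj X 1"
    note fw = ap_el[OF f w]
    have "conn Y (rs (cs Y) end0 (ap f 1 w)) (rs (cs Y) end1 (ap f 1 w))"
      unfolding conn_def using fw by (intro r_into_equivclp) blast
    then show "fn (comp_proj Y \<cdot>\<^bsub>SET\<^esub> fn f 0 \<cdot>\<^bsub>SET\<^esub> farr X end0) w = fn (comp_proj Y \<cdot>\<^bsub>SET\<^esub> fn f 0 \<cdot>\<^bsub>SET\<^esub> farr X end1) w"
      using rs_el[OF psh_cs[OF Y] end0_cub] rs_el[OF psh_cs[OF Y] end1_cub] fw
      by (simp add: SET_comp_fn[OF u w] SET_comp_fn[OF v w] SET_comp_fn[OF f0] rs0[OF end0_cub w] rs0[OF end1_cub w] Q(4))
  qed
  then have "\<exists>!h. h \<in> hom SET (pi0 X) (pi0 Y) \<and> h \<cdot>\<^bsub>SET\<^esub> comp_proj X = comp_proj Y \<cdot>\<^bsub>SET\<^esub> fn f 0"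
    using P(1) r unfolding is_coequalizer_def pi0_def[of X] by (auto simp: SET_hom(2)[OF u])
  from theI'[OF this] have h: "pi0_map f \<in> hom SET (pi0 X) (pi0 Y)" "pi0_map f \<cdot>\<^bsub>SET\<^esub> comp_proj X = comp_proj Y \<cdot>\<^bsub>SET\<^esub> fn f 0"
    by (simp_all add: pi0_map_def hom_src[OF f] hom_tgt[OF f])
  show "pi0_map f \<in> hom SET (pi0 X) (pi0 Y)" by (rule h(1))
  show "fn (pi0_map f) (fn (comp_proj X) x) = fn (comp_proj Y) (ap f 0 x)" if x: "x \<in> fobj X 0"
    using SET_comp_fn[OF P(2) x, of "pi0_map f"] SET_comp_fn[OF f0 x, of "comp_proj Y"] h(2) fap by simp
qed

lemma bijective_on_components_iff:
  assumes f: "f \<in> hom cS X Y"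
  shows "bijective_on_components f \<longleftrightarrow> (\<forall>y \<in> fobj Y 0. \<exists>x \<in> fobj X 0. conn Y (ap f 0 x) y) \<and>
    (\<forall>x \<in> fobj X 0. \<forall>x' \<in> fobj X 0. conn Y (ap f 0 x) (ap f 0 x') \<longrightarrow> conn X x x')"
proof -
  note X = hom_Obj(1)[OF f] and Y = hom_Obj(2)[OF f]
  note P = comp_proj[OF X] and Q = comp_proj[OF Y] and h = pi0_map[OF f] and el = ap_el[OF f]
  have "fn (pi0_map f) ` pi0 X = pi0 Y \<longleftrightarrow> (\<forall>y \<in> fobj Y 0. \<exists>x \<in> fobj X 0. conn Y (ap f 0 x) y)"
  proof -
    have "fn (pi0_map f) ` pi0 X \<subseteq> pi0 Y" using SET_hom(5)[OF h(1)] by blast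
    moreover have "fn (pi0_map f) ` pi0 X = (\<lambda>x. fn (comp_proj Y) (ap f 0 x)) ` fobj X 0"
      unfolding P(3)[symmetric] image_image using h(2) by simp
    moreover have "(\<exists>x \<in> fobj X 0. conn Y (ap f 0 x) y) \<longleftrightarrow> fn (comp_proj Y) y \<in> (\<lambda>x. fn (comp_proj Y) (ap f 0 x)) ` fobj X 0"
      if "y \<in> fobj Y 0" for y
      using Q(4)[OF el that] by (auto simp: image_iff) metis+
    ultimately show ?thesis unfolding Q(3)[symmetric] by auto
  qed
  moreover have "inj_on (fn (pi0_map f)) (pi0 X) \<longleftrightarrow>
    (\<forall>x \<in> fobj X 0. \<forall>x' \<in> fobj X 0. conn Y (ap f 0 x) (ap f 0 x') \<longrightarrow> conn X x x')"
    unfolding P(3)[symmetric] inj_on_def ball_simps using P(4) Q(4)[OF el el] h(2) by auto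
  ultimately show ?thesis
    unfolding bijective_on_components_def bij_betw_def by (simp add: hom_src[OF f] hom_tgt[OF f] conj_commute)
qed


section \<open>Points of function spaces\<close>

text \<open>The map \<open>Y \<rightarrow> K\<close> that corresponds to a vertex of
  \<open>K\<^sup>Y\<close>.\<close>

definition adj :: "'u cset => 'u cset => 'u => 'u cmap" where
  "adj Y K k = mp Y K (\<lambda>n y. evl Y K n (rs (cs (exp_obj cS Y K)) (bang n) k) y)"

context
  fixes Y K :: "'u cset"
  assumes Y: "Y \<in> Obj cS" and K: "K \<in> Obj cS"
begin

abbreviation E where "E \<equiv> exp_obj cS Y K"

lemma psh_E: "psh (cs E)"
  by (rule psh_cs[OF exp_Obj[OF Y K]])

lemma bang_comp: "a \<in> cub m n ==> bang n \<odot> a = bang m"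
  by (rule cub_0[OF comp_cub[OF _ bang_cub]])

lemma ap_adj: "y \<in> fobj Y n ==> ap (adj Y K k) n y = evl Y K n (rs (cs E) (bang n) k) y"
  by (simp add: adj_def)

lemma adj_hom:
  assumes k: "k \<in> fobj E 0"
  shows "adj Y K k \<in> hom cS Y K"
  unfolding adj_def
proof (rule mp_hom[OF Y K natmI])
  have kn: "rs (cs E) (bang n) k \<in> fobj E n" for n using rs_el[OF psh_E bang_cub] k by simp
  show "evl Y K n (rs (cs E) (bang n) k) y \<in> el (cs K) n" if "y \<in> el (cs Y) n" for n y
    using evl_el[OF Y K kn] that by simp
  show "evl Y K m (rs (cs E) (bang m) k) (rs (cs Y) a y) = rs (cs K) a (evl Y K n (rs (cs E) (bang n) k) y)"
    if a: "a \<in> cub m n" and "y \<in> el (cs Y) n" for m n a y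
    using evl_rs[OF Y K a kn, of y] rs_comp[OF psh_E a bang_cub, of k] that k by (simp add: bang_comp[OF a])
qed

lemma adj_inj:
  assumes k: "k \<in> fobj E 0" and k': "k' \<in> fobj E 0" and e: "adj Y K k = adj Y K k'"
  shows "k = k'"
proof (rule evl_eqI[OF Y K k k'])
  fix m a x assume "a \<in> cub m 0" and x: "x \<in> fobj Y m"
  then have "a = bang m" by (intro cub_0)
  then show "evl Y K m (rs (cs E) a k) x = evl Y K m (rs (cs E) a k') x"
    using ap_adj[OF x, of k] ap_adj[OF x, of k'] e by simp
qed

lemma adj_surj:
  assumes a: "a \<in> hom cS Y K"
  shows "\<exists>k \<in> fobj E 0. adj Y K k = a"
proof -
  have "natm (yo 0 \<otimes> cs Y) (cs K) (\<lambda>n w. ap a n (snd w))"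
    using ap_natm[OF a] by (auto simp: natm_def)
  from exp_transpose[OF Y K tinyp_yo this] obtain h where h: "natm (yo 0) (cs E) h"
    and eh: "\<And>n z x. z \<in> cub n 0 ==> x \<in> fobj Y n ==> evl Y K n (h n z) x = ap a n x" by auto
  let ?k = "h 0 (cid 0)"
  have k: "?k \<in> fobj E 0" using natm_el[OF h, of "cid 0" 0] by simp
  have "rs (cs E) (bang n) ?k = h n (bang n)" for n
    using natm_rs[OF h bang_cub, of "cid 0" n] by (simp add: cub_idl[OF bang_cub])
  then have "adj Y K ?k = a" by (intro hom_ext[OF adj_hom[OF k] a]) (simp add: ap_adj eh[OF bang_cub])
  then show ?thesis using k by blast
qed

text \<open>The edges of \<open>K\<^sup>Y\<close> transpose to the homotopies between maps \<open>Y \<rightarrow> K\<close>.\<close>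

lemma edge_htp:
  assumes w: "w \<in> fobj E 1"
  shows "htp Y K (adj Y K (rs (cs E) end0 w)) (adj Y K (rs (cs E) end1 w))"
  unfolding htp_def
proof (intro conjI exI[of _ "\<lambda>n (y, t). evl Y K n (rs (cs E) t w) y"] allI ballI)
  show "adj Y K (rs (cs E) end0 w) \<in> hom cS Y K" "adj Y K (rs (cs E) end1 w) \<in> hom cS Y K"
    using rs_el[OF psh_E end0_cub, of w] rs_el[OF psh_E end1_cub, of w] w by (simp_all add: adj_hom)
  have we: "rs (cs E) t w \<in> fobj E n" if "t \<in> cub n 1" for n t using rs_el[OF psh_E that] w by simp
  show "natm (cs Y \<otimes> Ip) (cs K) (\<lambda>n (y, t). evl Y K n (rs (cs E) t w) y)"
    unfolding case_prod_beta
  proof (rule natm_prodI)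
    show "evl Y K n (rs (cs E) t w) y \<in> el (cs K) n" if "y \<in> el (cs Y) n" "t \<in> cub n 1" for n y t
      using evl_el[OF Y K we[OF that(2)]] that(1) by simp
    show "evl Y K m (rs (cs E) (t \<odot> a) w) (rs (cs Y) a y) = rs (cs K) a (evl Y K n (rs (cs E) t w) y)"
      if "a \<in> cub m n" "y \<in> el (cs Y) n" "t \<in> cub n 1" for m n a y t
      using evl_rs[OF Y K that(1) we[OF that(3)], of y] rs_comp[OF psh_E that(1,3), of w] w that(2) by simp
  qed
  fix n y assume y: "y \<in> fobj Y n"
  show "(case (y, e0 n) of (y, t) => evl Y K n (rs (cs E) t w) y) = ap (adj Y K (rs (cs E) end0 w)) n y"
    using rs_comp[OF psh_E bang_cub end0_cub, of w n] w by (simp add: ap_adj[OF y] e0_def)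
  show "(case (y, e1 n) of (y, t) => evl Y K n (rs (cs E) t w) y) = ap (adj Y K (rs (cs E) end1 w)) n y"
    using rs_comp[OF psh_E bang_cub end1_cub, of w n] w by (simp add: ap_adj[OF y] e1_def)
qed

lemma htp_edge:
  assumes k: "k \<in> fobj E 0" and k': "k' \<in> fobj E 0" and "htp Y K (adj Y K k) (adj Y K k')"
  shows "\<exists>w \<in> fobj E 1. k = rs (cs E) end0 w \<and> k' = rs (cs E) end1 w"
proof -
  obtain H where H: "natm (cs Y \<otimes> Ip) (cs K) H"
    and H0: "\<And>n y. y \<in> fobj Y n ==> H n (y, e0 n) = ap (adj Y K k) n y"
    and H1: "\<And>n y. y \<in> fobj Y n ==> H n (y, e1 n) = ap (adj Y K k') n y"
    using assms(3) by (auto simp: htp_def)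
  have "natm (Ip \<otimes> cs Y) (cs Y \<otimes> Ip) (\<lambda>n w. (snd w, fst w))" by (auto simp: natm_def)
  from exp_transpose[OF Y K tinyp_yo natm_comp[OF this H]] obtain h where h: "natm Ip (cs E) h"
    and eh: "\<And>n t y. t \<in> cub n 1 ==> y \<in> fobj Y n ==> evl Y K n (h n t) y = H n (y, t)" by auto
  let ?w = "h 1 (cid 1)"
  have w: "?w \<in> fobj E 1" using natm_el[OF h, of "cid 1" 1] by simp
  have rw: "rs (cs E) t ?w = h n t" if "t \<in> cub n 1" for n t
    using natm_rs[OF h that, of "cid 1"] by (simp add: cub_idl[OF that])
  have hn: "rs (cs E) (bang n) (h 0 t) = h n (t \<odot> bang n)" if "t \<in> cub 0 1" for n t
    using natm_rs[OF h bang_cub, of t n] that by simp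
  have h0: "h 0 t \<in> fobj E 0" if "t \<in> cub 0 1" for t using natm_el[OF h, of t 0] that by simp
  have "adj Y K k = adj Y K (h 0 end0)"
    by (rule hom_ext[OF adj_hom[OF k] adj_hom[OF h0[OF end0_cub]]])
      (simp add: H0[symmetric] ap_adj[of _ _ "h 0 end0"] hn[OF end0_cub] e0_def[symmetric] eh)
  moreover have "adj Y K k' = adj Y K (h 0 end1)"
    by (rule hom_ext[OF adj_hom[OF k'] adj_hom[OF h0[OF end1_cub]]])
      (simp add: H1[symmetric] ap_adj[of _ _ "h 0 end1"] hn[OF end1_cub] e1_def[symmetric] eh)
  ultimately show ?thesis
    using adj_inj[OF k h0[OF end0_cub]] adj_inj[OF k' h0[OF end1_cub]] w rw[OF end0_cub] rw[OF end1_cub]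
    by (intro bexI[OF _ w]) simp
qed

lemma conn_iff_heq:
  assumes k: "k \<in> fobj E 0" and k': "k' \<in> fobj E 0"
  shows "conn E k k' \<longleftrightarrow> heq Y K (adj Y K k) (adj Y K k')"
proof
  show "heq Y K (adj Y K k) (adj Y K k')" if c: "conn E k k'"
    using c[unfolded conn_def]
  proof (rule equivclp_map)
    fix k k' assume "\<exists>w \<in> fobj E 1. k = rs (cs E) end0 w \<and> k' = rs (cs E) end1 w"
    then show "heq Y K (adj Y K k) (adj Y K k')" using edge_htp by (auto intro: r_into_equivclp)
  qed
  define g where "g a = (SOME k. k \<in> fobj E 0 \<and> adj Y K k = a)" for a
  have g: "g a \<in> fobj E 0 \<and> adj Y K (g a) = a" if "a \<in> hom cS Y K" for a
  proof -
    have "\<exists>k. k \<in> fobj E 0 \<and> adj Y K k = a" using adj_surj[OF that] by blast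
    from someI_ex[OF this] show ?thesis unfolding g_def .
  qed
  have gk: "g (adj Y K k) = k" if "k \<in> fobj E 0" for k
    using g[OF adj_hom[OF that]] adj_inj that by blast
  show "conn E k k'" if h: "heq Y K (adj Y K k) (adj Y K k')"
  proof -
    have "conn E (g (adj Y K k)) (g (adj Y K k'))"
      using h unfolding conn_def
    proof (rule equivclp_map)
      fix a b assume ab: "htp Y K a b"
      note gh = g[OF htp_hom(1)[OF ab]] g[OF htp_hom(2)[OF ab]]
      show "equivclp (\<lambda>x y. \<exists>w \<in> fobj E 1. x = rs (cs E) end0 w \<and> y = rs (cs E) end1 w) (g a) (g b)"
        using htp_edge[of "g a" "g b"] gh ab by (intro r_into_equivclp) simp
    qed
    then show ?thesis by (simp add: gk k k')
  qed
qed

lemma exp_pre: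
  assumes f: "f \<in> hom cS X Y"
  shows "exp_pre cS K f \<in> hom cS E (exp_obj cS X K)"
    and "k \<in> fobj E n ==> x \<in> fobj X n ==> evl X K n (ap (exp_pre cS K f) n k) x = evl Y K n k (ap f n x)"
proof -
  note X = hom_Obj(1)[OF f] and EO = exp_Obj[OF Y K]
  note m = prod_map_hom[OF id_hom'[OF EO] f]
  note c = comp_hom[OF m(1) evalc_hom[OF Y K]]
  have e: "exp_pre cS K f = curryc cS E X (evalc cS Y K \<bullet> prod_map cS (Idn cS E) f)"
    by (simp add: exp_pre_def hom_src[OF f] hom_tgt[OF f])
  note cc = curryc[OF X K c EO]
  show "exp_pre cS K f \<in> hom cS E (exp_obj cS X K)" unfolding e by (rule cc(1))
  show "evl X K n (ap (exp_pre cS K f) n k) x = evl Y K n k (ap f n x)" if "k \<in> fobj E n" "x \<in> fobj X n"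
    unfolding e cc(2)[OF that] using prod_elements(1)[OF EO X that] that
    by (simp add: ap_comp[OF m(1)] m(2) EO evl_def)
qed

end

lemma adj_exp_pre:
  assumes f: "f \<in> hom cS X Y" and K: "K \<in> Obj cS" and k: "k \<in> fobj (exp_obj cS Y K) 0"
  shows "adj X K (ap (exp_pre cS K f) 0 k) = adj Y K k \<bullet> f"
proof -
  note X = hom_Obj(1)[OF f] and Y = hom_Obj(2)[OF f]
  note P = exp_pre[OF Y K f]
  show ?thesis
  proof (rule hom_ext[OF adj_hom[OF X K ap_el[OF P(1) k]] comp_hom[OF f adj_hom[OF Y K k]]])
    fix n x assume x: "x \<in> fobj X n"
    have kn: "rs (cs (exp_obj cS Y K)) (bang n) k \<in> fobj (exp_obj cS Y K) n"
      using rs_el[OF psh_E[OF Y K] bang_cub] k by simp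
    show "ap (adj X K (ap (exp_pre cS K f) 0 k)) n x = ap (adj Y K k \<bullet> f) n x"
      using P(2)[OF kn x] ap_rs[OF P(1) bang_cub k, of n]
      by (simp add: ap_adj[OF X K x] ap_comp[OF f x] ap_adj[OF Y K ap_el[OF f x]])
  qed
qed

end

context cubical_cofibrations
begin

lemma weak_homotopy_equivalence_iff:
  assumes f: "f \<in> hom cS X Y"
  shows "f \<in> weak_homotopy_equivalences \<C> \<longleftrightarrow> whe X Y f"
proof -
  note X = hom_Obj(1)[OF f] and Y = hom_Obj(2)[OF f]
  have "bijective_on_components (exp_pre cS K f) \<longleftrightarrow> (\<forall>a \<in> hom cS X K. \<exists>b \<in> hom cS Y K. heq X K (b \<bullet> f) a) \<and>
    (\<forall>b \<in> hom cS Y K. \<forall>b' \<in> hom cS Y K. heq X K (b \<bullet> f) (b' \<bullet> f) \<longrightarrow> heq Y K b b')"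
    if "fibrant \<C> K" for K
  proof -
    have K: "K \<in> Obj cS" using \<open>fibrant \<C> K\<close> by (simp add: fibrant_def)
    note p = exp_pre(1)[OF Y K f]
    have hY: "hom cS Y K = adj Y K ` fobj (exp_obj cS Y K) 0" and hX: "hom cS X K = adj X K ` fobj (exp_obj cS X K) 0"
      using adj_hom[OF Y K] adj_surj[OF Y K] adj_hom[OF X K] adj_surj[OF X K] by blast+
    show ?thesis
      unfolding bijective_on_components_iff[OF p] hX hY ball_simps bex_simps
      by (simp add: conn_iff_heq[OF X K] conn_iff_heq[OF Y K] ap_el[OF p] adj_exp_pre[OF f K])
  qed
  then show ?thesis using f hom_Arr[OF f] by (auto simp: weak_homotopy_equivalences_def whe_def)
qed

end


section \<open>Limits and colimits of cubical sets\<close>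

lemma hom_op: "hom (op_cat C) A B = hom C B A"
  by (auto simp: hom_def)

context universe
begin

text \<open>At each stage, the limit is the set of compatible families.\<close>

lemma cSet_has_limits:
  fixes J :: "('u, 'u) cat"
  assumes J: "small_cat J"
  shows "has_limits J cS"
  unfolding has_limits_def
proof (intro allI impI)
  fix D assume D: "is_functor J cS D"
  have X: "fobj D i \<in> Obj cS" if "i \<in> Obj J" for i using D that by (simp add: is_functor_def)
  have du: "farr D u \<in> hom cS (fobj D (Dom J u)) (fobj D (Cod J u))" "Dom J u \<in> Obj J" "Cod J u \<in> Obj J"
    if "u \<in> Arr J" for u
    using D J that by (auto simp: is_functor_def small_cat_def category_def)
  define P where "P = Psh (\<lambda>n. {\<phi> \<in> (\<Pi>\<^sub>E i\<in>Obj J. fobj (fobj D i) n).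
    \<forall>u \<in> Arr J. ap (farr D u) n (\<phi> (Dom J u)) = \<phi> (Cod J u)}) (\<lambda>a \<phi>. \<lambda>i\<in>Obj J. rs (cs (fobj D i)) a (\<phi> i))"
  have elP: "\<phi> \<in> el P n \<longleftrightarrow> \<phi> \<in> (\<Pi>\<^sub>E i\<in>Obj J. fobj (fobj D i) n) \<and>
    (\<forall>u \<in> Arr J. ap (farr D u) n (\<phi> (Dom J u)) = \<phi> (Cod J u))" for \<phi> n by (simp add: P_def)
  have rsP: "rs P a \<phi> = (\<lambda>i\<in>Obj J. rs (cs (fobj D i)) a (\<phi> i))" for a \<phi> by (simp add: P_def)
  have Pel: "\<phi> i \<in> fobj (fobj D i) n" if "\<phi> \<in> el P n" "i \<in> Obj J" for \<phi> i n using that by (auto simp: elP)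
  have Pext: "\<phi> = \<psi>" if "\<phi> \<in> el P n" "\<psi> \<in> el P n" "\<And>i. i \<in> Obj J ==> \<phi> i = \<psi> i" for \<phi> \<psi> n
    using that by (auto simp: elP intro: PiE_ext)
  have PI: "(\<lambda>i\<in>Obj J. f i) \<in> el P n"
    if "\<And>i. i \<in> Obj J ==> f i \<in> fobj (fobj D i) n" "\<And>u. u \<in> Arr J ==> ap (farr D u) n (f (Dom J u)) = f (Cod J u)"
    for f n using that du by (simp add: elP)
  have Prs: "rs P a \<phi> \<in> el P m" if a: "a \<in> cub m n" and \<phi>: "\<phi> \<in> el P n" for m n a \<phi>
    unfolding rsP
  proof (rule PI)
    show "rs (cs (fobj D i)) a (\<phi> i) \<in> fobj (fobj D i) m" if "i \<in> Obj J" for i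
      using rs_el[OF psh_cs[OF X[OF that]] a] Pel[OF \<phi> that] by simp
    show "ap (farr D u) m (rs (cs (fobj D (Dom J u))) a (\<phi> (Dom J u))) = rs (cs (fobj D (Cod J u))) a (\<phi> (Cod J u))"
      if "u \<in> Arr J" for u
      using ap_rs[OF du(1)[OF that] a Pel[OF \<phi> du(2)[OF that]]] \<phi> that by (simp add: elP)
  qed
  have "psh P"
  proof (rule pshI[OF Prs])
    fix n \<phi> assume \<phi>: "\<phi> \<in> el P n"
    show "rs P (cid n) \<phi> = \<phi>"
      by (rule Pext[OF Prs[OF cid_cub \<phi>] \<phi>]) (use rs_id[OF psh_cs[OF X]] Pel[OF \<phi>] in \<open>simp add: rsP\<close>)
    fix l m a b assume ab: "a \<in> cub l m" "b \<in> cub m n"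
    show "rs P (b \<odot> a) \<phi> = rs P a (rs P b \<phi>)"
      by (rule Pext[OF Prs[OF comp_cub[OF ab] \<phi>] Prs[OF ab(1) Prs[OF ab(2) \<phi>]]])
        (use rs_comp[OF psh_cs[OF X] ab] Pel[OF \<phi>] in \<open>simp add: rsP\<close>)
  qed
  moreover have "tiny (el P n)" for n
  proof (rule tiny_functions)
    show "tiny (Obj J)" using J by (simp add: small_cat_def small_iff_tiny)
    then show "tiny (\<Union>i\<in>Obj J. fobj (fobj D i) n)"
      by (rule tiny_UN) (use tinyp_el[OF tinyp_cs[OF X]] in simp)
    show "\<phi> i \<in> (\<Union>i\<in>Obj J. fobj (fobj D i) n)" if "\<phi> \<in> el P n" "i \<in> Obj J" for \<phi> i using Pel[OF that] that(2) by blast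
  qed (rule Pext)
  ultimately have "tinyp P" by (simp add: tinyp_def)
  then obtain L e d where L: "L \<in> Obj cS" and iso: "natiso P (cs L) e d" using cset_coding by blast
  have e: "natm P (cs L) e" and d: "natm (cs L) P d" and de: "\<And>n z. z \<in> el P n ==> d n (e n z) = z"
    and ed: "\<And>n z. z \<in> fobj L n ==> e n (d n z) = z"
    using iso unfolding natiso_def by simp_all
  have dP: "d n w \<in> el P n" if "w \<in> fobj L n" for n w using natm_el[OF d] that by simp
  let ?p = "\<lambda>i. mp L (fobj D i) (\<lambda>n w. d n w i)"
  have p: "?p i \<in> hom cS L (fobj D i)" if i: "i \<in> Obj J" for i
  proof (rule mp_hom[OF L X[OF i] natmI])
    show "d n w i \<in> el (cs (fobj D i)) n" if "w \<in> el (cs L) n" for n w using Pel[OF dP i] that by simp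
    show "d m (rs (cs L) a w) i = rs (cs (fobj D i)) a (d n w i)" if "a \<in> cub m n" "w \<in> el (cs L) n" for m n a w
      using natm_rs[OF d that] i by (simp add: rsP)
  qed
  have "is_limit J cS D L ?p"
    unfolding is_limit_def
  proof (intro conjI allI impI)
    show "is_cone J cS D L ?p"
      unfolding is_cone_def
    proof (intro conjI ballI L p)
      fix u assume u: "u \<in> Arr J"
      note pu = p[OF du(2)[OF u]]
      show "farr D u \<bullet> ?p (Dom J u) = ?p (Cod J u)"
        by (rule hom_ext[OF comp_hom[OF pu du(1)[OF u]] p[OF du(3)[OF u]]])
          (use dP u in \<open>simp add: ap_comp[OF pu] elP\<close>)
    qed
    fix M q assume c: "is_cone J cS D M q"
    then have M: "M \<in> Obj cS" and q: "\<And>i. i \<in> Obj J ==> q i \<in> hom cS M (fobj D i)"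
      and qu: "\<And>u. u \<in> Arr J ==> farr D u \<bullet> q (Dom J u) = q (Cod J u)"
      by (simp_all add: is_cone_def)
    let ?f = "\<lambda>n z. \<lambda>i\<in>Obj J. ap (q i) n z"
    have fP: "?f n z \<in> el P n" if z: "z \<in> fobj M n" for n z
    proof (rule PI)
      show "ap (q i) n z \<in> fobj (fobj D i) n" if "i \<in> Obj J" for i by (rule ap_el[OF q[OF that] z])
      show "ap (farr D u) n (ap (q (Dom J u)) n z) = ap (q (Cod J u)) n z" if "u \<in> Arr J" for u
        using ap_comp[OF q[OF du(2)[OF that]] z, of "farr D u"] qu[OF that] by simp
    qed
    have f: "natm (cs M) P ?f"
    proof (rule natmI)
      show "?f n z \<in> el P n" if "z \<in> el (cs M) n" for n z using fP that by simp
      show "?f m (rs (cs M) a z) = rs P a (?f n z)" if "a \<in> cub m n" "z \<in> el (cs M) n" for m n a z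
        using ap_rs[OF q that(1)] that(2) by (simp add: rsP cong: restrict_cong)
    qed
    note h = mp_hom[OF M L natm_comp[OF f e]]
    show "\<exists>!h. h \<in> hom cS M L \<and> (\<forall>i \<in> Obj J. ?p i \<bullet> h = q i)"
    proof (intro ex1I conjI ballI)
      show "mp M L (\<lambda>n z. e n (?f n z)) \<in> hom cS M L" by (rule h)
      show "?p i \<bullet> mp M L (\<lambda>n z. e n (?f n z)) = q i" if i: "i \<in> Obj J" for i
        by (rule hom_ext[OF comp_hom[OF h p[OF i]] q[OF i]])
          (use natm_el[OF e fP] de[OF fP] i in \<open>simp add: ap_comp[OF h]\<close>)
      fix k assume "k \<in> hom cS M L \<and> (\<forall>i \<in> Obj J. ?p i \<bullet> k = q i)"
      then have k: "k \<in> hom cS M L" and pk: "\<And>i. i \<in> Obj J ==> ?p i \<bullet> k = q i" by simp_all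
      show "k = mp M L (\<lambda>n z. e n (?f n z))"
      proof (rule hom_ext[OF k h])
        fix n z assume z: "z \<in> fobj M n"
        note kz = ap_el[OF k z]
        have "d n (ap k n z) = ?f n z"
        proof (rule Pext[OF dP[OF kz] fP[OF z]])
          show "d n (ap k n z) i = ?f n z i" if i: "i \<in> Obj J" for i
            using ap_comp[OF k z, of "?p i"] pk[OF i] kz i by simp
        qed
        then show "ap k n z = ap (mp M L (\<lambda>n z. e n (?f n z))) n z" using ed[OF kz] z by simp
      qed
    qed
  qed
  then show "\<exists>L p. is_limit J cS D L p" by blast
qed

text \<open>At each stage, the colimit is the disjoint union modulo the equivalence generated by the
  arrows of the diagram.\<close>

lemma cSet_has_colimits:
  fixes J :: "('u, 'u) cat"
  assumes J: "small_cat J"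
  shows "has_limits (op_cat J) (op_cat cS)"
  unfolding has_limits_def
proof (intro allI impI)
  fix D assume D: "is_functor (op_cat J) (op_cat cS) D"
  have X: "fobj D i \<in> Obj cS" if "i \<in> Obj J" for i using D that by (simp add: is_functor_def)
  have du: "farr D u \<in> hom cS (fobj D (Dom J u)) (fobj D (Cod J u))" "Dom J u \<in> Obj J" "Cod J u \<in> Obj J"
    if "u \<in> Arr J" for u
    using D J that by (auto simp: is_functor_def small_cat_def category_def hom_op)
  define S where "S n = Sigma (Obj J) (\<lambda>i. fobj (fobj D i) n)" for n
  define r where "r n s t \<longleftrightarrow> (\<exists>u \<in> Arr J. fst s = Dom J u \<and> t = (Cod J u, ap (farr D u) n (snd s)) \<and> s \<in> S n \<and> t \<in> S n)" for n s t
  have rS: "s \<in> S n \<and> t \<in> S n" if "r n s t" for n s t using that by (auto simp: r_def)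
  have rep_S: "rep (r n) s \<in> S n" if "s \<in> S n" for n s
    using equivclp_invariant[OF equivclp_rep, of "r n" "\<lambda>s. s \<in> S n" s] rS that by blast
  define act where "act a s = (fst s, rs (cs (fobj D (fst s))) a (snd s))" for a and s :: "'u \<times> 'u"
  have actS: "act a s \<in> S m" if "a \<in> cub m n" "s \<in> S n" for m n a s
    using rs_el[OF psh_cs[OF X] that(1)] that(2) by (auto simp: act_def S_def)
  have actr: "r m (act a s) (act a t)" if a: "a \<in> cub m n" and st: "r n s t" for m n a s t
  proof -
    obtain u where u: "u \<in> Arr J" "fst s = Dom J u" "t = (Cod J u, ap (farr D u) n (snd s))" "s \<in> S n" "t \<in> S n"
      using st by (auto simp: r_def)
    have "snd s \<in> fobj (fobj D (Dom J u)) n" using u(2,4) by (auto simp: S_def)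
    then show ?thesis
      unfolding r_def using u(1,2) actS[OF a u(4)] actS[OF a u(5)] ap_rs[OF du(1)[OF u(1)] a]
      by (intro bexI[OF _ u(1)]) (simp add: act_def u(3))
  qed
  have act_rep: "rep (r m) (act a (rep (r n) s)) = rep (r m) (act a s)" if a: "a \<in> cub m n" for m n a s
  proof -
    have "equivclp (r m) (act a s) (act a (rep (r n) s))"
      by (rule equivclp_map[OF equivclp_rep]) (intro r_into_equivclp actr[OF a])
    then show ?thesis using rep_eq_iff[of "r m"] by metis
  qed
  define P where "P = Psh (\<lambda>n. rep (r n) ` S n) (\<lambda>a s. rep (r (Dom Cube a)) (act a s))"
  have elP: "el P n = rep (r n) ` S n" for n by (simp add: P_def)
  have rsP: "rs P a s = rep (r m) (act a s)" if "a \<in> cub m n" for m n a s using that by (simp add: P_def cub_Dom)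
  have repP: "rep (r n) s \<in> el P n" if "s \<in> S n" for n s using that by (simp add: elP)
  have "psh P"
  proof (rule pshI)
    show "rs P a z \<in> el P m" if "a \<in> cub m n" "z \<in> el P n" for m n a z
      using that actS[OF that(1) rep_S] unfolding rsP[OF that(1)] by (auto simp: elP)
    fix n z assume "z \<in> el P n"
    then obtain s where s: "s \<in> S n" "z = rep (r n) s" by (auto simp: elP)
    have "act (cid n) s = s" using s(1) rs_id[OF psh_cs[OF X]] by (auto simp: act_def S_def)
    then show "rs P (cid n) z = z" by (simp add: rsP[OF cid_cub] s(2) act_rep[OF cid_cub])
    fix l m a b assume ab: "a \<in> cub l m" "b \<in> cub m n"
    have "act (b \<odot> a) s = act a (act b s)" using s(1) rs_comp[OF psh_cs[OF X] ab] by (auto simp: act_def S_def)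
    then show "rs P (b \<odot> a) z = rs P a (rs P b z)"
      by (simp add: rsP[OF comp_cub[OF ab]] rsP[OF ab(1)] rsP[OF ab(2)] s(2) act_rep[OF comp_cub[OF ab]] act_rep[OF ab(1)] act_rep[OF ab(2)])
  qed
  moreover have "tiny (el P n)" for n
  proof -
    have "tiny (Obj J)" using J by (simp add: small_cat_def small_iff_tiny)
    then have "tiny (S n)" unfolding S_def by (rule tiny_Sigma) (use tinyp_el[OF tinyp_cs[OF X]] in simp)
    then show ?thesis unfolding elP by (rule tiny_image)
  qed
  ultimately have "tinyp P" by (simp add: tinyp_def)
  then obtain L e d where L: "L \<in> Obj cS" and iso: "natiso P (cs L) e d" using cset_coding by blast
  have e: "natm P (cs L) e" and d: "natm (cs L) P d" and de: "\<And>n z. z \<in> el P n ==> d n (e n z) = z"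
    and ed: "\<And>n z. z \<in> fobj L n ==> e n (d n z) = z"
    using iso unfolding natiso_def by simp_all
  let ?p = "\<lambda>i. mp (fobj D i) L (\<lambda>n x. e n (rep (r n) (i, x)))"
  have pel: "e n (rep (r n) s) \<in> fobj L n" if "s \<in> S n" for n s using natm_el[OF e repP[OF that]] by simp
  have SI: "(i, x) \<in> S n" if "i \<in> Obj J" "x \<in> fobj (fobj D i) n" for i x n using that by (simp add: S_def)
  have p: "?p i \<in> hom cS (fobj D i) L" if i: "i \<in> Obj J" for i
  proof (rule mp_hom[OF X[OF i] L natmI])
    show "e n (rep (r n) (i, x)) \<in> el (cs L) n" if "x \<in> el (cs (fobj D i)) n" for n x
      using pel SI[OF i] that by simp
    show "e m (rep (r m) (i, rs (cs (fobj D i)) a x)) = rs (cs L) a (e n (rep (r n) (i, x)))"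
      if a: "a \<in> cub m n" and "x \<in> el (cs (fobj D i)) n" for m n a x
      using natm_rs[OF e a repP[OF SI[OF i]], of x] that(2) by (simp add: rsP[OF a] act_rep[OF a]) (simp add: act_def)
  qed
  have onto: "\<exists>i \<in> Obj J. \<exists>x \<in> fobj (fobj D i) n. w = ap (?p i) n x \<and> d n w = rep (r n) (i, x)" if w: "w \<in> fobj L n" for n w
  proof -
    have "d n w \<in> el P n" using natm_el[OF d] w by simp
    then obtain i x where "i \<in> Obj J" "x \<in> fobj (fobj D i) n" "d n w = rep (r n) (i, x)" by (auto simp: elP S_def)
    then show ?thesis using ed[OF w] by (intro bexI[of _ i] bexI[of _ x]) simp_all
  qed
  have "is_limit (op_cat J) (op_cat cS) D L ?p"
    unfolding is_limit_def
  proof (intro conjI allI impI)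
    show "is_cone (op_cat J) (op_cat cS) D L ?p"
      unfolding is_cone_def op_simps hom_op
    proof (intro conjI ballI L p)
      fix u assume u: "u \<in> Arr J"
      note pu = p[OF du(3)[OF u]]
      show "?p (Cod J u) \<bullet> farr D u = ?p (Dom J u)"
      proof (rule hom_ext[OF comp_hom[OF du(1)[OF u] pu] p[OF du(2)[OF u]]])
        fix n x assume x: "x \<in> fobj (fobj D (Dom J u)) n"
        note ux = ap_el[OF du(1)[OF u] x]
        have "r n (Dom J u, x) (Cod J u, ap (farr D u) n x)"
          unfolding r_def using u SI[OF du(2)[OF u] x] SI[OF du(3)[OF u] ux] by auto
        then have "rep (r n) (Dom J u, x) = rep (r n) (Cod J u, ap (farr D u) n x)"
          unfolding rep_eq_iff by (rule r_into_equivclp)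
        then show "ap (?p (Cod J u) \<bullet> farr D u) n x = ap (?p (Dom J u)) n x"
          using x ux by (simp add: ap_comp[OF du(1)[OF u] x])
      qed
    qed
    fix M q assume "is_cone (op_cat J) (op_cat cS) D M q"
    then have M: "M \<in> Obj cS" and q: "\<And>i. i \<in> Obj J ==> q i \<in> hom cS (fobj D i) M"
      and qu: "\<And>u. u \<in> Arr J ==> q (Cod J u) \<bullet> farr D u = q (Dom J u)"
      by (simp_all add: is_cone_def hom_op)
    define Q where "Q n s = ap (q (fst s)) n (snd s)" for n s
    have Qrep: "Q n (rep (r n) s) = Q n s" for n s
    proof (rule equivclp_invariant[OF equivclp_rep, symmetric])
      fix s t assume "r n s t"
      then obtain u where u: "u \<in> Arr J" "fst s = Dom J u" "t = (Cod J u, ap (farr D u) n (snd s))" "s \<in> S n"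
        by (auto simp: r_def)
      have "snd s \<in> fobj (fobj D (Dom J u)) n" using u(2,4) by (auto simp: S_def)
      from ap_comp[OF du(1)[OF u(1)] this, of "q (Cod J u)"] show "Q n s = Q n t"
        by (simp add: Q_def u(2,3) qu[OF u(1)])
    qed
    have QS: "Q n s \<in> fobj M n" if "s \<in> S n" for n s using ap_el[OF q] that by (auto simp: Q_def S_def)
    have nQ: "natm P (cs M) Q"
    proof (rule natmI)
      show "Q n z \<in> el (cs M) n" if "z \<in> el P n" for n z using that by (auto simp: elP Qrep QS)
      fix m n a z assume a: "a \<in> cub m n" and "z \<in> el P n"
      then obtain s where s: "s \<in> S n" "z = rep (r n) s" by (auto simp: elP)
      have "Q m (act a s) = rs (cs M) a (Q n s)" using ap_rs[OF q a] s(1) by (auto simp: Q_def act_def S_def)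
      then show "Q m (rs P a z) = rs (cs M) a (Q n z)"
        by (simp add: rsP[OF a] s(2) act_rep[OF a] Qrep)
    qed
    note h = mp_hom[OF L M natm_comp[OF d nQ]]
    show "\<exists>!h. h \<in> hom (op_cat cS) M L \<and> (\<forall>i \<in> Obj (op_cat J). ?p i \<cdot>\<^bsub>op_cat cS\<^esub> h = q i)"
      unfolding op_simps hom_op
    proof (intro ex1I conjI ballI)
      show "mp L M (\<lambda>n w. Q n (d n w)) \<in> hom cS L M" by (rule h)
      show "mp L M (\<lambda>n w. Q n (d n w)) \<bullet> ?p i = q i" if i: "i \<in> Obj J" for i
      proof (rule hom_ext[OF comp_hom[OF p[OF i] h] q[OF i]])
        fix n x assume x: "x \<in> fobj (fobj D i) n"
        show "ap (mp L M (\<lambda>n w. Q n (d n w)) \<bullet> ?p i) n x = ap (q i) n x"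
          using x by (simp add: ap_comp[OF p[OF i] x] pel[OF SI[OF i x]] de[OF repP[OF SI[OF i x]]] Qrep) (simp add: Q_def)
      qed
      fix k assume "k \<in> hom cS L M \<and> (\<forall>i \<in> Obj J. k \<bullet> ?p i = q i)"
      then have k: "k \<in> hom cS L M" and kp: "\<And>i. i \<in> Obj J ==> k \<bullet> ?p i = q i" by simp_all
      show "k = mp L M (\<lambda>n w. Q n (d n w))"
      proof (rule hom_ext[OF k h])
        fix n w assume w: "w \<in> fobj L n"
        obtain i x where ix: "i \<in> Obj J" "x \<in> fobj (fobj D i) n" "w = ap (?p i) n x" "d n w = rep (r n) (i, x)"
          using onto[OF w] by blast
        have "ap k n w = ap (q i) n x" using ap_comp[OF p[OF ix(1)] ix(2), of k] kp[OF ix(1)] ix(3) by simp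
        also have "\<dots> = Q n (d n w)" unfolding ix(4) Qrep by (simp add: Q_def)
        finally show "ap k n w = ap (mp L M (\<lambda>n w. Q n (d n w))) n w" using w by simp
      qed
    qed
  qed
  then show "\<exists>L p. is_limit (op_cat J) (op_cat cS) D L p" by blast
qed

lemma cSet_bicomplete: "bicomplete TYPE('u) cS"
  by (simp add: bicomplete_def cSet_has_limits cSet_has_colimits)

end

theorem theorem67:
  fixes \<C> :: "'u cmap set"
  assumes "inaccessible (UNIV :: 'u set)"
    and "cofibrations \<C>"
    and "fibration_extension_property cSet (TCof \<C>) (Fib \<C>)"
  shows "three_for_two cSet (WEq \<C>) \<and>
    quillen_model_structure TYPE('u) cSet \<C> (WEq \<C>) (Fib \<C>) \<and>
    WEq \<C> = weak_homotopy_equivalences \<C>"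
proof -
  interpret cubical_cofibrations "TYPE('u)" \<C>
    using assms(1,2) by (simp add: cubical_cofibrations_def universe_def)
  have W: "three_for_two cSet (WEq \<C>)" by (rule three_for_two_WEq[OF assms(3)])
  have "quillen_model_structure TYPE('u) cSet \<C> (WEq \<C>) (Fib \<C>)"
    unfolding quillen_model_structure_def WEq_Fib C_WEq
    using category_cSet cSet_bicomplete C_Arr WEq_Arrs Fib_Arrs wfs_C_TFib wfs_TCof_Fib W by blast
  moreover have "f \<in> WEq \<C> \<longleftrightarrow> f \<in> weak_homotopy_equivalences \<C>" for f
  proof (cases "f \<in> Arr cSet")
    case True
    then have f: "f \<in> hom cSet (src f) (tgt f)" by (rule Arr_hom)
    show ?thesis using WEq_iff_whe[OF assms(3) f] weak_homotopy_equivalence_iff[OF f] by simp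
  next
    case False
    then show ?thesis using WEq_Arrs by (auto simp: weak_homotopy_equivalences_def)
  qed
  ultimately show ?thesis using W by blast
qed

end
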